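(* Let $d \geq 2$ be an integer and let $\omega = \exp(2\pi i/d)$. Let $X$ be a complex Banach space, let $T : X \to X$ be a compact linear operator, and suppose that for some positive integer $q_*$ the power $T^{q_*}$ is a nuclear operator. For $\alpha \in \mathbb{C}\setminus\{0\}$ let $m(\alpha)$ denote the algebraic multiplicity of $\alpha$ as an eigenvalue of $T$ (with $m(\alpha)=0$ if $\alpha \notin \sigma(T)$). Then the following two conditions are equivalent: (1) The spectrum of $T$ is $\mathbb{Z}_d$-symmetric, i.e. for every $\beta \in \mathbb{C}\setminus\{0\}$, $$m(\beta\omega^k) = m(\beta) \quad \text{for all } k = 0, 1, \dots, d-1.$$ (2) For all sufficiently large $p$ the traces of the powers $T^{dp+r}$ with $1 \le r \le d-1$ vanish, i.e. there is an integer $p_* \geq 4q_*$ such that $$\operatorname{Trace}\, T^{dp+r} = 0 \quad \text{for all integers } p \geq p_* \text{ and all integers } r \text{ with } 1 \leq r \leq d-1.$$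
   Context: Nuclear operators. A linear operator $A : X \to Y$ between Banach spaces is called nuclear if it has a representation $$Ax = \sum_{k=1}^{q} a_k f_k(x) y_k \quad (x \in X), \qquad q \leq \infty,$$ with $a_k > 0$, $\sum_k a_k < \infty$, $f_k \in X'$ (the dual of $X$) with $\|f_k\| \leq 1$, and $y_k \in Y$ with $\|y_k\| \leq 1$ for all $k$. Trace. For an operator $A : X \to X$ having such a representation (with $Y = X$) that moreover satisfies $\sum_k a_k^{2/3} < \infty$, one sets $$\operatorname{Trace} A = \sum_{k=1}^{q} a_k f_k(y_k).$$ By a theorem of Grothendieck, this number does not depend on the choice of representation satisfying $\sum_k a_k^{2/3} < \infty$. If $T^{q_*}$ is nuclear, then $T^n$ has a representation satisfying $\sum_k a_k^{2/3} < \infty$ for every $n \geq 4q_*$, so $\operatorname{Trace}\, T^n$ is well defined for all such $n$; in particular it is defined for all $n = dp + r$ with $p \geq 4q_*$ and $1 \le r \le d-1$. Algebraic multiplicity. For a compact operator $T : X \to X$ and $\alpha \in \mathbb{C}\setminus\{0\}$, the spectrum $\sigma(T)$ has no point other than possibly $\alpha$ in some closed disc of radius $\delta(\alpha) > 0$ around $\alpha$. The Riesz projection is $$P(\alpha) = \frac{1}{2\pi i} \int_{|z-\alpha| = \delta(\alpha)} (z - T)^{-1}\, dz,$$ and $m(\alpha) = \operatorname{Rank} P(\alpha)$. This is finite for every $\alpha \neq 0$, and $m(\alpha) = 0$ if and only if $\alpha \notin \sigma(T)$. *)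

theory Defs
  imports "HOL-Complex_Analysis.Complex_Analysis" "HOL-Library.Extended_Nat"
begin

class complex_banach = banach +
  fixes scaleC :: "complex \<Rightarrow> 'a \<Rightarrow> 'a"  (infixr \<open>*\<^sub>C\<close> 75)
  assumes scaleC_add_right: "c *\<^sub>C (x + y) = c *\<^sub>C x + c *\<^sub>C y"
    and scaleC_add_left: "(b + c) *\<^sub>C x = b *\<^sub>C x + c *\<^sub>C x"
    and scaleC_scaleC: "b *\<^sub>C (c *\<^sub>C x) = (b * c) *\<^sub>C x"
    and scaleC_one: "1 *\<^sub>C x = x"
    and scaleR_scaleC: "r *\<^sub>R x = complex_of_real r *\<^sub>C x"
    and norm_scaleC: "norm (c *\<^sub>C x) = cmod c * norm x"

lemma vector_space_scaleC:
  "vector_space (scaleC :: complex \<Rightarrow> 'a \<Rightarrow> 'a::complex_banach)"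
  by unfold_locales
    (simp_all add: scaleC_add_right scaleC_add_left scaleC_scaleC scaleC_one)

instantiation complex :: complex_banach
begin

definition scaleC_complex :: "complex \<Rightarrow> complex \<Rightarrow> complex"
  where "scaleC_complex c x = c * x"

instance
  by standard (simp_all add: scaleC_complex_def algebra_simps norm_mult scaleR_conv_of_real)

end

lemma bounded_linear_scaleC: "bounded_linear (\<lambda>x::'a::complex_banach. c *\<^sub>C x)"
proof (rule bounded_linear_intro[where K = "cmod c"])
  show "c *\<^sub>C (r *\<^sub>R x) = r *\<^sub>R (c *\<^sub>C x)" for r and x :: 'a
    by (simp add: scaleR_scaleC scaleC_scaleC mult.commute)
qed (simp_all add: scaleC_add_right norm_scaleC mult.commute)

text \<open>The real-linear bounded maps into a complex Banach space form a complex Banach space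
  under the scalar multiplication of the codomain.\<close>

instantiation blinfun :: (real_normed_vector, complex_banach) complex_banach
begin

definition scaleC_blinfun :: "complex \<Rightarrow> ('a \<Rightarrow>\<^sub>L 'b) \<Rightarrow> 'a \<Rightarrow>\<^sub>L 'b"
  where "scaleC_blinfun c S = Blinfun (\<lambda>x. c *\<^sub>C blinfun_apply S x)"

lemma blinfun_apply_scaleC: "blinfun_apply (c *\<^sub>C S) x = c *\<^sub>C blinfun_apply S x"
  unfolding scaleC_blinfun_def
  by (subst bounded_linear_Blinfun_apply)
    (auto intro: bounded_linear_compose[OF bounded_linear_scaleC] blinfun.bounded_linear_right)

instance
proof
  fix b c :: complex and r :: real and x y :: "'a \<Rightarrow>\<^sub>L 'b"
  show "c *\<^sub>C (x + y) = c *\<^sub>C x + c *\<^sub>C y"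
    by (rule blinfun_eqI) (simp add: blinfun_apply_scaleC blinfun.add_left scaleC_add_right)
  show "(b + c) *\<^sub>C x = b *\<^sub>C x + c *\<^sub>C x"
    by (rule blinfun_eqI) (simp add: blinfun_apply_scaleC blinfun.add_left scaleC_add_left)
  show "b *\<^sub>C (c *\<^sub>C x) = (b * c) *\<^sub>C x"
    by (rule blinfun_eqI) (simp add: blinfun_apply_scaleC scaleC_scaleC)
  show one: "1 *\<^sub>C x = x"
    by (rule blinfun_eqI) (simp add: blinfun_apply_scaleC scaleC_one)
  show "r *\<^sub>R x = complex_of_real r *\<^sub>C x"
    by (rule blinfun_eqI) (simp add: blinfun_apply_scaleC blinfun.scaleR_left scaleR_scaleC)
  have le: "norm (e *\<^sub>C z) \<le> cmod e * norm z" for e and z :: "'a \<Rightarrow>\<^sub>L 'b"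
    by (rule norm_blinfun_bound)
      (auto simp: blinfun_apply_scaleC norm_scaleC mult.assoc
        intro!: mult_left_mono norm_blinfun)
  show "norm (c *\<^sub>C x) = cmod c * norm x"
  proof (cases "c = 0")
    case True
    then show ?thesis using le[of c x] by simp
  next
    case False
    have "inverse c *\<^sub>C (c *\<^sub>C x) = x"
      by (rule blinfun_eqI) (simp add: blinfun_apply_scaleC scaleC_scaleC scaleC_one False)
    then have "norm x \<le> cmod (inverse c) * norm (c *\<^sub>C x)"
      using le[of "inverse c" "c *\<^sub>C x"] by simp
    then have "cmod c * norm x \<le> norm (c *\<^sub>C x)"
      using False by (simp add: norm_divide field_simps)
    then show ?thesis using le[of c x] by simp
  qed
qed

end

definition clinear :: "('a::complex_banach \<Rightarrow> 'b::complex_banach) \<Rightarrow> bool"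
  where "clinear A \<longleftrightarrow> Vector_Spaces.linear scaleC scaleC A"

definition compact_operator :: "('a::complex_banach \<Rightarrow> 'b::complex_banach) \<Rightarrow> bool"
  where "compact_operator A \<longleftrightarrow> clinear A \<and> compact (closure (A ` cball 0 1))"


subsection \<open>Nuclear operators and the trace\<close>

definition index_set :: "enat \<Rightarrow> nat set"
  where "index_set q = {k. 1 \<le> k \<and> enat k \<le> q}"

text \<open>Since the coefficients are summable, the operator series converges absolutely, so that
  the unordered sum agrees with the limit of the partial sums.\<close>

definition nuclear_representation ::
  "('a::complex_banach \<Rightarrow> 'b::complex_banach) \<Rightarrow>
    enat \<Rightarrow> (nat \<Rightarrow> real) \<Rightarrow> (nat \<Rightarrow> 'a \<Rightarrow> complex) \<Rightarrow> (nat \<Rightarrow> 'b) \<Rightarrow> bool"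
  where "nuclear_representation A q a f y \<longleftrightarrow>
    (\<forall>k\<in>index_set q. a k > 0) \<and> a summable_on index_set q \<and>
    (\<forall>k\<in>index_set q. clinear (f k) \<and> bounded_linear (f k) \<and> onorm (f k) \<le> 1) \<and>
    (\<forall>k\<in>index_set q. norm (y k) \<le> 1) \<and>
    (\<forall>x. ((\<lambda>k. (complex_of_real (a k) * f k x) *\<^sub>C y k) has_sum A x) (index_set q))"

definition nuclear :: "('a::complex_banach \<Rightarrow> 'b::complex_banach) \<Rightarrow> bool"
  where "nuclear A \<longleftrightarrow> clinear A \<and> (\<exists>q a f y. nuclear_representation A q a f y)"

text \<open>By a theorem of Grothendieck, the value described below is unique. It is unspecified
  for operators without a representation with summable \<open>a k powr (2/3)\<close>.\<close>

definition Trace :: "('a::complex_banach \<Rightarrow> 'a) \<Rightarrow> complex"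
  where "Trace A = (THE t. \<exists>q a f y. nuclear_representation A q a f y \<and>
    (\<lambda>k. a k powr (2/3)) summable_on index_set q \<and>
    ((\<lambda>k. complex_of_real (a k) * f k (y k)) has_sum t) (index_set q))"


subsection \<open>Spectrum and algebraic multiplicity\<close>

definition resolvent_set :: "('a::complex_banach \<Rightarrow> 'a) \<Rightarrow> complex set"
  where "resolvent_set T =
    {z. bij (\<lambda>x. z *\<^sub>C x - T x) \<and> bounded_linear (inv (\<lambda>x. z *\<^sub>C x - T x))}"

definition spectrum :: "('a::complex_banach \<Rightarrow> 'a) \<Rightarrow> complex set"
  where "spectrum T = - resolvent_set T"

definition resolvent :: "('a::complex_banach \<Rightarrow> 'a) \<Rightarrow> complex \<Rightarrow> 'a \<Rightarrow>\<^sub>L 'a"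
  where "resolvent T z = Blinfun (inv (\<lambda>x. z *\<^sub>C x - T x))"

text \<open>The analogue of \<^const>\<open>contour_integral\<close> for functions with values in a complex
  Banach space.\<close>

definition banach_contour_integral ::
  "(real \<Rightarrow> complex) \<Rightarrow> (complex \<Rightarrow> 'a::complex_banach) \<Rightarrow> 'a"
  where "banach_contour_integral g f =
    integral {0..1} (\<lambda>t. vector_derivative g (at t within {0..1}) *\<^sub>C f (g t))"

definition isolating_radius :: "('a::complex_banach \<Rightarrow> 'a) \<Rightarrow> complex \<Rightarrow> real \<Rightarrow> bool"
  where "isolating_radius T \<alpha> \<delta> \<longleftrightarrow> \<delta> > 0 \<and> spectrum T \<inter> cball \<alpha> \<delta> \<subseteq> {\<alpha>}"

text \<open>The projection does not depend on the choice of the isolating radius.\<close>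

definition riesz_projection :: "('a::complex_banach \<Rightarrow> 'a) \<Rightarrow> complex \<Rightarrow> 'a \<Rightarrow>\<^sub>L 'a"
  where "riesz_projection T \<alpha> =
    (1 / (2 * of_real pi * \<i>)) *\<^sub>C
      banach_contour_integral (circlepath \<alpha> (SOME \<delta>. isolating_radius T \<alpha> \<delta>)) (resolvent T)"

text \<open>The rank is a complex dimension. It is finite if \<open>T\<close> is compact and \<open>\<alpha> \<noteq> 0\<close>, the only case
  of interest here; the library's \<open>dim\<close> is \<open>0\<close> on infinite-dimensional spaces.\<close>

definition alg_multiplicity :: "('a::complex_banach \<Rightarrow> 'a) \<Rightarrow> complex \<Rightarrow> nat"
  where "alg_multiplicity T \<alpha> =
    vector_space.dim scaleC (range (blinfun_apply (riesz_projection T \<alpha>)))"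

end

theory Submission
  imports Defs "Jordan_Normal_Form.Schur_Decomposition" "HOL-Library.Diagonal_Subsequence"
begin

text \<open>Let \<open>m(\<alpha>)\<close> be the algebraic multiplicity of \<open>\<alpha>\<close>. If Lidskii's theorem were available, the trace
  of \<open>T\<^sup>n\<close> would be the sum of the \<open>m(\<alpha>) \<alpha>\<^sup>n\<close> over all eigenvalues, and the equivalence would express that
  these sums vanish for all large \<open>n\<close> not divisible by \<open>d\<close> exactly if \<open>m\<close> is invariant under
  multiplication by \<open>\<omega>\<close>. The proof replaces Lidskii's theorem by two weaker statements, each suited to
  one of the implications.

  The first is an asymptotic expansion, \<open>trace_asymptotics\<close>: for every \<open>\<rho> > 0\<close> the trace of \<open>T\<^sup>n\<close> is
  the finite sum of the \<open>m(\<alpha>) \<alpha>\<^sup>n\<close> with \<open>|\<alpha>| > \<rho>\<close>, up to an error \<open>O(\<rho>\<^sup>n)\<close>. By the Riesz theory of compact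
  operators (\<open>spectral_splitting_exists\<close>, \<open>riesz_projection_splitting\<close>) the space splits into the
  generalized eigenspaces for the eigenvalues of modulus at least \<open>\<rho>\<close>, on which \<open>T\<close> is triangular, and
  a complement on which the powers of \<open>T\<close> are \<open>O(\<rho>\<^sup>n)\<close> in norm (\<open>growth_off_large_eigenvalues\<close>). The trace
  of \<open>T\<^sup>n\<close> is a pairing of \<open>T\<^bsup>n - q\<^esup>\<close> with the fixed nuclear operator \<open>A = T\<^sup>q\<close>, and as such continuous in the
  operator norm. If the traces vanish for all large \<open>n\<close> not divisible by \<open>d\<close>, then replacing every \<open>\<alpha>\<close> by
  \<open>\<alpha> \<omega>\<^sup>k\<close> changes the finite sums by \<open>O(\<rho>\<^sup>n)\<close> only, for all large \<open>n\<close>. Exponentials with distinct bases of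
  modulus larger than \<open>\<rho>\<close> are independent modulo \<open>O(\<rho>\<^sup>n)\<close>, so the multiplicities agree.

  For the converse the traces have to vanish exactly. The second statement, \<open>traces_are_power_sums\<close>,
  says that for fixed \<open>n \<ge> 3 q\<close> there are numbers \<open>\<nu>\<^sub>j = O(1 / \<surd>j)\<close> such that three times the trace of
  \<open>T\<^bsup>n k\<^esup>\<close> is the sum of the \<open>\<nu>\<^sub>j\<^bsup>3 k\<^esup>\<close>, for all \<open>k > 0\<close>. These are limits of eigenvalues of finite matrices,
  whose squares are summable by Schur's inequality; cubes are then uniformly summable. This is why
  \<open>T\<^sup>n\<close> is written as a cyclic product of three factors. Comparison with the asymptotic expansion
  identifies the large \<open>\<nu>\<^sub>j\<^sup>3\<close> with the large \<open>\<alpha>\<^sup>n\<close>, and a symmetric spectrum makes the sums of the latter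
  vanish if \<open>\<omega>\<^sup>n \<noteq> 1\<close> (\<open>trace_zero_if_eigenvalue_sums_zero\<close>).

  It remains to identify \<open>Trace (T\<^sup>n)\<close> with this pairing, \<open>Trace_power\<close>. Uniqueness is Grothendieck's
  theorem \<open>trace_independent_of_series\<close>, reduced to series for the zero operator; factored through the
  sequence space these become operators of square zero. Existence needs a series for \<open>T\<^sup>n\<close> whose
  coefficients to the power \<open>2/3\<close> are summable. A nuclear operator factors through the sequence space
  so that the interchanged product of the factors is a Hilbert--Schmidt operator, and the fourth power
  of that operator has singular numbers \<open>O(1 / j\<^sup>2)\<close>, so that five factors \<open>A\<close> suffice: this is the origin of the bound \<open>n \<ge> 5 q\<close>.\<close>

section \<open>Bounded complex-linear operators\<close>

interpretation cvs: vector_space "scaleC :: complex \<Rightarrow> 'a \<Rightarrow> 'a::complex_banach"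
  by (rule vector_space_scaleC)

lemma clinear_iff:
  "clinear A \<longleftrightarrow> (\<forall>x y. A (x + y) = A x + A y) \<and> (\<forall>c x. A (c *\<^sub>C x) = c *\<^sub>C A x)"
  unfolding clinear_def Vector_Spaces.linear_iff by (auto simp: vector_space_scaleC)

definition bounded_clinear :: "('a::complex_banach \<Rightarrow> 'b::complex_banach) \<Rightarrow> bool"
  where "bounded_clinear A \<longleftrightarrow> clinear A \<and> bounded_linear A"

lemma bounded_clinear_imp_bounded_linear: "bounded_clinear A \<Longrightarrow> bounded_linear A"
  by (simp add: bounded_clinear_def)

lemma bounded_clinear_add: "bounded_clinear A \<Longrightarrow> A (x + y) = A x + A y"
  and bounded_clinear_scaleC: "bounded_clinear A \<Longrightarrow> A (c *\<^sub>C x) = c *\<^sub>C A x"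
  by (simp_all add: bounded_clinear_def clinear_iff)

lemma bounded_clinear_diff: "bounded_clinear A \<Longrightarrow> A (x - y) = A x - A y"
  and bounded_clinear_zero: "bounded_clinear A \<Longrightarrow> A 0 = 0"
  and bounded_clinear_minus: "bounded_clinear A \<Longrightarrow> A (- x) = - A x"
  and bounded_clinear_sum: "bounded_clinear A \<Longrightarrow> A (sum f S) = (\<Sum>i\<in>S. A (f i))"
  using Real_Vector_Spaces.linear_diff Real_Vector_Spaces.linear_0 Real_Vector_Spaces.linear_neg
    Real_Vector_Spaces.linear_sum bounded_linear.linear[OF bounded_clinear_imp_bounded_linear]
  by metis+

lemma bounded_clinearI:
  assumes "\<And>x y. A (x + y) = A x + A y" "\<And>c x. A (c *\<^sub>C x) = c *\<^sub>C A x"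
    and "\<And>x. norm (A x) \<le> K * norm x"
  shows "bounded_clinear A"
  unfolding bounded_clinear_def clinear_iff
proof (intro conjI allI)
  show "bounded_linear A"
    by (rule bounded_linear_intro[where K = K])
      (auto simp: assms scaleR_scaleC mult.commute)
qed (auto simp: assms)

lemma bounded_clinear_bound:
  assumes "bounded_clinear A"
  obtains K where "K > 0" "\<And>x. norm (A x) \<le> K * norm x"
  using bounded_linear.pos_bounded[OF bounded_clinear_imp_bounded_linear[OF assms]]
  by (metis mult.commute)

lemma bounded_clinear_ident: "bounded_clinear (\<lambda>x. x)"
  by (rule bounded_clinearI[where K = 1]) auto

lemma bounded_clinear_compose:
  assumes "bounded_clinear A" "bounded_clinear B"
  shows "bounded_clinear (\<lambda>x. A (B x))"
  using assms bounded_linear_compose unfolding bounded_clinear_def clinear_iff by auto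

lemma bounded_clinear_comp:
  "bounded_clinear A \<Longrightarrow> bounded_clinear B \<Longrightarrow> bounded_clinear (A \<circ> B)"
  unfolding comp_def by (rule bounded_clinear_compose)

lemma bounded_clinear_scale:
  assumes "bounded_clinear A"
  shows "bounded_clinear (\<lambda>x. c *\<^sub>C A x)"
  using assms bounded_linear_compose[OF bounded_linear_scaleC] unfolding bounded_clinear_def clinear_iff
  by (auto simp: scaleC_add_right scaleC_scaleC mult.commute)

lemma bounded_clinear_plus:
  assumes "bounded_clinear A" "bounded_clinear B"
  shows "bounded_clinear (\<lambda>x. A x + B x)"
  using assms bounded_linear_add unfolding bounded_clinear_def clinear_iff
  by (auto simp: scaleC_add_right)

lemma bounded_clinear_minus_fun:
  assumes "bounded_clinear A" "bounded_clinear B"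
  shows "bounded_clinear (\<lambda>x. A x - B x)"
  using assms bounded_linear_sub unfolding bounded_clinear_def clinear_iff
  by (auto simp: cvs.scale_right_diff_distrib)

lemma bounded_clinear_sum_fun:
  assumes "\<And>i. i \<in> S \<Longrightarrow> bounded_clinear (A i)"
  shows "bounded_clinear (\<lambda>x. \<Sum>i\<in>S. A i x)"
  using assms
proof (induction S rule: infinite_finite_induct)
  case (insert i S)
  then show ?case using bounded_clinear_plus[of "A i" "\<lambda>x. \<Sum>i\<in>S. A i x"] by simp
qed (auto intro!: bounded_clinearI[where K = 0])

lemma bounded_clinear_funpow:
  fixes A :: "'a::complex_banach \<Rightarrow> 'a"
  assumes "bounded_clinear A"
  shows "bounded_clinear (A ^^ n)"
  using assms
proof (induction n)
  case 0
  then show ?case using bounded_clinear_ident unfolding funpow.simps id_def by blast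
next
  case (Suc n)
  then show ?case using bounded_clinear_comp[of A "A ^^ n"] by (simp only: funpow.simps)
qed

lemma compact_operator_bounded_clinear:
  assumes "compact_operator A"
  shows "bounded_clinear A"
proof -
  have lin: "clinear A" and cpt: "compact (closure (A ` cball 0 1))"
    using assms by (auto simp: compact_operator_def)
  obtain M where M: "\<And>y. y \<in> A ` cball 0 1 \<Longrightarrow> norm y \<le> M"
    using bounded_subset[OF compact_imp_bounded[OF cpt] closure_subset] by (auto simp: bounded_iff)
  have "norm (A x) \<le> M * norm x" for x
  proof (cases "x = 0")
    case True
    have "A 0 = 0" using lin unfolding clinear_iff by (metis add_cancel_left_right)
    then show ?thesis by (simp add: True)
  next
    case False
    have "norm (A (complex_of_real (1 / norm x) *\<^sub>C x)) \<le> M"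
      by (rule M) (use False in \<open>auto simp: norm_scaleC norm_divide\<close>)
    then show ?thesis
      using lin False by (simp add: clinear_iff norm_scaleC norm_divide field_simps)
  qed
  then show ?thesis using lin by (auto simp: clinear_iff intro!: bounded_clinearI[where K = M])
qed

lemma compact_operator_subseq:
  assumes "compact_operator A" "\<And>n::nat. norm (x n) \<le> b"
  obtains r l where "strict_mono r" "(\<lambda>n::nat. A (x (r n))) \<longlonglongrightarrow> l"
proof -
  define c where "c = \<bar>b\<bar> + 1"
  have c: "c > 0" "norm (x n) \<le> c" for n using assms(2)[of n] by (auto simp: c_def)
  have lin: "clinear A" and cpt: "compact (closure (A ` cball 0 1))"
    using assms by (auto simp: compact_operator_def)
  have "A (complex_of_real (1/c) *\<^sub>C x n) \<in> closure (A ` cball 0 1)" for n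
    using c by (intro closure_subset[THEN subsetD] imageI) (auto simp: norm_scaleC norm_divide)
  then obtain l r where r: "strict_mono (r :: nat \<Rightarrow> nat)"
    and "((\<lambda>n. A (complex_of_real (1/c) *\<^sub>C x n)) \<circ> r) \<longlonglongrightarrow> l"
    using seq_compactE[OF compact_imp_seq_compact[OF cpt], of "\<lambda>n. A (complex_of_real (1/c) *\<^sub>C x n)"]
    by blast
  then have lim: "(\<lambda>n. A (complex_of_real (1/c) *\<^sub>C x (r n))) \<longlonglongrightarrow> l"
    by (simp add: comp_def)
  have "(\<lambda>n. complex_of_real c *\<^sub>C A (complex_of_real (1/c) *\<^sub>C x (r n)))
      \<longlonglongrightarrow> complex_of_real c *\<^sub>C l"
    by (rule bounded_linear.tendsto[OF bounded_linear_scaleC lim])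
  moreover have "complex_of_real c *\<^sub>C A (complex_of_real (1/c) *\<^sub>C y) = A y" for y
    using lin c by (simp add: clinear_iff scaleC_scaleC scaleC_one)
  ultimately show ?thesis using that[OF r] by simp
qed

section \<open>Compact perturbations of scalar operators\<close>

text \<open>Riesz's lemma: divide \<open>v - y\<close> by its norm, where \<open>y \<in> F\<close> almost realizes the distance of \<open>v\<close>
  from \<open>F\<close>.\<close>

lemma riesz_almost_orthogonal:
  fixes F :: "'a::complex_banach set"
  assumes F: "cvs.subspace F" "closed F" and G: "cvs.subspace G" "F \<subseteq> G" "v \<in> G" "v \<notin> F"
  obtains x where "x \<in> G" "norm x = 1" "\<And>y. y \<in> F \<Longrightarrow> norm (x - y) \<ge> 1/2"
proof -
  have F0: "0 \<in> F" using F(1) cvs.subspace_0 by blast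
  define d where "d = infdist v F"
  have d: "d > 0"
    unfolding d_def using F F0 G by (metis infdist_pos_not_in_closed empty_iff)
  obtain y where y: "y \<in> F" "dist v y < 2 * d"
    using infdist_attains_inf cInf_lessD[of "(dist v) ` F" "2 * d"] F0 d
    unfolding d_def infdist_def by (auto split: if_splits)
  define s where "s = norm (v - y)"
  have s: "s > 0" "s < 2 * d" using y G by (auto simp: s_def dist_norm)
  define x where "x = complex_of_real (1/s) *\<^sub>C (v - y)"
  show ?thesis
  proof
    show "x \<in> G" unfolding x_def using G y by (intro cvs.subspace_scale cvs.subspace_diff) auto
    show "norm x = 1" using s by (simp add: x_def norm_scaleC norm_divide s_def)
  next
    fix z assume z: "z \<in> F"
    have "y + complex_of_real s *\<^sub>C z \<in> F"
      using F y z by (intro cvs.subspace_add cvs.subspace_scale) auto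
    then have "d \<le> norm (v - (y + complex_of_real s *\<^sub>C z))"
      unfolding d_def by (metis infdist_le dist_norm)
    moreover have "x - z = complex_of_real (1/s) *\<^sub>C (v - (y + complex_of_real s *\<^sub>C z))"
      using s by (simp add: x_def cvs.scale_right_diff_distrib cvs.scale_right_distrib scaleC_scaleC scaleC_one)
    ultimately have "norm (x - z) \<ge> d / s"
      using s by (simp add: norm_scaleC norm_divide divide_right_mono)
    moreover have "d / s \<ge> 1/2" using s by (simp add: field_simps)
    ultimately show "norm (x - z) \<ge> 1/2" by linarith
  qed
qed

lemma infdist_scale_bound:
  fixes F :: "'a::complex_banach set"
  assumes F: "cvs.subspace F" and y: "y \<in> F"
  shows "cmod c * infdist b F \<le> norm (c *\<^sub>C b + y)"
proof (cases "c = 0")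
  case False
  have "infdist b F \<le> norm (b - (- (inverse c *\<^sub>C y)))"
    unfolding dist_norm[symmetric]
    by (rule infdist_le) (use F y in \<open>auto intro!: cvs.subspace_neg cvs.subspace_scale\<close>)
  also have "b - (- (inverse c *\<^sub>C y)) = inverse c *\<^sub>C (c *\<^sub>C b + y)"
    using False by (simp add: cvs.scale_right_distrib scaleC_scaleC scaleC_one)
  finally have "infdist b F \<le> norm (c *\<^sub>C b + y) / cmod c"
    by (simp only: norm_scaleC norm_inverse divide_inverse mult.commute)
  then show ?thesis using False by (simp add: pos_le_divide_eq mult.commute)
qed auto

text \<open>By induction on the set: in a convergent sequence \<open>c\<^sub>n b + y\<^sub>n\<close> with \<open>y\<^sub>n\<close> in a closed subspace
  not containing \<open>b\<close>, the distance of \<open>b\<close> from that subspace controls the coefficients \<open>c\<^sub>n\<close>.\<close>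

lemma closed_span_finite:
  fixes S :: "'a::complex_banach set"
  assumes "finite S"
  shows "closed (cvs.span S)"
  using assms
proof (induction S)
  case (insert b S)
  let ?F = "cvs.span S"
  show ?case
  proof (cases "b \<in> ?F")
    case True
    then have "cvs.span (insert b S) = ?F" by (rule cvs.span_redundant)
    then show ?thesis using insert by simp
  next
    case False
    define d where "d = infdist b ?F"
    have d: "d > 0"
      unfolding d_def using False insert.IH cvs.span_zero
      by (metis infdist_pos_not_in_closed empty_iff)
    show ?thesis unfolding closed_sequential_limits
    proof (intro allI impI, elim conjE)
      fix x l assume x: "\<forall>n. x n \<in> cvs.span (insert b S)" and lim: "x \<longlonglongrightarrow> l"
      have "\<forall>n. \<exists>c. x n - c *\<^sub>C b \<in> ?F" using x unfolding cvs.span_insert by auto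
      then obtain c where c: "\<And>n. x n - c n *\<^sub>C b \<in> ?F" by metis
      have bound: "dist (c m) (c n) * d \<le> dist (x m) (x n)" for m n
      proof -
        have "(x m - c m *\<^sub>C b) - (x n - c n *\<^sub>C b) \<in> ?F" using c cvs.span_diff by blast
        from infdist_scale_bound[OF cvs.subspace_span this, of "c m - c n" b]
        show ?thesis by (simp add: d_def dist_norm cvs.scale_left_diff_distrib algebra_simps)
      qed
      have "Cauchy c"
        unfolding Cauchy_def
      proof (intro allI impI)
        fix e :: real assume e: "e > 0"
        obtain M where M: "\<And>m n. m \<ge> M \<Longrightarrow> n \<ge> M \<Longrightarrow> dist (x m) (x n) < e * d"
          using LIMSEQ_imp_Cauchy[OF lim] d e unfolding Cauchy_def by (metis mult_pos_pos)
        show "\<exists>M. \<forall>m\<ge>M. \<forall>n\<ge>M. dist (c m) (c n) < e"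
          using M bound d by (meson le_less_trans mult_less_cancel_right_pos)
      qed
      then obtain c0 where c0: "c \<longlonglongrightarrow> c0" using Cauchy_convergent convergent_def by blast
      have "(\<lambda>n. norm ((c n - c0) *\<^sub>C b)) \<longlonglongrightarrow> 0"
        using tendsto_mult_right[OF tendsto_norm_zero[OF LIM_zero[OF c0]], of "norm b"]
        by (simp add: norm_scaleC mult.commute)
      then have "(\<lambda>n. c n *\<^sub>C b) \<longlonglongrightarrow> c0 *\<^sub>C b"
        using LIM_zero_cancel[OF tendsto_norm_zero_cancel, of "\<lambda>n. c n *\<^sub>C b" "c0 *\<^sub>C b"]
        by (simp add: cvs.scale_left_diff_distrib)
      then have "(\<lambda>n. x n - c n *\<^sub>C b) \<longlonglongrightarrow> l - c0 *\<^sub>C b" by (rule tendsto_diff[OF lim])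
      then have "l - c0 *\<^sub>C b \<in> ?F"
        by (rule closed_sequentially[OF insert.IH, rotated]) (rule c)
      then show "l \<in> cvs.span (insert b S)" unfolding cvs.span_insert by blast
    qed
  qed
qed simp

locale compact_shift =
  fixes T :: "'a::complex_banach \<Rightarrow> 'a" and \<alpha> :: complex
  assumes compact: "compact_operator T" and nonzero: "\<alpha> \<noteq> 0"
begin

definition L :: "'a \<Rightarrow> 'a" where "L x = \<alpha> *\<^sub>C x - T x"

lemma bcT: "bounded_clinear T" by (rule compact_operator_bounded_clinear[OF compact])

lemma bcL: "bounded_clinear L"
  unfolding L_def
  by (intro bounded_clinear_minus_fun bounded_clinear_scale bounded_clinear_ident bcT)

lemma bcLn: "bounded_clinear (L ^^ n)" by (rule bounded_clinear_funpow[OF bcL])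

text \<open>Since \<open>\<alpha> x = L x + T x\<close>, compactness of \<open>T\<close> turns convergence of \<open>L (x n)\<close> into convergence
  of a subsequence of \<open>x\<close> itself.\<close>

lemma convergent_subseq:
  assumes x: "\<And>n. norm (x n) \<le> b" and lim: "(\<lambda>n::nat. L (x n)) \<longlonglongrightarrow> y"
  obtains r l where "strict_mono r" "(x \<circ> r) \<longlonglongrightarrow> l" "L l = y"
proof -
  obtain r t where r: "strict_mono r" and t: "(\<lambda>n. T (x (r n))) \<longlonglongrightarrow> t"
    using compact_operator_subseq[OF compact, of x b] x by blast
  have "(\<lambda>n. L (x (r n))) \<longlonglongrightarrow> y"
    using LIMSEQ_subseq_LIMSEQ[OF lim r] by (simp add: comp_def)
  then have "(\<lambda>n. inverse \<alpha> *\<^sub>C (L (x (r n)) + T (x (r n)))) \<longlonglongrightarrow> inverse \<alpha> *\<^sub>C (y + t)"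
    by (intro bounded_linear.tendsto[OF bounded_linear_scaleC] tendsto_add t)
  then have lim': "(x \<circ> r) \<longlonglongrightarrow> inverse \<alpha> *\<^sub>C (y + t)"
    using nonzero by (simp add: L_def comp_def scaleC_scaleC scaleC_one)
  have "(\<lambda>n. L ((x \<circ> r) n)) \<longlonglongrightarrow> L (inverse \<alpha> *\<^sub>C (y + t))"
    by (rule bounded_linear.tendsto[OF bounded_clinear_imp_bounded_linear[OF bcL] lim'])
  moreover have "(\<lambda>n. L ((x \<circ> r) n)) \<longlonglongrightarrow> y" using LIMSEQ_subseq_LIMSEQ[OF lim r] by (simp add: comp_def)
  ultimately have "L (inverse \<alpha> *\<^sub>C (y + t)) = y" by (rule LIMSEQ_unique)
  then show ?thesis using that[OF r lim'] by blast
qed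

lemma no_separated_images:
  assumes x: "\<And>n::nat. norm (x n) \<le> 1" and c: "c > 0"
    and sep: "\<And>m n. m < n \<Longrightarrow> norm (T (x m) - T (x n)) \<ge> c"
  shows False
proof -
  obtain r t where r: "strict_mono r" and t: "(\<lambda>n. T (x (r n))) \<longlonglongrightarrow> t"
    using compact_operator_subseq[OF compact, of x 1] x by blast
  obtain M where "\<And>m n. m \<ge> M \<Longrightarrow> n \<ge> M \<Longrightarrow> dist (T (x (r m))) (T (x (r n))) < c"
    using LIMSEQ_imp_Cauchy[OF t] c unfolding Cauchy_def by meson
  from this[of M "Suc M"] sep[of "r M" "r (Suc M)"] r show False
    by (simp add: strict_mono_def dist_norm)
qed

text \<open>Otherwise there are unit vectors \<open>z n\<close> of \<open>G\<close> at distance at least \<open>1/2\<close> from the kernel with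
  \<open>L (z n)\<close> tending to zero; a subsequence converges to a point of the kernel.\<close>

lemma bounded_below_mod_kernel:
  assumes G: "cvs.subspace G" "closed G"
  obtains C where "C > 0" "\<And>x. x \<in> G \<Longrightarrow> \<exists>x'\<in>G. L x' = L x \<and> norm x' \<le> C * norm (L x)"
proof -
  have "\<exists>C>0. \<forall>x\<in>G. \<exists>x'\<in>G. L x' = L x \<and> norm x' \<le> C * norm (L x)"
  proof (rule ccontr)
    assume "\<not> ?thesis"
    then have "\<exists>x\<in>G. \<forall>x'\<in>G. L x' = L x \<longrightarrow> norm x' > real (Suc n) * norm (L x)" for n
      by (metis not_le of_nat_0_less_iff zero_less_Suc)
    then obtain x where xG: "\<And>n. x n \<in> G"
      and x: "\<And>n x'. x' \<in> G \<Longrightarrow> L x' = L (x n) \<Longrightarrow> norm x' > real (Suc n) * norm (L (x n))"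
      by metis
    define K where "K = {x \<in> G. L x = 0}"
    have L0: "L 0 = 0" by (rule bounded_clinear_zero[OF bcL])
    have K: "cvs.subspace K"
      using G(1) unfolding K_def cvs.subspace_def
      by (simp add: L0 bounded_clinear_add[OF bcL] bounded_clinear_scaleC[OF bcL])
    have "closed (L -` {0})"
      by (rule continuous_closed_vimage)
        (auto intro: bounded_linear.isCont[OF bounded_clinear_imp_bounded_linear[OF bcL]])
    moreover have "K = G \<inter> (L -` {0})" by (auto simp: K_def)
    ultimately have clK: "closed K" using G(2) by auto
    have notK: "x n \<notin> K" for n
    proof
      assume "x n \<in> K"
      then show False using x[of 0 n] L0 G(1) cvs.subspace_0 unfolding K_def by fastforce
    qed
    have "\<exists>z\<in>G. norm z = 1 \<and> (\<forall>y\<in>K. norm (z - y) \<ge> 1/2) \<and> norm (L z) < 1 / real (Suc n)" for n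
    proof -
      have "cvs.span (insert (x n) K) \<subseteq> G"
        using xG G(1) by (intro cvs.span_minimal) (auto simp: K_def)
      obtain z where z: "z \<in> cvs.span (insert (x n) K)" "norm z = 1"
        "\<And>y. y \<in> K \<Longrightarrow> norm (z - y) \<ge> 1/2"
        using riesz_almost_orthogonal[OF K clK, of "cvs.span (insert (x n) K)" "x n"] notK
        by (metis cvs.span_base cvs.span_superset cvs.subspace_span insertI1 insert_subset)
      obtain c where "z - c *\<^sub>C x n \<in> cvs.span K" using z(1) unfolding cvs.span_insert by auto
      then have zc: "z - c *\<^sub>C x n \<in> K" using K by (simp add: cvs.span_eq_iff[THEN iffD2])
      have "c \<noteq> 0" using zc z(3)[of z] by force
      have zG: "z \<in> G" using z(1) \<open>cvs.span (insert (x n) K) \<subseteq> G\<close> by blast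
      have Lz: "L z = c *\<^sub>C L (x n)"
        using zc by (simp add: K_def bounded_clinear_diff[OF bcL] bounded_clinear_scaleC[OF bcL])
      have "norm (inverse c *\<^sub>C z) > real (Suc n) * norm (L (x n))"
      proof (rule x)
        show "inverse c *\<^sub>C z \<in> G" using zG G(1) cvs.subspace_scale by blast
        show "L (inverse c *\<^sub>C z) = L (x n)"
          using \<open>c \<noteq> 0\<close> by (simp add: bounded_clinear_scaleC[OF bcL] Lz scaleC_scaleC scaleC_one)
      qed
      then have "1 > real (Suc n) * (cmod c * norm (L (x n)))"
        using z(2) \<open>c \<noteq> 0\<close> by (simp add: norm_scaleC norm_inverse norm_divide field_simps)
      then have "norm (L z) < 1 / real (Suc n)"
        by (simp add: Lz norm_scaleC field_simps)
      then show ?thesis using z zG by blast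
    qed
    then obtain z where z: "\<And>n. z n \<in> G" "\<And>n. norm (z n) = 1"
      "\<And>n y. y \<in> K \<Longrightarrow> norm (z n - y) \<ge> 1/2" "\<And>n. norm (L (z n)) < 1 / real (Suc n)"
      by metis
    have "(\<lambda>n. L (z n)) \<longlonglongrightarrow> 0"
      by (rule Lim_null_comparison[OF _ LIMSEQ_inverse_real_of_nat])
        (use z(4) in \<open>auto intro!: always_eventually less_imp_le simp: inverse_eq_divide\<close>)
    then obtain r l where r: "strict_mono r" and l: "(z \<circ> r) \<longlonglongrightarrow> l" "L l = 0"
      using convergent_subseq[of z 1] z(2) by auto
    have "l \<in> G" by (rule closed_sequentially[OF G(2) _ l(1)]) (simp add: z)
    then have "l \<in> K" using l by (simp add: K_def)
    then have "\<And>n. dist ((z \<circ> r) n) l \<ge> 1/2" using z(3) by (simp add: dist_norm)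
    then show False using metric_LIMSEQ_D[OF l(1), of "1/2"] by (auto simp: not_less[symmetric])
  qed
  then show ?thesis using that by blast
qed

lemma closed_image:
  assumes G: "cvs.subspace G" "closed G"
  shows "closed (L ` G)"
  unfolding closed_sequential_limits
proof (intro allI impI, elim conjE)
  fix y l assume y: "\<forall>n. y n \<in> L ` G" and lim: "y \<longlonglongrightarrow> l"
  obtain C where C: "C > 0" "\<And>x. x \<in> G \<Longrightarrow> \<exists>x'\<in>G. L x' = L x \<and> norm x' \<le> C * norm (L x)"
    using bounded_below_mod_kernel[OF G] by blast
  have "\<forall>n. \<exists>x\<in>G. L x = y n \<and> norm x \<le> C * norm (y n)" using y C(2) by (metis imageE)
  then obtain x where x: "\<And>n. x n \<in> G" "\<And>n. L (x n) = y n" "\<And>n. norm (x n) \<le> C * norm (y n)"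
    by metis
  obtain b where b: "\<And>n. norm (y n) \<le> b"
    using convergent_imp_Bseq[OF convergentI[OF lim]] by (auto simp: Bseq_def)
  have "norm (x n) \<le> C * b" for n
    using x(3)[of n] b[of n] C(1) by (meson mult_left_mono less_imp_le order_trans)
  then obtain r m where "strict_mono r" and m: "(x \<circ> r) \<longlonglongrightarrow> m" "L m = l"
    using convergent_subseq[of x "C * b" l] lim x(2) by auto
  have "m \<in> G" by (rule closed_sequentially[OF G(2) _ m(1)]) (simp add: x)
  then show "l \<in> L ` G" using m by blast
qed

lemma subspace_L_image: "cvs.subspace G \<Longrightarrow> cvs.subspace (L ` G)"
proof -
  interpret Vector_Spaces.linear scaleC scaleC L
    using bcL by (simp add: bounded_clinear_def clinear_def)
  show "cvs.subspace G \<Longrightarrow> cvs.subspace (L ` G)" by (rule subspace_image)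
qed

lemma range_power:
  "cvs.subspace (range (L ^^ n))" "closed (range (L ^^ n))" "range (L ^^ Suc n) \<subseteq> range (L ^^ n)"
proof -
  have "cvs.subspace (range (L ^^ n)) \<and> closed (range (L ^^ n))"
  proof (induction n)
    case (Suc n)
    have "range (L ^^ Suc n) = L ` range (L ^^ n)" by (auto simp: image_iff)
    then show ?case using Suc subspace_L_image closed_image by simp
  qed (simp add: cvs.subspace_UNIV)
  then show "cvs.subspace (range (L ^^ n))" "closed (range (L ^^ n))" by auto
  show "range (L ^^ Suc n) \<subseteq> range (L ^^ n)" by (auto simp: funpow_swap1)
qed

lemma range_power_mono: "m \<le> n \<Longrightarrow> range (L ^^ n) \<subseteq> range (L ^^ m)"
  by (rule lift_Suc_antimono_le[of "\<lambda>n. range (L ^^ n)"]) (rule range_power(3))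

text \<open>If the ranges kept shrinking, almost orthogonal unit vectors \<open>x n\<close> of consecutive ranges
  would have separated images under \<open>T\<close>, because \<open>T x = \<alpha> x - L x\<close>.\<close>

lemma ranges_stabilize:
  obtains j where "j \<ge> m" "range (L ^^ Suc j) = range (L ^^ j)"
proof -
  have "\<exists>j\<ge>m. range (L ^^ Suc j) = range (L ^^ j)"
  proof (rule ccontr)
    assume "\<not> ?thesis"
    then have ne: "range (L ^^ Suc j) \<noteq> range (L ^^ j)" if "j \<ge> m" for j using that by blast
    have "\<exists>x. x \<in> range (L ^^ (m + n)) \<and> norm x = 1 \<and> (\<forall>y\<in>range (L ^^ Suc (m + n)). norm (x - y) \<ge> 1/2)" for n
    proof -
      obtain v where "v \<in> range (L ^^ (m + n))" "v \<notin> range (L ^^ Suc (m + n))"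
        using ne[of "m + n"] range_power(3)[of "m + n"] by auto
      from riesz_almost_orthogonal[OF range_power(1,2) range_power(1) range_power(3) this]
      show ?thesis by metis
    qed
    then obtain x where x: "\<And>n. x n \<in> range (L ^^ (m + n))" "\<And>n. norm (x n) = 1"
      "\<And>n y. y \<in> range (L ^^ Suc (m + n)) \<Longrightarrow> norm (x n - y) \<ge> 1/2"
      by metis
    have sep: "norm (T (x k) - T (x n)) \<ge> cmod \<alpha> / 2" if "k < n" for k n
    proof -
      let ?R = "range (L ^^ Suc (m + k))"
      have Lx: "L (x k) \<in> ?R" using x(1)[of k] by auto
      have xn: "x n \<in> ?R" using x(1)[of n] range_power_mono[of "Suc (m + k)" "m + n"] that by auto
      then have Lxn: "L (x n) \<in> ?R"
        using range_power(3)[of "Suc (m + k)"] by auto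
      define y where "y = inverse \<alpha> *\<^sub>C (L (x k) + \<alpha> *\<^sub>C x n - L (x n))"
      note R = range_power(1)[of "Suc (m + k)"]
      have "y \<in> ?R" unfolding y_def
        by (intro cvs.subspace_scale[OF R] cvs.subspace_diff[OF R] cvs.subspace_add[OF R] Lx xn Lxn)
      have "T (x k) - T (x n) = \<alpha> *\<^sub>C (x k - y)"
        using nonzero by (simp add: y_def L_def cvs.scale_right_diff_distrib cvs.scale_right_distrib scaleC_scaleC scaleC_one algebra_simps)
      then show ?thesis using x(3)[OF \<open>y \<in> ?R\<close>] nonzero by (simp add: norm_scaleC)
    qed
    show False
      by (rule no_separated_images[of x "cmod \<alpha> / 2"]) (use x sep nonzero in auto)
  qed
  then show ?thesis using that by blast
qed

definition gen_kernel :: "'a set" where "gen_kernel = {x. \<exists>k. (L ^^ k) x = 0}"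

lemma L_gen_kernel: "x \<in> gen_kernel \<Longrightarrow> L x \<in> gen_kernel"
proof -
  assume "x \<in> gen_kernel"
  then obtain k where "(L ^^ k) x = 0" by (auto simp: gen_kernel_def)
  then have "(L ^^ k) (L x) = 0"
    by (metis bounded_clinear_zero[OF bcL] funpow_swap1)
  then show ?thesis by (auto simp: gen_kernel_def)
qed

lemma subspace_gen_kernel: "cvs.subspace gen_kernel"
  unfolding cvs.subspace_def
proof (intro conjI ballI allI)
  have mono: "(L ^^ (n + k)) x = 0" if "(L ^^ k) x = 0" for n k x
    using that bounded_clinear_zero[OF bcLn] by (simp add: funpow_add)
  show "x + y \<in> gen_kernel" if xy: "x \<in> gen_kernel" "y \<in> gen_kernel" for x y
  proof -
    obtain k n where "(L ^^ k) x = 0" "(L ^^ n) y = 0" using xy unfolding gen_kernel_def by blast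
    then have "(L ^^ (n + k)) (x + y) = 0"
      using mono[of k x n] mono[of n y k] by (simp add: bounded_clinear_add[OF bcLn] add.commute)
    then show ?thesis by (auto simp: gen_kernel_def)
  qed
  show "0 \<in> gen_kernel" by (auto simp: gen_kernel_def bounded_clinear_zero[OF bcLn])
  show "c *\<^sub>C x \<in> gen_kernel" if "x \<in> gen_kernel" for c x
    using that by (auto simp: gen_kernel_def bounded_clinear_scaleC[OF bcLn])
qed

text \<open>Adjoins, as long as possible, a generalized eigenvector that \<open>L\<close> maps into the span of
  the earlier ones.\<close>

primrec flag :: "nat \<Rightarrow> 'a list" where
  "flag 0 = []"
| "flag (Suc n) = flag n @ [SOME v. v \<in> gen_kernel \<and> v \<notin> cvs.span (set (flag n)) \<and> L v \<in> cvs.span (set (flag n))]"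

lemma flag_extend:
  assumes "set (flag n) \<subseteq> gen_kernel" "gen_kernel \<noteq> cvs.span (set (flag n))"
  defines "v \<equiv> last (flag (Suc n))"
  shows "v \<in> gen_kernel \<and> v \<notin> cvs.span (set (flag n)) \<and> L v \<in> cvs.span (set (flag n))"
proof -
  let ?F = "cvs.span (set (flag n))"
  have "?F \<subseteq> gen_kernel" using assms(1) subspace_gen_kernel cvs.span_minimal by blast
  then obtain w where w: "w \<in> gen_kernel" "w \<notin> ?F" using assms(2) by auto
  from w(1) obtain k0 where "(L ^^ k0) w = 0" by (auto simp: gen_kernel_def)
  then have k0: "(L ^^ k0) w \<in> ?F" by (simp add: cvs.span_zero)
  define k where "k = (LEAST k. (L ^^ k) w \<in> ?F)"
  have k: "(L ^^ k) w \<in> ?F" unfolding k_def by (rule LeastI[of _ k0]) (rule k0)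
  have "k \<noteq> 0" using k w(2) by (metis funpow_0)
  then obtain j where j: "k = Suc j" by (cases k) auto
  have "(L ^^ j) w \<notin> ?F" using not_less_Least[of j "\<lambda>k. (L ^^ k) w \<in> ?F"] j by (simp add: k_def)
  moreover have "(L ^^ j) w \<in> gen_kernel" by (induction j) (auto simp: w L_gen_kernel)
  moreover have "L ((L ^^ j) w) \<in> ?F" using k j by simp
  ultimately have ex: "\<exists>v. v \<in> gen_kernel \<and> v \<notin> ?F \<and> L v \<in> ?F" by blast
  show ?thesis unfolding v_def using someI_ex[OF ex] by simp
qed

text \<open>An endless flag would give a strictly increasing chain of closed subspaces \<open>F n\<close> with
  \<open>L (F (Suc n)) \<subseteq> F n\<close>, and almost orthogonal unit vectors of this chain would have separated images
  under \<open>T\<close>.\<close>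

lemma flag_exhausts: "\<exists>n. gen_kernel = cvs.span (set (flag n))"
proof (rule ccontr)
  assume *: "\<not> ?thesis"
  define F where "F n = cvs.span (set (flag n))" for n
  define e where "e n = last (flag (Suc n))" for n
  have sub: "set (flag n) \<subseteq> gen_kernel" for n
  proof (induction n)
    case (Suc n)
    have "last (flag (Suc n)) \<in> gen_kernel" using flag_extend[OF Suc] * by blast
    then show ?case using Suc by simp
  qed simp_all
  have e: "e n \<notin> F n" "L (e n) \<in> F n" for n using flag_extend[OF sub] * unfolding F_def e_def by blast+
  have setS: "set (flag (Suc n)) = insert (e n) (set (flag n))" for n by (auto simp: e_def)
  have sF: "cvs.subspace (F n)" "closed (F n)" for n by (auto simp: F_def closed_span_finite)
  have F_Suc: "F n \<subseteq> F (Suc n)" for n unfolding F_def setS by (rule cvs.span_mono) auto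
  have F_mono: "F m \<subseteq> F n" if "m \<le> n" for m n using lift_Suc_mono_le[of F, OF F_Suc that] .
  have eF: "e n \<in> F (Suc n)" for n unfolding F_def setS by (simp add: cvs.span_base)
  have LF: "L x \<in> F n" if "x \<in> F (Suc n)" for x n
    using that
  proof (induction n arbitrary: x)
    case 0
    then obtain c where "x = c *\<^sub>C e 0" unfolding F_def setS by (auto simp: cvs.span_insert)
    then show ?case using e[of 0] by (simp add: bounded_clinear_scaleC[OF bcL] sF cvs.subspace_scale)
  next
    case (Suc n)
    then obtain c where "x - c *\<^sub>C e (Suc n) \<in> F (Suc n)" unfolding F_def setS[of "Suc n"] cvs.span_insert by auto
    then have 1: "L (x - c *\<^sub>C e (Suc n)) \<in> F (Suc n)" using Suc.IH F_Suc by blast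
    have 2: "L (c *\<^sub>C e (Suc n)) \<in> F (Suc n)"
      using e[of "Suc n"] by (simp add: bounded_clinear_scaleC[OF bcL] sF cvs.subspace_scale)
    have "L x = L (x - c *\<^sub>C e (Suc n)) + L (c *\<^sub>C e (Suc n))" by (simp add: bounded_clinear_diff[OF bcL])
    then show ?case using 1 2 sF cvs.subspace_add by metis
  qed
  have "\<exists>x. x \<in> F (Suc n) \<and> norm x = 1 \<and> (\<forall>y\<in>F n. norm (x - y) \<ge> 1/2)" for n
    using riesz_almost_orthogonal[OF sF sF(1) F_Suc eF e(1)] by metis
  then obtain x where x: "\<And>n. x n \<in> F (Suc n)" "\<And>n. norm (x n) = 1"
      "\<And>n y. y \<in> F n \<Longrightarrow> norm (x n - y) \<ge> 1/2"
    by metis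
  have sep: "norm (T (x k) - T (x n)) \<ge> cmod \<alpha> / 2" if "k < n" for k n
  proof -
    have xk: "x k \<in> F n" using x(1) F_mono[of "Suc k" n] that by auto
    have Lxk: "L (x k) \<in> F n" using LF[OF x(1)] F_mono[of k n] that by auto
    define y where "y = inverse \<alpha> *\<^sub>C (L (x n) + \<alpha> *\<^sub>C x k - L (x k))"
    have "y \<in> F n" unfolding y_def
      by (intro cvs.subspace_scale[OF sF(1)] cvs.subspace_diff[OF sF(1)] cvs.subspace_add[OF sF(1)]
          LF[OF x(1)] xk Lxk)
    have "T (x n) - T (x k) = \<alpha> *\<^sub>C (x n - y)"
      using nonzero by (simp add: y_def L_def cvs.scale_right_diff_distrib cvs.scale_right_distrib scaleC_scaleC scaleC_one algebra_simps)
    then have "norm (T (x n) - T (x k)) \<ge> cmod \<alpha> / 2"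
      using x(3)[OF \<open>y \<in> F n\<close>] nonzero by (simp add: norm_scaleC)
    then show ?thesis by (simp add: norm_minus_commute)
  qed
  show False
    by (rule no_separated_images[of x "cmod \<alpha> / 2"]) (use x sep nonzero in auto)
qed

definition gdim :: nat where "gdim = (LEAST n. gen_kernel = cvs.span (set (flag n)))"

definition basis :: "nat \<Rightarrow> 'a" where "basis n = last (flag (Suc n))"

lemma set_flag: "set (flag n) = basis ` {..<n}"
  by (induction n) (auto simp: basis_def lessThan_Suc)

lemma gen_kernel_eq_span: "gen_kernel = cvs.span (basis ` {..<gdim})"
  unfolding set_flag[symmetric] gdim_def by (rule LeastI_ex[OF flag_exhausts])

lemma basis_flag:
  assumes "i < gdim"
  shows "basis i \<notin> cvs.span (basis ` {..<i})" "L (basis i) \<in> cvs.span (basis ` {..<i})"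
proof -
  have ne: "gen_kernel \<noteq> cvs.span (set (flag n))" if "n < gdim" for n
    using not_less_Least that unfolding gdim_def by blast
  have sub: "set (flag n) \<subseteq> gen_kernel" if "n < gdim" for n
    using that
  proof (induction n)
    case (Suc n)
    have "last (flag (Suc n)) \<in> gen_kernel" using flag_extend[of n] Suc ne[of n] by simp
    then show ?case using Suc by simp
  qed simp
  show "basis i \<notin> cvs.span (basis ` {..<i})" "L (basis i) \<in> cvs.span (basis ` {..<i})"
    using flag_extend[OF sub[OF assms] ne[OF assms]] unfolding basis_def[symmetric] set_flag by auto
qed

lemma power_L_span_basis:
  "n \<le> gdim \<Longrightarrow> x \<in> cvs.span (basis ` {..<n}) \<Longrightarrow> (L ^^ n) x = 0"
proof (induction n arbitrary: x)
  case (Suc n)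
  obtain c where "x - c *\<^sub>C basis n \<in> cvs.span (basis ` {..<n})"
    using Suc.prems(2) by (auto simp: lessThan_Suc cvs.span_insert)
  then have "(L ^^ n) (x - c *\<^sub>C basis n) = 0" using Suc by simp
  moreover have "(L ^^ n) (L (c *\<^sub>C basis n)) = 0"
    using basis_flag(2)[of n] Suc by (simp add: bounded_clinear_scaleC[OF bcL] cvs.span_scale)
  ultimately have "(L ^^ Suc n) (x - c *\<^sub>C basis n) + (L ^^ Suc n) (c *\<^sub>C basis n) = 0"
    unfolding funpow.simps(2)[of n L] comp_apply funpow_swap1[of L n "c *\<^sub>C basis n"]
    by (simp add: bounded_clinear_zero[OF bcL])
  then show ?case by (simp only: bounded_clinear_add[OF bcLn, symmetric] diff_add_cancel)
qed simp

lemma power_L_gen_kernel: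
  assumes "x \<in> gen_kernel" "n \<ge> gdim"
  shows "(L ^^ n) x = 0"
proof -
  have "(L ^^ gdim) x = 0" using power_L_span_basis assms(1) gen_kernel_eq_span by blast
  then have "(L ^^ (n - gdim)) ((L ^^ gdim) x) = 0" by (simp add: bounded_clinear_zero[OF bcLn])
  then show ?thesis using assms(2) by (metis comp_apply funpow_add le_add_diff_inverse2)
qed

lemma gen_kernel_powerD: "(L ^^ n) x \<in> gen_kernel \<Longrightarrow> x \<in> gen_kernel"
proof -
  assume "(L ^^ n) x \<in> gen_kernel"
  then obtain k where "(L ^^ k) ((L ^^ n) x) = 0" by (auto simp: gen_kernel_def)
  then have "(L ^^ (k + n)) x = 0" by (simp add: funpow_add)
  then show ?thesis by (auto simp: gen_kernel_def)
qed

end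

text \<open>What the Riesz theory of a compact operator says at a point \<open>\<alpha> \<noteq> 0\<close>: the projection \<open>E\<close>
  onto the generalized eigenspace along an invariant complement, the inverse \<open>B\<close> of \<open>\<alpha> - T\<close> on
  that complement (extended by zero), and a basis \<open>e\<close> of the range of \<open>E\<close> in which
  \<open>\<alpha> - T\<close> is strictly upper triangular.\<close>

definition spectral_splitting ::
  "('a::complex_banach \<Rightarrow> 'a) \<Rightarrow> complex \<Rightarrow> ('a \<Rightarrow> 'a) \<Rightarrow> ('a \<Rightarrow> 'a) \<Rightarrow> nat \<Rightarrow> (nat \<Rightarrow> 'a) \<Rightarrow> bool"
  where "spectral_splitting T \<alpha> E B m e \<longleftrightarrow>
    bounded_clinear E \<and> bounded_clinear B \<and>
    (\<forall>x. E (E x) = E x) \<and> (\<forall>x. E (T x) = T (E x)) \<and>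
    (\<forall>x. \<alpha> *\<^sub>C B x - T (B x) = x - E x) \<and> (\<forall>x. B (\<alpha> *\<^sub>C x - T x) = x - E x) \<and>
    (\<forall>x. E (B x) = 0) \<and> (\<forall>x. B (E x) = 0) \<and>
    (\<forall>x. ((\<lambda>x. \<alpha> *\<^sub>C x - T x) ^^ m) (E x) = 0) \<and>
    range E = cvs.span (e ` {..<m}) \<and>
    (\<forall>i<m. e i \<notin> cvs.span (e ` {..<i}) \<and> \<alpha> *\<^sub>C e i - T (e i) \<in> cvs.span (e ` {..<i}))"

context compact_shift
begin

text \<open>Choose \<open>j\<close> at least the length of the flag and such that the ranges of the powers of \<open>L\<close> are
  stationary from \<open>j\<close> on, and let \<open>R\<close> be the range of \<open>L\<^sup>j\<close>. Then \<open>L\<close> maps \<open>R\<close> bijectively onto itself,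
  with bounded inverse. The solution \<open>r x \<in> R\<close> of \<open>L\<^sup>j (r x) = L\<^sup>j x\<close> is the component of \<open>x\<close> in \<open>R\<close>: the
  difference \<open>x - r x\<close> lies in the generalized eigenspace.\<close>

theorem spectral_splitting_exists: "\<exists>E B m e. spectral_splitting T \<alpha> E B m e"
proof -
  obtain j where j: "j \<ge> gdim" "range (L ^^ Suc j) = range (L ^^ j)"
    using ranges_stabilize[of gdim] .
  define R where "R = range (L ^^ j)"
  have R: "cvs.subspace R" "closed R" by (simp_all add: R_def range_power)
  note add = bounded_clinear_add[OF bcL] bounded_clinear_add[OF bcLn]
  note scale = bounded_clinear_scaleC[OF bcL] bounded_clinear_scaleC[OF bcLn]
  note diff = bounded_clinear_diff[OF bcL] bounded_clinear_diff[OF bcLn]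
  note zero = bounded_clinear_zero[OF bcL] bounded_clinear_zero[OF bcLn]
  have LR: "L ` R = R"
    using j(2) unfolding R_def by (auto simp: image_iff set_eq_iff)
  have LRn: "(L ^^ n) ` R = R" for n
  proof (induction n)
    case (Suc n)
    have "(L ^^ Suc n) ` R = L ` ((L ^^ n) ` R)" by (auto simp: image_iff)
    then show ?case using Suc LR by simp
  qed simp
  have disj: "x = 0" if "x \<in> R" "x \<in> gen_kernel" for x
  proof -
    obtain u where u: "x = (L ^^ j) u" using \<open>x \<in> R\<close> by (auto simp: R_def)
    have "u \<in> gen_kernel" using gen_kernel_powerD[of j u] that(2) by (simp add: u)
    then show ?thesis using power_L_gen_kernel[of u j] j(1) by (simp add: u)
  qed
  have inj: "x = y" if "x \<in> R" "y \<in> R" "(L ^^ n) x = (L ^^ n) y" for x y n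
  proof -
    have "x - y \<in> R" using that R cvs.subspace_diff by blast
    moreover have "x - y \<in> gen_kernel" using that by (auto simp: gen_kernel_def diff intro!: exI[of _ n])
    ultimately show ?thesis using disj[of "x - y"] by simp
  qed
  obtain C where C: "C > 0" "\<And>x. x \<in> R \<Longrightarrow> \<exists>x'\<in>R. L x' = L x \<and> norm x' \<le> C * norm (L x)"
    using bounded_below_mod_kernel[OF R] by blast
  have below: "norm x \<le> C * norm (L x)" if "x \<in> R" for x
    using C(2)[OF that] inj[of _ x 1] that by auto
  have belown: "norm x \<le> C ^ n * norm ((L ^^ n) x)" if "x \<in> R" for x n
    using that
  proof (induction n arbitrary: x)
    case (Suc n)
    have "norm x \<le> C * norm (L x)" using below Suc by blast
    also have "\<dots> \<le> C * (C ^ n * norm ((L ^^ n) (L x)))"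
      using C(1) Suc LR by (intro mult_left_mono Suc.IH) auto
    finally show ?case by (simp add: funpow_swap1 mult.assoc)
  qed simp
  define r where "r x = (SOME r. r \<in> R \<and> (L ^^ j) r = (L ^^ j) x)" for x
  have r: "r x \<in> R" "(L ^^ j) (r x) = (L ^^ j) x" for x
  proof -
    have "(L ^^ j) x \<in> (L ^^ j) ` R" unfolding LRn by (simp add: R_def)
    then have "\<exists>r. r \<in> R \<and> (L ^^ j) r = (L ^^ j) x" by (metis imageE)
    from someI_ex[OF this] show "r x \<in> R" "(L ^^ j) (r x) = (L ^^ j) x" by (auto simp: r_def)
  qed
  have r_eqI: "r x = y" if "y \<in> R" "(L ^^ j) y = (L ^^ j) x" for x y
    using inj[of "r x" y j] r that by simp
  define s where "s y = (SOME s. s \<in> R \<and> L s = y)" for y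
  have s: "s y \<in> R" "L (s y) = y" if "y \<in> R" for y
  proof -
    have "\<exists>s. s \<in> R \<and> L s = y" using LR that by (metis imageE)
    from someI_ex[OF this] show "s y \<in> R" "L (s y) = y" by (auto simp: s_def)
  qed
  have s_eqI: "s (L x) = x" if "x \<in> R" for x
    using inj[of "s (L x)" x 1] s[of "L x"] LR that by auto
  have bcr: "bounded_clinear r"
  proof -
    obtain K where K: "K > 0" "\<And>x. norm ((L ^^ j) x) \<le> K * norm x"
      using bounded_clinear_bound[OF bcLn] by blast
    show ?thesis
    proof (rule bounded_clinearI)
    show "norm (r x) \<le> C ^ j * K * norm x" for x
    proof -
      have "norm (r x) \<le> C ^ j * norm ((L ^^ j) x)" using belown[OF r(1)[of x], of j] by (simp add: r)
      also have "\<dots> \<le> C ^ j * (K * norm x)" using C(1) K(2) by (intro mult_left_mono) auto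
      finally show ?thesis by (simp add: mult.assoc)
    qed
    qed (auto intro!: r_eqI cvs.subspace_add cvs.subspace_scale simp: R r add scale)
  qed
  have rL: "r (L x) = L (r x)" for x
  proof (rule r_eqI)
    show "L (r x) \<in> R" using LR r(1)[of x] by blast
    show "(L ^^ j) (L (r x)) = (L ^^ j) (L x)" by (simp add: funpow_swap1[symmetric] r)
  qed
  have r_id: "r x = x" if "x \<in> R" for x by (rule r_eqI) (use that in auto)
  have r_kernel: "r x = 0" if "x \<in> gen_kernel" for x
    by (rule r_eqI) (use that power_L_gen_kernel[OF that j(1)] R cvs.subspace_0 in \<open>auto simp: zero\<close>)
  have compl: "x - r x \<in> gen_kernel" for x
    using r(2)[of x] by (auto simp: gen_kernel_def diff intro!: exI[of _ j])
  define E where "E x = x - r x" for x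
  define B where "B x = s (r x)" for x
  have Lfun: "L = (\<lambda>x. \<alpha> *\<^sub>C x - T x)" by (simp add: L_def fun_eq_iff)
  have bcB: "bounded_clinear B"
  proof -
    obtain K where K: "K > 0" "\<And>x. norm (r x) \<le> K * norm x"
      using bounded_clinear_bound[OF bcr] by blast
    show ?thesis
    proof (rule bounded_clinearI)
    show "norm (B x) \<le> C * K * norm x" for x
    proof -
      have "norm (B x) \<le> C * norm (r x)" using below[of "B x"] s[OF r(1)] by (simp add: B_def)
      also have "\<dots> \<le> C * (K * norm x)" using C(1) K(2) by simp
      finally show ?thesis by (simp add: mult.assoc)
    qed
    show "B (x + y) = B x + B y" for x y
    proof -
      have "s (L (B x + B y)) = B x + B y"
        by (rule s_eqI) (simp add: B_def R s r cvs.subspace_add)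
      then show ?thesis by (simp add: B_def add s r bounded_clinear_add[OF bcr])
    qed
    show "B (c *\<^sub>C x) = c *\<^sub>C B x" for c x
    proof -
      have "s (L (c *\<^sub>C B x)) = c *\<^sub>C B x"
        by (rule s_eqI) (simp add: B_def R s r cvs.subspace_scale)
      then show ?thesis by (simp add: B_def scale s r bounded_clinear_scaleC[OF bcr])
    qed
    qed
  qed
  have bcE: "bounded_clinear E"
    unfolding E_def by (intro bounded_clinear_minus_fun bounded_clinear_ident bcr)
  have "spectral_splitting T \<alpha> E B gdim basis"
    unfolding spectral_splitting_def Lfun[symmetric]
  proof (intro conjI allI impI bcE bcB)
    show "E (E x) = E x" for x
      by (simp add: E_def bounded_clinear_diff[OF bcr] r_id r)
    show "E (T x) = T (E x)" for x
    proof -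
      have "T y = \<alpha> *\<^sub>C y - L y" for y by (simp add: L_def)
      then show ?thesis
        by (simp add: E_def bounded_clinear_diff[OF bcr] bounded_clinear_scaleC[OF bcr] rL diff cvs.scale_right_diff_distrib)
    qed
    show "\<alpha> *\<^sub>C B x - T (B x) = x - E x" for x
      unfolding L_def[symmetric] by (simp add: B_def E_def s r)
    show "B (\<alpha> *\<^sub>C x - T x) = x - E x" for x
      unfolding L_def[symmetric] by (simp add: B_def E_def rL s_eqI r)
    show "E (B x) = 0" for x by (simp add: E_def B_def r_id s r)
    have "s 0 = 0" using s_eqI[OF cvs.subspace_0[OF R(1)]] by (simp add: zero)
    then show "B (E x) = 0" for x by (simp add: E_def B_def r_kernel[OF compl])
    show "(L ^^ gdim) (E x) = 0" for x
      unfolding E_def by (rule power_L_gen_kernel[OF compl order_refl])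
    have "x \<in> range E" if "x \<in> gen_kernel" for x
      using r_kernel[OF that] by (auto simp: E_def image_iff intro!: exI[of _ x])
    then show "range E = cvs.span (basis ` {..<gdim})"
      unfolding gen_kernel_eq_span[symmetric] using compl by (auto simp: E_def)
    show "basis i \<notin> cvs.span (basis ` {..<i})" if "i < gdim" for i by (rule basis_flag[OF that])
    show "\<alpha> *\<^sub>C basis i - T (basis i) \<in> cvs.span (basis ` {..<i})" if "i < gdim" for i
      using basis_flag(2)[OF that] by (simp add: L_def)
  qed
  then show ?thesis by blast
qed

end

section \<open>Resolvents and circle integrals\<close>

lemma bounded_bilinear_scaleC:
  "bounded_bilinear (scaleC :: complex \<Rightarrow> 'a \<Rightarrow> 'a::complex_banach)"
proof
  show "\<exists>K. \<forall>c x::'a. norm (c *\<^sub>C x) \<le> norm c * norm x * K"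
    by (rule exI[of _ 1]) (simp add: norm_scaleC)
qed (simp_all add: scaleC_add_left scaleC_add_right scaleR_scaleC scaleC_scaleC scaleR_conv_of_real scaleC_complex_def mult.commute)

lemmas continuous_on_scaleC [continuous_intros] = bounded_bilinear.continuous_on[OF bounded_bilinear_scaleC]

text \<open>The contour integral over a circle, divided by \<open>2 \<pi> i\<close>.\<close>

definition circle_mean :: "(complex \<Rightarrow> 'a::complex_banach) \<Rightarrow> complex \<Rightarrow> real \<Rightarrow> 'a"
  where "circle_mean F c r = integral {0..1}
    (\<lambda>t. (of_real r * exp (2 * of_real pi * \<i> * of_real t)) *\<^sub>C F (c + of_real r * exp (2 * of_real pi * \<i> * of_real t)))"

lemma contour_integral_circle_mean:
  "(1 / (2 * of_real pi * \<i>)) *\<^sub>C banach_contour_integral (circlepath c r) F = circle_mean F c r"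
proof -
  have "banach_contour_integral (circlepath c r) F = integral {0..1}
    (\<lambda>t. (2 * of_real pi * \<i>) *\<^sub>C ((of_real r * exp (2 * of_real pi * \<i> * of_real t)) *\<^sub>C F (c + of_real r * exp (2 * of_real pi * \<i> * of_real t))))"
    unfolding banach_contour_integral_def
    by (rule integral_cong)
      (simp add: vector_derivative_circlepath01, simp add: circlepath scaleC_scaleC mult.assoc)
  also have "\<dots> = (2 * of_real pi * \<i>) *\<^sub>C circle_mean F c r"
  proof (cases "(\<lambda>t. (of_real r * exp (2 * of_real pi * \<i> * of_real t)) *\<^sub>C F (c + of_real r * exp (2 * of_real pi * \<i> * of_real t))) integrable_on {0..1}")
    case True
    from integral_linear[OF True bounded_linear_scaleC, of "2 * of_real pi * \<i>"]
    show ?thesis by (simp add: circle_mean_def comp_def)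
  next
    case False
    let ?f = "\<lambda>t. (of_real r * exp (2 * of_real pi * \<i> * of_real t)) *\<^sub>C F (c + of_real r * exp (2 * of_real pi * \<i> * of_real t))"
    have "\<not> (\<lambda>t. (2 * of_real pi * \<i>) *\<^sub>C ?f t) integrable_on {0..1}"
    proof
      assume "(\<lambda>t. (2 * of_real pi * \<i>) *\<^sub>C ?f t) integrable_on {0..1}"
      from integrable_linear[OF this bounded_linear_scaleC, of "1 / (2 * of_real pi * \<i>)"]
      show False using False by (simp add: comp_def scaleC_scaleC scaleC_one)
    qed
    then show ?thesis using False by (simp add: circle_mean_def not_integrable_integral)
  qed
  finally show ?thesis by (simp add: scaleC_scaleC scaleC_one)
qed

lemma norm_circle_mean_le:
  assumes cont: "continuous_on (sphere c r) F" and r: "r \<ge> 0"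
    and M: "\<And>z. z \<in> sphere c r \<Longrightarrow> norm (F z) \<le> M"
  shows "norm (circle_mean F c r) \<le> r * M"
proof -
  have *: "c + of_real r * exp (2 * of_real pi * \<i> * of_real t) \<in> sphere c r" for t :: real
    using r by (simp add: dist_norm norm_mult norm_exp_eq_Re)
  have "norm (circle_mean F c r) \<le> r * M * (1 - 0)"
    unfolding circle_mean_def
  proof (rule integral_bound)
    show "continuous_on {0..1} (\<lambda>t. (of_real r * exp (2 * of_real pi * \<i> * of_real t)) *\<^sub>C
        F (c + of_real r * exp (2 * of_real pi * \<i> * of_real t)))"
      by (intro continuous_intros continuous_on_compose2[OF cont]) (use * in auto)
    show "norm ((of_real r * exp (2 * of_real pi * \<i> * of_real t)) *\<^sub>C
        F (c + of_real r * exp (2 * of_real pi * \<i> * of_real t))) \<le> r * M" for t :: real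
      using M[OF *[of t]] r by (simp add: norm_scaleC norm_mult norm_exp_eq_Re mult_left_mono)
  qed simp
  then show ?thesis by simp
qed

lemma circle_mean_eqI:
  assumes "\<And>z. z \<in> sphere c r \<Longrightarrow> F z = G z" "r \<ge> 0"
  shows "circle_mean F c r = circle_mean G c r"
  unfolding circle_mean_def
  by (rule integral_cong) (use assms in \<open>simp add: dist_norm norm_mult norm_exp_eq_Re\<close>)

lemma circle_mean_add:
  assumes "continuous_on (sphere c r) F" "continuous_on (sphere c r) G" "r \<ge> 0"
  shows "circle_mean (\<lambda>z. F z + G z) c r = circle_mean F c r + circle_mean G c r"
proof -
  have *: "c + of_real r * exp (2 * of_real pi * \<i> * of_real t) \<in> sphere c r" for t :: real
    using assms by (simp add: dist_norm norm_mult norm_exp_eq_Re)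
  have "(\<lambda>t. (of_real r * exp (2 * of_real pi * \<i> * of_real t)) *\<^sub>C
        H (c + of_real r * exp (2 * of_real pi * \<i> * of_real t))) integrable_on {0..1}"
    if "continuous_on (sphere c r) H" for H :: "complex \<Rightarrow> 'a"
    by (intro integrable_continuous_real continuous_intros continuous_on_compose2[OF that]) (use * in auto)
  then show ?thesis
    unfolding circle_mean_def scaleC_add_right using assms by (intro integral_add) auto
qed

lemma circle_mean_sum:
  assumes "\<And>i. i \<in> I \<Longrightarrow> continuous_on (sphere c r) (F i)" "r \<ge> 0"
  shows "circle_mean (\<lambda>z. \<Sum>i\<in>I. F i z) c r = (\<Sum>i\<in>I. circle_mean (F i) c r)"
  using assms
proof (induction I rule: infinite_finite_induct)
  case (insert i I)
  have "circle_mean (\<lambda>z. F i z + (\<Sum>i\<in>I. F i z)) c r = circle_mean (F i) c r + circle_mean (\<lambda>z. \<Sum>i\<in>I. F i z) c r"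
    using insert by (intro circle_mean_add continuous_on_sum) auto
  then show ?case using insert by simp
qed (auto simp: circle_mean_def)

lemma circle_mean_linear:
  assumes "continuous_on (sphere c r) F" "r \<ge> 0" "bounded_linear h" "\<And>a x. h (a *\<^sub>C x) = a *\<^sub>C h x"
  shows "circle_mean (\<lambda>z. h (F z)) c r = h (circle_mean F c r)"
proof -
  have *: "c + of_real r * exp (2 * of_real pi * \<i> * of_real t) \<in> sphere c r" for t :: real
    using assms by (simp add: dist_norm norm_mult norm_exp_eq_Re)
  have "(\<lambda>t. (of_real r * exp (2 * of_real pi * \<i> * of_real t)) *\<^sub>C
        F (c + of_real r * exp (2 * of_real pi * \<i> * of_real t))) integrable_on {0..1}"
    by (intro integrable_continuous_real continuous_intros continuous_on_compose2[OF assms(1)]) (use * in auto)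
  from integral_linear[OF this assms(3)] show ?thesis
    unfolding circle_mean_def by (simp add: comp_def assms)
qed

text \<open>The residue calculus of powers of \<open>z - c\<close>.\<close>

lemma integral_exp_period:
  assumes "k \<noteq> (0::int)"
  shows "((\<lambda>t::real. exp (2 * of_real pi * \<i> * of_int k * of_real t)) has_integral (0::complex)) {0..1}"
proof -
  let ?w = "2 * of_real pi * \<i> * of_int k :: complex"
  have w: "?w \<noteq> 0" using assms by simp
  have "((\<lambda>t::real. exp (?w * of_real t)) has_integral (exp (?w * of_real 1) / ?w - exp (?w * of_real 0) / ?w)) {0..1}"
  proof (rule fundamental_theorem_of_calculus)
    show "((\<lambda>t. exp (?w * of_real t) / ?w) has_vector_derivative exp (?w * of_real t)) (at t within {0..1})" for t :: real
    proof -
      have "((\<lambda>z. exp (?w * z) / ?w) has_field_derivative exp (?w * of_real t)) (at (of_real t))"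
        using w by (auto intro!: derivative_eq_intros)
      then show ?thesis by (rule has_vector_derivative_real_field)
    qed
  qed simp
  moreover have "exp (?w * of_real 1) = 1"
    using exp_integer_2pi[of "of_int k"] by (simp add: mult_ac)
  ultimately show ?thesis by simp
qed

lemma circle_mean_power:
  assumes "r > 0" "k \<noteq> (-1::int)"
  shows "circle_mean (\<lambda>z. ((z - c) powi k) *\<^sub>C x) c r = 0"
proof -
  have eq: "(of_real r * exp (2 * of_real pi * \<i> * of_real t)) * (of_real r * exp (2 * of_real pi * \<i> * of_real t)) powi k
      = of_real (r powi (k + 1)) * exp (2 * of_real pi * \<i> * of_int (k + 1) * of_real t)" for t :: real
  proof -
    have "u * u powi k = u powi (k + 1)" if "u \<noteq> 0" for u :: complex
      using that by (simp add: power_int_add)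
    then have "(of_real r * exp (2 * of_real pi * \<i> * of_real t)) * (of_real r * exp (2 * of_real pi * \<i> * of_real t)) powi k
      = (of_real r * exp (2 * of_real pi * \<i> * of_real t)) powi (k + 1)" using assms by simp
    also have "\<dots> = of_real (r powi (k + 1)) * exp (of_int (k+1) * (2 * of_real pi * \<i> * of_real t))"
      by (simp only: power_int_mult_distrib exp_power_int of_real_power_int)
    finally show ?thesis by (simp add: mult_ac)
  qed
  have "((\<lambda>t::real. exp (2 * of_real pi * \<i> * of_int (k+1) * of_real t) *\<^sub>C (of_real (r powi (k + 1)) *\<^sub>C x)) has_integral
       0 *\<^sub>C (of_real (r powi (k + 1)) *\<^sub>C x)) {0..1}"
  proof (rule has_integral_linear[OF integral_exp_period, unfolded comp_def])
    show "k + 1 \<noteq> 0" using assms by linarith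
    show "bounded_linear (\<lambda>a. a *\<^sub>C (of_real (r powi (k + 1)) *\<^sub>C x))"
      by (rule bounded_bilinear.bounded_linear_left[OF bounded_bilinear_scaleC])
  qed
  moreover have "exp (2 * of_real pi * \<i> * of_int (k+1) * of_real t) *\<^sub>C (of_real (r powi (k + 1)) *\<^sub>C x) =
      (of_real r * exp (2 * of_real pi * \<i> * of_real t)) *\<^sub>C
        ((c + of_real r * exp (2 * of_real pi * \<i> * of_real t) - c) powi k *\<^sub>C x)" for t :: real
    unfolding scaleC_scaleC add_diff_cancel_left' eq by (simp only: mult.commute)
  ultimately have "((\<lambda>t. (of_real r * exp (2 * of_real pi * \<i> * of_real t)) *\<^sub>C
        ((c + of_real r * exp (2 * of_real pi * \<i> * of_real t) - c) powi k *\<^sub>C x)) has_integral 0) {0..1}"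
    by (simp only: cvs.scale_zero_left)
  then show ?thesis unfolding circle_mean_def by (rule integral_unique)
qed

lemma circle_mean_inverse:
  assumes "r > 0"
  shows "circle_mean (\<lambda>z. (1 / (z - c)) *\<^sub>C x) c r = x"
  unfolding circle_mean_def using assms by (simp add: scaleC_scaleC scaleC_one)

text \<open>Homotopy invariance of the integral between concentric circles: the derivative of the mean
  with respect to the radius is the integral of a derivative along the closed circle.\<close>

lemma circle_mean_radius_independent:
  fixes F :: "complex \<Rightarrow> 'a::complex_banach"
  assumes r: "0 < r0" "r0 \<le> r1"
    and F: "\<And>z. r0 \<le> dist c z \<Longrightarrow> dist c z \<le> r1 \<Longrightarrow> (F has_derivative (\<lambda>h. h *\<^sub>C F' z)) (at z)"
    and F': "continuous_on {z. r0 \<le> dist c z \<and> dist c z \<le> r1} F'"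
  shows "circle_mean F c r0 = circle_mean F c r1"
proof -
  define e where "e t = exp (2 * of_real pi * \<i> * of_real t)" for t :: real
  have ne: "cmod (e t) = 1" for t by (simp add: e_def norm_exp_eq_Re)
  have e': "(e has_vector_derivative (2 * of_real pi * \<i>) * e t) (at t within S)" for t S
  proof -
    have "((\<lambda>z. exp (2 * of_real pi * \<i> * z)) has_field_derivative (2 * of_real pi * \<i>) * e t) (at (of_real t))"
      by (auto intro!: derivative_eq_intros simp: e_def)
    then show ?thesis unfolding e_def[abs_def] by (rule has_vector_derivative_real_field)
  qed
  have conte: "continuous_on S e" for S unfolding e_def by (intro continuous_intros)
  have ann: "r0 \<le> dist c (c + of_real r * e t)" "dist c (c + of_real r * e t) \<le> r1" if "r \<in> {r0..r1}" for r t
    using that assms(1) by (auto simp: dist_norm norm_mult ne)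
  have contF: "continuous_on {z. r0 \<le> dist c z \<and> dist c z \<le> r1} F"
    by (rule continuous_at_imp_continuous_on) (auto intro: has_derivative_continuous[OF F])
  define fx where "fx r t = e t *\<^sub>C F (c + of_real r * e t) + (of_real r * e t) *\<^sub>C (e t *\<^sub>C F' (c + of_real r * e t))" for r t
  define f where "f r t = (of_real r * e t) *\<^sub>C F (c + of_real r * e t)" for r t
  have d: "((\<lambda>r. integral (cbox 0 1) (f r)) has_vector_derivative integral (cbox 0 1) (fx r)) (at r within {r0..r1})"
    if "r \<in> {r0..r1}" for r
  proof (rule leibniz_rule_vector_derivative[OF _ _ _ that])
    show "((\<lambda>r. f r t) has_vector_derivative fx r t) (at r within {r0..r1})" if "r \<in> {r0..r1}" for r t
    proof -
      have 1: "((\<lambda>r. of_real r * e t) has_vector_derivative e t) (at r within {r0..r1})"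
        by (auto intro!: derivative_eq_intros)
      have 2: "((\<lambda>r. c + of_real r * e t) has_vector_derivative e t) (at r within {r0..r1})"
        by (auto intro!: derivative_eq_intros)
      have "(F has_derivative (\<lambda>h. h *\<^sub>C F' (c + of_real r * e t))) (at (c + of_real r * e t))"
        by (rule F) (use ann that in auto)
      from has_derivative_compose[OF 2[unfolded has_vector_derivative_def] this]
      have "((\<lambda>r. F (c + of_real r * e t)) has_vector_derivative e t *\<^sub>C F' (c + of_real r * e t)) (at r within {r0..r1})"
        by (simp add: has_vector_derivative_def scaleR_scaleC scaleC_scaleC scaleC_complex_def)
      from bounded_bilinear.has_vector_derivative[OF bounded_bilinear_scaleC 1 this]
      show ?thesis by (simp add: f_def fx_def add.commute)
    qed
    show "f r integrable_on cbox 0 1" if "r \<in> {r0..r1}" for r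
      unfolding f_def cbox_interval
      by (intro integrable_continuous_real continuous_intros continuous_on_compose2[OF contF] conte)
        (use ann that in auto)
    show "continuous_on ({r0..r1} \<times> cbox 0 1) (\<lambda>(r, t). fx r t)"
      unfolding fx_def split_def
      by (intro continuous_intros continuous_on_compose2[OF contF] continuous_on_compose2[OF F']
          continuous_on_compose2[OF conte[of UNIV]]) (use ann in auto)
  qed simp
  have "integral (cbox 0 1) (fx r) = 0" if r: "r \<in> {r0..r1}" for r
  proof -
    let ?w = "2 * of_real pi * \<i> :: complex"
    have "((\<lambda>t. ?w *\<^sub>C fx r t) has_integral e 1 *\<^sub>C F (c + of_real r * e 1) - e 0 *\<^sub>C F (c + of_real r * e 0)) {0..1}"
    proof (rule fundamental_theorem_of_calculus)
      fix t :: real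
      have 2: "((\<lambda>t. c + of_real r * e t) has_vector_derivative of_real r * (?w * e t)) (at t within {0..1})"
        by (auto intro!: derivative_eq_intros e')
      have "(F has_derivative (\<lambda>h. h *\<^sub>C F' (c + of_real r * e t))) (at (c + of_real r * e t))"
        by (rule F) (use ann r in auto)
      from has_derivative_compose[OF 2[unfolded has_vector_derivative_def] this]
      have "((\<lambda>t. F (c + of_real r * e t)) has_vector_derivative (of_real r * (?w * e t)) *\<^sub>C F' (c + of_real r * e t)) (at t within {0..1})"
        by (simp add: has_vector_derivative_def scaleR_scaleC scaleC_scaleC scaleC_complex_def)
      from bounded_bilinear.has_vector_derivative[OF bounded_bilinear_scaleC e' this]
      show "((\<lambda>t. e t *\<^sub>C F (c + of_real r * e t)) has_vector_derivative ?w *\<^sub>C fx r t) (at t within {0..1})"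
        by (simp add: fx_def cvs.scale_right_distrib scaleC_scaleC mult_ac add.commute)
    qed simp
    moreover have "e 1 = e 0" using exp_integer_2pi[of 1] by (simp add: e_def mult_ac)
    ultimately have "((\<lambda>t. ?w *\<^sub>C fx r t) has_integral 0) {0..1}" by simp
    from has_integral_linear[OF this bounded_linear_scaleC[of "1 / ?w"]]
    have "(fx r has_integral 0) {0..1}" by (simp add: comp_def scaleC_scaleC scaleC_one)
    then show ?thesis by (simp add: integral_unique)
  qed
  with d have "((\<lambda>r. integral (cbox 0 1) (f r)) has_vector_derivative 0) (at r within {r0..r1})"
    if "r \<in> {r0..r1}" for r using that by metis
  then have "((\<lambda>r. integral (cbox 0 1) (f r)) has_derivative (\<lambda>h. 0)) (at r within {r0..r1})"
    if "r \<in> {r0..r1}" for r using that by (simp add: has_vector_derivative_def)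
  then obtain k where "\<And>r. r \<in> {r0..r1} \<Longrightarrow> integral (cbox 0 1) (f r) = k"
    using has_derivative_zero_constant[of "{r0..r1}" "\<lambda>r. integral (cbox 0 1) (f r)"] by auto
  then show ?thesis using assms by (simp add: circle_mean_def f_def[abs_def] e_def)
qed

text \<open>The inverse of \<open>1 + S\<close>, obtained from the fixed points of the contractions
  \<open>x \<mapsto> y - S x\<close>.\<close>

lemma neumann_inverse:
  fixes S :: "'a::complex_banach \<Rightarrow> 'a"
  assumes S: "bounded_clinear S" "\<And>x. norm (S x) \<le> q * norm x" "0 \<le> q" "q < 1"
  shows "\<exists>V. bounded_clinear V \<and> (\<forall>x. V x + S (V x) = x) \<and> (\<forall>x. V (x + S x) = x) \<and>
    (\<forall>x. norm (V x) \<le> norm x / (1 - q))"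
proof -
  have "\<exists>x. x + S x = y" for y
  proof -
    have "\<exists>!x. y - S x = x"
    proof (rule banach_fix_type)
      show "\<forall>x z. dist (y - S x) (y - S z) \<le> q * dist x z"
      proof (intro allI)
        fix x z
        have "y - S x - (y - S z) = S (z - x)" by (simp add: bounded_clinear_diff[OF S(1)])
        then show "dist (y - S x) (y - S z) \<le> q * dist x z"
          using S(2)[of "z - x"] by (simp add: dist_norm norm_minus_commute)
      qed
    qed (use S in auto)
    then obtain x where "y - S x = x" by blast
    then have "x + S x = y" by (metis diff_add_cancel)
    then show ?thesis by blast
  qed
  then obtain V where V: "\<And>y. V y + S (V y) = y" by metis
  have bound: "(1 - q) * norm x \<le> norm (x + S x)" for x
    using S(2)[of x] norm_triangle_ineq2[of x "- S x"] by (simp add: algebra_simps)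
  have inj: "x = y" if "x + S x = y + S y" for x y
  proof -
    have "(x - y) + S (x - y) = 0" using that by (simp add: bounded_clinear_diff[OF S(1)] algebra_simps)
    then show ?thesis using bound[of "x - y"] S(4) by (simp add: mult_le_0_iff)
  qed
  have left: "V (x + S x) = x" for x by (rule inj) (rule V)
  have le: "norm (V x) \<le> norm x / (1 - q)" for x
    using bound[of "V x"] S(4) by (simp add: V pos_le_divide_eq mult.commute)
  have "bounded_clinear V"
  proof (rule bounded_clinearI)
    show "norm (V x) \<le> (1 / (1 - q)) * norm x" for x using le[of x] by simp
    show "V (x + y) = V x + V y" for x y
    proof (rule inj)
      have "V x + V y + S (V x + V y) = (V x + S (V x)) + (V y + S (V y))"
        by (simp add: bounded_clinear_add[OF S(1)] algebra_simps)
      then show "V (x + y) + S (V (x + y)) = V x + V y + S (V x + V y)" by (simp only: V)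
    qed
    show "V (c *\<^sub>C x) = c *\<^sub>C V x" for c x
    proof (rule inj)
      have "c *\<^sub>C V x + S (c *\<^sub>C V x) = c *\<^sub>C (V x + S (V x))"
        by (simp add: bounded_clinear_scaleC[OF S(1)] scaleC_add_right)
      then show "V (c *\<^sub>C x) + S (V (c *\<^sub>C x)) = c *\<^sub>C V x + S (c *\<^sub>C V x)" by (simp only: V)
    qed
  qed
  then show ?thesis using V left le by blast
qed

definition is_resolvent :: "('a::complex_banach \<Rightarrow> 'a) \<Rightarrow> complex \<Rightarrow> ('a \<Rightarrow> 'a) \<Rightarrow> bool"
  where "is_resolvent T z R \<longleftrightarrow> bounded_clinear R \<and> (\<forall>x. z *\<^sub>C R x - T (R x) = x) \<and> (\<forall>x. R (z *\<^sub>C x - T x) = x)"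

lemma is_resolvent_imp:
  assumes "is_resolvent T z R"
  shows "z \<in> resolvent_set T" "blinfun_apply (resolvent T z) = R"
proof -
  let ?f = "\<lambda>x. z *\<^sub>C x - T x"
  have R: "?f (R x) = x" "R (?f x) = x" for x using assms by (auto simp: is_resolvent_def)
  have bij: "bij ?f" by (rule bijI') (metis R)+
  have inv: "inv_into UNIV ?f = R" by (rule inv_equality) (use R in auto)
  have "bounded_linear R" using assms by (simp add: is_resolvent_def bounded_clinear_def)
  then show "z \<in> resolvent_set T" "blinfun_apply (resolvent T z) = R"
    using bij by (simp_all add: resolvent_set_def resolvent_def inv bounded_linear_Blinfun_apply)
qed

lemma is_resolvent_resolvent:
  assumes T: "bounded_clinear T" and z: "z \<in> resolvent_set T"
  shows "is_resolvent T z (blinfun_apply (resolvent T z))"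
proof -
  let ?f = "\<lambda>x. z *\<^sub>C x - T x"
  have bij: "bij ?f" and bl: "bounded_linear (inv_into UNIV ?f)" using z by (auto simp: resolvent_set_def)
  have R: "blinfun_apply (resolvent T z) = inv_into UNIV ?f"
    by (simp add: resolvent_def bounded_linear_Blinfun_apply[OF bl])
  have 1: "?f (inv_into UNIV ?f x) = x" "inv_into UNIV ?f (?f x) = x" for x
    by (rule surj_f_inv_f[OF bij_is_surj[OF bij]], rule inv_f_f[OF bij_is_inj[OF bij]])
  have "clinear (inv_into UNIV ?f)" unfolding clinear_iff
  proof (intro conjI allI)
    show "inv_into UNIV ?f (x + y) = inv_into UNIV ?f x + inv_into UNIV ?f y" for x y
    proof -
      have "?f (inv_into UNIV ?f x + inv_into UNIV ?f y) = x + y"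
        using 1(1)[of x] 1(1)[of y] by (simp add: scaleC_add_right bounded_clinear_add[OF T] algebra_simps)
      then show ?thesis using 1(2)[of "inv_into UNIV ?f x + inv_into UNIV ?f y"] by simp
    qed
    show "inv_into UNIV ?f (c *\<^sub>C x) = c *\<^sub>C inv_into UNIV ?f x" for c x
    proof -
      have "?f (c *\<^sub>C inv_into UNIV ?f x) = c *\<^sub>C ?f (inv_into UNIV ?f x)"
        by (simp add: cvs.scale_right_diff_distrib bounded_clinear_scaleC[OF T] scaleC_scaleC mult.commute)
      then show ?thesis using 1(2)[of "c *\<^sub>C inv_into UNIV ?f x"] by (simp add: 1)
    qed
  qed
  then show ?thesis using 1 bl unfolding is_resolvent_def R bounded_clinear_def by auto
qed

lemma resolvent_right: "bounded_clinear T \<Longrightarrow> z \<in> resolvent_set T \<Longrightarrow> z *\<^sub>C resolvent T z x - T (resolvent T z x) = x"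
  and resolvent_left: "bounded_clinear T \<Longrightarrow> z \<in> resolvent_set T \<Longrightarrow> resolvent T z (z *\<^sub>C x - T x) = x"
  and bounded_clinear_resolvent: "bounded_clinear T \<Longrightarrow> z \<in> resolvent_set T \<Longrightarrow> bounded_clinear (resolvent T z)"
  using is_resolvent_resolvent unfolding is_resolvent_def by blast+

lemma resolvent_perturb:
  assumes T: "bounded_clinear T" and w: "w \<in> resolvent_set T" and z: "cmod (z - w) * norm (resolvent T w) \<le> 1/2"
  shows "z \<in> resolvent_set T"
proof -
  let ?R = "blinfun_apply (resolvent T w)"
  note R = bounded_clinear_resolvent[OF T w]
  let ?S = "\<lambda>x. (z - w) *\<^sub>C ?R x"
  have S: "bounded_clinear ?S" by (rule bounded_clinear_scale[OF R])
  have "norm (?S x) \<le> (1/2) * norm x" for x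
  proof -
    have "norm (?S x) \<le> cmod (z - w) * (norm (resolvent T w) * norm x)"
      by (simp add: norm_scaleC mult_left_mono norm_blinfun)
    also have "\<dots> \<le> (1/2) * norm x" using mult_right_mono[OF z, of "norm x"] by (simp add: mult.assoc)
    finally show ?thesis .
  qed
  then obtain V where V: "bounded_clinear V" "\<And>x. V x + ?S (V x) = x" "\<And>x. V (x + ?S x) = x"
    using neumann_inverse[OF S, of "1/2"] by auto
  have comm: "T (?R x) = ?R (T x)" for x
  proof -
    have "w *\<^sub>C ?R x - T (?R x) = w *\<^sub>C ?R x - ?R (T x)"
      using resolvent_right[OF T w, of x] resolvent_left[OF T w, of x]
      by (simp add: bounded_clinear_diff[OF R] bounded_clinear_scaleC[OF R])
    then show ?thesis by simp
  qed
  have f: "z *\<^sub>C ?R y - T (?R y) = y + ?S y" for y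
    using resolvent_right[OF T w, of y] by (simp add: cvs.scale_left_diff_distrib algebra_simps)
  have fl: "?R (z *\<^sub>C x - T x) = x + ?S x" for x
    using f[of x] by (simp add: bounded_clinear_diff[OF R] bounded_clinear_scaleC[OF R] comm)
  have RV: "?R (V x) = V (?R x)" for x
  proof -
    have "V (?R (V x + ?S (V x))) = ?R (V x)"
      using V(3)[of "?R (V x)"] by (simp add: bounded_clinear_add[OF R] bounded_clinear_scaleC[OF R])
    then show ?thesis by (simp add: V)
  qed
  have "is_resolvent T z (\<lambda>x. ?R (V x))"
    unfolding is_resolvent_def
  proof (intro conjI allI)
    show "bounded_clinear (\<lambda>x. ?R (V x))" by (rule bounded_clinear_compose[OF R V(1)])
    show "z *\<^sub>C ?R (V x) - T (?R (V x)) = x" for x unfolding f V ..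
    show "?R (V (z *\<^sub>C x - T x)) = x" for x unfolding RV fl V ..
  qed
  then show ?thesis by (rule is_resolvent_imp)
qed

lemma open_resolvent_set:
  assumes T: "bounded_clinear T"
  shows "open (resolvent_set T)"
  unfolding open_dist
proof (intro ballI)
  fix w assume w: "w \<in> resolvent_set T"
  let ?e = "1 / (2 * (norm (resolvent T w) + 1))"
  have pos: "norm (resolvent T w) + 1 > 0" by (intro add_nonneg_pos) auto
  have "y \<in> resolvent_set T" if "dist y w < ?e" for y
  proof (rule resolvent_perturb[OF T w])
    have "cmod (y - w) * norm (resolvent T w) \<le> ?e * (norm (resolvent T w) + 1)"
      using that pos by (intro mult_mono) (auto simp: dist_norm)
    also have "\<dots> = 1/2" using pos by (simp add: field_simps)
    finally show "cmod (y - w) * norm (resolvent T w) \<le> 1/2" .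
  qed
  then show "\<exists>e>0. \<forall>y. dist y w < e \<longrightarrow> y \<in> resolvent_set T"
    using pos by (intro exI[of _ ?e]) auto
qed

lemma resolvent_identity:
  assumes T: "bounded_clinear T" and zw: "z \<in> resolvent_set T" "w \<in> resolvent_set T"
  shows "resolvent T z - resolvent T w = (w - z) *\<^sub>C (resolvent T z o\<^sub>L resolvent T w)"
proof (rule blinfun_eqI)
  fix x
  let ?y = "resolvent T w x"
  note Rz = bounded_clinear_resolvent[OF T zw(1)]
  have "resolvent T z x = resolvent T z ((z *\<^sub>C ?y - T ?y) + (w - z) *\<^sub>C ?y)"
    using resolvent_right[OF T zw(2), of x] by (simp add: cvs.scale_left_diff_distrib)
  also have "\<dots> = ?y + (w - z) *\<^sub>C resolvent T z ?y"
    by (simp only: bounded_clinear_add[OF Rz] bounded_clinear_scaleC[OF Rz] resolvent_left[OF T zw(1)])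
  finally show "(resolvent T z - resolvent T w) x = ((w - z) *\<^sub>C (resolvent T z o\<^sub>L resolvent T w)) x"
    by (simp add: blinfun_apply_scaleC minus_blinfun.rep_eq)
qed

lemma resolvent_continuous:
  assumes T: "bounded_clinear T" and w: "w \<in> resolvent_set T"
  shows "isCont (resolvent T) w"
proof -
  let ?n = "norm (resolvent T w)"
  have ev: "eventually (\<lambda>z. norm (resolvent T z - resolvent T w) \<le> 2 * ?n * ?n * cmod (z - w)) (at w)"
  proof -
    have "eventually (\<lambda>z. z \<in> resolvent_set T) (at w)"
      by (rule eventually_at_in_open'[OF open_resolvent_set[OF T] w])
    moreover have "((\<lambda>z. cmod (z - w) * ?n) \<longlongrightarrow> cmod (w - w) * ?n) (at w)"
      by (intro tendsto_intros)
    then have "eventually (\<lambda>z. cmod (z - w) * ?n < 1/2) (at w)"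
      by (rule order_tendstoD) simp
    ultimately show ?thesis
    proof eventually_elim
      case (elim z)
      let ?m = "norm (resolvent T z)"
      have le: "norm (resolvent T z - resolvent T w) \<le> cmod (z - w) * (?m * ?n)"
        unfolding resolvent_identity[OF T elim(1) w]
        by (simp add: norm_scaleC norm_minus_commute mult_left_mono norm_blinfun_compose)
      have "?m \<le> norm (resolvent T z - resolvent T w) + ?n" using norm_triangle_sub by (metis add.commute)
      also have "\<dots> \<le> cmod (z - w) * ?n * ?m + ?n" using le by (simp add: mult_ac)
      also have "\<dots> \<le> 1/2 * ?m + ?n" using elim(2) by (intro add_mono mult_right_mono) auto
      finally have "?m \<le> 2 * ?n" by simp
      then have "cmod (z - w) * (?m * ?n) \<le> cmod (z - w) * ((2 * ?n) * ?n)"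
        by (intro mult_left_mono mult_right_mono) auto
      then show ?case using le by (simp add: mult_ac)
    qed
  qed
  have "((\<lambda>z. 2 * ?n * ?n * cmod (z - w)) \<longlongrightarrow> 2 * ?n * ?n * cmod (w - w)) (at w)"
    by (intro tendsto_intros)
  then have "((\<lambda>z. 2 * ?n * ?n * cmod (z - w)) \<longlongrightarrow> 0) (at w)" by simp
  from Lim_null_comparison[OF ev this] show ?thesis
    by (simp add: isCont_def LIM_zero_iff)
qed

lemma resolvent_has_derivative:
  assumes T: "bounded_clinear T" and w: "w \<in> resolvent_set T"
  shows "(resolvent T has_derivative (\<lambda>h. h *\<^sub>C - (resolvent T w o\<^sub>L resolvent T w))) (at w)"
proof (rule has_derivativeI)
  show "bounded_linear (\<lambda>h. h *\<^sub>C - (resolvent T w o\<^sub>L resolvent T w))"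
    by (rule bounded_bilinear.bounded_linear_left[OF bounded_bilinear_scaleC])
  let ?g = "\<lambda>z. norm ((resolvent T w - resolvent T z) o\<^sub>L resolvent T w)"
  have "((\<lambda>z. (resolvent T w - resolvent T z) o\<^sub>L resolvent T w) \<longlongrightarrow> (resolvent T w - resolvent T w) o\<^sub>L resolvent T w) (at w)"
    using resolvent_continuous[OF T w] unfolding isCont_def
    by (intro tendsto_intros bounded_bilinear.tendsto[OF bounded_bilinear_blinfun_compose])
  then have lim: "(?g \<longlongrightarrow> 0) (at w)" by (simp add: tendsto_norm_zero)
  have "eventually (\<lambda>z. z \<in> resolvent_set T - {w}) (at w)"
    by (rule eventually_at_in_open[OF open_resolvent_set[OF T] w])
  then have "eventually (\<lambda>z. ?g z = norm (((resolvent T z - resolvent T w) - (z - w) *\<^sub>C - (resolvent T w o\<^sub>L resolvent T w))) / norm (z - w)) (at w)"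
  proof eventually_elim
    case (elim z)
    have "(resolvent T z - resolvent T w) - (z - w) *\<^sub>C - (resolvent T w o\<^sub>L resolvent T w)
       = (z - w) *\<^sub>C ((resolvent T w - resolvent T z) o\<^sub>L resolvent T w)"
      unfolding resolvent_identity[OF T DiffD1[OF elim] w]
      by (simp add: bounded_bilinear.diff_left[OF bounded_bilinear_blinfun_compose]
        cvs.scale_right_diff_distrib cvs.scale_left_diff_distrib)
    then show ?case using elim by (simp add: norm_scaleC)
  qed
  from Lim_transform_eventually[OF lim this]
  show "((\<lambda>y. ((resolvent T y - resolvent T w) - (y - w) *\<^sub>C - (resolvent T w o\<^sub>L resolvent T w)) /\<^sub>R norm (y - w)) \<longlongrightarrow> 0) (at w)"
    by (rule_tac tendsto_norm_zero_cancel) (simp add: divide_inverse_commute)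
qed

text \<open>The resolvent is holomorphic with derivative \<open>- R(z)\<^sup>2\<close>.\<close>

lemma circle_mean_resolvent:
  assumes T: "bounded_clinear T" and r: "0 < r0" "r0 \<le> r1"
    and sub: "\<And>z. r0 \<le> dist c z \<Longrightarrow> dist c z \<le> r1 \<Longrightarrow> z \<in> resolvent_set T"
  shows "circle_mean (resolvent T) c r0 = circle_mean (resolvent T) c r1"
proof (rule circle_mean_radius_independent[OF r, where F' = "\<lambda>w. - (resolvent T w o\<^sub>L resolvent T w)"])
  show "(resolvent T has_derivative (\<lambda>h. h *\<^sub>C - (resolvent T z o\<^sub>L resolvent T z))) (at z)"
    if "r0 \<le> dist c z" "dist c z \<le> r1" for z
    by (rule resolvent_has_derivative[OF T sub[OF that]])
  have "continuous_on {z. r0 \<le> dist c z \<and> dist c z \<le> r1} (resolvent T)"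
    by (rule continuous_at_imp_continuous_on) (auto intro: resolvent_continuous[OF T] sub)
  then show "continuous_on {z. r0 \<le> dist c z \<and> dist c z \<le> r1} (\<lambda>w. - (resolvent T w o\<^sub>L resolvent T w))"
    by (intro continuous_intros bounded_bilinear.continuous_on[OF bounded_bilinear_blinfun_compose])
qed

lemma large_in_resolvent_set:
  assumes T: "bounded_clinear T" and K: "\<And>x. norm (T x) \<le> K * norm x" "K \<ge> 0" and z: "cmod z > K"
  shows "z \<in> resolvent_set T" "norm (resolvent T z) \<le> 1 / (cmod z - K)"
proof -
  have z0: "z \<noteq> 0" using K z by auto
  let ?S = "\<lambda>x. (- inverse z) *\<^sub>C T x"
  have S: "bounded_clinear ?S" by (rule bounded_clinear_scale[OF T])
  have "norm (?S x) \<le> (K / cmod z) * norm x" for x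
    using mult_right_mono[OF K(1)[of x], of "inverse (cmod z)"]
    by (simp add: norm_scaleC norm_inverse divide_inverse mult_ac)
  then have "\<exists>V. bounded_clinear V \<and> (\<forall>x. V x + ?S (V x) = x) \<and> (\<forall>x. V (x + ?S x) = x) \<and>
    (\<forall>x. norm (V x) \<le> norm x / (1 - K / cmod z))"
    by (rule neumann_inverse[OF S]) (use z K z0 in \<open>auto simp: divide_less_eq\<close>)
  then obtain V where V: "bounded_clinear V" "\<And>x. V x + ?S (V x) = x" "\<And>x. V (x + ?S x) = x"
    "\<And>x. norm (V x) \<le> norm x / (1 - K / cmod z)" by blast
  have f: "z *\<^sub>C x - T x = z *\<^sub>C (x + ?S x)" for x
  proof -
    have "z *\<^sub>C (inverse z *\<^sub>C T x) = T x"
      by (simp only: scaleC_scaleC right_inverse[OF z0] scaleC_one)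
    then show ?thesis by (simp add: cvs.scale_right_diff_distrib)
  qed
  have R: "is_resolvent T z (\<lambda>x. inverse z *\<^sub>C V x)"
    unfolding is_resolvent_def f
  proof (intro conjI allI)
    show "bounded_clinear (\<lambda>x. inverse z *\<^sub>C V x)" by (rule bounded_clinear_scale[OF V(1)])
    show "z *\<^sub>C (inverse z *\<^sub>C V x + ?S (inverse z *\<^sub>C V x)) = x" for x
    proof -
      have "inverse z *\<^sub>C V x + ?S (inverse z *\<^sub>C V x) = inverse z *\<^sub>C (V x + ?S (V x))"
        by (simp add: bounded_clinear_scaleC[OF T] scaleC_scaleC cvs.scale_right_distrib mult_ac cvs.scale_right_diff_distrib)
      then show ?thesis by (simp only: V scaleC_scaleC right_inverse[OF z0] scaleC_one)
    qed
    show "inverse z *\<^sub>C V (z *\<^sub>C (x + ?S x)) = x" for x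
      unfolding bounded_clinear_scaleC[OF V(1)] V(3) using z0 by (simp add: scaleC_scaleC scaleC_one)
  qed
  show "z \<in> resolvent_set T" by (rule is_resolvent_imp[OF R])
  show "norm (resolvent T z) \<le> 1 / (cmod z - K)"
  proof (rule norm_blinfun_bound)
    fix x
    have "norm (resolvent T z x) = norm (V x) / cmod z"
      using z0 by (simp add: is_resolvent_imp[OF R] norm_scaleC norm_inverse norm_divide divide_inverse mult.commute)
    also have "\<dots> \<le> (norm x / (1 - K / cmod z)) / cmod z" using V(4) by (intro divide_right_mono) auto
    also have "\<dots> = 1 / (cmod z - K) * norm x" using z0 z by (simp add: divide_simps)
    finally show "norm (resolvent T z x) \<le> 1 / (cmod z - K) * norm x" .
  qed (use z in auto)
qed

section \<open>Riesz projections of compact operators\<close>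

lemma splittingD:
  assumes "spectral_splitting T \<alpha> E B m e"
  shows "bounded_clinear E" "bounded_clinear B" "E (E x) = E x" "E (T x) = T (E x)"
    "\<alpha> *\<^sub>C B x - T (B x) = x - E x" "B (\<alpha> *\<^sub>C x - T x) = x - E x" "E (B x) = 0" "B (E x) = 0"
    "((\<lambda>x. \<alpha> *\<^sub>C x - T x) ^^ m) (E x) = 0" "range E = cvs.span (e ` {..<m})"
    "i < m \<Longrightarrow> e i \<notin> cvs.span (e ` {..<i})" "i < m \<Longrightarrow> \<alpha> *\<^sub>C e i - T (e i) \<in> cvs.span (e ` {..<i})"
  using assms unfolding spectral_splitting_def by simp_all

lemma flag_independent:
  assumes "\<And>i. i < m \<Longrightarrow> e i \<notin> cvs.span (e ` {..<i})"
  shows "cvs.independent (e ` {..<m})" "card (e ` {..<m}) = m"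
proof -
  have "cvs.independent (e ` {..<n}) \<and> card (e ` {..<n}) = n" if "n \<le> m" for n
    using that
  proof (induction n)
    case (Suc n)
    have e: "e n \<notin> cvs.span (e ` {..<n})" using assms[of n] Suc by simp
    then have "e n \<notin> e ` {..<n}" by (rule contrapos_nn) (rule cvs.span_base)
    then show ?case using Suc e by (simp add: lessThan_Suc cvs.independent_insertI)
  qed (simp add: cvs.independent_empty)
  then show "cvs.independent (e ` {..<m})" "card (e ` {..<m}) = m" by auto
qed

text \<open>The coefficient of \<open>(z - \<alpha>)\<^bsup>-i-1\<^esup>\<close> in the Laurent series of the resolvent at \<open>\<alpha>\<close>. It vanishes from
  \<open>i = m\<close> on, because \<open>T - \<alpha>\<close> is nilpotent on the range of \<open>E\<close>.\<close>

definition principal_coeff :: "('a::complex_banach \<Rightarrow> 'a) \<Rightarrow> complex \<Rightarrow> ('a \<Rightarrow> 'a) \<Rightarrow> nat \<Rightarrow> 'a \<Rightarrow> 'a"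
  where "principal_coeff T \<alpha> E i x = ((\<lambda>x. T x - \<alpha> *\<^sub>C x) ^^ i) (E x)"

context
  fixes T :: "'a::complex_banach \<Rightarrow> 'a" and \<alpha> E B m e
  assumes T: "bounded_clinear T" and split: "spectral_splitting T \<alpha> E B m e"
begin

lemma bounded_clinear_principal_coeff: "bounded_clinear (principal_coeff T \<alpha> E i)"
  unfolding principal_coeff_def[abs_def]
  by (intro bounded_clinear_compose[OF bounded_clinear_funpow splittingD(1)[OF split]]
      bounded_clinear_minus_fun bounded_clinear_scale bounded_clinear_ident T)

lemma principal_coeff_last: "principal_coeff T \<alpha> E m x = 0"
proof -
  have "((\<lambda>x. T x - \<alpha> *\<^sub>C x) ^^ i) y = (- 1) ^ i *\<^sub>C ((\<lambda>x. \<alpha> *\<^sub>C x - T x) ^^ i) y" for i y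
  proof (induction i)
    case (Suc i)
    then show ?case
      by (simp add: bounded_clinear_scaleC[OF T] cvs.scale_right_diff_distrib scaleC_scaleC mult.commute)
  qed (simp add: scaleC_one)
  then show ?thesis by (simp add: principal_coeff_def splittingD(9)[OF split])
qed

text \<open>On the range of \<open>E\<close> the finite principal part inverts \<open>z - T\<close>, by a telescoping sum. On the
  complement \<open>z - T = (1 + (z - \<alpha>) B) (\<alpha> - T)\<close>, where \<open>V\<close> inverts the first factor and \<open>B\<close> the
  second.\<close>

lemma resolvent_near_aux:
  assumes V: "bounded_clinear V" "\<And>x. V x + (z - \<alpha>) *\<^sub>C B (V x) = x" "\<And>x. V (x + (z - \<alpha>) *\<^sub>C B x) = x"
    and z: "z \<noteq> \<alpha>"
  shows "is_resolvent T z (\<lambda>x. (\<Sum>i<m. ((z - \<alpha>) powi (- int i - 1)) *\<^sub>C principal_coeff T \<alpha> E i x) + B (V x))"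
proof -
  note sp = splittingD[OF split]
  let ?C = "principal_coeff T \<alpha> E" and ?w = "z - \<alpha>"
  let ?P = "\<lambda>x. \<Sum>i<m. (?w powi (- int i - 1)) *\<^sub>C ?C i x"
  let ?R = "\<lambda>x. ?P x + B (V x)"
  have bcR: "bounded_clinear ?R"
    by (intro bounded_clinear_plus bounded_clinear_sum_fun bounded_clinear_scale
        bounded_clinear_principal_coeff bounded_clinear_compose[OF sp(2) V(1)])
  have zT: "z *\<^sub>C y - T y = ?w *\<^sub>C y + (\<alpha> *\<^sub>C y - T y)" for y
    by (simp add: cvs.scale_left_diff_distrib)
  have C_Suc: "\<alpha> *\<^sub>C ?C i x - T (?C i x) = - ?C (Suc i) x" for i x
    by (simp add: principal_coeff_def)
  have tele: "?w *\<^sub>C (\<Sum>i<n. (?w powi (- int i - 1)) *\<^sub>C ?C i x) + (\<alpha> *\<^sub>C (\<Sum>i<n. (?w powi (- int i - 1)) *\<^sub>C ?C i x)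
      - T (\<Sum>i<n. (?w powi (- int i - 1)) *\<^sub>C ?C i x)) = ?C 0 x - (?w powi (- int n)) *\<^sub>C ?C n x" for n x
  proof (induction n)
    case (Suc n)
    let ?t = "(?w powi (- int n - 1)) *\<^sub>C ?C n x"
    have "?w * ?w powi (- int n - 1) = ?w powi (- int n)"
      using z by (simp add: power_int_diff)
    then have 1: "?w *\<^sub>C ?t = (?w powi (- int n)) *\<^sub>C ?C n x" by (simp add: scaleC_scaleC)
    have "\<alpha> *\<^sub>C ?t - T ?t = (?w powi (- int n - 1)) *\<^sub>C (\<alpha> *\<^sub>C ?C n x - T (?C n x))"
      by (simp add: bounded_clinear_scaleC[OF T] cvs.scale_right_diff_distrib scaleC_scaleC mult.commute)
    also have "\<dots> = - ((?w powi (- int n - 1)) *\<^sub>C ?C (Suc n) x)"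
      unfolding C_Suc by simp
    finally have 2: "\<alpha> *\<^sub>C ?t - T ?t = - ((?w powi (- int n - 1)) *\<^sub>C ?C (Suc n) x)" .
    have exponent: "- int (Suc n) = - int n - 1" by simp
    show ?case
      using Suc.IH 1 2 unfolding exponent
      by (simp add: scaleC_add_right bounded_clinear_add[OF T] algebra_simps)
  qed (simp add: bounded_clinear_zero[OF T] scaleC_one)
  have P: "z *\<^sub>C ?P x - T (?P x) = E x" for x
    unfolding zT tele principal_coeff_last by (simp add: principal_coeff_def)
  have EV: "E (V x) = E x" for x
  proof -
    have "E (V x + ?w *\<^sub>C B (V x)) = E (V x)"
      by (simp add: bounded_clinear_add[OF sp(1)] bounded_clinear_scaleC[OF sp(1)] sp(7))
    then show ?thesis by (simp add: V)
  qed
  have BV: "z *\<^sub>C B (V x) - T (B (V x)) = x - E x" for x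
  proof -
    have "z *\<^sub>C B (V x) - T (B (V x)) = ?w *\<^sub>C B (V x) + (V x - E (V x))"
      unfolding zT sp(5) ..
    also have "\<dots> = (V x + ?w *\<^sub>C B (V x)) - E x" by (simp add: EV)
    finally show ?thesis by (simp add: V)
  qed
  have right: "z *\<^sub>C ?R x - T (?R x) = x" for x
    using P[of x] BV[of x] by (simp add: scaleC_add_right bounded_clinear_add[OF T] algebra_simps)
  have TB: "T (B x) = B (T x)" for x
  proof -
    have "\<alpha> *\<^sub>C B x - T (B x) = \<alpha> *\<^sub>C B x - B (T x)"
      using sp(5,6)[of x] by (simp add: bounded_clinear_diff[OF sp(2)] bounded_clinear_scaleC[OF sp(2)])
    then show ?thesis by simp
  qed
  have TV: "V (T x) = T (V x)" for x
  proof -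
    have "V (T (V x + ?w *\<^sub>C B (V x))) = V (T (V x) + ?w *\<^sub>C B (T (V x)))"
      by (simp add: bounded_clinear_add[OF T] bounded_clinear_scaleC[OF T] TB)
    then show ?thesis by (simp only: V)
  qed
  have TC: "?C i (T x) = T (?C i x)" for i x
  proof (induction i)
    case (Suc i)
    then show ?case
      by (simp add: principal_coeff_def bounded_clinear_diff[OF T] bounded_clinear_scaleC[OF T])
  qed (simp add: principal_coeff_def sp)
  have RT: "?R (T x) = T (?R x)" for x
    by (simp add: TC TV TB bounded_clinear_add[OF T] bounded_clinear_sum[OF T] bounded_clinear_scaleC[OF T])
  have left: "?R (z *\<^sub>C x - T x) = x" for x
  proof -
    have "?R (z *\<^sub>C x - T x) = ?R (z *\<^sub>C x) - ?R (T x)" by (rule bounded_clinear_diff[OF bcR])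
    also have "\<dots> = z *\<^sub>C ?R x - T (?R x)" by (simp only: RT bounded_clinear_scaleC[OF bcR])
    also have "\<dots> = x" by (rule right)
    finally show ?thesis .
  qed
  show ?thesis unfolding is_resolvent_def using bcR right left by blast
qed

text \<open>Near \<open>\<alpha>\<close> the resolvent is a finite principal part plus a bounded remainder.\<close>

lemma resolvent_near:
  obtains s M where "s > 0"
    "\<And>z. z \<noteq> \<alpha> \<Longrightarrow> cmod (z - \<alpha>) \<le> s \<Longrightarrow> z \<in> resolvent_set T"
    "\<And>z. z \<noteq> \<alpha> \<Longrightarrow> cmod (z - \<alpha>) \<le> s \<Longrightarrow>
      norm (resolvent T z - (\<Sum>i<m. ((z - \<alpha>) powi (- int i - 1)) *\<^sub>C Blinfun (principal_coeff T \<alpha> E i))) \<le> M"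
proof -
  note sp = splittingD[OF split]
  obtain K where K: "K > 0" "\<And>x. norm (B x) \<le> K * norm x" using bounded_clinear_bound[OF sp(2)] by blast
  have main: "z \<in> resolvent_set T \<and> norm (resolvent T z - (\<Sum>i<m. ((z - \<alpha>) powi (- int i - 1)) *\<^sub>C Blinfun (principal_coeff T \<alpha> E i))) \<le> 2 * K"
    if z: "z \<noteq> \<alpha>" "cmod (z - \<alpha>) \<le> 1 / (2 * K)" for z
  proof -
    let ?S = "\<lambda>x. (z - \<alpha>) *\<^sub>C B x"
    have "norm (?S x) \<le> 1/2 * norm x" for x
    proof -
      have "norm (?S x) \<le> (1 / (2 * K)) * (K * norm x)"
        unfolding norm_scaleC using z K by (intro mult_mono) auto
      then show ?thesis using K by simp
    qed
    then obtain V where V: "bounded_clinear V" "\<And>x. V x + ?S (V x) = x" "\<And>x. V (x + ?S x) = x"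
      "\<And>x. norm (V x) \<le> norm x * 2"
      using neumann_inverse[of ?S "1/2"] bounded_clinear_scale[OF sp(2)] by auto
    note R = is_resolvent_imp[OF resolvent_near_aux[OF V(1-3) z(1)]]
    have "norm (resolvent T z - (\<Sum>i<m. ((z - \<alpha>) powi (- int i - 1)) *\<^sub>C Blinfun (principal_coeff T \<alpha> E i))) \<le> 2 * K"
    proof (rule norm_blinfun_bound)
      fix x
      have "(resolvent T z - (\<Sum>i<m. ((z - \<alpha>) powi (- int i - 1)) *\<^sub>C Blinfun (principal_coeff T \<alpha> E i))) x = B (V x)"
        by (simp add: minus_blinfun.rep_eq R(2) blinfun.sum_left blinfun_apply_scaleC
            bounded_linear_Blinfun_apply bounded_clinear_imp_bounded_linear bounded_clinear_principal_coeff)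
      moreover have "norm (B (V x)) \<le> K * (norm x * 2)"
        using K(2)[of "V x"] mult_left_mono[OF V(4)[of x], of K] K(1) by linarith
      ultimately show "norm ((resolvent T z - (\<Sum>i<m. ((z - \<alpha>) powi (- int i - 1)) *\<^sub>C Blinfun (principal_coeff T \<alpha> E i))) x) \<le> 2 * K * norm x"
        by (simp add: mult_ac)
    qed (use K in auto)
    then show ?thesis using R by blast
  qed
  show ?thesis by (rule that[of "1 / (2 * K)" "2 * K"]) (use main K in auto)
qed

text \<open>The mean of the resolvent over a circle does not depend on the radius, which may therefore
  tend to zero. In the limit only the coefficient \<open>E\<close> of \<open>(z - \<alpha>)\<^bsup>-1\<^esup>\<close> survives.\<close>

lemma riesz_projection_splitting: "blinfun_apply (riesz_projection T \<alpha>) = E"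
proof -
  note sp = splittingD[OF split]
  let ?C = "\<lambda>i. Blinfun (principal_coeff T \<alpha> E i)"
  let ?P = "\<lambda>z. \<Sum>i<m. ((z - \<alpha>) powi (- int i - 1)) *\<^sub>C ?C i"
  obtain s M where s: "s > 0"
    "\<And>z. z \<noteq> \<alpha> \<Longrightarrow> cmod (z - \<alpha>) \<le> s \<Longrightarrow> z \<in> resolvent_set T"
    "\<And>z. z \<noteq> \<alpha> \<Longrightarrow> cmod (z - \<alpha>) \<le> s \<Longrightarrow> norm (resolvent T z - ?P z) \<le> M"
    using resolvent_near by blast
  have "isolating_radius T \<alpha> s"
    unfolding isolating_radius_def spectrum_def
  proof (intro conjI s(1) subsetI)
    fix z assume "z \<in> - resolvent_set T \<inter> cball \<alpha> s"
    then show "z \<in> {\<alpha>}" using s(2)[of z] by (cases "z = \<alpha>") (auto simp: dist_norm norm_minus_commute)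
  qed
  define \<delta> where "\<delta> = (SOME \<delta>. isolating_radius T \<alpha> \<delta>)"
  have "isolating_radius T \<alpha> \<delta>" unfolding \<delta>_def by (rule someI) fact
  then have \<delta>: "\<delta> > 0" "\<And>z. dist \<alpha> z \<le> \<delta> \<Longrightarrow> z \<noteq> \<alpha> \<Longrightarrow> z \<in> resolvent_set T"
    by (auto simp: isolating_radius_def spectrum_def)
  have C0: "?C 0 = (\<Sum>i<m. circle_mean (\<lambda>z. ((z - \<alpha>) powi (- int i - 1)) *\<^sub>C ?C i) \<alpha> t)" if "t > 0" for t
  proof -
    have i0: "circle_mean (\<lambda>z. ((z - \<alpha>) powi (- int i - 1)) *\<^sub>C ?C i) \<alpha> t = (if i = 0 then ?C 0 else 0)" for i
    proof (cases "i = 0")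
      case True
      then show ?thesis using circle_mean_inverse[OF that, of \<alpha> "?C 0"]
        by (simp add: power_int_minus_divide)
    next
      case False
      then show ?thesis using circle_mean_power[OF that, of "- int i - 1" \<alpha> "?C i"] by simp
    qed
    have "?C 0 = 0" if "m = 0"
      using principal_coeff_last that
      by (intro blinfun_eqI) (simp add: bounded_linear_Blinfun_apply bounded_clinear_imp_bounded_linear bounded_clinear_principal_coeff)
    then show ?thesis unfolding i0 by (cases "m = 0") (auto simp: sum.delta)
  qed
  have le: "norm (circle_mean (resolvent T) \<alpha> \<delta> - ?C 0) \<le> t * M" if t: "0 < t" "t \<le> \<delta>" "t \<le> s" for t
  proof -
    have sph: "z \<noteq> \<alpha>" "cmod (z - \<alpha>) \<le> s" if "z \<in> sphere \<alpha> t" for z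
      using that t by (auto simp: dist_norm norm_minus_commute)
    have contR: "continuous_on (sphere \<alpha> t) (resolvent T)"
      by (rule continuous_at_imp_continuous_on) (auto intro!: resolvent_continuous[OF T] s(2) sph)
    have contP: "continuous_on (sphere \<alpha> t) (\<lambda>z. ((z - \<alpha>) powi (- int i - 1)) *\<^sub>C ?C i)" for i
      by (intro continuous_intros) (use sph in auto)
    then have contS: "continuous_on (sphere \<alpha> t) ?P" by (intro continuous_on_sum)
    have "circle_mean (resolvent T) \<alpha> \<delta> = circle_mean (resolvent T) \<alpha> t"
    proof (rule circle_mean_resolvent[OF T t(1,2), symmetric])
      fix z assume "t \<le> dist \<alpha> z" "dist \<alpha> z \<le> \<delta>"
      moreover have "z \<noteq> \<alpha>" using t(1) calculation(1) by auto
      ultimately show "z \<in> resolvent_set T" using \<delta>(2) by blast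
    qed
    also have "\<dots> = circle_mean (\<lambda>z. ?P z + (resolvent T z - ?P z)) \<alpha> t" by simp
    also have "\<dots> = circle_mean ?P \<alpha> t + circle_mean (\<lambda>z. resolvent T z - ?P z) \<alpha> t"
      using contS contR t by (intro circle_mean_add continuous_intros) auto
    also have "circle_mean ?P \<alpha> t = ?C 0"
      using contP t C0[OF t(1)] by (simp add: circle_mean_sum)
    finally have "circle_mean (resolvent T) \<alpha> \<delta> - ?C 0 = circle_mean (\<lambda>z. resolvent T z - ?P z) \<alpha> t" by simp
    also have "norm \<dots> \<le> t * M"
    proof (rule norm_circle_mean_le)
      show "norm (resolvent T z - ?P z) \<le> M" if "z \<in> sphere \<alpha> t" for z
        by (rule s(3)[OF sph[OF that]])
    qed (use contS contR t in \<open>auto intro: continuous_on_diff\<close>)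
    finally show ?thesis .
  qed
  have "norm (circle_mean (resolvent T) \<alpha> \<delta> - ?C 0) \<le> 0"
  proof (rule tendsto_lowerbound)
    show "((\<lambda>t. t * M) \<longlongrightarrow> 0) (at_right 0)" by (auto intro!: tendsto_eq_intros)
    show "eventually (\<lambda>t. norm (circle_mean (resolvent T) \<alpha> \<delta> - ?C 0) \<le> t * M) (at_right 0)"
      using eventually_at_right_real[of 0 "min \<delta> s"] \<delta>(1) s(1) le
      by (auto elim!: eventually_mono)
  qed simp
  then have "riesz_projection T \<alpha> = ?C 0"
    unfolding riesz_projection_def \<delta>_def[symmetric] contour_integral_circle_mean by simp
  then show ?thesis
    using bounded_clinear_principal_coeff[of 0]
    by (simp add: bounded_linear_Blinfun_apply bounded_clinear_imp_bounded_linear principal_coeff_def[abs_def])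
qed

lemma alg_multiplicity_splitting: "alg_multiplicity T \<alpha> = m"
proof -
  note sp = splittingD[OF split]
  have "cvs.independent (e ` {..<m})" "card (e ` {..<m}) = m"
    using flag_independent[of m e] sp(11) by blast+
  then show ?thesis
    by (auto simp: alg_multiplicity_def riesz_projection_splitting sp(10) cvs.dim_eq_card_independent)
qed

end

lemma riesz_splitting:
  assumes "compact_operator T" "\<alpha> \<noteq> 0"
  obtains B e where "spectral_splitting T \<alpha> (riesz_projection T \<alpha>) B (alg_multiplicity T \<alpha>) e"
proof -
  interpret compact_shift T \<alpha> using assms by unfold_locales
  obtain E B m e where sp: "spectral_splitting T \<alpha> E B m e" using spectral_splitting_exists by blast
  show ?thesis
    using that sp unfolding riesz_projection_splitting[OF bcT sp] alg_multiplicity_splitting[OF bcT sp] by blast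
qed

lemma alg_multiplicity_outside_spectrum:
  assumes "compact_operator T" "\<alpha> \<noteq> 0" "\<alpha> \<notin> spectrum T"
  shows "alg_multiplicity T \<alpha> = 0"
proof -
  note T = compact_operator_bounded_clinear[OF assms(1)]
  obtain B e where sp: "spectral_splitting T \<alpha> (riesz_projection T \<alpha>) B (alg_multiplicity T \<alpha>) e"
    using riesz_splitting[OF assms(1,2)] .
  have \<alpha>: "\<alpha> \<in> resolvent_set T" using assms(3) by (simp add: spectrum_def)
  show ?thesis
  proof (rule ccontr)
    assume "alg_multiplicity T \<alpha> \<noteq> 0"
    then have "e 0 \<notin> cvs.span {}" "\<alpha> *\<^sub>C e 0 - T (e 0) \<in> cvs.span {}"
      using splittingD(11,12)[OF sp, of 0] by auto
    then show False using resolvent_left[OF T \<alpha>, of "e 0"] by (simp add: blinfun.zero_right)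
  qed
qed

text \<open>The spectrum is bounded, and by the expansion of the resolvent none of its points of modulus at
  least \<open>\<rho>\<close> is an accumulation point.\<close>

lemma finite_spectrum_outside_disc:
  assumes "compact_operator T" "\<rho> > 0"
  shows "finite {\<alpha> \<in> spectrum T. \<rho> \<le> cmod \<alpha>}"
proof (rule ccontr)
  note T = compact_operator_bounded_clinear[OF assms(1)]
  obtain K where K: "K > 0" "\<And>x. norm (T x) \<le> K * norm x" using bounded_clinear_bound[OF T] by blast
  let ?F = "{\<alpha> \<in> spectrum T. \<rho> \<le> cmod \<alpha>}" and ?S = "cball 0 K \<inter> {z. \<rho> \<le> cmod z}"
  assume inf: "infinite ?F"
  have "?F \<subseteq> ?S"
  proof
    fix z assume z: "z \<in> ?F"
    have "\<not> cmod z > K" using large_in_resolvent_set(1)[OF T K(2), of z] K(1) z by (auto simp: spectrum_def)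
    then show "z \<in> ?S" using z by simp
  qed
  moreover have "compact ?S"
    by (intro compact_Int_closed compact_cball closed_Collect_le continuous_intros)
  ultimately obtain \<alpha> where \<alpha>: "\<alpha> \<in> ?S" "\<alpha> islimpt ?F"
    using inf unfolding compact_eq_Bolzano_Weierstrass by blast
  then have "\<alpha> \<noteq> 0" using assms(2) by auto
  then obtain B e where sp: "spectral_splitting T \<alpha> (riesz_projection T \<alpha>) B (alg_multiplicity T \<alpha>) e"
    using riesz_splitting[OF assms(1)] by blast
  obtain s where s: "s > 0" "\<And>z. z \<noteq> \<alpha> \<Longrightarrow> cmod (z - \<alpha>) \<le> s \<Longrightarrow> z \<in> resolvent_set T"
    by (rule resolvent_near[OF T sp], rule that) auto
  then obtain y where "y \<in> ?F" "y \<noteq> \<alpha>" "dist y \<alpha> < s"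
    using \<alpha>(2) unfolding islimpt_approachable by blast
  then show False using s(2)[of y] by (auto simp: spectrum_def dist_norm)
qed

section \<open>Growth of powers off finitely many eigenvalues\<close>

lemma power_resolvent:
  assumes S: "bounded_clinear S" and z: "z \<in> resolvent_set S"
  shows "(S ^^ n) (resolvent S z x) = z ^ n *\<^sub>C resolvent S z x - (\<Sum>k<n. z ^ (n - 1 - k) *\<^sub>C (S ^^ k) x)"
proof (induction n)
  case (Suc n)
  have "(S ^^ Suc n) (resolvent S z x) = (S ^^ n) (S (resolvent S z x))" by (simp add: funpow_swap1)
  also have "S (resolvent S z x) = z *\<^sub>C resolvent S z x - x" using resolvent_right[OF S z, of x] by (simp add: algebra_simps)
  also have "(S ^^ n) \<dots> = z *\<^sub>C (S ^^ n) (resolvent S z x) - (S ^^ n) x"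
    by (simp add: bounded_clinear_diff bounded_clinear_scaleC bounded_clinear_funpow[OF S])
  also have "\<dots> = z ^ Suc n *\<^sub>C resolvent S z x - ((\<Sum>k<n. (z * z ^ (n - 1 - k)) *\<^sub>C (S ^^ k) x) + (S ^^ n) x)"
    unfolding Suc by (simp add: cvs.scale_right_diff_distrib scaleC_scaleC cvs.scale_sum_right)
  also have "(\<Sum>k<n. (z * z ^ (n - 1 - k)) *\<^sub>C (S ^^ k) x) = (\<Sum>k<n. z ^ (Suc n - 1 - k) *\<^sub>C (S ^^ k) x)"
  proof (rule sum.cong)
    fix k assume "k \<in> {..<n}"
    then have "Suc n - 1 - k = Suc (n - 1 - k)" by auto
    then show "(z * z ^ (n - 1 - k)) *\<^sub>C (S ^^ k) x = z ^ (Suc n - 1 - k) *\<^sub>C (S ^^ k) x" by simp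
  qed simp
  finally show ?case by (simp add: scaleC_one)
qed (simp add: scaleC_one)

text \<open>Cauchy's formula: \<open>S\<^sup>n\<close> is the mean of \<open>z\<^sup>n R(z)\<close> over the circle of radius \<open>\<rho>\<close>. Indeed
  \<open>S\<^sup>n R(z)\<close> and \<open>z\<^sup>n R(z)\<close> differ by a polynomial in \<open>z\<close>, and the mean of \<open>R\<close> itself is the identity.\<close>

lemma power_bound_by_resolvent:
  fixes S :: "'a::complex_banach \<Rightarrow> 'a"
  assumes S: "bounded_clinear S" and \<rho>: "\<rho> > 0" and res: "\<And>z. cmod z \<ge> \<rho> \<Longrightarrow> z \<in> resolvent_set S"
  obtains K where "\<And>n x. norm ((S ^^ n) x) \<le> K * \<rho> ^ n * norm x"
proof -
  let ?R = "resolvent S"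
  obtain C where C: "C > 0" "\<And>x. norm (S x) \<le> C * norm x" using bounded_clinear_bound[OF S] by blast
  have contR: "continuous_on (sphere 0 r) ?R" if "r \<ge> \<rho>" for r
    by (rule continuous_at_imp_continuous_on)
      (use that in \<open>auto intro!: resolvent_continuous[OF S] res\<close>)
  let ?A = "\<lambda>n. Blinfun (S ^^ n)"
  have A: "blinfun_apply (?A n) = S ^^ n" for n
    by (simp add: bounded_linear_Blinfun_apply bounded_clinear_imp_bounded_linear bounded_clinear_funpow[OF S])
  have S_apply: "blinfun_apply (Blinfun S) = S"
    by (simp add: bounded_linear_Blinfun_apply bounded_clinear_imp_bounded_linear S)
  \<comment> \<open>The integral over a circle of radius \<open>r\<close> tends to the identity as \<open>r\<close> grows.\<close>
  have id: "circle_mean ?R 0 \<rho> = id_blinfun"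
  proof -
    have le: "norm (circle_mean ?R 0 \<rho> - id_blinfun) \<le> C / (r - C)" if r: "r \<ge> \<rho>" "r > C" for r
    proof -
      have R_eq: "?R z = (1 / (z - 0)) *\<^sub>C id_blinfun + (1 / z) *\<^sub>C (Blinfun S o\<^sub>L ?R z)" if "z \<in> sphere 0 r" for z
      proof (rule blinfun_eqI)
        fix x
        have z: "z \<noteq> 0" "cmod z \<ge> \<rho>" using that r \<rho> by auto
        have "z *\<^sub>C ?R z x = x + S (?R z x)" using resolvent_right[OF S res[OF z(2)], of x] by (simp add: algebra_simps)
        then have "(1 / z) *\<^sub>C (z *\<^sub>C ?R z x) = (1 / z) *\<^sub>C (x + S (?R z x))" by simp
        then show "?R z x = ((1 / (z - 0)) *\<^sub>C id_blinfun + (1 / z) *\<^sub>C (Blinfun S o\<^sub>L ?R z)) x"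
          using z(1) by (simp add: scaleC_scaleC scaleC_one blinfun.add_left blinfun_apply_scaleC S_apply scaleC_add_right)
      qed
      have r0: "r > 0" using r \<rho> by simp
      have cont1: "continuous_on (sphere 0 r) (\<lambda>z. (1 / (z - 0)) *\<^sub>C id_blinfun)"
        by (intro continuous_intros) (use r0 in auto)
      have cont2: "continuous_on (sphere 0 r) (\<lambda>z. (1 / z) *\<^sub>C (Blinfun S o\<^sub>L ?R z))"
        by (intro continuous_intros bounded_bilinear.continuous_on[OF bounded_bilinear_blinfun_compose] contR)
          (use r0 r in auto)
      have "circle_mean ?R 0 \<rho> = circle_mean ?R 0 r"
        by (rule circle_mean_resolvent[OF S \<rho> r(1)]) (simp add: res)
      also have "\<dots> = circle_mean (\<lambda>z. (1 / (z - 0)) *\<^sub>C id_blinfun + (1 / z) *\<^sub>C (Blinfun S o\<^sub>L ?R z)) 0 r"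
        by (rule circle_mean_eqI) (use R_eq r0 in auto)
      also have "\<dots> = id_blinfun + circle_mean (\<lambda>z. (1 / z) *\<^sub>C (Blinfun S o\<^sub>L ?R z)) 0 r"
        unfolding circle_mean_add[OF cont1 cont2 less_imp_le[OF r0]] circle_mean_inverse[OF r0] ..
      finally have "norm (circle_mean ?R 0 \<rho> - id_blinfun) = norm (circle_mean (\<lambda>z. (1 / z) *\<^sub>C (Blinfun S o\<^sub>L ?R z)) 0 r)" by simp
      also have "\<dots> \<le> r * ((1 / r) * (C * (1 / (r - C))))"
      proof (rule norm_circle_mean_le[OF cont2])
        fix z :: complex assume z: "z \<in> sphere 0 r"
        have "norm (Blinfun S o\<^sub>L ?R z) \<le> norm (Blinfun S) * norm (?R z)" by (rule norm_blinfun_compose)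
        also have "\<dots> \<le> C * (1 / (r - C))"
        proof (intro mult_mono)
          show "norm (Blinfun S) \<le> C" by (rule norm_blinfun_bound) (use C in \<open>auto simp: S_apply\<close>)
          show "norm (?R z) \<le> 1 / (r - C)"
            using large_in_resolvent_set(2)[OF S C(2), of z] C(1) z r by simp
        qed (use C in auto)
        finally show "norm ((1 / z) *\<^sub>C (Blinfun S o\<^sub>L ?R z)) \<le> (1 / r) * (C * (1 / (r - C)))"
          using z r0 mult_left_mono[of "norm (Blinfun S o\<^sub>L ?R z)" "C * (1 / (r - C))" "1 / r"]
          by (simp add: norm_scaleC norm_divide)
      qed (use r0 in simp)
      also have "\<dots> = C / (r - C)" using r0 by simp
      finally show ?thesis .
    qed
    have "((\<lambda>r. C / (r - C)) \<longlongrightarrow> 0) at_top" by real_asymp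
    then have "norm (circle_mean ?R 0 \<rho> - id_blinfun) \<le> 0"
    proof (rule tendsto_lowerbound)
      show "\<forall>\<^sub>F r in at_top. norm (circle_mean ?R 0 \<rho> - id_blinfun) \<le> C / (r - C)"
        using eventually_gt_at_top[of "max C \<rho>"] by eventually_elim (use le in auto)
    qed simp
    then show ?thesis by simp
  qed
  have "compact (?R ` sphere 0 \<rho>)" by (rule compact_continuous_image[OF contR]) auto
  then have "\<exists>M. \<forall>z\<in>sphere 0 \<rho>. norm (?R z) \<le> M"
    using compact_imp_bounded[of "?R ` sphere 0 \<rho>"] by (auto simp: bounded_iff)
  then obtain M where M: "\<And>z. z \<in> sphere 0 \<rho> \<Longrightarrow> norm (?R z) \<le> M" by blast
  have "norm (?A n) \<le> \<rho> * (\<rho> ^ n * M)" for n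
  proof -
    let ?P = "\<lambda>z. \<Sum>k<n. (z - 0) ^ (n - 1 - k) *\<^sub>C (- ?A k)"
    have cont1: "continuous_on (sphere 0 \<rho>) (\<lambda>z. z ^ n *\<^sub>C ?R z)"
      by (intro continuous_intros contR) auto
    have cont2: "continuous_on (sphere 0 \<rho>) (\<lambda>z. (z - 0) ^ (n - 1 - k) *\<^sub>C (- ?A k))" for k
      by (intro continuous_intros)
    have "?A n = ?A n o\<^sub>L circle_mean ?R 0 \<rho>" by (rule blinfun_eqI) (simp add: id)
    also have "\<dots> = circle_mean (\<lambda>z. ?A n o\<^sub>L ?R z) 0 \<rho>"
    proof (rule circle_mean_linear[symmetric])
      show "bounded_linear ((o\<^sub>L) (?A n))"
        by (rule bounded_bilinear.bounded_linear_right[OF bounded_bilinear_blinfun_compose])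
      show "?A n o\<^sub>L (a *\<^sub>C X) = a *\<^sub>C (?A n o\<^sub>L X)" for a and X :: "'a \<Rightarrow>\<^sub>L 'a"
        by (rule blinfun_eqI) (simp add: A blinfun_apply_scaleC bounded_clinear_scaleC bounded_clinear_funpow[OF S])
    qed (use \<rho> contR in auto)
    also have "\<dots> = circle_mean (\<lambda>z. z ^ n *\<^sub>C ?R z + ?P z) 0 \<rho>"
    proof (rule circle_mean_eqI)
      fix z :: complex assume "z \<in> sphere 0 \<rho>"
      then have z: "z \<in> resolvent_set S" by (intro res) simp
      show "?A n o\<^sub>L ?R z = z ^ n *\<^sub>C ?R z + ?P z"
        by (rule blinfun_eqI)
          (simp add: A power_resolvent[OF S z] blinfun.add_left blinfun.sum_left blinfun_apply_scaleC
            uminus_blinfun.rep_eq minus_blinfun.rep_eq sum_negf)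
    qed (use \<rho> in simp)
    also have "\<dots> = circle_mean (\<lambda>z. z ^ n *\<^sub>C ?R z) 0 \<rho> + circle_mean ?P 0 \<rho>"
      using cont1 cont2 \<rho> by (intro circle_mean_add continuous_on_sum) auto
    also have "circle_mean ?P 0 \<rho> = (\<Sum>k<n. circle_mean (\<lambda>z. (z - 0) ^ (n - 1 - k) *\<^sub>C (- ?A k)) 0 \<rho>)"
      using cont2 \<rho> by (intro circle_mean_sum) auto
    also have "\<dots> = 0"
    proof (intro sum.neutral ballI)
      fix k
      show "circle_mean (\<lambda>z. (z - 0) ^ (n - 1 - k) *\<^sub>C (- ?A k)) 0 \<rho> = 0"
        using circle_mean_power[OF \<rho>, of "int (n - 1 - k)" 0 "- ?A k"] unfolding power_int_of_nat by simp
    qed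
    finally have "norm (?A n) = norm (circle_mean (\<lambda>z. z ^ n *\<^sub>C ?R z) 0 \<rho>)" by simp
    also have "\<dots> \<le> \<rho> * (\<rho> ^ n * M)"
      by (rule norm_circle_mean_le[OF cont1])
        (use M \<rho> in \<open>auto simp: norm_scaleC norm_power intro!: mult_left_mono\<close>)
    finally show ?thesis .
  qed
  note le = this
  have "norm ((S ^^ n) x) \<le> (\<rho> * M) * \<rho> ^ n * norm x" for n x
    using norm_blinfun[of "?A n" x] mult_right_mono[OF le[of n], of "norm x"] by (simp add: A mult_ac)
  then show ?thesis using that by blast
qed

lemma funpow_commute_fun: "(\<And>x. f (g x) = g (f x)) \<Longrightarrow> (f ^^ n) (g x) = g ((f ^^ n) x)"
  by (induction n) auto

text \<open>A common generalized eigenvector for \<open>\<alpha>\<close> and \<open>\<beta>\<close> would yield an eigenvector \<open>u\<close> for \<open>\<alpha>\<close>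
  that \<open>\<beta> - T\<close> multiplies by \<open>\<beta> - \<alpha> \<noteq> 0\<close>, although some power of \<open>\<beta> - T\<close> annihilates it.\<close>

lemma riesz_projections_orthogonal:
  assumes T: "compact_operator T" and ne: "\<alpha> \<noteq> 0" "\<beta> \<noteq> 0" "\<alpha> \<noteq> \<beta>"
  shows "riesz_projection T \<alpha> (riesz_projection T \<beta> x) = 0"
proof (rule ccontr)
  note bT = compact_operator_bounded_clinear[OF T]
  define y where "y = riesz_projection T \<alpha> (riesz_projection T \<beta> x)"
  assume "\<not> ?thesis"
  then have y0: "y \<noteq> 0" by (simp add: y_def)
  obtain A e where sa: "spectral_splitting T \<alpha> (riesz_projection T \<alpha>) A (alg_multiplicity T \<alpha>) e"
    using riesz_splitting[OF T ne(1)] .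
  obtain B e' where sb: "spectral_splitting T \<beta> (riesz_projection T \<beta>) B (alg_multiplicity T \<beta>) e'"
    using riesz_splitting[OF T ne(2)] .
  let ?La = "\<lambda>x. \<alpha> *\<^sub>C x - T x" and ?Lb = "\<lambda>x. \<beta> *\<^sub>C x - T x"
  let ?n = "alg_multiplicity T \<alpha>" and ?k = "alg_multiplicity T \<beta>"
  note Ea = splittingD(1,4)[OF sa]
  have La: "(?La ^^ ?n) y = 0" unfolding y_def by (rule splittingD(9)[OF sa])
  have bLa: "bounded_clinear ?La" and bLb: "bounded_clinear ?Lb"
    by (intro bounded_clinear_minus_fun bounded_clinear_scale bounded_clinear_ident bT)+
  have comm: "?Lb (riesz_projection T \<alpha> x) = riesz_projection T \<alpha> (?Lb x)" for x
    using Ea by (simp add: bounded_clinear_diff bounded_clinear_scaleC)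
  have Lb: "(?Lb ^^ ?k) y = 0"
    unfolding y_def funpow_commute_fun[where f = ?Lb and g = "blinfun_apply (riesz_projection T \<alpha>)", OF comm] splittingD(9)[OF sb] by (rule blinfun.zero_right)
  define j where "j = (LEAST j. (?La ^^ j) y = 0)"
  have j: "(?La ^^ j) y = 0" unfolding j_def by (rule LeastI[of _ ?n]) (rule La)
  then have "j \<noteq> 0" using y0 by (metis funpow_0)
  then obtain i where i: "j = Suc i" by (cases j) auto
  define u where "u = (?La ^^ i) y"
  have u0: "u \<noteq> 0" using not_less_Least[of i "\<lambda>j. (?La ^^ j) y = 0"] i by (auto simp: u_def j_def)
  have "?La u = 0" using j i by (simp add: u_def)
  then have Lbu: "?Lb (c *\<^sub>C u) = (c * (\<beta> - \<alpha>)) *\<^sub>C u" for c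
  proof -
    have "T u = \<alpha> *\<^sub>C u" using \<open>?La u = 0\<close> by simp
    then show ?thesis
      by (simp add: bounded_clinear_scaleC[OF bT] cvs.scale_left_diff_distrib scaleC_scaleC algebra_simps)
  qed
  have "(?Lb ^^ n) u = (\<beta> - \<alpha>) ^ n *\<^sub>C u" for n
  proof (induction n)
    case (Suc n)
    have "(?Lb ^^ Suc n) u = ?Lb ((\<beta> - \<alpha>) ^ n *\<^sub>C u)" by (simp add: Suc)
    also have "\<dots> = (\<beta> - \<alpha>) ^ Suc n *\<^sub>C u" unfolding Lbu by (simp add: mult.commute)
    finally show ?case .
  qed (simp add: scaleC_one)
  moreover have "(?Lb ^^ ?k) u = 0"
  proof -
    have c1: "?Lb (?La x) = ?La (?Lb x)" for x
      by (simp add: bounded_clinear_diff[OF bT] bounded_clinear_scaleC[OF bT] cvs.scale_right_diff_distrib scaleC_scaleC mult.commute)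
    have c2: "?Lb ((?La ^^ i) x) = (?La ^^ i) (?Lb x)" for x
      using funpow_commute_fun[of ?La ?Lb i x] c1 by simp
    have "(?Lb ^^ ?k) u = (?La ^^ i) ((?Lb ^^ ?k) y)"
      unfolding u_def by (rule funpow_commute_fun) (rule c2)
    then show ?thesis by (simp only: Lb bounded_clinear_zero[OF bounded_clinear_funpow[OF bLa]])
  qed
  ultimately have "(\<beta> - \<alpha>) ^ ?k *\<^sub>C u = 0" by simp
  then have "norm ((\<beta> - \<alpha>) ^ ?k *\<^sub>C u) = 0" by simp
  then show False using u0 ne(3) by (simp add: norm_scaleC norm_power)
qed

text \<open>Removing the generalized eigenspaces for the eigenvalues of modulus at least \<open>\<rho>\<close> leaves an
  operator whose resolvent set contains all points of modulus at least \<open>\<rho>\<close>.\<close>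

theorem growth_off_large_eigenvalues:
  fixes T :: "'a::complex_banach \<Rightarrow> 'a"
  assumes T: "compact_operator T" and \<rho>: "\<rho> > 0"
  defines "F \<equiv> {\<alpha> \<in> spectrum T. \<rho> \<le> cmod \<alpha>}"
  obtains K where "\<And>n x. norm ((T ^^ n) (x - (\<Sum>\<alpha>\<in>F. riesz_projection T \<alpha> x))) \<le> K * \<rho> ^ n * norm x"
proof -
  note bT = compact_operator_bounded_clinear[OF T]
  have fin: "finite F" unfolding F_def by (rule finite_spectrum_outside_disc[OF T \<rho>])
  have F0: "\<alpha> \<noteq> 0" if "\<alpha> \<in> F" for \<alpha> using that \<rho> by (auto simp: F_def)
  let ?E = "\<lambda>\<alpha>. blinfun_apply (riesz_projection T \<alpha>)"
  define Q where "Q x = x - (\<Sum>\<alpha>\<in>F. ?E \<alpha> x)" for x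
  have E: "bounded_clinear (?E \<alpha>)" "?E \<alpha> (?E \<alpha> x) = ?E \<alpha> x" "?E \<alpha> (T x) = T (?E \<alpha> x)" if "\<alpha> \<in> F" for \<alpha> x
    using riesz_splitting[OF T F0[OF that]] splittingD(1,3,4) by metis+
  have bQ: "bounded_clinear Q"
    unfolding Q_def[abs_def] by (intro bounded_clinear_minus_fun bounded_clinear_ident bounded_clinear_sum_fun E)
  have QT: "Q (T x) = T (Q x)" for x
    by (simp add: Q_def bounded_clinear_diff[OF bT] bounded_clinear_sum[OF bT] E)
  have EQ: "?E \<alpha> (Q x) = 0" if "\<alpha> \<in> F" for \<alpha> x
  proof -
    have "?E \<alpha> (Q x) = ?E \<alpha> x - (\<Sum>\<beta>\<in>F. ?E \<alpha> (?E \<beta> x))"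
      by (simp add: Q_def bounded_clinear_diff[OF E(1)[OF that]] bounded_clinear_sum[OF E(1)[OF that]])
    also have "(\<Sum>\<beta>\<in>F. ?E \<alpha> (?E \<beta> x)) = (\<Sum>\<beta>\<in>F. if \<beta> = \<alpha> then ?E \<alpha> x else 0)"
      by (rule sum.cong) (use that E(2) riesz_projections_orthogonal[OF T] F0 in auto)
    also have "\<dots> = ?E \<alpha> x" using that fin by simp
    finally show ?thesis by simp
  qed
  have QQ: "Q (Q x) = Q x" for x unfolding Q_def[of "Q x"] using EQ by simp
  define S where "S x = T (Q x)" for x
  have bS: "bounded_clinear S" unfolding S_def[abs_def] by (rule bounded_clinear_compose[OF bT bQ])
  \<comment> \<open>The inverse of \<open>z - T\<close> on the range of \<open>Q\<close> is \<open>B\<close> or the resolvent of \<open>T\<close>; off it \<open>S\<close> is zero.\<close>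
  have res: "z \<in> resolvent_set S" if z: "cmod z \<ge> \<rho>" for z
  proof -
    have z0: "z \<noteq> 0" using z \<rho> by auto
    have "\<exists>R. bounded_clinear R \<and> (\<forall>x. z *\<^sub>C R (Q x) - T (R (Q x)) = Q x) \<and> (\<forall>x. R (z *\<^sub>C Q x - T (Q x)) = Q x)"
    proof (cases "z \<in> spectrum T")
      case True
      then have zF: "z \<in> F" using z by (simp add: F_def)
      obtain B e where sp: "spectral_splitting T z (?E z) B (alg_multiplicity T z) e"
        using riesz_splitting[OF T z0] .
      show ?thesis
        by (rule exI[of _ B]) (simp add: splittingD(2,5,6)[OF sp] EQ[OF zF])
    next
      case False
      then have "z \<in> resolvent_set T" by (simp add: spectrum_def)
      then show ?thesis
        using bounded_clinear_resolvent[OF bT] resolvent_left[OF bT] resolvent_right[OF bT] by blast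
    qed
    then obtain R where R: "bounded_clinear R" "\<And>x. z *\<^sub>C R (Q x) - T (R (Q x)) = Q x"
      "\<And>x. R (z *\<^sub>C Q x - T (Q x)) = Q x" by blast
    let ?R' = "\<lambda>x. Q (R (Q x)) + inverse z *\<^sub>C (x - Q x)"
    have "is_resolvent S z ?R'"
      unfolding is_resolvent_def
    proof (intro conjI allI)
      show "bounded_clinear ?R'"
        by (intro bounded_clinear_plus bounded_clinear_scale bounded_clinear_minus_fun bounded_clinear_ident
            bounded_clinear_compose[OF bQ] bounded_clinear_compose[OF R(1)] bQ)
      show "z *\<^sub>C ?R' x - S (?R' x) = x" for x
      proof -
        have "Q (?R' x) = Q (R (Q x))"
          by (simp add: bounded_clinear_add[OF bQ] bounded_clinear_scaleC[OF bQ] bounded_clinear_diff[OF bQ] QQ)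
        then have "S (?R' x) = Q (T (R (Q x)))" by (simp add: S_def QT)
        moreover have "z *\<^sub>C ?R' x = Q (z *\<^sub>C R (Q x)) + (x - Q x)"
          using z0 by (simp add: scaleC_add_right bounded_clinear_scaleC[OF bQ] scaleC_scaleC scaleC_one del: inverse_eq_divide)
        ultimately have "z *\<^sub>C ?R' x - S (?R' x) = Q (z *\<^sub>C R (Q x) - T (R (Q x))) + (x - Q x)"
          by (simp add: bounded_clinear_diff[OF bQ])
        then show ?thesis by (simp add: R(2) QQ)
      qed
      show "?R' (z *\<^sub>C x - S x) = x" for x
      proof -
        have "Q (z *\<^sub>C x - S x) = z *\<^sub>C Q x - T (Q x)"
          by (simp add: S_def bounded_clinear_diff[OF bQ] bounded_clinear_scaleC[OF bQ] QT QQ)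
        moreover have "(z *\<^sub>C x - S x) - (z *\<^sub>C Q x - T (Q x)) = z *\<^sub>C (x - Q x)"
          by (simp add: S_def cvs.scale_right_diff_distrib)
        ultimately have "?R' (z *\<^sub>C x - S x) = Q (Q x) + inverse z *\<^sub>C (z *\<^sub>C (x - Q x))"
          by (simp only: R(3))
        also have "\<dots> = Q x + (x - Q x)" by (simp only: QQ scaleC_scaleC left_inverse[OF z0] scaleC_one)
        finally show ?thesis by simp
      qed
    qed
    then show ?thesis by (rule is_resolvent_imp)
  qed
  obtain K where K: "\<And>n x. norm ((S ^^ n) x) \<le> K * \<rho> ^ n * norm x"
    using power_bound_by_resolvent[OF bS \<rho> res] by blast
  have Sn: "(S ^^ n) (Q x) = (T ^^ n) (Q x)" for n x
  proof (induction n)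
    case (Suc n)
    have "Q ((T ^^ n) (Q x)) = (T ^^ n) (Q (Q x))"
      using funpow_commute_fun[of T Q n "Q x"] QT by simp
    then have "S ((T ^^ n) (Q x)) = T ((T ^^ n) (Q x))" by (simp add: S_def QQ)
    then show ?case by (simp add: Suc)
  qed simp
  obtain C where C: "C > 0" "\<And>x. norm (Q x) \<le> C * norm x" using bounded_clinear_bound[OF bQ] by blast
  have "norm ((T ^^ n) (Q x)) \<le> (\<bar>K\<bar> * C) * \<rho> ^ n * norm x" for n x
  proof -
    have "norm ((T ^^ n) (Q x)) \<le> K * \<rho> ^ n * norm (Q x)" using K[of n "Q x"] by (simp add: Sn)
    also have "\<dots> \<le> \<bar>K\<bar> * \<rho> ^ n * (C * norm x)" using \<rho> C by (intro mult_mono) auto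
    finally show ?thesis by (simp add: mult_ac)
  qed
  then show ?thesis using that unfolding Q_def by blast
qed

section \<open>The Hilbert space of square summable sequences\<close>

typedef ell2 = "{f :: nat \<Rightarrow> complex. summable (\<lambda>k. (cmod (f k))\<^sup>2)}"
  morphisms coord Ell2
  by (rule exI[of _ "\<lambda>_. 0"]) simp

lemma summable_coord: "summable (\<lambda>k. (cmod (coord x k))\<^sup>2)"
  using coord[of x] by simp

lemma coord_Ell2: "summable (\<lambda>k. (cmod (f k))\<^sup>2) \<Longrightarrow> coord (Ell2 f) = f"
  by (simp add: Ell2_inverse)

lemma ell2_eqI: "(\<And>k. coord x k = coord y k) \<Longrightarrow> x = y"
  by (metis coord_inject ext)

lemma summable_square_add:
  fixes f g :: "nat \<Rightarrow> complex"
  assumes "summable (\<lambda>k. (cmod (f k))\<^sup>2)" "summable (\<lambda>k. (cmod (g k))\<^sup>2)"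
  shows "summable (\<lambda>k. (cmod (f k + g k))\<^sup>2)"
proof (rule summable_comparison_test')
  show "summable (\<lambda>k. 2 * (cmod (f k))\<^sup>2 + 2 * (cmod (g k))\<^sup>2)"
    by (intro summable_add summable_mult assms)
  show "norm ((cmod (f k + g k))\<^sup>2) \<le> 2 * (cmod (f k))\<^sup>2 + 2 * (cmod (g k))\<^sup>2" for k
  proof -
    have "(cmod (f k + g k))\<^sup>2 \<le> (cmod (f k) + cmod (g k))\<^sup>2" by (simp add: norm_triangle_ineq power_mono)
    also have "\<dots> \<le> 2 * (cmod (f k))\<^sup>2 + 2 * (cmod (g k))\<^sup>2"
      using zero_le_power2[of "cmod (f k) - cmod (g k)"] by (simp add: power2_eq_square algebra_simps)
    finally show ?thesis by simp
  qed
qed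

lemma summable_square_scale:
  fixes f :: "nat \<Rightarrow> complex"
  assumes "summable (\<lambda>k. (cmod (f k))\<^sup>2)"
  shows "summable (\<lambda>k. (cmod (c * f k))\<^sup>2)"
  using summable_mult[OF assms, of "(cmod c)\<^sup>2"] by (simp add: norm_mult power_mult_distrib)

lemma summable_abs_product:
  fixes f g :: "nat \<Rightarrow> complex"
  assumes "summable (\<lambda>k. (cmod (f k))\<^sup>2)" "summable (\<lambda>k. (cmod (g k))\<^sup>2)"
  shows "summable (\<lambda>k. cmod (f k * g k))"
proof (rule summable_comparison_test')
  show "summable (\<lambda>k. (cmod (f k))\<^sup>2 + (cmod (g k))\<^sup>2)" by (intro summable_add assms)
  show "norm (cmod (f k * g k)) \<le> (cmod (f k))\<^sup>2 + (cmod (g k))\<^sup>2" for k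
  proof -
    have "2 * (cmod (f k) * cmod (g k)) \<le> (cmod (f k))\<^sup>2 + (cmod (g k))\<^sup>2"
      using zero_le_power2[of "cmod (f k) - cmod (g k)"] by (simp add: power2_eq_square algebra_simps)
    moreover have "0 \<le> cmod (f k) * cmod (g k)" by simp
    ultimately have "cmod (f k) * cmod (g k) \<le> (cmod (f k))\<^sup>2 + (cmod (g k))\<^sup>2" by linarith
    then show ?thesis by (simp add: norm_mult)
  qed
qed

definition cinner :: "ell2 \<Rightarrow> ell2 \<Rightarrow> complex"
  where "cinner x y = (\<Sum>k. coord x k * cnj (coord y k))"

lemma summable_cinner_abs: "summable (\<lambda>k. cmod (coord x k * cnj (coord y k)))"
  using summable_abs_product[OF summable_coord[of x], of "\<lambda>k. cnj (coord y k)"] summable_coord[of y] by simp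

lemma summable_cinner: "summable (\<lambda>k. coord x k * cnj (coord y k))"
  by (rule summable_norm_cancel[OF summable_cinner_abs])

instantiation ell2 :: real_inner
begin

definition zero_ell2 where "0 = Ell2 (\<lambda>_. 0)"
definition plus_ell2 where "x + y = Ell2 (\<lambda>k. coord x k + coord y k)"
definition uminus_ell2 where "- x = Ell2 (\<lambda>k. - coord x k)"
definition minus_ell2 where "x - y = Ell2 (\<lambda>k. coord x k - coord y k)"
definition scaleR_ell2 where "r *\<^sub>R x = Ell2 (\<lambda>k. of_real r * coord x k)"
definition inner_ell2 where "inner (x :: ell2) y = Re (cinner x y)"
definition norm_ell2 where "norm (x :: ell2) = sqrt (inner x x)"
definition dist_ell2 where "dist (x :: ell2) y = norm (x - y)"
definition sgn_ell2 where "sgn (x :: ell2) = scaleR (inverse (norm x)) x"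
definition uniformity_ell2
  where "(uniformity :: (ell2 \<times> ell2) filter) = (INF e\<in>{0 <..}. principal {(x, y). dist x y < e})"
definition open_ell2
  where "open (S :: ell2 set) = (\<forall>x\<in>S. \<forall>\<^sub>F (x', y) in uniformity. x' = x \<longrightarrow> y \<in> S)"

lemma coord_simps [simp]:
  "coord 0 k = 0" "coord (x + y) k = coord x k + coord y k" "coord (- x) k = - coord x k"
  "coord (x - y) k = coord x k - coord y k" "coord (r *\<^sub>R x) k = of_real r * coord x k"
proof -
  show "coord 0 k = 0" by (simp add: zero_ell2_def coord_Ell2)
  show "coord (x + y) k = coord x k + coord y k"
    by (simp add: plus_ell2_def coord_Ell2 summable_square_add summable_coord)
  show "coord (- x) k = - coord x k" by (simp add: uminus_ell2_def coord_Ell2 summable_coord)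
  show "coord (x - y) k = coord x k - coord y k"
    using summable_square_add[OF summable_coord[of x], of "\<lambda>k. - coord y k"]
    by (simp add: minus_ell2_def coord_Ell2 summable_coord)
  show "coord (r *\<^sub>R x) k = of_real r * coord x k"
    by (simp add: scaleR_ell2_def coord_Ell2 summable_square_scale summable_coord)
qed

lemma cinner_self: "cinner x x = of_real (\<Sum>k. (cmod (coord x k))\<^sup>2)"
  unfolding cinner_def suminf_of_real[OF summable_coord]
  by (rule suminf_cong) (simp only: complex_norm_square)

instance
proof
  show "x + y + z = x + (y + z)" for x y z :: ell2 by (rule ell2_eqI) simp
  show "x + y = y + x" for x y :: ell2 by (rule ell2_eqI) simp
  show "0 + x = x" for x :: ell2 by (rule ell2_eqI) simp
  show "- x + x = 0" for x :: ell2 by (rule ell2_eqI) simp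
  show "x - y = x + - y" for x y :: ell2 by (rule ell2_eqI) simp
  show "a *\<^sub>R (x + y) = a *\<^sub>R x + a *\<^sub>R y" for a and x y :: ell2 by (rule ell2_eqI) (simp add: algebra_simps)
  show "(a + b) *\<^sub>R x = a *\<^sub>R x + b *\<^sub>R x" for a b and x :: ell2 by (rule ell2_eqI) (simp add: algebra_simps)
  show "a *\<^sub>R b *\<^sub>R x = (a * b) *\<^sub>R x" for a b and x :: ell2 by (rule ell2_eqI) (simp add: algebra_simps)
  show "1 *\<^sub>R x = x" for x :: ell2 by (rule ell2_eqI) simp
  show "dist x y = norm (x - y)" for x y :: ell2 by (rule dist_ell2_def)
  show "sgn x = scaleR (inverse (norm x)) x" for x :: ell2 by (rule sgn_ell2_def)
  show "uniformity = (INF e\<in>{0 <..}. principal {(x :: ell2, y). dist x y < e})" by (rule uniformity_ell2_def)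
  show "open S = (\<forall>x\<in>S. \<forall>\<^sub>F (x', y) in uniformity. x' = x \<longrightarrow> y \<in> S)" for S :: "ell2 set" by (rule open_ell2_def)
  show "inner x y = inner y x" for x y :: ell2
    unfolding inner_ell2_def cinner_def Re_suminf[OF summable_cinner]
    by (rule suminf_cong) (simp add: algebra_simps)
  show "inner (x + y) z = inner x z + inner y z" for x y z :: ell2
    by (simp add: inner_ell2_def cinner_def ring_distribs suminf_add[OF summable_cinner summable_cinner, symmetric])
  show "inner (r *\<^sub>R x) y = r * inner x y" for r and x y :: ell2
    using suminf_mult[OF summable_cinner[of x y], of "of_real r"]
    by (simp add: inner_ell2_def cinner_def mult.assoc)
  show "0 \<le> inner x x" for x :: ell2
    by (simp add: inner_ell2_def cinner_self suminf_nonneg summable_coord)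
  show "inner x x = 0 \<longleftrightarrow> x = 0" for x :: ell2
  proof
    assume "inner x x = 0"
    then have "(\<Sum>k. (cmod (coord x k))\<^sup>2) = 0" by (simp add: inner_ell2_def cinner_self)
    then have "\<forall>k. coord x k = 0" using suminf_eq_zero_iff[OF summable_coord[of x]] by simp
    then show "x = 0" by (intro ell2_eqI) simp
  qed (simp add: inner_ell2_def cinner_def)
  show "norm x = sqrt (inner x x)" for x :: ell2 by (rule norm_ell2_def)
qed

end

lemma norm_ell2_sq: "(norm x)\<^sup>2 = (\<Sum>k. (cmod (coord x k))\<^sup>2)" for x :: ell2
  by (simp add: norm_ell2_def inner_ell2_def cinner_self suminf_nonneg summable_coord)

lemma sum_coord_le_norm: "(\<Sum>k<n. (cmod (coord x k))\<^sup>2) \<le> (norm x)\<^sup>2"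
  unfolding norm_ell2_sq by (rule sum_le_suminf) (auto simp: summable_coord)

lemma norm_ell2_leI:
  assumes "\<And>n. (\<Sum>k<n. (cmod (coord x k))\<^sup>2) \<le> c\<^sup>2" "c \<ge> 0"
  shows "norm x \<le> c"
proof -
  have "(norm x)\<^sup>2 \<le> c\<^sup>2"
    unfolding norm_ell2_sq by (rule suminf_le_const[OF summable_coord]) (rule assms)
  then show ?thesis using assms(2) by (rule power2_le_imp_le)
qed

lemma Ell2_bounded:
  assumes "\<And>n. (\<Sum>k<n. (cmod (f k))\<^sup>2) \<le> c\<^sup>2" "c \<ge> 0"
  shows "coord (Ell2 f) = f" "norm (Ell2 f) \<le> c"
proof -
  have "summable (\<lambda>k. (cmod (f k))\<^sup>2)"
    by (rule bounded_imp_summable[where B = "c\<^sup>2"]) (auto intro: order_trans[OF _ assms(1)[of "Suc _"]] simp: lessThan_Suc_atMost)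
  then show c: "coord (Ell2 f) = f" by (rule coord_Ell2)
  show "norm (Ell2 f) \<le> c" by (rule norm_ell2_leI) (simp_all add: c assms)
qed

lemma cmod_coord_le_norm: "cmod (coord x k) \<le> norm x"
proof -
  have "(cmod (coord x k))\<^sup>2 \<le> (\<Sum>j<Suc k. (cmod (coord x j))\<^sup>2)" by (simp add: sum_nonneg)
  also have "\<dots> \<le> (norm x)\<^sup>2" by (rule sum_coord_le_norm)
  finally show ?thesis by (rule power2_le_imp_le) simp
qed

instance ell2 :: banach
proof
  fix X :: "nat \<Rightarrow> ell2" assume X: "Cauchy X"
  have "Cauchy (\<lambda>n. coord (X n) k)" for k
    unfolding Cauchy_def
  proof (intro allI impI)
    fix e :: real assume "e > 0"
    then obtain M where M: "\<And>m n. m \<ge> M \<Longrightarrow> n \<ge> M \<Longrightarrow> norm (X m - X n) < e"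
      using X unfolding Cauchy_def dist_norm by meson
    have "cmod (coord (X m) k - coord (X n) k) \<le> norm (X m - X n)" for m n
      using cmod_coord_le_norm[of "X m - X n" k] by simp
    then show "\<exists>M. \<forall>m\<ge>M. \<forall>n\<ge>M. dist (coord (X m) k) (coord (X n) k) < e"
      using M unfolding dist_norm by (meson le_less_trans)
  qed
  then have "\<forall>k. \<exists>l. (\<lambda>n. coord (X n) k) \<longlonglongrightarrow> l" using Cauchy_convergent convergent_def by blast
  then obtain f where f: "\<And>k. (\<lambda>n. coord (X n) k) \<longlonglongrightarrow> f k" by metis
  have *: "(\<Sum>k<K. (cmod (f k - coord (X n) k))\<^sup>2) \<le> e\<^sup>2"
    if "e \<ge> 0" and M: "\<And>m n. m \<ge> M \<Longrightarrow> n \<ge> M \<Longrightarrow> norm (X m - X n) \<le> e" and "n \<ge> M" for e M n K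
  proof (rule tendsto_upperbound)
    show "(\<lambda>m. \<Sum>k<K. (cmod (coord (X m) k - coord (X n) k))\<^sup>2) \<longlonglongrightarrow> (\<Sum>k<K. (cmod (f k - coord (X n) k))\<^sup>2)"
      by (intro tendsto_intros f)
    show "eventually (\<lambda>m. (\<Sum>k<K. (cmod (coord (X m) k - coord (X n) k))\<^sup>2) \<le> e\<^sup>2) sequentially"
    proof (rule eventually_sequentiallyI)
      fix m assume "m \<ge> M"
      have "(\<Sum>k<K. (cmod (coord (X m) k - coord (X n) k))\<^sup>2) \<le> (norm (X m - X n))\<^sup>2"
        using sum_coord_le_norm[of "X m - X n" K] by simp
      also have "\<dots> \<le> e\<^sup>2" using M[OF \<open>m \<ge> M\<close> \<open>n \<ge> M\<close>] by (simp add: power_mono)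
      finally show "(\<Sum>k<K. (cmod (coord (X m) k - coord (X n) k))\<^sup>2) \<le> e\<^sup>2" .
    qed
  qed simp
  have sub: "coord (Ell2 (\<lambda>k. f k - coord (X n) k)) = (\<lambda>k. f k - coord (X n) k)"
    "norm (Ell2 (\<lambda>k. f k - coord (X n) k)) \<le> e"
    if "e \<ge> 0" "\<And>m n. m \<ge> M \<Longrightarrow> n \<ge> M \<Longrightarrow> norm (X m - X n) \<le> e" "n \<ge> M" for e M n
    by (rule Ell2_bounded[OF *[OF that]], use that in auto)+
  have "\<exists>M1. \<forall>m\<ge>M1. \<forall>n\<ge>M1. norm (X m - X n) < 1"
    using X unfolding Cauchy_def dist_norm by simp
  then obtain M1 where M1: "\<And>m n. m \<ge> M1 \<Longrightarrow> n \<ge> M1 \<Longrightarrow> norm (X m - X n) < 1" by blast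
  define l where "l = Ell2 (\<lambda>k. f k - coord (X M1) k) + X M1"
  have l: "coord l k = f k" for k
    using sub(1)[of 1 M1 M1] M1 by (auto simp: l_def less_imp_le)
  have lim: "norm (l - X n) \<le> e"
    if "e \<ge> 0" "\<And>m n. m \<ge> M \<Longrightarrow> n \<ge> M \<Longrightarrow> norm (X m - X n) \<le> e" "n \<ge> M" for e M n
  proof -
    have "l - X n = Ell2 (\<lambda>k. f k - coord (X n) k)"
      by (rule ell2_eqI) (simp add: sub(1)[OF that] l)
    then show ?thesis using sub(2)[OF that] by simp
  qed
  have "X \<longlonglongrightarrow> l"
  proof (rule metric_LIMSEQ_I)
    fix e :: real assume e: "e > 0"
    then obtain M where M: "\<And>m n. m \<ge> M \<Longrightarrow> n \<ge> M \<Longrightarrow> norm (X m - X n) < e / 2"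
      using X unfolding Cauchy_def dist_norm by (meson half_gt_zero)
    have "dist (X n) l < e" if "n \<ge> M" for n
      using lim[of "e / 2" M n] M e that by (force simp: dist_norm norm_minus_commute less_imp_le)
    then show "\<exists>M. \<forall>n\<ge>M. dist (X n) l < e" by blast
  qed
  then show "convergent X" by (rule convergentI)
qed

instantiation ell2 :: complex_banach
begin

definition scaleC_ell2 where "c *\<^sub>C x = Ell2 (\<lambda>k. c * coord x k)"

lemma coord_scaleC [simp]: "coord (c *\<^sub>C x) k = c * coord x k"
  by (simp add: scaleC_ell2_def coord_Ell2 summable_square_scale summable_coord)

instance
proof
  fix b c :: complex and r :: real and x y :: ell2
  show "c *\<^sub>C (x + y) = c *\<^sub>C x + c *\<^sub>C y" by (rule ell2_eqI) (simp add: algebra_simps)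
  show "(b + c) *\<^sub>C x = b *\<^sub>C x + c *\<^sub>C x" by (rule ell2_eqI) (simp add: algebra_simps)
  show "b *\<^sub>C c *\<^sub>C x = (b * c) *\<^sub>C x" by (rule ell2_eqI) simp
  show "1 *\<^sub>C x = x" by (rule ell2_eqI) simp
  show "r *\<^sub>R x = complex_of_real r *\<^sub>C x" by (rule ell2_eqI) simp
  have "(norm (c *\<^sub>C x))\<^sup>2 = (cmod c * norm x)\<^sup>2"
    by (simp add: norm_ell2_sq power_mult_distrib norm_mult suminf_mult summable_coord)
  then show "norm (c *\<^sub>C x) = cmod c * norm x" by (rule power2_eq_imp_eq) auto
qed

end

lemma cinner_add_left: "cinner (x + y) z = cinner x z + cinner y z"
  and cinner_add_right: "cinner x (y + z) = cinner x y + cinner x z"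
  and cinner_scale_left: "cinner (c *\<^sub>C x) y = c * cinner x y"
  and cinner_scale_right: "cinner x (c *\<^sub>C y) = cnj c * cinner x y"
  and cinner_commute: "cinner x y = cnj (cinner y x)"
proof -
  show "cinner (x + y) z = cinner x z + cinner y z"
    by (simp add: cinner_def ring_distribs suminf_add[OF summable_cinner summable_cinner, symmetric])
  show "cinner x (y + z) = cinner x y + cinner x z"
    by (simp add: cinner_def ring_distribs suminf_add[OF summable_cinner summable_cinner, symmetric])
  show "cinner (c *\<^sub>C x) y = c * cinner x y"
    by (simp add: cinner_def mult.assoc suminf_mult[OF summable_cinner])
  show "cinner x (c *\<^sub>C y) = cnj c * cinner x y"
    using suminf_mult[OF summable_cinner[of x y], of "cnj c"] by (simp add: cinner_def mult_ac)
  show "cinner x y = cnj (cinner y x)"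
    unfolding cinner_def bounded_linear.suminf[OF bounded_linear_cnj summable_cinner]
    by (rule suminf_cong) (simp add: mult.commute)
qed

lemma cinner_zero [simp]: "cinner 0 x = 0" "cinner x 0 = 0"
  by (simp_all add: cinner_def)

lemma cinner_self_norm: "cinner x x = of_real ((norm x)\<^sup>2)"
  by (simp add: cinner_self norm_ell2_sq)

lemma cinner_minus_left: "cinner (- x) y = - cinner x y"
  using cinner_add_left[of x "- x" y] by (simp add: eq_neg_iff_add_eq_0 add.commute)

lemma cinner_diff_left: "cinner (x - y) z = cinner x z - cinner y z"
  by (metis cinner_add_left cinner_minus_left diff_conv_add_uminus)

lemma cinner_diff_right: "cinner x (y - z) = cinner x y - cinner x z"
  by (metis cinner_commute cinner_diff_left complex_cnj_diff)

lemma cinner_sum_left: "cinner (sum f A) y = (\<Sum>i\<in>A. cinner (f i) y)"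
  by (induction A rule: infinite_finite_induct) (simp_all add: cinner_add_left)

lemma cinner_sum_right: "cinner y (sum f A) = (\<Sum>i\<in>A. cinner y (f i))"
  by (induction A rule: infinite_finite_induct) (simp_all add: cinner_add_right)

lemma cmod_cinner_le: "cmod (cinner x y) \<le> norm x * norm y"
proof (cases "cinner x y = 0")
  case False
  define u where "u = cnj (cinner x y) / of_real (cmod (cinner x y))"
  have u: "cmod u = 1" using False by (simp add: u_def norm_divide)
  have "u * cinner x y = of_real (cmod (cinner x y))"
    using False by (simp add: u_def complex_norm_square[symmetric] power2_eq_square mult.commute)
  then have "cmod (cinner x y) = Re (cinner (u *\<^sub>C x) y)" by (simp add: cinner_scale_left)
  also have "\<dots> = inner (u *\<^sub>C x) y" by (simp add: inner_ell2_def)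
  also have "\<dots> \<le> norm (u *\<^sub>C x) * norm y" by (rule norm_cauchy_schwarz)
  also have "\<dots> = norm x * norm y" by (simp add: norm_scaleC u)
  finally show ?thesis .
qed simp

lemma bounded_clinear_cinner: "bounded_clinear (\<lambda>x. cinner x y)"
  by (rule bounded_clinearI[where K = "norm y"])
    (auto simp: cinner_add_left cinner_scale_left scaleC_complex_def cmod_cinner_le mult.commute[of "norm y"])

definition ell2_unit :: "nat \<Rightarrow> ell2" where "ell2_unit k = Ell2 (\<lambda>j. if j = k then 1 else 0)"

lemma coord_ell2_unit [simp]: "coord (ell2_unit k) j = (if j = k then 1 else 0)"
proof -
  have "summable (\<lambda>j. (cmod (if j = k then 1 else 0))\<^sup>2)"
    by (rule summable_finite[of "{k}"]) auto
  then show ?thesis by (simp add: ell2_unit_def coord_Ell2)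
qed

lemma cinner_ell2_unit [simp]: "cinner x (ell2_unit k) = coord x k" "cinner (ell2_unit k) x = cnj (coord x k)"
proof -
  have "(\<Sum>j. coord x j * cnj (if j = k then 1 else 0)) = (\<Sum>j\<in>{k}. coord x j * cnj (if j = k then 1 else 0))"
    by (rule suminf_finite) auto
  then show 1: "cinner x (ell2_unit k) = coord x k" by (simp add: cinner_def)
  show "cinner (ell2_unit k) x = cnj (coord x k)" using cinner_commute[of "ell2_unit k" x] 1 by simp
qed

lemma coord_sum: "coord (sum f A) k = (\<Sum>i\<in>A. coord (f i) k)"
  by (induction A rule: infinite_finite_induct) simp_all

lemma ell2_expansion: "(\<lambda>n. \<Sum>k<n. coord x k *\<^sub>C ell2_unit k) \<longlonglongrightarrow> x"
proof -
  have eq: "(norm (x - (\<Sum>k<n. coord x k *\<^sub>C ell2_unit k)))\<^sup>2 = (\<Sum>k. (cmod (coord x (k + n)))\<^sup>2)" for n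
  proof -
    have c: "coord (x - (\<Sum>k<n. coord x k *\<^sub>C ell2_unit k)) j = (if j < n then 0 else coord x j)" for j
      by (simp add: coord_sum if_distrib[of "\<lambda>u. _ * u"] cong: if_cong)
    have "(\<Sum>j. (cmod (if j < n then 0 else coord x j))\<^sup>2)
       = (\<Sum>j. (cmod (if j + n < n then 0 else coord x (j + n)))\<^sup>2) + (\<Sum>j<n. (cmod (if j < n then 0 else coord x j))\<^sup>2)"
      by (rule suminf_split_initial_segment) (use summable_coord[of "x - (\<Sum>k<n. coord x k *\<^sub>C ell2_unit k)"] in \<open>simp only: c\<close>)
    then show ?thesis unfolding norm_ell2_sq c by simp
  qed
  have "(\<lambda>n. sqrt (\<Sum>k. (cmod (coord x (k + n)))\<^sup>2)) \<longlonglongrightarrow> sqrt 0"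
    by (intro tendsto_real_sqrt suminf_exist_split2 summable_coord)
  then have "(\<lambda>n. norm (x - (\<Sum>k<n. coord x k *\<^sub>C ell2_unit k))) \<longlonglongrightarrow> 0"
    by (simp add: eq[symmetric])
  then have "(\<lambda>n. x - (\<Sum>k<n. coord x k *\<^sub>C ell2_unit k)) \<longlonglongrightarrow> 0" by (rule tendsto_norm_zero_cancel)
  from tendsto_diff[OF tendsto_const[of x] this] show ?thesis by simp
qed

text \<open>The values of \<open>\<phi>\<close> at the unit vectors are square summable: test \<open>\<phi>\<close> on the finite sum with
  the conjugate values as coordinates.\<close>

lemma ell2_riesz_representation:
  assumes "bounded_clinear \<phi>" "\<And>x. cmod (\<phi> x) \<le> K * norm x" "K \<ge> 0"
  obtains v where "\<And>x. \<phi> x = cinner x v" "norm v \<le> K"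
proof -
  let ?f = "\<lambda>k. cnj (\<phi> (ell2_unit k))"
  have "(\<Sum>k<n. (cmod (?f k))\<^sup>2) \<le> K\<^sup>2" for n
  proof -
    let ?x = "\<Sum>k<n. ?f k *\<^sub>C ell2_unit k"
    let ?s = "\<Sum>k<n. (cmod (?f k))\<^sup>2"
    have "\<phi> ?x = (\<Sum>k<n. ?f k * cnj (?f k))"
      by (simp add: bounded_clinear_sum[OF assms(1)] bounded_clinear_scaleC[OF assms(1)] scaleC_complex_def)
    also have "\<dots> = of_real ?s" unfolding of_real_sum complex_norm_square by simp
    finally have eq: "\<phi> ?x = of_real ?s" .
    have "?s \<le> cmod (\<phi> ?x)" unfolding eq norm_of_real by (rule abs_ge_self)
    also have "\<dots> \<le> K * norm ?x" by (rule assms(2))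
    finally have "?s \<le> K * norm ?x" .
    moreover have "(norm ?x)\<^sup>2 = ?s"
    proof -
      have "cinner ?x ?x = (\<Sum>k<n. ?f k * cnj (?f k))"
        by (simp add: cinner_sum_right cinner_scale_right coord_sum mult.commute
          if_distrib[of "\<lambda>u. _ * u"] cong: if_cong)
      also have "\<dots> = of_real ?s" unfolding of_real_sum complex_norm_square by simp
      finally show ?thesis unfolding cinner_self_norm by (metis of_real_eq_iff)
    qed
    ultimately have "(norm ?x)\<^sup>2 \<le> K * norm ?x" by simp
    then have "norm ?x \<le> K" using assms(3) by (cases "norm ?x = 0") (auto simp: power2_eq_square)
    then have "(norm ?x)\<^sup>2 \<le> K\<^sup>2" by (intro power_mono) auto
    then show ?thesis by (simp only: \<open>(norm ?x)\<^sup>2 = ?s\<close>)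
  qed
  note v = Ell2_bounded[OF this assms(3)]
  show ?thesis
  proof
    fix x
    have "(\<lambda>n. \<phi> (\<Sum>k<n. coord x k *\<^sub>C ell2_unit k)) \<longlonglongrightarrow> \<phi> x"
      by (rule bounded_linear.tendsto[OF bounded_clinear_imp_bounded_linear[OF assms(1)] ell2_expansion])
    moreover have "(\<lambda>n. cinner (\<Sum>k<n. coord x k *\<^sub>C ell2_unit k) (Ell2 ?f)) \<longlonglongrightarrow> cinner x (Ell2 ?f)"
      by (rule bounded_linear.tendsto[OF bounded_clinear_imp_bounded_linear[OF bounded_clinear_cinner] ell2_expansion])
    moreover have "\<phi> (\<Sum>k<n. coord x k *\<^sub>C ell2_unit k) = cinner (\<Sum>k<n. coord x k *\<^sub>C ell2_unit k) (Ell2 ?f)" for n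
      by (simp add: bounded_clinear_sum[OF assms(1)] bounded_clinear_scaleC[OF assms(1)] scaleC_complex_def
        cinner_sum_left cinner_scale_left v)
    ultimately show "\<phi> x = cinner x (Ell2 ?f)" using LIMSEQ_unique by simp
  qed (rule v)
qed

subsection \<open>Orthonormal systems\<close>

text \<open>Zero vectors are admitted, so that the Gram--Schmidt process applies to every sequence.\<close>

definition orthosystem :: "(nat \<Rightarrow> ell2) \<Rightarrow> bool"
  where "orthosystem e \<longleftrightarrow> (\<forall>i. norm (e i) = 1 \<or> e i = 0) \<and> (\<forall>i j. i \<noteq> j \<longrightarrow> cinner (e i) (e j) = 0)"

definition projection :: "(nat \<Rightarrow> ell2) \<Rightarrow> nat \<Rightarrow> ell2 \<Rightarrow> ell2"
  where "projection e n x = (\<Sum>i<n. cinner x (e i) *\<^sub>C e i)"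

lemma orthosystem_norm_le: "orthosystem e \<Longrightarrow> norm (e i) \<le> 1"
  unfolding orthosystem_def by (metis norm_zero order_refl zero_le_one)

lemma cinner_projection:
  assumes e: "orthosystem e" and j: "j < n"
  shows "cinner (projection e n x) (e j) = cinner x (e j)"
proof -
  have "cinner (projection e n x) (e j) = (\<Sum>i<n. cinner x (e i) * cinner (e i) (e j))"
    by (simp add: projection_def cinner_sum_left cinner_scale_left)
  also have "\<dots> = (\<Sum>i<n. if i = j then cinner x (e j) * cinner (e j) (e j) else 0)"
    by (rule sum.cong) (use e in \<open>auto simp: orthosystem_def\<close>)
  also have "\<dots> = cinner x (e j) * cinner (e j) (e j)" using j by simp
  also have "\<dots> = cinner x (e j)"
    using e unfolding orthosystem_def by (metis cinner_self_norm cinner_zero(2) mult.right_neutral mult_zero_left of_real_1 one_power2)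
  finally show ?thesis .
qed

lemma projection_pythagoras:
  assumes e: "orthosystem e"
  shows "(norm (x - projection e n x))\<^sup>2 + (\<Sum>i<n. (cmod (cinner x (e i)))\<^sup>2) = (norm x)\<^sup>2"
proof -
  let ?p = "projection e n x"
  have xp: "cinner y ?p = (\<Sum>i<n. cnj (cinner x (e i)) * cinner y (e i))" for y
    by (simp add: projection_def cinner_sum_right cinner_scale_right)
  have 0: "cinner (x - ?p) ?p = 0"
    unfolding xp cinner_diff_left by (rule sum.neutral) (simp add: cinner_projection[OF e])
  have "cinner x ?p = of_real (\<Sum>i<n. (cmod (cinner x (e i)))\<^sup>2)"
    unfolding xp of_real_sum complex_norm_square by (simp add: mult.commute)
  moreover have "cinner x x = cinner (x - ?p) x + cinner ?p x" by (simp add: cinner_diff_left)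
  moreover have "cinner (x - ?p) x = cinner (x - ?p) (x - ?p)" using 0 by (simp add: cinner_diff_right)
  moreover have "cinner ?p x = cnj (cinner x ?p)" by (rule cinner_commute)
  ultimately have "of_real ((norm x)\<^sup>2) = (of_real ((norm (x - ?p))\<^sup>2 + (\<Sum>i<n. (cmod (cinner x (e i)))\<^sup>2)) :: complex)"
    by (simp add: cinner_self_norm del: of_real_power of_real_sum)
  then show ?thesis by (metis of_real_eq_iff)
qed

lemma bessel:
  assumes "orthosystem e"
  shows "(\<Sum>i<n. (cmod (cinner x (e i)))\<^sup>2) \<le> (norm x)\<^sup>2"
  using projection_pythagoras[OF assms, of x n] zero_le_power2[of "norm (x - projection e n x)"] by linarith

lemma norm_diff_projection_le:
  assumes "orthosystem e"
  shows "norm (x - projection e n x) \<le> norm x"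
proof (rule power2_le_imp_le)
  have "0 \<le> (\<Sum>i<n. (cmod (cinner x (e i)))\<^sup>2)" by (intro sum_nonneg) simp
  then show "(norm (x - projection e n x))\<^sup>2 \<le> (norm x)\<^sup>2"
    using projection_pythagoras[OF assms, of x n] by linarith
qed simp

lemma cinner_diff_projection:
  "orthosystem e \<Longrightarrow> j < n \<Longrightarrow> cinner (x - projection e n x) (e j) = 0"
  by (simp add: cinner_diff_left cinner_projection)

primrec orthonormalize_list :: "(nat \<Rightarrow> ell2) \<Rightarrow> nat \<Rightarrow> ell2 list" where
  "orthonormalize_list v 0 = []"
| "orthonormalize_list v (Suc n) = orthonormalize_list v n @
    [sgn (v n - (\<Sum>e\<leftarrow>orthonormalize_list v n. cinner (v n) e *\<^sub>C e))]"

definition orthonormalize :: "(nat \<Rightarrow> ell2) \<Rightarrow> nat \<Rightarrow> ell2"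
  where "orthonormalize v n = last (orthonormalize_list v (Suc n))"

lemma orthonormalize_list: "orthonormalize_list v n = map (orthonormalize v) [0..<n]"
  by (induction n) (simp_all add: orthonormalize_def)

lemma orthonormalize_rec: "orthonormalize v n = sgn (v n - projection (orthonormalize v) n (v n))"
proof -
  have "orthonormalize v n = sgn (v n - (\<Sum>e\<leftarrow>orthonormalize_list v n. cinner (v n) e *\<^sub>C e))"
    by (simp add: orthonormalize_def)
  then show ?thesis
    by (simp only: orthonormalize_list map_map comp_def projection_def
      interv_sum_list_conv_sum_set_nat atLeast0LessThan set_upt)
qed

lemma orthosystem_orthonormalize: "orthosystem (orthonormalize v)"
proof -
  let ?e = "orthonormalize v"
  have n1: "norm (?e i) = 1 \<or> ?e i = 0" for i
    by (subst (1 2) orthonormalize_rec) (simp add: norm_sgn)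
  have lt: "i < n \<Longrightarrow> j < n \<Longrightarrow> i \<noteq> j \<Longrightarrow> cinner (?e i) (?e j) = 0" for i j n
  proof (induction n arbitrary: i j)
    case (Suc n)
    have new: "cinner (?e n) (?e j) = 0" if j: "j < n" for j
    proof -
      \<comment> \<open>Cutting the sequence off at \<open>n\<close> turns the induction hypothesis into an orthonormal system.\<close>
      define e where "e i = (if i < n then ?e i else 0)" for i
      have "orthosystem e" unfolding orthosystem_def e_def using n1 Suc.IH by auto
      from cinner_diff_projection[OF this j, of "v n"]
      have "cinner (v n - projection ?e n (v n)) (?e j) = 0" using j by (simp add: e_def projection_def)
      then show ?thesis
        by (subst orthonormalize_rec) (simp add: sgn_div_norm scaleR_scaleC cinner_scale_left)
    qed
    consider "i < n" "j < n" | "i = n" "j < n" | "i < n" "j = n" using Suc.prems by linarith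
    then show ?case
    proof cases
      case 3
      then have "cnj (cinner (?e j) (?e i)) = 0" using new by simp
      then show ?thesis by (metis cinner_commute)
    qed (use Suc new in auto)
  qed simp
  show ?thesis unfolding orthosystem_def using n1 lt[of _ "Suc (max _ _)"]
    by (metis less_Suc_eq_le max.cobounded1 max.cobounded2)
qed

lemma orthonormalize_span: "v n = projection (orthonormalize v) n (v n) + complex_of_real (norm (v n - projection (orthonormalize v) n (v n))) *\<^sub>C orthonormalize v n"
proof -
  let ?w = "v n - projection (orthonormalize v) n (v n)"
  have "complex_of_real (norm w) *\<^sub>C sgn w = w" for w :: ell2
    by (cases "w = 0") (simp_all add: sgn_div_norm scaleR_scaleC[symmetric])
  from this[of ?w] have "complex_of_real (norm ?w) *\<^sub>C orthonormalize v n = ?w"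
    by (simp only: orthonormalize_rec[of v n, symmetric])
  then show ?thesis by simp
qed

lemma orthogonal_orthonormalize:
  assumes "\<And>i. i < n \<Longrightarrow> cinner x (orthonormalize v i) = 0" "i < n"
  shows "cinner x (v i) = 0"
  by (subst orthonormalize_span)
    (use assms in \<open>simp add: cinner_add_right cinner_scale_right projection_def cinner_sum_right\<close>)

section \<open>Eigenvalues of finite matrices\<close>

primrec matpow :: "nat \<Rightarrow> (nat \<Rightarrow> nat \<Rightarrow> complex) \<Rightarrow> nat \<Rightarrow> nat \<Rightarrow> nat \<Rightarrow> complex" where
  "matpow n A 0 = (\<lambda>i j. if i = j then 1 else 0)"
| "matpow n A (Suc k) = (\<lambda>i j. \<Sum>l<n. A i l * matpow n A k l j)"

lemma index_times_mat:
  assumes "A \<in> carrier_mat n n" "B \<in> carrier_mat n n" "i < n" "j < n"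
  shows "(A * B) $$ (i, j) = (\<Sum>l<n. A $$ (i, l) * B $$ (l, j))"
  using assms by (simp add: scalar_prod_def atLeast0LessThan)

text \<open>Matrices are functions of two indices throughout, as their sizes vary in the limit processes
  below.\<close>

lemma triangularization:
  fixes A :: "nat \<Rightarrow> nat \<Rightarrow> complex"
  obtains P Q B :: "nat \<Rightarrow> nat \<Rightarrow> complex" where
    "\<And>i j. i < n \<Longrightarrow> j < n \<Longrightarrow> (\<Sum>l<n. A i l * P l j) = (\<Sum>l<n. P i l * B l j)"
    "\<And>i j. i < n \<Longrightarrow> j < i \<Longrightarrow> B i j = 0"
    "\<And>i j. i < n \<Longrightarrow> j < n \<Longrightarrow> (\<Sum>l<n. P i l * Q l j) = (if i = j then 1 else 0)"
    "\<And>i j. i < n \<Longrightarrow> j < n \<Longrightarrow> (\<Sum>l<n. Q i l * P l j) = (if i = j then 1 else 0)"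
proof -
  let ?A = "mat n n (\<lambda>(i, j). A i j)"
  have A: "?A \<in> carrier_mat n n" by simp
  obtain as where "char_poly ?A = (\<Prod>a\<leftarrow>as. [:- a, 1:])" using char_poly_factorized[OF A] by blast
  from schur_decomposition_exists[OF A this]
  obtain B P Q where ut: "upper_triangular B" and sim: "similar_mat_wit ?A B P Q"
    unfolding similar_mat_def by blast
  note s = similar_mat_witD2[OF A sim]
  have "?A * P = P * B * (Q * P)" unfolding s(3) using s by (simp add: assoc_mult_mat[of _ n n _ n _ n])
  then have AP: "?A * P = P * B" using s by simp
  show ?thesis
  proof (rule that[of "\<lambda>i j. P $$ (i, j)" "\<lambda>i j. B $$ (i, j)" "\<lambda>i j. Q $$ (i, j)"])
    fix i j assume ij: "i < n" "j < n"
    show "(\<Sum>l<n. A i l * P $$ (l, j)) = (\<Sum>l<n. P $$ (i, l) * B $$ (l, j))"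
      using arg_cong[OF AP, of "\<lambda>X. X $$ (i, j)"] ij
      unfolding index_times_mat[OF A s(6) ij] index_times_mat[OF s(6,5) ij] by simp
    show "(\<Sum>l<n. P $$ (i, l) * Q $$ (l, j)) = (if i = j then 1 else 0)"
      using arg_cong[OF s(1), of "\<lambda>X. X $$ (i, j)"] ij
      unfolding index_times_mat[OF s(6,7) ij] by simp
    show "(\<Sum>l<n. Q $$ (i, l) * P $$ (l, j)) = (if i = j then 1 else 0)"
      using arg_cong[OF s(2), of "\<lambda>X. X $$ (i, j)"] ij
      unfolding index_times_mat[OF s(7,6) ij] by simp
  next
    show "B $$ (i, j) = 0" if "i < n" "j < i" for i j
      using ut s(5) that by (auto simp: upper_triangular_def)
  qed
qed

lemma matpow_triangular:
  assumes B: "\<And>i j. i < n \<Longrightarrow> j < i \<Longrightarrow> B i j = 0"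
  shows "i < n \<Longrightarrow> j \<le> i \<Longrightarrow> matpow n B k i j = (if i = j then B i i ^ k else 0)"
proof (induction k arbitrary: i j)
  case (Suc k)
  have "matpow n B (Suc k) i j = (\<Sum>l<n. if l = i then B i i * matpow n B k i j else 0)"
    unfolding matpow.simps
  proof (rule sum.cong)
    fix l assume l: "l \<in> {..<n}"
    show "B i l * matpow n B k l j = (if l = i then B i i * matpow n B k i j else 0)"
      using Suc B[of i l] l by (cases "l < i") auto
  qed simp
  then show ?case using Suc by simp
qed simp

lemma matpow_intertwine:
  assumes AP: "\<And>i j. i < n \<Longrightarrow> j < n \<Longrightarrow> (\<Sum>l<n. A i l * P l j) = (\<Sum>l<n. P i l * B l j)"
  shows "i < n \<Longrightarrow> j < n \<Longrightarrow> (\<Sum>l<n. matpow n A k i l * P l j) = (\<Sum>l<n. P i l * matpow n B k l j)"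
proof (induction k arbitrary: i j)
  case 0
  then show ?case by (simp add: if_distrib[of "\<lambda>u. u * _"] if_distrib[of "\<lambda>u. _ * u"] cong: if_cong)
next
  case (Suc k)
  have "(\<Sum>l<n. matpow n A (Suc k) i l * P l j) = (\<Sum>l<n. \<Sum>h<n. A i h * (matpow n A k h l * P l j))"
    by (simp add: sum_distrib_right mult.assoc)
  also have "\<dots> = (\<Sum>h<n. A i h * (\<Sum>l<n. matpow n A k h l * P l j))"
    by (subst sum.swap) (simp add: sum_distrib_left)
  also have "\<dots> = (\<Sum>h<n. A i h * (\<Sum>l<n. P h l * matpow n B k l j))"
    using Suc by (intro sum.cong) auto
  also have "\<dots> = (\<Sum>l<n. (\<Sum>h<n. A i h * P h l) * matpow n B k l j)"
    by (simp add: sum_distrib_left sum_distrib_right mult.assoc) (rule sum.swap)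
  also have "\<dots> = (\<Sum>l<n. (\<Sum>h<n. P i h * B h l) * matpow n B k l j)"
    using Suc AP by (intro sum.cong) auto
  also have "\<dots> = (\<Sum>h<n. P i h * (\<Sum>l<n. B h l * matpow n B k l j))"
    by (simp add: sum_distrib_left sum_distrib_right mult.assoc) (rule sum.swap)
  finally show ?case by simp
qed

lemma trace_matpow:
  assumes AP: "\<And>i j. i < n \<Longrightarrow> j < n \<Longrightarrow> (\<Sum>l<n. A i l * P l j) = (\<Sum>l<n. P i l * B l j)"
    and B: "\<And>i j. i < n \<Longrightarrow> j < i \<Longrightarrow> B i j = 0"
    and PQ: "\<And>i j. i < n \<Longrightarrow> j < n \<Longrightarrow> (\<Sum>l<n. P i l * Q l j) = (if i = j then 1 else 0)"
    and QP: "\<And>i j. i < n \<Longrightarrow> j < n \<Longrightarrow> (\<Sum>l<n. Q i l * P l j) = (if i = j then 1 else 0)"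
  shows "(\<Sum>i<n. matpow n A k i i) = (\<Sum>i<n. B i i ^ k)"
proof -
  have "(\<Sum>i<n. matpow n A k i i) = (\<Sum>i<n. \<Sum>l<n. matpow n A k i l * (\<Sum>j<n. P l j * Q j i))"
    by (intro sum.cong) (simp_all add: PQ if_distrib[of "\<lambda>u. _ * u"] cong: if_cong)
  also have "\<dots> = (\<Sum>i<n. \<Sum>j<n. (\<Sum>l<n. matpow n A k i l * P l j) * Q j i)"
    by (rule sum.cong[OF refl]) (simp add: sum_distrib_left sum_distrib_right mult.assoc, rule sum.swap)
  also have "\<dots> = (\<Sum>i<n. \<Sum>j<n. (\<Sum>l<n. P i l * matpow n B k l j) * Q j i)"
    by (intro sum.cong refl arg_cong2[where f = "(*)"] matpow_intertwine[OF AP]) auto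
  also have "\<dots> = (\<Sum>i<n. \<Sum>j<n. \<Sum>l<n. matpow n B k l j * (Q j i * P i l))"
    by (simp add: sum_distrib_left sum_distrib_right mult_ac)
  also have "\<dots> = (\<Sum>j<n. \<Sum>i<n. \<Sum>l<n. matpow n B k l j * (Q j i * P i l))" by (rule sum.swap)
  also have "\<dots> = (\<Sum>j<n. \<Sum>l<n. matpow n B k l j * (\<Sum>i<n. Q j i * P i l))"
    by (rule sum.cong[OF refl]) (simp add: sum_distrib_left, rule sum.swap)
  also have "\<dots> = (\<Sum>j<n. matpow n B k j j)"
    by (intro sum.cong) (simp_all add: QP if_distrib[of "\<lambda>u. _ * u"] cong: if_cong)
  also have "\<dots> = (\<Sum>i<n. B i i ^ k)" by (intro sum.cong) (simp_all add: matpow_triangular[OF B])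
  finally show ?thesis .
qed

text \<open>Schur's inequality: in the orthonormal basis obtained from a triangularizing basis, the
  eigenvalues are the diagonal entries \<open>\<langle>A e\<^sub>j, e\<^sub>j\<rangle>\<close>, and the sum of the \<open>|A e\<^sub>j|\<^sup>2\<close> is the square of the
  Frobenius norm.\<close>

lemma schur_inequality:
  fixes A P Q B :: "nat \<Rightarrow> nat \<Rightarrow> complex"
  assumes AP: "\<And>i j. i < n \<Longrightarrow> j < n \<Longrightarrow> (\<Sum>l<n. A i l * P l j) = (\<Sum>l<n. P i l * B l j)"
    and B: "\<And>i j. i < n \<Longrightarrow> j < i \<Longrightarrow> B i j = 0"
    and QP: "\<And>i j. i < n \<Longrightarrow> j < n \<Longrightarrow> (\<Sum>l<n. Q i l * P l j) = (if i = j then 1 else 0)"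
  shows "(\<Sum>j<n. (cmod (B j j))\<^sup>2) \<le> (\<Sum>i<n. \<Sum>j<n. (cmod (A i j))\<^sup>2)"
proof -
  define v where "v j = (\<Sum>i<n. P i j *\<^sub>C ell2_unit i)" for j
  define r where "r i = (\<Sum>j<n. cnj (A i j) *\<^sub>C ell2_unit j)" for i
  define M where "M x = (\<Sum>i<n. cinner x (r i) *\<^sub>C ell2_unit i)" for x
  define e where "e = orthonormalize v"
  define S where "S j = cvs.span (v ` {..<j})" for j
  have e: "orthosystem e" unfolding e_def by (rule orthosystem_orthonormalize)
  have cv: "coord (v j) i = (if i < n then P i j else 0)" for i j
    by (simp add: v_def coord_sum if_distrib[of "\<lambda>u. _ * u"] cong: if_cong)
  have cr: "coord (r i) j = (if j < n then cnj (A i j) else 0)" for i j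
    by (simp add: r_def coord_sum if_distrib[of "\<lambda>u. _ * u"] cong: if_cong)
  have add: "M (x + y) = M x + M y" and scale: "M (c *\<^sub>C x) = c *\<^sub>C M x" for x y c
    by (simp_all add: M_def cinner_add_left cinner_scale_left scaleC_add_left sum.distrib cvs.scale_sum_right scaleC_scaleC)
  have sumM: "M (sum g I) = (\<Sum>i\<in>I. M (g i))" for g :: "nat \<Rightarrow> ell2" and I
    by (induction I rule: infinite_finite_induct) (simp_all add: add, simp_all add: M_def)
  have vr: "cinner (v j) (r i) = (\<Sum>l<n. A i l * P l j)" for i j
    by (simp add: r_def cinner_sum_right cinner_scale_right cv)
  have Mv: "M (v j) = (\<Sum>l<n. B l j *\<^sub>C v l)" if "j < n" for j
  proof -
    have "M (v j) = (\<Sum>i<n. (\<Sum>l<n. P i l * B l j) *\<^sub>C ell2_unit i)"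
      unfolding M_def vr using AP that by (intro sum.cong) auto
    also have "\<dots> = (\<Sum>l<n. \<Sum>i<n. (B l j * P i l) *\<^sub>C ell2_unit i)"
      by (simp add: cvs.scale_sum_left mult.commute) (rule sum.swap)
    finally show ?thesis by (simp add: v_def cvs.scale_sum_right scaleC_scaleC)
  qed
  have S_mono: "i \<le> j \<Longrightarrow> S i \<subseteq> S j" for i j unfolding S_def by (intro cvs.span_mono) auto
  have vS: "i < j \<Longrightarrow> v i \<in> S j" for i j unfolding S_def by (intro cvs.span_base) auto
  have Mv': "M (v j) - B j j *\<^sub>C v j \<in> S j" if j: "j < n" for j
  proof -
    have "M (v j) = B j j *\<^sub>C v j + (\<Sum>l\<in>{..<n} - {j}. B l j *\<^sub>C v l)"
      unfolding Mv[OF j] using j by (intro sum.remove) auto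
    moreover have "(\<Sum>l\<in>{..<n} - {j}. B l j *\<^sub>C v l) \<in> S j"
      unfolding S_def
    proof (rule cvs.span_sum)
      fix l assume l: "l \<in> {..<n} - {j}"
      show "B l j *\<^sub>C v l \<in> cvs.span (v ` {..<j})"
      proof (cases "j < l")
        case True
        then show ?thesis using B[of l j] l by (simp add: cvs.span_zero)
      next
        case False
        then have "v l \<in> v ` {..<j}" using l by auto
        then show ?thesis by (intro cvs.span_scale cvs.span_base)
      qed
    qed
    ultimately show ?thesis by simp
  qed
  have MS: "x \<in> S j \<Longrightarrow> M x \<in> S j" if "j \<le> n" for x j
    unfolding S_def
  proof (induction rule: cvs.span_induct_alt)
    case base
    then show ?case using scale[of 0 0] by (simp add: cvs.span_zero)
  next
    case (step c x y)
    then obtain i where i: "x = v i" "i < j" by auto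
    have "M (v i) - B i i *\<^sub>C v i \<in> S j" using Mv'[of i] S_mono[of i j] i that by auto
    moreover have "B i i *\<^sub>C v i \<in> S j" using vS[OF i(2)] unfolding S_def by (rule cvs.span_scale)
    ultimately have "(M (v i) - B i i *\<^sub>C v i) + B i i *\<^sub>C v i \<in> S j"
      unfolding S_def by (rule cvs.span_add)
    then have "M x \<in> cvs.span (v ` {..<j})" by (simp add: i S_def)
    then show ?case using step unfolding add scale by (intro cvs.span_add cvs.span_scale)
  qed
  have proj: "v j = projection e j (v j) + complex_of_real (norm (v j - projection e j (v j))) *\<^sub>C e j" for j
    unfolding e_def by (rule orthonormalize_span)
  have eS: "e j \<in> S (Suc j)" for j
  proof (induction j rule: less_induct)
    case (less j)
    have "projection e j (v j) \<in> S (Suc j)"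
      unfolding projection_def S_def
    proof (rule cvs.span_sum)
      fix i assume "i \<in> {..<j}"
      then have "e i \<in> S (Suc j)" using less[of i] S_mono[of "Suc i" "Suc j"] by auto
      then show "cinner (v j) (e i) *\<^sub>C e i \<in> cvs.span (v ` {..<Suc j})" unfolding S_def by (rule cvs.span_scale)
    qed
    then have "v j - projection e j (v j) \<in> S (Suc j)"
      using vS[of j "Suc j"] unfolding S_def by (intro cvs.span_diff) simp_all
    moreover have "e j = sgn (v j - projection e j (v j))" unfolding e_def by (rule orthonormalize_rec)
    ultimately show ?case unfolding S_def by (simp add: sgn_div_norm scaleR_scaleC cvs.span_scale)
  qed
  have pS: "projection e j x \<in> S j" for j x
    unfolding projection_def S_def
  proof (rule cvs.span_sum)
    fix i assume "i \<in> {..<j}"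
    then have "e i \<in> S j" using eS[of i] S_mono[of "Suc i" j] by auto
    then show "cinner x (e i) *\<^sub>C e i \<in> cvs.span (v ` {..<j})" unfolding S_def by (rule cvs.span_scale)
  qed
  have orth: "cinner x (e j) = 0" if "x \<in> S j" for x j
    using that unfolding S_def
  proof (induction rule: cvs.span_induct_alt)
    case (step c x y)
    then obtain i where i: "x = v i" "i < j" by auto
    have "cinner (e j) (v i) = 0"
      unfolding e_def by (rule orthogonal_orthonormalize[of j]) (use e i in \<open>auto simp: e_def orthosystem_def\<close>)
    then have "cinner (v i) (e j) = 0" by (subst cinner_commute) simp
    then show ?case using step by (simp add: i cinner_add_left cinner_scale_left)
  qed simp
  \<comment> \<open>The row \<open>j\<close> of the inverse matrix is a functional separating \<open>v j\<close> from the earlier columns.\<close>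
  define w where "w j = v j - projection e j (v j)" for j
  have w0: "w j \<noteq> 0" if j: "j < n" for j
  proof
    assume "w j = 0"
    then have vj: "v j \<in> S j" using pS[of j "v j"] by (simp add: w_def)
    define \<phi> where "\<phi> x = (\<Sum>i<n. Q j i * coord x i)" for x
    have \<phi>v: "\<phi> (v l) = (if l = j then 1 else 0)" if "l < n" for l
      using QP[OF j that] by (simp add: \<phi>_def cv)
    have "\<phi> x = 0" if "x \<in> S j" for x
      using that unfolding S_def
    proof (induction rule: cvs.span_induct_alt)
      case (step c x y)
      then obtain i where i: "x = v i" "i < j" by auto
      have "\<phi> (c *\<^sub>C x + y) = c * \<phi> x + \<phi> y"
        by (simp add: \<phi>_def algebra_simps sum.distrib sum_distrib_left)
      then show ?case using step i j by (simp add: \<phi>v)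
    qed (simp add: \<phi>_def)
    then show False using \<phi>v[OF j] vj by simp
  qed
  have diag: "cinner (M (e j)) (e j) = B j j" if j: "j < n" for j
  proof -
    let ?c = "complex_of_real (norm (w j))"
    have vj: "v j = projection e j (v j) + ?c *\<^sub>C e j" using proj[of j] by (simp add: w_def)
    have ej: "e j = sgn (w j)" unfolding e_def w_def by (rule orthonormalize_rec)
    have ee: "cinner (e j) (e j) = 1" using w0[OF j] by (simp add: cinner_self_norm ej norm_sgn)
    have "M (v j) = M (projection e j (v j)) + ?c *\<^sub>C M (e j)" by (subst vj) (simp add: add scale)
    then have "cinner (M (v j)) (e j) = ?c * cinner (M (e j)) (e j)"
      using orth[OF MS[OF _ pS]] j by (simp add: cinner_add_left cinner_scale_left)
    moreover have "cinner (M (v j)) (e j) = B j j * cinner (v j) (e j)"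
      using orth[OF Mv'[OF j]] by (simp add: cinner_diff_left cinner_scale_left)
    moreover have "cinner (v j) (e j) = ?c"
      by (subst vj) (simp add: cinner_add_left cinner_scale_left ee orth[OF pS])
    ultimately have eq: "?c * cinner (M (e j)) (e j) = ?c * B j j"
      by (simp only: mult.commute[of "B j j"])
    have "?c \<noteq> 0" using w0[OF j] by simp
    then show ?thesis using eq unfolding mult_cancel_left by blast
  qed
  have "(\<Sum>j<n. (cmod (B j j))\<^sup>2) \<le> (\<Sum>j<n. \<Sum>i<n. (cmod (cinner (r i) (e j)))\<^sup>2)"
  proof (rule sum_mono)
    fix j assume "j \<in> {..<n}"
    then have "cmod (B j j) \<le> norm (M (e j)) * norm (e j)" using diag cmod_cinner_le by (metis lessThan_iff)
    also have "\<dots> \<le> norm (M (e j)) * 1" using orthosystem_norm_le[OF e] by (intro mult_left_mono) auto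
    finally have "(cmod (B j j))\<^sup>2 \<le> (norm (M (e j)))\<^sup>2" by (simp add: power_mono)
    also have "(norm (M (e j)))\<^sup>2 = (\<Sum>i<n. (cmod (cinner (r i) (e j)))\<^sup>2)"
    proof -
      have c: "coord (M (e j)) i = (if i < n then cinner (e j) (r i) else 0)" for i
        by (simp add: M_def coord_sum if_distrib[of "\<lambda>u. _ * u"] cong: if_cong)
      have "(norm (M (e j)))\<^sup>2 = (\<Sum>i<n. (cmod (if i < n then cinner (e j) (r i) else 0))\<^sup>2)"
        unfolding norm_ell2_sq c by (rule suminf_finite) auto
      also have "\<dots> = (\<Sum>i<n. (cmod (cinner (r i) (e j)))\<^sup>2)"
      proof (rule sum.cong)
        fix i assume "i \<in> {..<n}"
        then show "(cmod (if i < n then cinner (e j) (r i) else 0))\<^sup>2 = (cmod (cinner (r i) (e j)))\<^sup>2"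
          by (subst (2) cinner_commute) simp
      qed simp
      finally show ?thesis .
    qed
    finally show "(cmod (B j j))\<^sup>2 \<le> (\<Sum>i<n. (cmod (cinner (r i) (e j)))\<^sup>2)" .
  qed
  also have "\<dots> = (\<Sum>i<n. \<Sum>j<n. (cmod (cinner (r i) (e j)))\<^sup>2)" by (rule sum.swap)
  also have "\<dots> \<le> (\<Sum>i<n. (norm (r i))\<^sup>2)" by (intro sum_mono bessel[OF e])
  also have "\<dots> = (\<Sum>i<n. \<Sum>j<n. (cmod (A i j))\<^sup>2)"
  proof (rule sum.cong)
    fix i
    have "(norm (r i))\<^sup>2 = (\<Sum>j<n. (cmod (if j < n then cnj (A i j) else 0))\<^sup>2)"
      unfolding norm_ell2_sq cr by (rule suminf_finite) auto
    then show "(norm (r i))\<^sup>2 = (\<Sum>j<n. (cmod (A i j))\<^sup>2)" by simp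
  qed simp
  finally show ?thesis .
qed

text \<open>The family \<open>\<mu>\<close> lists the eigenvalues with multiplicity, as the diagonal of a triangular form.\<close>

theorem eigenvalues_of_finite_matrix:
  fixes A :: "nat \<Rightarrow> nat \<Rightarrow> complex"
  obtains \<mu> where "\<And>k. (\<Sum>i<n. matpow n A k i i) = (\<Sum>i<n. \<mu> i ^ k)"
    "(\<Sum>i<n. (cmod (\<mu> i))\<^sup>2) \<le> (\<Sum>i<n. \<Sum>j<n. (cmod (A i j))\<^sup>2)"
proof (rule triangularization[of n A])
  fix P Q B :: "nat \<Rightarrow> nat \<Rightarrow> complex"
  assume t: "\<And>i j. i < n \<Longrightarrow> j < n \<Longrightarrow> (\<Sum>l<n. A i l * P l j) = (\<Sum>l<n. P i l * B l j)"
    "\<And>i j. i < n \<Longrightarrow> j < i \<Longrightarrow> B i j = 0"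
    "\<And>i j. i < n \<Longrightarrow> j < n \<Longrightarrow> (\<Sum>l<n. P i l * Q l j) = (if i = j then 1 else 0)"
    "\<And>i j. i < n \<Longrightarrow> j < n \<Longrightarrow> (\<Sum>l<n. Q i l * P l j) = (if i = j then 1 else 0)"
  show thesis
    by (rule that[of "\<lambda>i. B i i"]) (rule trace_matpow[OF t], assumption+, rule schur_inequality[OF t(1,2,4)])
qed

section \<open>Limits of power sums\<close>

text \<open>If \<open>j + 1\<close> numbers have at least the modulus of \<open>\<nu>\<^sub>j\<close>, then \<open>(j + 1) |\<nu>\<^sub>j|\<^sup>2 \<le> C\<close>.\<close>

lemma sorted_by_modulus:
  fixes \<mu> :: "nat \<Rightarrow> complex"
  assumes "(\<Sum>i<n. (cmod (\<mu> i))\<^sup>2) \<le> C"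
  obtains \<nu> where "\<And>j. cmod (\<nu> j) \<le> sqrt (C / real (Suc j))" "\<And>j. j \<ge> n \<Longrightarrow> \<nu> j = 0"
    "\<And>k. (\<Sum>i<n. \<mu> i ^ k) = (\<Sum>i<n. \<nu> i ^ k)"
proof -
  define xs where "xs = sort_key (\<lambda>z. - cmod z) (map \<mu> [0..<n])"
  have len: "length xs = n" by (simp add: xs_def)
  have sum: "(\<Sum>i<n. g (xs ! i)) = (\<Sum>i<n. g (\<mu> i))" for g :: "complex \<Rightarrow> 'b::comm_monoid_add"
  proof -
    have "(\<Sum>i<n. g (xs ! i)) = sum_list (map g xs)"
      by (simp add: sum_list_sum_nth len atLeast0LessThan)
    also have "\<dots> = sum_list (map g (map \<mu> [0..<n]))"
    proof -
      have "mset xs = mset (map \<mu> [0..<n])" by (simp add: xs_def)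
      then have "mset (map g xs) = mset (map g (map \<mu> [0..<n]))" unfolding mset_map[of g] by (rule arg_cong)
      then show ?thesis by (simp only: sum_mset_sum_list[symmetric])
    qed
    also have "\<dots> = (\<Sum>i<n. g (\<mu> i))"
      by (simp add: comp_def interv_sum_list_conv_sum_set_nat atLeast0LessThan)
    finally show ?thesis .
  qed
  have dec: "cmod (xs ! j) \<le> cmod (xs ! i)" if "i \<le> j" "j < n" for i j
  proof -
    have "sorted (map (\<lambda>z. - cmod z) xs)" unfolding xs_def by (rule sorted_sort_key)
    from sorted_nth_mono[OF this that(1)] show ?thesis using that len by simp
  qed
  define \<nu> where "\<nu> j = (if j < n then xs ! j else 0)" for j
  have C0: "C \<ge> 0" using assms by (rule order_trans[rotated]) (simp add: sum_nonneg)
  show ?thesis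
  proof
    show "cmod (\<nu> j) \<le> sqrt (C / real (Suc j))" for j
    proof (cases "j < n")
      case True
      have "real (Suc j) * (cmod (xs ! j))\<^sup>2 = (\<Sum>i<Suc j. (cmod (xs ! j))\<^sup>2)" by simp
      also have "\<dots> \<le> (\<Sum>i<Suc j. (cmod (xs ! i))\<^sup>2)"
        using True by (intro sum_mono power_mono dec) auto
      also have "\<dots> \<le> (\<Sum>i<n. (cmod (xs ! i))\<^sup>2)" using True by (intro sum_mono2) auto
      also have "\<dots> \<le> C" using assms by (simp add: sum[of "\<lambda>z. (cmod z)\<^sup>2"])
      finally have "(cmod (\<nu> j))\<^sup>2 \<le> C / real (Suc j)" using True by (simp add: \<nu>_def field_simps)
      then show ?thesis by (simp add: real_le_rsqrt)
    qed (use C0 in \<open>simp add: \<nu>_def\<close>)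
    show "j \<ge> n \<Longrightarrow> \<nu> j = 0" for j by (simp add: \<nu>_def)
    show "(\<Sum>i<n. \<mu> i ^ k) = (\<Sum>i<n. \<nu> i ^ k)" for k
      using sum[of "\<lambda>z. z ^ k"] by (simp add: \<nu>_def)
  qed
qed

lemma summable_sqrt_power:
  assumes "C \<ge> 0" "k \<ge> 3"
  shows "summable (\<lambda>j. sqrt (C / real (Suc j)) ^ k)"
proof (rule summable_comparison_test')
  have "summable (\<lambda>n. real (Suc n) powr (-3/2))"
    by (subst summable_Suc_iff) (simp add: summable_real_powr_iff)
  then show "summable (\<lambda>j. sqrt C ^ k * real (Suc j) powr (-3/2))" by (rule summable_mult)
  show "norm (sqrt (C / real (Suc j)) ^ k) \<le> sqrt C ^ k * real (Suc j) powr (-3/2)" for j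
  proof -
    have "(1 / sqrt (real (Suc j))) ^ k \<le> (1 / sqrt (real (Suc j))) ^ 3"
      using assms(2) by (intro power_decreasing) auto
    also have "\<dots> = real (Suc j) powr (-3/2)"
    proof -
      have "(1 / sqrt (real (Suc j))) = real (Suc j) powr (-1/2)"
        by (simp add: powr_half_sqrt[symmetric] powr_minus_divide)
      moreover have "(real (Suc j) powr (-1/2)) ^ 3 = real (Suc j) powr (-3/2)"
        by (simp add: powr_power)
      ultimately show ?thesis by simp
    qed
    finally have "sqrt C ^ k * (1 / sqrt (real (Suc j))) ^ k \<le> sqrt C ^ k * real (Suc j) powr (-3/2)"
      using assms(1) by (intro mult_left_mono) auto
    then show ?thesis using assms(1) by (simp add: real_sqrt_divide power_divide)
  qed
qed

text \<open>A uniform bound on the sums of squares makes the tails of the sums of higher powers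
  uniformly small, so the limits of the power sums are again power sums.\<close>

theorem limit_of_power_sums:
  fixes \<mu> :: "nat \<Rightarrow> nat \<Rightarrow> complex" and n :: "nat \<Rightarrow> nat"
  assumes C: "\<And>N. (\<Sum>i<n N. (cmod (\<mu> N i))\<^sup>2) \<le> C"
    and K: "\<And>k. k \<in> K \<Longrightarrow> k \<ge> 3" and lim: "\<And>k. k \<in> K \<Longrightarrow> (\<lambda>N. \<Sum>i<n N. \<mu> N i ^ k) \<longlonglongrightarrow> t k"
  obtains \<nu> where "\<And>j. cmod (\<nu> j) \<le> sqrt (C / real (Suc j))" "\<And>k. k \<in> K \<Longrightarrow> (\<Sum>j. \<nu> j ^ k) = t k"
proof -
  have C0: "C \<ge> 0" using C[of 0] by (rule order_trans[rotated]) (simp add: sum_nonneg)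
  have "\<exists>\<nu>. (\<forall>j. cmod (\<nu> j) \<le> sqrt (C / real (Suc j))) \<and> (\<forall>j\<ge>n N. \<nu> j = 0) \<and> (\<forall>k. (\<Sum>i<n N. \<mu> N i ^ k) = (\<Sum>i<n N. \<nu> i ^ k))" for N
    by (rule sorted_by_modulus[OF C[of N]]) blast
  then obtain \<xi> where \<xi>: "\<And>N j. cmod (\<xi> N j) \<le> sqrt (C / real (Suc j))" "\<And>N j. j \<ge> n N \<Longrightarrow> \<xi> N j = 0"
    "\<And>N k. (\<Sum>i<n N. \<mu> N i ^ k) = (\<Sum>i<n N. \<xi> N i ^ k)" by metis
  interpret subseqs "\<lambda>j s. convergent (\<lambda>N. \<xi> (s N) j)"
  proof
    fix j and s :: "nat \<Rightarrow> nat" assume "strict_mono s"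
    have "\<forall>N. \<xi> (s N) j \<in> cball 0 (sqrt (C / real (Suc j)))" using \<xi>(1) by simp
    then obtain l r where "strict_mono r" "((\<lambda>N. \<xi> (s N) j) \<circ> r) \<longlonglongrightarrow> l"
      using seq_compactE[OF compact_imp_seq_compact[OF compact_cball]] by metis
    then show "\<exists>r. strict_mono r \<and> convergent (\<lambda>N. \<xi> ((s \<circ> r) N) j)"
      by (auto simp: comp_def intro: convergentI)
  qed
  have "convergent (\<lambda>N. \<xi> ((diagseq \<circ> ((+) (Suc j))) N) j)" for j
    by (rule diagseq_holds[of j]) (auto dest: convergent_subseq_convergent simp: comp_def)
  then have "convergent (\<lambda>N. \<xi> (diagseq (N + Suc j)) j)" for j by (simp add: add.commute[of _ j])
  then have conv: "convergent (\<lambda>N. \<xi> (diagseq N) j)" for j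
    using convergent_ignore_initial_segment[of "\<lambda>N. \<xi> (diagseq N) j"] by blast
  define \<nu> where "\<nu> j = lim (\<lambda>N. \<xi> (diagseq N) j)" for j
  have \<nu>: "(\<lambda>N. \<xi> (diagseq N) j) \<longlonglongrightarrow> \<nu> j" for j
    using conv[of j] by (simp add: \<nu>_def convergent_LIMSEQ_iff)
  show ?thesis
  proof
    show "cmod (\<nu> j) \<le> sqrt (C / real (Suc j))" for j
      by (rule Lim_bounded[OF tendsto_norm[OF \<nu>]]) (use \<xi>(1) in auto)
    show "(\<Sum>j. \<nu> j ^ k) = t k" if k: "k \<in> K" for k
    proof -
      have "(\<lambda>N. \<Sum>j. \<xi> (diagseq N) j ^ k) \<longlonglongrightarrow> (\<Sum>j. \<nu> j ^ k)"
      proof -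
        have "(\<lambda>N. \<xi> (diagseq N) j ^ k) \<longlonglongrightarrow> \<nu> j ^ k" for j by (intro tendsto_intros \<nu>)
        moreover have "\<forall>\<^sub>F (j, N) in sequentially \<times>\<^sub>F sequentially. norm (\<xi> (diagseq N) j ^ k) \<le> sqrt (C / real (Suc j)) ^ k"
          by (intro always_eventually) (auto simp: norm_power intro!: power_mono \<xi>(1)[simplified])
        ultimately show ?thesis
          using tannerys_theorem[of "\<lambda>j N. \<xi> (diagseq N) j ^ k" "\<lambda>j. \<nu> j ^ k" sequentially "\<lambda>j. sqrt (C / real (Suc j)) ^ k"]
            summable_sqrt_power[OF C0 K[OF k]] by simp
      qed
      moreover have "(\<Sum>j. \<xi> N j ^ k) = (\<Sum>i<n N. \<mu> N i ^ k)" for N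
        unfolding \<xi>(3) by (rule suminf_finite) (use \<xi>(2) K[OF k] in \<open>auto simp: not_less\<close>)
      ultimately have "(\<lambda>N. \<Sum>i<n (diagseq N). \<mu> (diagseq N) i ^ k) \<longlonglongrightarrow> (\<Sum>j. \<nu> j ^ k)" by simp
      moreover have "(\<lambda>N. \<Sum>i<n (diagseq N). \<mu> (diagseq N) i ^ k) \<longlonglongrightarrow> t k"
        using LIMSEQ_subseq_LIMSEQ[OF lim[OF k] subseq_diagseq] by (simp add: comp_def)
      ultimately show ?thesis by (rule LIMSEQ_unique)
    qed
  qed
qed

text \<open>Exponentials with distinct bases of modulus larger than \<open>r\<close> are independent modulo \<open>O(r\<^sup>k)\<close>.
  The polynomial \<open>p\<close> below annihilates all bases except \<open>\<gamma>\<close>.\<close>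

lemma exponential_sum_coefficients_zero:
  fixes c :: "complex \<Rightarrow> complex"
  assumes S: "finite S" "\<And>\<beta>. \<beta> \<in> S \<Longrightarrow> cmod \<beta> > r" and r: "r > 0"
    and bound: "\<And>k. k \<ge> k0 \<Longrightarrow> cmod (\<Sum>\<beta>\<in>S. c \<beta> * \<beta> ^ k) \<le> K * r ^ k"
    and \<gamma>: "\<gamma> \<in> S"
  shows "c \<gamma> = 0"
proof -
  define p where "p = (\<Prod>\<beta>\<in>S - {\<gamma>}. [:- \<beta>, 1:])"
  have p0: "poly p \<beta> = 0" if "\<beta> \<in> S - {\<gamma>}" for \<beta>
    using that S(1) by (auto simp: p_def poly_prod)
  have pg: "poly p \<gamma> \<noteq> 0" using S(1) by (auto simp: p_def poly_prod)
  have eq: "(\<Sum>i\<le>degree p. coeff p i * (\<Sum>\<beta>\<in>S. c \<beta> * \<beta> ^ (k + i))) = c \<gamma> * poly p \<gamma> * \<gamma> ^ k" for k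
  proof -
    have "(\<Sum>i\<le>degree p. coeff p i * (\<Sum>\<beta>\<in>S. c \<beta> * \<beta> ^ (k + i))) = (\<Sum>\<beta>\<in>S. \<Sum>i\<le>degree p. coeff p i * (c \<beta> * \<beta> ^ (k + i)))"
      by (simp add: sum_distrib_left) (rule sum.swap)
    also have "\<dots> = (\<Sum>\<beta>\<in>S. c \<beta> * poly p \<beta> * \<beta> ^ k)"
      by (intro sum.cong refl) (simp add: poly_altdef sum_distrib_left sum_distrib_right power_add mult_ac)
    also have "\<dots> = (\<Sum>\<beta>\<in>{\<gamma>}. c \<beta> * poly p \<beta> * \<beta> ^ k)"
      by (rule sum.mono_neutral_right) (use S(1) \<gamma> p0 in auto)
    finally show ?thesis by simp
  qed
  define D where "D = (\<Sum>i\<le>degree p. cmod (coeff p i) * (\<bar>K\<bar> * r ^ i))"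
  have le: "cmod (c \<gamma> * poly p \<gamma>) \<le> D * (r / cmod \<gamma>) ^ k" if k: "k \<ge> k0" for k
  proof -
    have \<gamma>0: "cmod \<gamma> > 0" using S(2)[OF \<gamma>] r by linarith
    have "cmod (c \<gamma> * poly p \<gamma>) * cmod \<gamma> ^ k = cmod (\<Sum>i\<le>degree p. coeff p i * (\<Sum>\<beta>\<in>S. c \<beta> * \<beta> ^ (k + i)))"
      unfolding eq by (simp add: norm_mult norm_power)
    also have "\<dots> \<le> (\<Sum>i\<le>degree p. cmod (coeff p i) * (\<bar>K\<bar> * r ^ (k + i)))"
    proof (rule order_trans[OF norm_sum], rule sum_mono)
      fix i
      have "cmod (\<Sum>\<beta>\<in>S. c \<beta> * \<beta> ^ (k + i)) \<le> \<bar>K\<bar> * r ^ (k + i)"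
        using bound[of "k + i"] k r by (rule_tac order_trans) (auto intro!: mult_right_mono)
      then show "norm (coeff p i * (\<Sum>\<beta>\<in>S. c \<beta> * \<beta> ^ (k + i))) \<le> cmod (coeff p i) * (\<bar>K\<bar> * r ^ (k + i))"
        by (simp add: norm_mult mult_left_mono)
    qed
    also have "\<dots> = D * r ^ k" by (simp add: D_def sum_distrib_left sum_distrib_right power_add mult_ac)
    finally show ?thesis using \<gamma>0 by (simp add: power_divide field_simps)
  qed
  have "r / cmod \<gamma> < 1" using S(2)[OF \<gamma>] r by (subst divide_less_eq_1_pos) linarith+
  then have "(\<lambda>k. D * (r / cmod \<gamma>) ^ k) \<longlonglongrightarrow> D * 0"
    using r by (intro tendsto_mult tendsto_const LIMSEQ_power_zero) simp
  then have "cmod (c \<gamma> * poly p \<gamma>) \<le> D * 0"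
    by (rule tendsto_lowerbound) (use le in \<open>auto simp: eventually_sequentially\<close>)
  then show ?thesis using pg by simp
qed

section \<open>Power sums of a nuclear operator\<close>

text \<open>Compared with a nuclear representation, the index runs through all natural numbers and the
  coefficients may vanish.\<close>

locale nuclear_series =
  fixes A :: "'a::complex_banach \<Rightarrow> 'a" and a :: "nat \<Rightarrow> real" and f :: "nat \<Rightarrow> 'a \<Rightarrow> complex" and y :: "nat \<Rightarrow> 'a"
  assumes a_nonneg: "\<And>k. 0 \<le> a k" and summable_a: "summable a"
    and bcf: "\<And>k. bounded_clinear (f k)" and f_le: "\<And>k x. cmod (f k x) \<le> norm x"
    and y_le: "\<And>k. norm (y k) \<le> 1"
    and A_sums: "\<And>x. (\<lambda>k. (of_real (a k) * f k x) *\<^sub>C y k) sums A x"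
begin

text \<open>The trace of the product \<open>A B\<close>, computed from the given series for \<open>A\<close>. At \<open>B = id\<close> it is the
  trace of the series. For powers of \<open>T\<close> and \<open>A = T\<^sup>q\<close>, the trace of \<open>T\<^sup>n\<close> is \<open>tr (T\<^bsup>n - q\<^esup>)\<close>,
  and in this form it is continuous in the second factor with respect to the operator norm.\<close>

definition tr :: "('a \<Rightarrow> 'a) \<Rightarrow> complex"
  where "tr B = (\<Sum>k. of_real (a k) * f k (B (y k)))"

lemma norm_term_le: "norm ((of_real (a k) * f k x) *\<^sub>C y k) \<le> a k * norm x"
proof -
  have "norm ((of_real (a k) * f k x) *\<^sub>C y k) = a k * cmod (f k x) * norm (y k)"
    using a_nonneg by (simp add: norm_scaleC norm_mult)
  also have "\<dots> \<le> a k * norm x * 1"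
    using a_nonneg f_le y_le by (intro mult_mono mult_left_mono mult_nonneg_nonneg) auto
  finally show ?thesis by simp
qed

lemma norm_tail_le: "norm (A x - (\<Sum>k<N. (of_real (a k) * f k x) *\<^sub>C y k)) \<le> (\<Sum>k. a (k + N)) * norm x"
proof -
  let ?t = "\<lambda>k. (of_real (a k) * f k x) *\<^sub>C y k"
  have s: "summable (\<lambda>k. a (k + N) * norm x)"
    using summable_a by (intro summable_mult2) (simp add: summable_iff_shift)
  have "A x - (\<Sum>k<N. ?t k) = (\<Sum>k. ?t (k + N))"
    using suminf_minus_initial_segment[OF sums_summable[OF A_sums[of x]], of N] sums_unique[OF A_sums[of x]] by simp
  also have "norm \<dots> \<le> (\<Sum>k. a (k + N) * norm x)"
    by (rule norm_suminf_le[OF norm_term_le s])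
  also have "\<dots> = (\<Sum>k. a (k + N)) * norm x"
    using summable_a by (intro suminf_mult2[symmetric]) (simp add: summable_iff_shift)
  finally show ?thesis .
qed

lemma bounded_clinear_term: "bounded_clinear (\<lambda>x. (of_real (a k) * f k x) *\<^sub>C y k)"
proof (rule bounded_clinearI)
  show "norm ((of_real (a k) * f k x) *\<^sub>C y k) \<le> a k * norm x" for x by (rule norm_term_le)
qed (auto simp: bounded_clinear_add[OF bcf] bounded_clinear_scaleC[OF bcf] scaleC_complex_def
    distrib_left scaleC_add_left scaleC_scaleC mult_ac)

lemma bcA: "bounded_clinear A"
proof (rule bounded_clinearI)
  show "norm (A x) \<le> (\<Sum>k. a k) * norm x" for x using norm_tail_le[of x 0] by simp
  show "A (x + z) = A x + A z" for x z
    by (rule sums_unique2[OF A_sums])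
      (use sums_add[OF A_sums A_sums] in \<open>simp add: bounded_clinear_add[OF bcf] distrib_left scaleC_add_left\<close>)
  show "A (c *\<^sub>C x) = c *\<^sub>C A x" for c x
    by (rule sums_unique2[OF A_sums])
      (use bounded_linear.sums[OF bounded_linear_scaleC A_sums] in \<open>simp add: bounded_clinear_scaleC[OF bcf] scaleC_complex_def scaleC_scaleC mult_ac\<close>)
qed

lemma norm_trace_term_le:
  assumes "\<And>x. norm (B x) \<le> K * norm x" "K \<ge> 0"
  shows "norm (of_real (a k) * f k (B (y k))) \<le> a k * K"
proof -
  have "cmod (f k (B (y k))) \<le> norm (B (y k))" by (rule f_le)
  also have "\<dots> \<le> K * norm (y k)" by (rule assms)
  also have "\<dots> \<le> K * 1" using y_le assms(2) by (intro mult_left_mono) auto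
  finally show ?thesis using a_nonneg by (simp add: norm_mult mult_left_mono)
qed

lemma summable_trace:
  assumes "bounded_clinear B"
  shows "summable (\<lambda>k. of_real (a k) * f k (B (y k)))"
proof -
  obtain K where K: "K > 0" "\<And>x. norm (B x) \<le> K * norm x" using bounded_clinear_bound[OF assms] by blast
  show ?thesis
    by (rule summable_comparison_test'[OF summable_mult2[OF summable_a, of K]])
      (rule norm_trace_term_le, use K in auto)
qed

lemma norm_tr_le:
  assumes "\<And>x. norm (B x) \<le> K * norm x" "K \<ge> 0"
  shows "cmod (tr B) \<le> (\<Sum>k. a k) * K"
  unfolding tr_def suminf_mult2[OF summable_a]
  by (rule norm_suminf_le[OF norm_trace_term_le[OF assms] summable_mult2[OF summable_a]])

lemma tr_add:
  assumes "bounded_clinear B" "bounded_clinear C"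
  shows "tr (\<lambda>x. B x + C x) = tr B + tr C"
  unfolding tr_def suminf_add[OF summable_trace[OF assms(1)] summable_trace[OF assms(2)]]
  by (rule suminf_cong) (simp add: bounded_clinear_add[OF bcf] distrib_left)

text \<open>When \<open>B x = \<phi> x \<cdot> z\<close>, the sum over the series for \<open>A\<close> collapses by continuity of \<open>\<phi>\<close>. On
  finite-rank operators \<open>B\<close> the number \<open>tr B\<close> is therefore the usual trace of \<open>A B\<close>, and does not depend
  on the series.\<close>

lemma tr_rank_one:
  assumes "bounded_clinear (\<phi> :: 'a \<Rightarrow> complex)"
  shows "tr (\<lambda>x. \<phi> x *\<^sub>C z) = \<phi> (A z)"
proof -
  have "(\<lambda>k. \<phi> ((of_real (a k) * f k z) *\<^sub>C y k)) sums \<phi> (A z)"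
    by (rule bounded_linear.sums[OF bounded_clinear_imp_bounded_linear[OF assms] A_sums])
  then have "(\<lambda>k. of_real (a k) * f k (\<phi> (y k) *\<^sub>C z)) sums \<phi> (A z)"
    by (simp add: bounded_clinear_scaleC[OF bcf] bounded_clinear_scaleC[OF assms] scaleC_complex_def mult_ac)
  then show ?thesis unfolding tr_def by (rule sums_unique[symmetric])
qed

definition trunc :: "nat \<Rightarrow> 'a \<Rightarrow>\<^sub>L 'a"
  where "trunc N = Blinfun (\<lambda>x. \<Sum>k<N. (of_real (a k) * f k x) *\<^sub>C y k)"

lemma trunc_apply: "blinfun_apply (trunc N) x = (\<Sum>k<N. (of_real (a k) * f k x) *\<^sub>C y k)"
  unfolding trunc_def
  by (subst bounded_linear_Blinfun_apply)
    (rule bounded_clinear_imp_bounded_linear[OF bounded_clinear_sum_fun[OF bounded_clinear_term]], rule refl)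

lemma A_apply: "blinfun_apply (Blinfun A) = A"
  by (simp add: bounded_linear_Blinfun_apply bounded_clinear_imp_bounded_linear bcA)

lemma trunc_tendsto: "trunc \<longlonglongrightarrow> Blinfun A"
proof -
  have "norm (trunc N - Blinfun A) \<le> (\<Sum>k. a (k + N))" for N
  proof (rule norm_blinfun_bound)
    show "0 \<le> (\<Sum>k. a (k + N))"
      using summable_a a_nonneg by (intro suminf_nonneg) (simp_all add: summable_iff_shift)
    show "norm ((trunc N - Blinfun A) x) \<le> (\<Sum>k. a (k + N)) * norm x" for x
      using norm_tail_le[of x N] by (simp add: minus_blinfun.rep_eq trunc_apply A_apply norm_minus_commute)
  qed
  then have "(\<lambda>N. trunc N - Blinfun A) \<longlonglongrightarrow> 0"
    by (intro Lim_null_comparison[OF _ suminf_exist_split2[OF summable_a]] always_eventually allI)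
  then show ?thesis by (rule LIM_zero_cancel)
qed

lemma truncated_trace_tendsto:
  assumes "Z \<longlonglongrightarrow> Z0"
  shows "(\<lambda>N. \<Sum>i<N. of_real (a i) * f i (blinfun_apply (Z N) (y i))) \<longlonglongrightarrow> tr (blinfun_apply Z0)"
proof -
  have bound: "norm (of_real (a i) * f i (blinfun_apply W (y i))) \<le> a i * norm W" for i and W :: "'a \<Rightarrow>\<^sub>L 'a"
    by (rule norm_trace_term_le) (auto simp: norm_blinfun)
  have s: "summable (\<lambda>i. of_real (a i) * f i (blinfun_apply W (y i)))" for W :: "'a \<Rightarrow>\<^sub>L 'a"
    by (rule summable_comparison_test'[OF summable_mult2[OF summable_a, of "norm W"]]) (rule bound)
  have "(\<lambda>N. \<Sum>i<N. of_real (a i) * f i (blinfun_apply (Z N - Z0) (y i))) \<longlonglongrightarrow> 0"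
  proof (rule Lim_null_comparison)
    show "eventually (\<lambda>N. norm (\<Sum>i<N. of_real (a i) * f i (blinfun_apply (Z N - Z0) (y i))) \<le> (\<Sum>i. a i) * norm (Z N - Z0)) sequentially"
    proof (intro always_eventually allI)
      fix N
      have "norm (\<Sum>i<N. of_real (a i) * f i (blinfun_apply (Z N - Z0) (y i))) \<le> (\<Sum>i<N. a i * norm (Z N - Z0))"
        by (rule order_trans[OF norm_sum]) (intro sum_mono bound)
      also have "\<dots> = (\<Sum>i<N. a i) * norm (Z N - Z0)" by (simp add: sum_distrib_right)
      also have "\<dots> \<le> (\<Sum>i. a i) * norm (Z N - Z0)"
        by (intro mult_right_mono sum_le_suminf[OF summable_a]) (auto simp: a_nonneg)
      finally show "norm (\<Sum>i<N. of_real (a i) * f i (blinfun_apply (Z N - Z0) (y i))) \<le> (\<Sum>i. a i) * norm (Z N - Z0)" .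
    qed
    have "(\<lambda>N. norm (Z N - Z0)) \<longlonglongrightarrow> 0" using LIM_zero[OF assms] by (rule tendsto_norm_zero)
    from tendsto_mult_right_zero[OF this] show "(\<lambda>N. (\<Sum>i. a i) * norm (Z N - Z0)) \<longlonglongrightarrow> 0" .
  qed
  moreover have "(\<lambda>N. \<Sum>i<N. of_real (a i) * f i (blinfun_apply Z0 (y i))) \<longlonglongrightarrow> tr (blinfun_apply Z0)"
    unfolding tr_def by (rule summable_LIMSEQ[OF s])
  ultimately have "(\<lambda>N. (\<Sum>i<N. of_real (a i) * f i (blinfun_apply (Z N - Z0) (y i))) + (\<Sum>i<N. of_real (a i) * f i (blinfun_apply Z0 (y i)))) \<longlonglongrightarrow> 0 + tr (blinfun_apply Z0)"
    by (rule tendsto_add)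
  then show ?thesis
    by (simp add: minus_blinfun.rep_eq bounded_clinear_diff[OF bcf] right_diff_distrib sum_subtractf)
qed

text \<open>The weights are distributed evenly over rows and columns, which makes the entries square
  summable.\<close>

definition kern :: "('a \<Rightarrow>\<^sub>L 'a) \<Rightarrow> nat \<Rightarrow> nat \<Rightarrow> complex"
  where "kern Z i j = of_real (sqrt (a i)) * f i (blinfun_apply Z (y j)) * of_real (sqrt (a j))"

lemma sqrt_a: "complex_of_real (sqrt (a i)) * complex_of_real (sqrt (a i)) = of_real (a i)"
  using a_nonneg by (simp add: of_real_mult[symmetric] del: of_real_mult)

lemma kern_mult:
  "(\<Sum>l<N. kern X i l * kern Z l j) = kern (X o\<^sub>L (trunc N o\<^sub>L Z)) i j"
  if "\<And>c x. blinfun_apply X (c *\<^sub>C x) = c *\<^sub>C blinfun_apply X x"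
proof -
  have eq: "kern X i l * kern Z l j = of_real (sqrt (a i)) * f i (X ((of_real (a l) * f l (Z (y j))) *\<^sub>C y l)) * of_real (sqrt (a j))" for l
    unfolding that by (simp add: kern_def bounded_clinear_scaleC[OF bcf] scaleC_complex_def sqrt_a[of l, symmetric])
  show ?thesis unfolding eq
    by (simp add: kern_def[of "X o\<^sub>L _"] trunc_apply blinfun.sum_right bounded_clinear_sum[OF bcf] sum_distrib_left sum_distrib_right)
qed

lemma cmod_kern_le:
  "(cmod (kern Z i j))\<^sup>2 \<le> (norm Z)\<^sup>2 * (a i * a j)"
proof -
  have "cmod (f i (Z (y j))) \<le> norm Z * norm (y j)" using f_le norm_blinfun order_trans by blast
  also have "\<dots> \<le> norm Z * 1" using y_le by (intro mult_left_mono) auto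
  finally have "(cmod (f i (Z (y j))))\<^sup>2 \<le> (norm Z)\<^sup>2" by (simp add: power_mono)
  then have "a i * (cmod (f i (Z (y j))))\<^sup>2 * a j \<le> a i * (norm Z)\<^sup>2 * a j"
    using a_nonneg by (intro mult_right_mono mult_left_mono) auto
  then show ?thesis using a_nonneg by (simp add: kern_def norm_mult power_mult_distrib mult_ac)
qed

text \<open>The alternating product \<open>B\<^sub>c X B\<^bsub>c+1\<^esub> X \<dots> X B\<^bsub>c+s\<^esub>\<close>.\<close>

primrec alternate :: "('a \<Rightarrow>\<^sub>L 'a) \<Rightarrow> (nat \<Rightarrow> 'a \<Rightarrow>\<^sub>L 'a) \<Rightarrow> nat \<Rightarrow> nat \<Rightarrow> 'a \<Rightarrow>\<^sub>L 'a" where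
  "alternate X B c 0 = B c"
| "alternate X B c (Suc s) = B c o\<^sub>L (X o\<^sub>L alternate X B (Suc c) s)"

lemma alternate_tendsto:
  "X \<longlonglongrightarrow> X0 \<Longrightarrow> (\<lambda>N::nat. alternate (X N) B c s) \<longlonglongrightarrow> alternate X0 B c s"
proof (induction s arbitrary: c)
  case (Suc s)
  then show ?case unfolding alternate.simps
    by (intro bounded_bilinear.tendsto[OF bounded_bilinear_blinfun_compose] tendsto_const) auto
qed simp

lemma alternate_mod:
  assumes B: "\<And>c c'. c mod 3 = c' mod (3::nat) \<Longrightarrow> B c = B c'"
  shows "c mod 3 = c' mod 3 \<Longrightarrow> alternate X B c s = alternate X B c' s"
proof (induction s arbitrary: c c')
  case 0
  then show ?case unfolding alternate.simps by (rule B)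
next
  case (Suc s)
  have "Suc c mod 3 = Suc c' mod 3" by (simp only: mod_Suc Suc.prems)
  from Suc.IH[OF this] B[OF Suc.prems] show ?case by (simp only: alternate.simps)
qed

end

lemma mod3_simps:
  "3 * i mod 3 = (0::nat)" "(3 * i + 1) mod 3 = (1::nat)" "(3 * i + 2) mod 3 = (2::nat)"
  "3 * i div 3 = (i::nat)" "(3 * i + 1) div 3 = i" "(3 * i + 2) div 3 = i"
  by presburger+

lemma sum_mod3: "(\<Sum>i<3 * N. h i) = (\<Sum>i<N. h (3 * i) + h (3 * i + 1) + h (3 * i + 2))"
  for h :: "nat \<Rightarrow> 'b::comm_monoid_add"
proof (induction N)
  case (Suc N)
  have "{..<3 * Suc N} = insert (3 * N + 2) (insert (3 * N + 1) (insert (3 * N) {..<3 * N}))" by auto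
  then show ?case using Suc by (simp add: ac_simps)
qed simp

context nuclear_series
begin

text \<open>A product \<open>B\<^sub>0 A B\<^sub>1 A B\<^sub>2 A\<close> of three factors is the diagonal part of the cube of a
  cyclic block matrix. The point is that the block matrix has bounded Frobenius norm, so Schur's
  inequality applies to it.\<close>

definition cyclic_block :: "(nat \<Rightarrow> 'a \<Rightarrow>\<^sub>L 'a) \<Rightarrow> nat \<Rightarrow> nat \<Rightarrow> complex"
  where "cyclic_block B i j = (if j mod 3 = Suc i mod 3 then kern (B i) (i div 3) (j div 3) else 0)"

lemma sum_residue_class:
  "(r::nat) < 3 \<Longrightarrow> (\<Sum>l<3 * N. if l mod 3 = r then g (l div 3) else (0::complex)) = (\<Sum>l<N. g l)"
proof -
  assume r: "r < 3"
  consider "r = 0" | "r = 1" | "r = 2" using r by linarith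
  then show ?thesis unfolding sum_mod3 mod3_simps by cases simp_all
qed

context
  fixes B :: "nat \<Rightarrow> 'a \<Rightarrow>\<^sub>L 'a"
  assumes B_mod: "\<And>c c'. c mod 3 = c' mod (3::nat) \<Longrightarrow> B c = B c'"
    and B_scale: "\<And>c k x. blinfun_apply (B c) (k *\<^sub>C x) = k *\<^sub>C blinfun_apply (B c) x"
begin

text \<open>Multiplying kernel matrices inserts the truncation of \<open>A\<close> between the operators, and each factor
  moves the residue class modulo 3 on by one.\<close>

lemma matpow_cyclic_block:
  "j < 3 * N \<Longrightarrow> matpow (3 * N) (cyclic_block B) (Suc s) i j =
    (if j mod 3 = (i + Suc s) mod 3 then kern (alternate (trunc N) B i s) (i div 3) (j div 3) else 0)"
proof (induction s arbitrary: i)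
  case 0
  then show ?case by (simp add: cyclic_block_def if_distrib[of "\<lambda>u. _ * u"] cong: if_cong)
next
  case (Suc s)
  let ?r = "Suc i mod 3"
  let ?Z = "alternate (trunc N) B (Suc i) s"
  let ?ok = "j mod 3 = (i + Suc (Suc s)) mod 3"
  have "matpow (3 * N) (cyclic_block B) (Suc (Suc s)) i j = (\<Sum>l<3 * N. cyclic_block B i l * matpow (3 * N) (cyclic_block B) (Suc s) l j)"
    by (rule matpow.simps(2)[THEN fun_cong, THEN fun_cong])
  also have "\<dots> = (\<Sum>l<3 * N. if l mod 3 = ?r then (kern (B i) (i div 3) (l div 3) * (if ?ok then kern ?Z (l div 3) (j div 3) else 0)) else 0)"
  proof (rule sum.cong)
    fix l
    show "cyclic_block B i l * matpow (3 * N) (cyclic_block B) (Suc s) l j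
      = (if l mod 3 = ?r then (kern (B i) (i div 3) (l div 3) * (if ?ok then kern ?Z (l div 3) (j div 3) else 0)) else 0)"
    proof (cases "l mod 3 = ?r")
      case True
      have "alternate (trunc N) B l s = ?Z" by (rule alternate_mod[OF B_mod True])
      moreover have "(l + Suc s) mod 3 = (i + Suc (Suc s)) mod 3"
        using mod_add_cong[OF True refl, of "Suc s"] by (simp only: add_Suc add_Suc_right)
      ultimately show ?thesis unfolding Suc.IH[OF Suc.prems] using True by (simp add: cyclic_block_def)
    qed (simp add: cyclic_block_def)
  qed simp
  also have "\<dots> = (\<Sum>l<N. kern (B i) (i div 3) l * (if ?ok then kern ?Z l (j div 3) else 0))"
    by (rule sum_residue_class) simp
  also have "\<dots> = (if ?ok then kern (B i o\<^sub>L (trunc N o\<^sub>L ?Z)) (i div 3) (j div 3) else 0)"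
    using kern_mult[of "B i", OF B_scale] by simp
  finally show ?case by simp
qed

lemma frobenius_cyclic_block:
  assumes K: "\<And>c. norm (B c) \<le> K"
  shows "(\<Sum>i<3 * N. \<Sum>j<3 * N. (cmod (cyclic_block B i j))\<^sup>2) \<le> 9 * K\<^sup>2 * (\<Sum>k. a k)\<^sup>2"
proof -
  have K0: "K \<ge> 0" using K[of 0] norm_ge_zero order_trans by blast
  have "(cmod (cyclic_block B i j))\<^sup>2 \<le> K\<^sup>2 * (a (i div 3) * a (j div 3))" for i j
  proof -
    have "(cmod (cyclic_block B i j))\<^sup>2 \<le> (norm (B i))\<^sup>2 * (a (i div 3) * a (j div 3))"
      using cmod_kern_le[of "B i" "i div 3" "j div 3"] a_nonneg by (simp add: cyclic_block_def)
    also have "\<dots> \<le> K\<^sup>2 * (a (i div 3) * a (j div 3))"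
      using K a_nonneg by (intro mult_right_mono power_mono) auto
    finally show ?thesis .
  qed
  then have "(\<Sum>i<3 * N. \<Sum>j<3 * N. (cmod (cyclic_block B i j))\<^sup>2) \<le> (\<Sum>i<3 * N. \<Sum>j<3 * N. K\<^sup>2 * (a (i div 3) * a (j div 3)))"
    by (intro sum_mono)
  also have "\<dots> = K\<^sup>2 * (\<Sum>i<3 * N. a (i div 3))\<^sup>2"
    by (simp add: power2_eq_square sum_product sum_distrib_left mult_ac)
  also have "(\<Sum>i<3 * N. a (i div 3)) = 3 * (\<Sum>i<N. a i)"
    unfolding sum_mod3 mod3_simps by (simp add: sum_distrib_left)
  also have "K\<^sup>2 * (3 * (\<Sum>i<N. a i))\<^sup>2 \<le> K\<^sup>2 * (3 * (\<Sum>k. a k))\<^sup>2"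
    using a_nonneg by (intro mult_left_mono power_mono sum_le_suminf[OF summable_a] sum_nonneg mult_nonneg_nonneg) auto
  finally show ?thesis by (simp add: power_mult_distrib mult_ac)
qed

lemma trace_cyclic_block_tendsto:
  assumes "k > 0"
  shows "(\<lambda>N. \<Sum>i<3 * N. matpow (3 * N) (cyclic_block B) (3 * k) i i) \<longlonglongrightarrow>
    (\<Sum>c<3. tr (blinfun_apply (alternate (Blinfun A) B c (3 * k - 1))))"
proof -
  let ?s = "3 * k - 1"
  have s: "3 * k = Suc ?s" using assms by simp
  have kern_diag: "kern Z i i = of_real (a i) * f i (blinfun_apply Z (y i))" for Z i
    using sqrt_a[of i] by (simp add: kern_def mult_ac)
  have "(\<Sum>i<3 * N. matpow (3 * N) (cyclic_block B) (3 * k) i i) = (\<Sum>c<3. \<Sum>i<N. of_real (a i) * f i (blinfun_apply (alternate (trunc N) B c ?s) (y i)))" for N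
  proof -
    have "(\<Sum>i<3 * N. matpow (3 * N) (cyclic_block B) (3 * k) i i) = (\<Sum>i<3 * N. kern (alternate (trunc N) B i ?s) (i div 3) (i div 3))"
    proof (rule sum.cong)
      fix i assume i: "i \<in> {..<3 * N}"
      have m: "(i + Suc ?s) mod 3 = i mod 3" unfolding s[symmetric] by simp
      have "i < 3 * N" using i by simp
      from matpow_cyclic_block[OF this, of ?s i]
      have "matpow (3 * N) (cyclic_block B) (Suc ?s) i i = kern (alternate (trunc N) B i ?s) (i div 3) (i div 3)"
        by (simp only: m if_True simp_thms)
      then show "matpow (3 * N) (cyclic_block B) (3 * k) i i = kern (alternate (trunc N) B i ?s) (i div 3) (i div 3)"
        unfolding s[symmetric] .
    qed simp
    also have "\<dots> = (\<Sum>i<N. kern (alternate (trunc N) B 0 ?s) i i + kern (alternate (trunc N) B 1 ?s) i i + kern (alternate (trunc N) B 2 ?s) i i)"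
      unfolding sum_mod3
    proof (rule sum.cong)
      fix i
      have "alternate (trunc N) B (3 * i) ?s = alternate (trunc N) B 0 ?s"
        "alternate (trunc N) B (3 * i + 1) ?s = alternate (trunc N) B 1 ?s"
        "alternate (trunc N) B (3 * i + 2) ?s = alternate (trunc N) B 2 ?s"
        by (rule alternate_mod[OF B_mod], assumption, simp only: mod3_simps mod_less)+
      then show "kern (alternate (trunc N) B (3 * i) ?s) (3 * i div 3) (3 * i div 3) + kern (alternate (trunc N) B (3 * i + 1) ?s) ((3 * i + 1) div 3) ((3 * i + 1) div 3)
         + kern (alternate (trunc N) B (3 * i + 2) ?s) ((3 * i + 2) div 3) ((3 * i + 2) div 3)
        = kern (alternate (trunc N) B 0 ?s) i i + kern (alternate (trunc N) B 1 ?s) i i + kern (alternate (trunc N) B 2 ?s) i i"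
        by (simp only: mod3_simps)
    qed simp
    also have "\<dots> = (\<Sum>c<3. \<Sum>i<N. kern (alternate (trunc N) B c ?s) i i)"
      by (simp add: numeral_3_eq_3 sum.distrib numeral_2_eq_2)
    finally show ?thesis by (simp add: kern_diag)
  qed
  moreover have "(\<lambda>N. \<Sum>c<3. \<Sum>i<N. of_real (a i) * f i (blinfun_apply (alternate (trunc N) B c ?s) (y i))) \<longlonglongrightarrow>
    (\<Sum>c<3. tr (blinfun_apply (alternate (Blinfun A) B c ?s)))"
    by (intro tendsto_sum truncated_trace_tendsto alternate_tendsto trunc_tendsto)
  ultimately show ?thesis by simp
qed

end

text \<open>Apply the preceding construction to the factorization \<open>T\<^sup>n = A A T\<^sup>l A\<close> with \<open>l = n - 3 q\<close>. The
  eigenvalues of the truncated block matrices have uniformly bounded sums of squares, and the sums of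
  their powers of exponent \<open>3 k\<close> converge to three times the trace of \<open>T\<^bsup>n k\<^esup>\<close>.\<close>

theorem traces_are_power_sums:
  assumes T: "bounded_clinear T" and A: "A = T ^^ q" and n: "n \<ge> 3 * q"
  obtains \<nu> C where "\<And>j. cmod (\<nu> j) \<le> sqrt (C / real (Suc j))" "C \<ge> 0"
    "\<And>k. k > 0 \<Longrightarrow> (\<Sum>j. \<nu> j ^ (3 * k)) = 3 * tr (T ^^ (n * k - q))"
proof -
  define l where "l = n - 3 * q"
  define b where "b c = (if c mod 3 = (2::nat) then l else 0)" for c
  define B where "B c = Blinfun (T ^^ b c)" for c
  have Bapp: "blinfun_apply (B c) = T ^^ b c" for c
    by (simp add: B_def bounded_linear_Blinfun_apply bounded_clinear_imp_bounded_linear bounded_clinear_funpow[OF T])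
  have Aapp: "blinfun_apply (Blinfun A) = T ^^ q" using A_apply A by simp
  have B_mod: "c mod 3 = c' mod (3::nat) \<Longrightarrow> B c = B c'" for c c' by (simp add: B_def b_def)
  have B_scale: "blinfun_apply (B c) (k *\<^sub>C x) = k *\<^sub>C blinfun_apply (B c) x" for c k x
    by (simp add: Bapp bounded_clinear_scaleC bounded_clinear_funpow[OF T])
  define K where "K = max (norm (B 0)) (norm (B 2))"
  have K: "norm (B c) \<le> K" for c
    by (cases "c mod 3 = 2") (simp_all add: K_def B_def b_def)
  define ex where "ex = rec_nat b (\<lambda>s e c. b c + q + e (Suc c))"
  have ex_simps: "ex 0 c = b c" "ex (Suc s) c = b c + q + ex s (Suc c)" for s c by (simp_all add: ex_def)
  have alt: "blinfun_apply (alternate (Blinfun A) B c s) = T ^^ ex s c" for c s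
  proof (induction s arbitrary: c)
    case (Suc s)
    have "blinfun_apply (alternate (Blinfun A) B c (Suc s)) x = (T ^^ ex (Suc s) c) x" for x
      using Suc by (simp add: Bapp Aapp ex_simps funpow_add)
    then show ?case by (rule ext)
  qed (simp add: Bapp ex_simps)
  have bsum: "b c + b (Suc c) + b (Suc (Suc c)) = l" for c
  proof -
    consider "c mod 3 = 0" | "c mod 3 = 1" | "c mod 3 = 2" by linarith
    then show ?thesis unfolding b_def by cases (simp_all add: mod_Suc)
  qed
  have bper: "b (c + 3) = b c" for c by (simp add: b_def)
  have exper: "ex s (c + 3) = ex s c" for s c
  proof (induction s arbitrary: c)
    case 0
    then show ?case by (simp only: ex_simps bper)
  next
    case (Suc s)
    then show ?case using Suc[of "Suc c"] by (simp only: ex_simps bper add_Suc)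
  qed
  have ex3: "ex (Suc (Suc (Suc s))) c = ex s c + n" for s c
    using bsum[of c] exper[of s c] n by (simp add: ex_simps l_def eval_nat_numeral)
  have ex2: "ex 2 c + q = n" for c
    using bsum[of c] n by (simp add: ex_simps l_def eval_nat_numeral)
  have exk: "ex (3 * k - 1) c + q = n * k" if "k > 0" for k c
    using that
  proof (induction k)
    case (Suc k)
    show ?case
    proof (cases k)
      case 0
      then show ?thesis using ex2[of c] by (simp add: numeral_2_eq_2[symmetric])
    next
      case (Suc k')
      then have "3 * Suc k - 1 = Suc (Suc (Suc (3 * k - 1)))" by simp
      then show ?thesis using Suc.IH Suc by (simp only: ex3) simp
    qed
  qed simp
  let ?C = "9 * K\<^sup>2 * (\<Sum>k. a k)\<^sup>2"
  have "\<exists>\<mu>. (\<forall>k. (\<Sum>i<3 * N. matpow (3 * N) (cyclic_block B) k i i) = (\<Sum>i<3 * N. \<mu> i ^ k)) \<and> (\<Sum>i<3 * N. (cmod (\<mu> i))\<^sup>2) \<le> ?C" for N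
    by (rule eigenvalues_of_finite_matrix[of "3 * N" "cyclic_block B"])
      (use frobenius_cyclic_block[where B = B and N = N, OF B_mod B_scale K] order_trans in blast)
  then obtain \<mu> where \<mu>: "\<And>N k. (\<Sum>i<3 * N. matpow (3 * N) (cyclic_block B) k i i) = (\<Sum>i<3 * N. \<mu> N i ^ k)"
    "\<And>N. (\<Sum>i<3 * N. (cmod (\<mu> N i))\<^sup>2) \<le> ?C" by metis
  show ?thesis
  proof (rule limit_of_power_sums[OF \<mu>(2), where K = "{3 * k | k. k > 0}" and t = "\<lambda>m. 3 * tr (T ^^ (n * (m div 3) - q))"])
    fix m :: nat assume "m \<in> {3 * k | k. k > 0}"
    then obtain k where k: "m = 3 * k" "k > 0" by blast
    then show "m \<ge> 3" by simp
    have "ex (3 * k - 1) c = n * k - q" for c using exk[OF k(2), of c] by linarith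
    then have "blinfun_apply (alternate (Blinfun A) B c (3 * k - 1)) = T ^^ (n * k - q)" for c
      by (simp only: alt)
    then have "(\<Sum>c<3. tr (blinfun_apply (alternate (Blinfun A) B c (3 * k - 1)))) = 3 * tr (T ^^ (n * (m div 3) - q))"
      using k by simp
    then show "(\<lambda>N. \<Sum>i<3 * N. \<mu> N i ^ m) \<longlonglongrightarrow> 3 * tr (T ^^ (n * (m div 3) - q))"
      using trace_cyclic_block_tendsto[where B = B, OF B_mod B_scale k(2)] unfolding \<mu>(1) k(1) by simp
  next
    fix \<nu> assume \<nu>: "\<And>j. cmod (\<nu> j) \<le> sqrt (?C / real (Suc j))"
      "\<And>m. m \<in> {3 * k | k. k > 0} \<Longrightarrow> (\<Sum>j. \<nu> j ^ m) = 3 * tr (T ^^ (n * (m div 3) - q))"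
    show ?thesis
    proof (rule that[OF \<nu>(1)])
      show "(\<Sum>j. \<nu> j ^ (3 * k)) = 3 * tr (T ^^ (n * k - q))" if "k > 0" for k
        using \<nu>(2)[of "3 * k"] that by auto
    qed simp
  qed
qed

end

section \<open>Factorization through the sequence space\<close>

definition synthesis :: "(nat \<Rightarrow> real) \<Rightarrow> (nat \<Rightarrow> 'a::complex_banach) \<Rightarrow> ell2 \<Rightarrow> 'a"
  where "synthesis b y c = (\<Sum>k. (of_real (b k) * coord c k) *\<^sub>C y k)"

definition analysis :: "(nat \<Rightarrow> real) \<Rightarrow> (nat \<Rightarrow> 'a::complex_banach \<Rightarrow> complex) \<Rightarrow> 'a \<Rightarrow> ell2"
  where "analysis b f x = Ell2 (\<lambda>k. of_real (b k) * f k x)"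

lemma summable_synthesis:
  assumes b: "summable (\<lambda>k. (b k)\<^sup>2)" and y: "\<And>k. norm (y k) \<le> 1"
  shows "summable (\<lambda>k. norm ((of_real (b k) * coord c k) *\<^sub>C y k))"
    "(\<Sum>k. norm ((of_real (b k) * coord c k) *\<^sub>C y k)) \<le> sqrt (\<Sum>k. (b k)\<^sup>2) * norm c"
proof -
  have sb: "summable (\<lambda>k. (cmod (of_real (b k)))\<^sup>2)" using b by simp
  define \<beta> where "\<beta> = Ell2 (\<lambda>k. of_real \<bar>b k\<bar>)"
  have \<beta>: "coord \<beta> k = of_real \<bar>b k\<bar>" for k using b by (simp add: \<beta>_def coord_Ell2)
  define \<gamma> where "\<gamma> = Ell2 (\<lambda>k. of_real (cmod (coord c k)))"
  have \<gamma>: "coord \<gamma> k = of_real (cmod (coord c k))" for k using summable_coord[of c] by (simp add: \<gamma>_def coord_Ell2)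
  have n\<gamma>: "norm \<gamma> = norm c" by (rule power2_eq_imp_eq) (simp_all add: norm_ell2_sq \<gamma>)
  have n\<beta>: "norm \<beta> = sqrt (\<Sum>k. (b k)\<^sup>2)"
    by (rule real_sqrt_unique[symmetric]) (simp_all add: norm_ell2_sq \<beta>)
  have s: "summable (\<lambda>k. \<bar>b k\<bar> * cmod (coord c k))"
    using summable_abs_product[OF sb summable_coord[of c]] by (simp add: norm_mult)
  have le: "norm ((of_real (b k) * coord c k) *\<^sub>C y k) \<le> \<bar>b k\<bar> * cmod (coord c k)" for k
    using mult_left_mono[OF y[of k], of "\<bar>b k\<bar> * cmod (coord c k)"] by (simp add: norm_scaleC norm_mult)
  show sm: "summable (\<lambda>k. norm ((of_real (b k) * coord c k) *\<^sub>C y k))"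
    by (rule summable_comparison_test'[OF s]) (simp add: le)
  have "(\<Sum>k. norm ((of_real (b k) * coord c k) *\<^sub>C y k)) \<le> (\<Sum>k. \<bar>b k\<bar> * cmod (coord c k))"
    by (rule suminf_le[OF le sm s])
  also have "\<dots> = cmod (cinner \<beta> \<gamma>)"
  proof -
    have "cinner \<beta> \<gamma> = of_real (\<Sum>k. \<bar>b k\<bar> * cmod (coord c k))"
      unfolding cinner_def suminf_of_real[OF s] by (rule suminf_cong) (simp add: \<beta> \<gamma>)
    then show ?thesis by (simp add: suminf_nonneg[OF s])
  qed
  also have "\<dots> \<le> norm \<beta> * norm \<gamma>" by (rule cmod_cinner_le)
  finally show "(\<Sum>k. norm ((of_real (b k) * coord c k) *\<^sub>C y k)) \<le> sqrt (\<Sum>k. (b k)\<^sup>2) * norm c"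
    by (simp add: n\<beta> n\<gamma>)
qed

lemma bounded_clinear_synthesis:
  assumes b: "summable (\<lambda>k. (b k)\<^sup>2)" and y: "\<And>k. norm (y k) \<le> 1"
  shows "bounded_clinear (synthesis b y)"
proof (rule bounded_clinearI)
  note s = summable_norm_cancel[OF summable_synthesis(1)[OF b y]]
  show "norm (synthesis b y c) \<le> sqrt (\<Sum>k. (b k)\<^sup>2) * norm c" for c
    unfolding synthesis_def
    by (rule order_trans[OF summable_norm[OF summable_synthesis(1)[OF b y]] summable_synthesis(2)[OF b y]])
  show "synthesis b y (c + d) = synthesis b y c + synthesis b y d" for c d
    unfolding synthesis_def suminf_add[OF s s] by (simp add: distrib_left scaleC_add_left)
  show "synthesis b y (k *\<^sub>C c) = k *\<^sub>C synthesis b y c" for k c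
    unfolding synthesis_def bounded_linear.suminf[OF bounded_linear_scaleC s]
    by (rule suminf_cong) (simp add: scaleC_scaleC mult_ac)
qed

lemma synthesis_unit: "synthesis b y (ell2_unit k) = of_real (b k) *\<^sub>C y k"
proof -
  have "synthesis b y (ell2_unit k) = (\<Sum>j\<in>{k}. (of_real (b j) * coord (ell2_unit k) j) *\<^sub>C y j)"
    unfolding synthesis_def by (rule suminf_finite) auto
  then show ?thesis by simp
qed

lemma
  assumes b: "summable (\<lambda>k. (b k)\<^sup>2)" and f: "\<And>k. bounded_clinear (f k)" "\<And>k x. cmod (f k x) \<le> norm x"
  shows coord_analysis: "coord (analysis b f x) k = of_real (b k) * f k x"
    and bounded_clinear_analysis: "bounded_clinear (analysis b f)"
proof -
  let ?K = "sqrt (\<Sum>k. (b k)\<^sup>2)"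
  have K: "?K\<^sup>2 = (\<Sum>k. (b k)\<^sup>2)" by (simp add: suminf_nonneg[OF b])
  have le: "(\<Sum>k<n. (cmod (of_real (b k) * f k x))\<^sup>2) \<le> (?K * norm x)\<^sup>2" for n x
  proof -
    have "(\<Sum>k<n. (cmod (of_real (b k) * f k x))\<^sup>2) \<le> (\<Sum>k<n. (b k)\<^sup>2 * (norm x)\<^sup>2)"
      using f(2) by (intro sum_mono) (auto simp: norm_mult power_mult_distrib intro!: mult_left_mono power_mono)
    also have "\<dots> = (\<Sum>k<n. (b k)\<^sup>2) * (norm x)\<^sup>2" by (simp add: sum_distrib_right)
    also have "\<dots> \<le> (\<Sum>k. (b k)\<^sup>2) * (norm x)\<^sup>2"
      by (intro mult_right_mono sum_le_suminf[OF b]) auto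
    finally show ?thesis by (simp only: power_mult_distrib K)
  qed
  have K0: "?K * norm x \<ge> 0" for x :: 'a by (simp add: suminf_nonneg[OF b])
  have c: "coord (analysis b f x) k = of_real (b k) * f k x" for x k
    unfolding analysis_def Ell2_bounded(1)[OF le K0] ..
  show "coord (analysis b f x) k = of_real (b k) * f k x" by (rule c)
  show "bounded_clinear (analysis b f)"
  proof (rule bounded_clinearI)
    show "norm (analysis b f x) \<le> ?K * norm x" for x
      unfolding analysis_def by (rule Ell2_bounded(2)[OF le K0])
  qed (auto intro!: ell2_eqI simp: c bounded_clinear_add[OF f(1)] bounded_clinear_scaleC[OF f(1)] scaleC_complex_def algebra_simps)
qed

lemma sums_coord_unit:
  assumes "bounded_clinear (\<psi> :: ell2 \<Rightarrow> 'b::complex_banach)"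
  shows "(\<lambda>j. coord x j *\<^sub>C \<psi> (ell2_unit j)) sums \<psi> x"
  unfolding sums_def
  using bounded_linear.tendsto[OF bounded_clinear_imp_bounded_linear[OF assms] ell2_expansion[of x]]
  by (simp add: bounded_clinear_sum[OF assms] bounded_clinear_scaleC[OF assms])

lemma bounded_clinear_coord: "bounded_clinear (\<lambda>x. coord x k)"
  using bounded_clinear_cinner[of "ell2_unit k"] by simp

lemma bounded_clinear_projection: "bounded_clinear (projection e n)"
  unfolding projection_def[abs_def]
proof (rule bounded_clinear_sum_fun)
  fix i
  show "bounded_clinear (\<lambda>x. cinner x (e i) *\<^sub>C e i)"
  proof (rule bounded_clinearI)
    show "norm (cinner x (e i) *\<^sub>C e i) \<le> (norm (e i) * norm (e i)) * norm x" for x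
      using mult_right_mono[OF cmod_cinner_le[of x "e i"], of "norm (e i)"] by (simp add: norm_scaleC mult_ac)
  qed (simp_all add: cinner_add_left cinner_scale_left scaleC_add_left scaleC_scaleC)
qed

text \<open>Grothendieck's theorem. Put \<open>b\<^sub>k = a\<^sub>k\<^sup>1\<^sup>/\<^sup>3\<close> and factor the zero operator as \<open>V \<circ> W\<close> through
  the sequence space. Then \<open>M = W \<circ> V\<close> has square zero and its trace is the trace in question. Let
  \<open>R\<close> be the orthogonal projection onto the span of the first \<open>L\<close> columns of \<open>M\<close>. As \<open>M\<close> vanishes on
  the range of \<open>R\<close>, the trace of \<open>R M\<close> is that of \<open>M R = 0\<close>; and \<open>(1 - R) M\<close> has only the columns
  from \<open>L\<close> on, which contribute at most \<open>|b|\<^sup>2 |b\<^sub>\<ge>\<^sub>L|\<close> to the trace.\<close>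

lemma trace_of_zero_operator:
  fixes y :: "nat \<Rightarrow> 'a::complex_banach"
  assumes "nuclear_series (\<lambda>x. 0) a f y" and a23: "summable (\<lambda>k. a k powr (2/3))"
  shows "nuclear_series.tr a f y (\<lambda>x. x) = 0"
proof -
  interpret nuclear_series "\<lambda>x. 0" a f y by fact
  \<comment> \<open>With \<open>b\<close> in \<open>V\<close> and \<open>b\<^sup>2\<close> in \<open>W\<close>, both weights are square summable and their product is \<open>a\<close>.\<close>
  define b where "b k = a k powr (1/3)" for k
  have b0: "b k \<ge> 0" for k by (simp add: b_def)
  have b2: "(b k)\<^sup>2 = a k powr (2/3)" for k
    by (simp add: b_def power2_eq_square powr_add[symmetric])
  have b3: "b k * (b k)\<^sup>2 = a k" for k
    unfolding b2 using a_nonneg[of k] by (simp add: b_def powr_add[symmetric])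
  have sb: "summable (\<lambda>k. (b k)\<^sup>2)" using a23 by (simp add: b2)
  define B where "B = (\<Sum>k. (b k)\<^sup>2)"
  have sb4: "summable (\<lambda>k. ((b k)\<^sup>2)\<^sup>2)"
  proof (rule summable_comparison_test'[OF summable_mult2[OF sb, of B]])
    fix k
    have "(b k)\<^sup>2 \<le> B"
      using sum_le_suminf[OF sb, of "{k}"] by (simp add: B_def)
    then have "(b k)\<^sup>2 * (b k)\<^sup>2 \<le> (b k)\<^sup>2 * B" by (rule mult_left_mono) simp
    moreover have "norm (((b k)\<^sup>2)\<^sup>2) = (b k)\<^sup>2 * (b k)\<^sup>2" by (simp only: power2_eq_square real_norm_def abs_mult_self_eq abs_mult)
    ultimately show "norm (((b k)\<^sup>2)\<^sup>2) \<le> (b k)\<^sup>2 * B" by (simp only:)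
  qed
  define V where "V = synthesis b y"
  define W where "W = analysis (\<lambda>k. (b k)\<^sup>2) f"
  define M where "M x = W (V x)" for x
  have bcV: "bounded_clinear V" unfolding V_def by (rule bounded_clinear_synthesis[OF sb y_le])
  note Wfacts = coord_analysis[OF sb4 bcf f_le] bounded_clinear_analysis[OF sb4 bcf f_le]
  have bcW: "bounded_clinear W" unfolding W_def by (rule Wfacts(2))
  have cW: "coord (W x) k = of_real ((b k)\<^sup>2) * f k x" for x k unfolding W_def by (rule Wfacts(1))
  have bcM: "bounded_clinear M" unfolding M_def[abs_def] by (rule bounded_clinear_compose[OF bcW bcV])
  have VW: "V (W x) = 0" for x
  proof -
    have "V (W x) = (\<Sum>k. (of_real (a k) * f k x) *\<^sub>C y k)"
      unfolding V_def synthesis_def cW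
      by (rule suminf_cong) (simp only: mult.assoc[symmetric] of_real_mult[symmetric] b3)
    then show ?thesis using sums_unique[OF A_sums[of x]] by simp
  qed
  have MM: "M (M x) = 0" for x by (simp add: M_def VW bounded_clinear_zero[OF bcW])
  have Mu: "M (ell2_unit k) = of_real (b k) *\<^sub>C W (y k)" for k
    by (simp add: M_def V_def synthesis_unit bounded_clinear_scaleC[OF bcW])
  have diag: "coord (M (ell2_unit k)) k = of_real (a k) * f k (y k)" for k
    unfolding Mu coord_scaleC cW mult.assoc[symmetric] of_real_mult[symmetric] b3 ..
  have sum_diag: "summable (\<lambda>k. coord (M (ell2_unit k)) k)"
    unfolding diag using summable_trace[OF bounded_clinear_ident] .
  define e where "e = orthonormalize (\<lambda>k. M (ell2_unit k))"
  have e: "orthosystem e" unfolding e_def by (rule orthosystem_orthonormalize)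
  have Me: "M (e i) = 0" for i
  proof (induction i rule: less_induct)
    case (less i)
    define w where "w = M (ell2_unit i) - projection e i (M (ell2_unit i))"
    have "M w = 0"
      using less by (simp add: w_def bounded_clinear_diff[OF bcM] MM projection_def bounded_clinear_sum[OF bcM] bounded_clinear_scaleC[OF bcM])
    moreover have "e i = sgn w" unfolding e_def w_def by (rule orthonormalize_rec)
    ultimately show ?case by (simp add: sgn_div_norm scaleR_scaleC bounded_clinear_scaleC[OF bcM])
  qed
  have main: "cmod (tr (\<lambda>x. x)) \<le> B * sqrt (\<Sum>k. (b (k + L))\<^sup>2)" for L
  proof -
    define Q where "Q x = x - projection e L x" for x
    have bcQ: "bounded_clinear Q"
      unfolding Q_def[abs_def] by (intro bounded_clinear_minus_fun bounded_clinear_ident bounded_clinear_projection)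
    have nQ: "norm (Q x) \<le> norm x" for x unfolding Q_def by (rule norm_diff_projection_le[OF e])
    have Q0: "Q (M (ell2_unit k)) = 0" if "k < L" for k
    proof -
      let ?v = "M (ell2_unit k)"
      have orth: "cinner (Q ?v) (e i) = 0" if "i < L" for i
        unfolding Q_def by (rule cinner_diff_projection[OF e that])
      have "cinner (Q ?v) ?v = 0"
        by (rule orthogonal_orthonormalize[of L "Q ?v" "\<lambda>k. M (ell2_unit k)" k]) (use orth that in \<open>auto simp: e_def\<close>)
      moreover have "cinner (Q ?v) (projection e L ?v) = 0"
        by (simp add: projection_def cinner_sum_right cinner_scale_right orth)
      ultimately have "cinner (Q ?v) (?v - projection e L ?v) = 0" by (simp add: cinner_diff_right)
      then have "cinner (Q ?v) (Q ?v) = 0" by (simp only: Q_def[of ?v, symmetric])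
      then show ?thesis by (simp add: cinner_self_norm)
    qed
    have trR: "(\<lambda>k. coord (projection e L (M (ell2_unit k))) k) sums 0"
    proof -
      have "(\<lambda>k. coord (e i) k * cinner (M (ell2_unit k)) (e i)) sums 0" for i
        using sums_coord_unit[OF bounded_clinear_compose[OF bounded_clinear_cinner[of "e i"] bcM], of "e i"]
        by (simp add: scaleC_complex_def Me)
      then have "(\<lambda>k. \<Sum>i<L. coord (e i) k * cinner (M (ell2_unit k)) (e i)) sums (\<Sum>i<L. 0)"
        by (rule sums_sum)
      then show ?thesis by (simp add: projection_def coord_sum mult.commute)
    qed
    have "tr (\<lambda>x. x) = (\<Sum>k. coord (M (ell2_unit k)) k)" by (simp add: tr_def diag)
    then have "(\<lambda>k. coord (M (ell2_unit k)) k) sums tr (\<lambda>x. x)" using summable_sums[OF sum_diag] by simp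
    from sums_diff[OF this trR] have trQ: "(\<lambda>k. coord (Q (M (ell2_unit k))) k) sums tr (\<lambda>x. x)"
      by (simp add: Q_def)
    define \<rho> where "\<rho> j k = coord (Q (ell2_unit j)) k" for j k
    define \<beta> where "\<beta> = sqrt (\<Sum>k. (b (k + L))\<^sup>2)"
    have row: "(\<Sum>k\<in>{L..<N}. b k * cmod (\<rho> j k)) \<le> \<beta>" for j N
    proof -
      have "(\<Sum>k\<in>{L..<N}. b k * cmod (\<rho> j k)) = (\<Sum>k\<in>{L..<N}. \<bar>b k\<bar> * \<bar>cmod (\<rho> j k)\<bar>)"
        using b0 by simp
      also have "\<dots> \<le> L2_set b {L..<N} * L2_set (\<lambda>k. cmod (\<rho> j k)) {L..<N}" by (rule L2_set_mult_ineq)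
      also have "\<dots> \<le> \<beta> * 1"
      proof (rule mult_mono)
        have "(\<Sum>k\<in>{L..<N}. (b k)\<^sup>2) = (\<Sum>k<N - L. (b (k + L))\<^sup>2)"
          by (rule sum.reindex_bij_witness[of _ "\<lambda>k. k + L" "\<lambda>k. k - L"]) auto
        also have "\<dots> \<le> (\<Sum>k. (b (k + L))\<^sup>2)"
          by (rule sum_le_suminf) (use sb in \<open>auto simp: summable_iff_shift[of "\<lambda>k. (b k)\<^sup>2"]\<close>)
        finally show "L2_set b {L..<N} \<le> \<beta>" by (simp add: L2_set_def \<beta>_def)
        have "(\<Sum>k\<in>{L..<N}. (cmod (\<rho> j k))\<^sup>2) \<le> (\<Sum>k<N. (cmod (\<rho> j k))\<^sup>2)"
          by (rule sum_mono2) auto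
        also have "\<dots> \<le> (norm (Q (ell2_unit j)))\<^sup>2" unfolding \<rho>_def by (rule sum_coord_le_norm)
        also have "\<dots> \<le> 1\<^sup>2"
        proof (rule power_mono)
          have "cinner (ell2_unit j) (ell2_unit j) = of_real ((norm (ell2_unit j))\<^sup>2)" by (rule cinner_self_norm)
          then have "norm (ell2_unit j) = 1" by (simp del: of_real_power) (metis norm_ge_zero of_real_eq_1_iff power2_eq_1_iff le_minus_one_simps(3))
          then show "norm (Q (ell2_unit j)) \<le> 1" using nQ[of "ell2_unit j"] by simp
        qed simp
        finally show "L2_set (\<lambda>k. cmod (\<rho> j k)) {L..<N} \<le> 1" by (simp add: L2_set_def)
      qed (auto simp: \<beta>_def L2_set_nonneg suminf_nonneg sb summable_iff_shift[of "\<lambda>k. (b k)\<^sup>2"])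
      finally show ?thesis by simp
    qed
    have \<rho>1: "cmod (\<rho> j k) \<le> norm (ell2_unit j)" for j k
      unfolding \<rho>_def using cmod_coord_le_norm nQ order_trans by blast
    have term_sum: "summable (\<lambda>j. (b j)\<^sup>2 * cmod (\<rho> j k))" for k
    proof (rule summable_comparison_test'[OF sb])
      fix j
      have "cinner (ell2_unit j) (ell2_unit j) = of_real ((norm (ell2_unit j))\<^sup>2)" by (rule cinner_self_norm)
      then have "norm (ell2_unit j) = 1" by (simp del: of_real_power) (metis norm_ge_zero of_real_eq_1_iff power2_eq_1_iff le_minus_one_simps(3))
      then have "cmod (\<rho> j k) \<le> 1" using \<rho>1[of j k] by simp
      then show "norm ((b j)\<^sup>2 * cmod (\<rho> j k)) \<le> (b j)\<^sup>2" by (simp add: mult_left_le)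
    qed
    have term_le: "cmod (coord (Q (M (ell2_unit k))) k) \<le> b k * (\<Sum>j. (b j)\<^sup>2 * cmod (\<rho> j k))" for k
    proof -
      have "(\<lambda>j. coord (W (y k)) j *\<^sub>C \<rho> j k) sums coord (Q (W (y k))) k"
        unfolding \<rho>_def by (rule sums_coord_unit[OF bounded_clinear_compose[OF bounded_clinear_coord bcQ]])
      then have "coord (Q (W (y k))) k = (\<Sum>j. coord (W (y k)) j * \<rho> j k)"
        by (simp add: sums_iff scaleC_complex_def)
      also have "cmod \<dots> \<le> (\<Sum>j. (b j)\<^sup>2 * cmod (\<rho> j k))"
      proof (rule norm_suminf_le[OF _ term_sum])
        fix j
        have "cmod (f j (y k)) \<le> 1" using f_le[of j "y k"] y_le[of k] by linarith
        then have "cmod (coord (W (y k)) j) \<le> (b j)\<^sup>2" by (simp add: cW norm_mult norm_power mult_left_le)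
        then show "norm (coord (W (y k)) j * \<rho> j k) \<le> (b j)\<^sup>2 * cmod (\<rho> j k)"
          by (simp add: norm_mult mult_right_mono)
      qed
      finally have "cmod (coord (Q (W (y k))) k) \<le> (\<Sum>j. (b j)\<^sup>2 * cmod (\<rho> j k))" .
      then show ?thesis
        using b0 by (simp add: Mu bounded_clinear_scaleC[OF bcQ] norm_mult mult_left_mono)
    qed
    have "cmod (\<Sum>k<N. coord (Q (M (ell2_unit k))) k) \<le> B * \<beta>" for N
    proof -
      have "(\<Sum>k<N. coord (Q (M (ell2_unit k))) k) = (\<Sum>k\<in>{L..<N}. coord (Q (M (ell2_unit k))) k)"
        by (rule sum.mono_neutral_right) (auto simp: Q0)
      also have "cmod \<dots> \<le> (\<Sum>k\<in>{L..<N}. b k * (\<Sum>j. (b j)\<^sup>2 * cmod (\<rho> j k)))"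
        by (rule order_trans[OF norm_sum]) (intro sum_mono term_le)
      also have "\<dots> = (\<Sum>k\<in>{L..<N}. \<Sum>j. (b j)\<^sup>2 * (b k * cmod (\<rho> j k)))"
        by (intro sum.cong refl, subst suminf_mult[OF term_sum, symmetric]) (simp add: mult_ac)
      also have "\<dots> = (\<Sum>j. \<Sum>k\<in>{L..<N}. (b j)\<^sup>2 * (b k * cmod (\<rho> j k)))"
      proof (rule suminf_sum[symmetric])
        show "summable (\<lambda>j. (b j)\<^sup>2 * (b k * cmod (\<rho> j k)))" for k
          using summable_mult[OF term_sum[of k], of "b k"] by (simp add: mult_ac)
      qed
      also have "\<dots> \<le> (\<Sum>j. (b j)\<^sup>2 * \<beta>)"
      proof (rule suminf_le)
        show "(\<Sum>k\<in>{L..<N}. (b j)\<^sup>2 * (b k * cmod (\<rho> j k))) \<le> (b j)\<^sup>2 * \<beta>" for j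
          using mult_left_mono[OF row[of j N], of "(b j)\<^sup>2"] by (simp add: sum_distrib_left)
        show "summable (\<lambda>j. (b j)\<^sup>2 * \<beta>)" by (rule summable_mult2[OF sb])
        show "summable (\<lambda>j. \<Sum>k\<in>{L..<N}. (b j)\<^sup>2 * (b k * cmod (\<rho> j k)))"
        proof (rule summable_sum)
          show "summable (\<lambda>j. (b j)\<^sup>2 * (b k * cmod (\<rho> j k)))" for k
            using summable_mult[OF term_sum[of k], of "b k"] by (simp add: mult_ac)
        qed
      qed
      also have "\<dots> = B * \<beta>" unfolding B_def by (rule suminf_mult2[OF sb, symmetric])
      finally show ?thesis .
    qed
    moreover have "(\<lambda>N. cmod (\<Sum>k<N. coord (Q (M (ell2_unit k))) k)) \<longlonglongrightarrow> cmod (tr (\<lambda>x. x))"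
      using trQ unfolding sums_def by (rule tendsto_norm)
    ultimately show ?thesis unfolding \<beta>_def by (rule_tac Lim_bounded) auto
  qed
  have "(\<lambda>L. B * sqrt (\<Sum>k. (b (k + L))\<^sup>2)) \<longlonglongrightarrow> B * sqrt 0"
    by (intro tendsto_mult tendsto_const tendsto_real_sqrt suminf_exist_split2[OF sb])
  then have "cmod (tr (\<lambda>x. x)) \<le> B * sqrt 0"
    by (rule tendsto_lowerbound) (use main in auto)
  then show ?thesis by simp
qed

lemma interleaved_sums:
  fixes u v :: "nat \<Rightarrow> 'b::banach"
  assumes "summable (\<lambda>k. norm (u k))" "summable (\<lambda>k. norm (v k))"
  shows "(\<lambda>k. if even k then u (k div 2) else v (k div 2)) sums (suminf u + suminf v)"
proof -
  let ?w = "\<lambda>k. if even k then u (k div 2) else v (k div 2)"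
  have u: "(u has_sum suminf u) UNIV" and v: "(v has_sum suminf v) UNIV"
    using assms by (auto intro!: norm_summable_imp_has_sum summable_sums summable_norm_cancel)
  have sum_even: "(?w has_sum suminf u) (range (\<lambda>k. 2 * k))"
    by (subst has_sum_reindex) (use u in \<open>auto simp: comp_def inj_on_def\<close>)
  have sum_odd: "(?w has_sum suminf v) (range (\<lambda>k. 2 * k + 1))"
    by (subst has_sum_reindex) (use v in \<open>auto simp: comp_def inj_on_def\<close>)
  have disj: "range (\<lambda>k. 2 * k) \<inter> range (\<lambda>k. 2 * k + 1) = ({} :: nat set)" by auto presburger
  have "range (\<lambda>k. 2 * k) \<union> range (\<lambda>k. 2 * k + 1) = (UNIV :: nat set)"
    by (auto simp: image_iff) presburger
  then show ?thesis
    using has_sum_Un_disjoint[OF sum_even sum_odd disj] has_sum_imp_sums by simp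
qed

text \<open>Two series for the same operator combine into one for the zero operator.\<close>

theorem trace_independent_of_series:
  assumes "nuclear_series A a f y" "summable (\<lambda>k. a k powr (2/3))"
    and "nuclear_series A b g z" "summable (\<lambda>k. b k powr (2/3))"
  shows "nuclear_series.tr a f y (\<lambda>x. x) = nuclear_series.tr b g z (\<lambda>x. x)"
proof -
  interpret N1: nuclear_series A a f y by fact
  interpret N2: nuclear_series A b g z by fact
  define c where "c k = (if even k then a (k div 2) else b (k div 2))" for k
  define h where "h k = (if even k then f (k div 2) else g (k div 2))" for k
  define w where "w k = (if even k then y (k div 2) else - z (k div 2))" for k
  have sc: "summable c"
    unfolding c_def using N1.summable_a N2.summable_a N1.a_nonneg N2.a_nonneg
    by (intro sums_summable[OF interleaved_sums]) auto
  have s1: "summable (\<lambda>k. norm ((of_real (a k) * f k x) *\<^sub>C y k))" for x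
    by (rule summable_comparison_test'[OF summable_mult2[OF N1.summable_a, of "norm x"]]) (simp add: N1.norm_term_le)
  have s2: "summable (\<lambda>k. norm (- ((of_real (b k) * g k x) *\<^sub>C z k)))" for x
    by (rule summable_comparison_test'[OF summable_mult2[OF N2.summable_a, of "norm x"]]) (simp add: N2.norm_term_le)
  have zero: "nuclear_series (\<lambda>x. 0) c h w"
  proof
    show "0 \<le> c k" for k by (simp add: c_def N1.a_nonneg N2.a_nonneg)
    show "summable c" by (rule sc)
    show "bounded_clinear (h k)" for k by (simp add: h_def N1.bcf N2.bcf)
    show "cmod (h k x) \<le> norm x" for k x by (simp add: h_def N1.f_le N2.f_le)
    show "norm (w k) \<le> 1" for k by (simp add: w_def N1.y_le N2.y_le)
    show "(\<lambda>k. (of_real (c k) * h k x) *\<^sub>C w k) sums 0" for x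
    proof -
      have "(\<Sum>k. - ((of_real (b k) * g k x) *\<^sub>C z k)) = - A x"
        using sums_minus[OF N2.A_sums[of x]] by (simp add: sums_iff)
      moreover have "(\<Sum>k. (of_real (a k) * f k x) *\<^sub>C y k) = A x" using N1.A_sums[of x] by (simp add: sums_iff)
      ultimately have "(\<lambda>k. if even k then (of_real (a (k div 2)) * f (k div 2) x) *\<^sub>C y (k div 2) else - ((of_real (b (k div 2)) * g (k div 2) x) *\<^sub>C z (k div 2))) sums 0"
        using interleaved_sums[OF s1[of x] s2[of x]] by simp
      moreover have "(if even k then (of_real (a (k div 2)) * f (k div 2) x) *\<^sub>C y (k div 2) else - ((of_real (b (k div 2)) * g (k div 2) x) *\<^sub>C z (k div 2)))
        = (of_real (c k) * h k x) *\<^sub>C w k" for k by (simp add: c_def h_def w_def)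
      ultimately show ?thesis by simp
    qed
  qed
  have "summable (\<lambda>k. if even k then a (k div 2) powr (2/3) else b (k div 2) powr (2/3))"
    by (rule sums_summable[OF interleaved_sums]) (use assms in auto)
  then have "summable (\<lambda>k. c k powr (2/3))" by (simp add: c_def if_distrib[of "\<lambda>u. u powr _"])
  from trace_of_zero_operator[OF zero this]
  have "(\<Sum>k. of_real (c k) * h k (w k)) = 0" by (simp add: nuclear_series.tr_def[OF zero])
  moreover have t1: "summable (\<lambda>k. norm (of_real (a k) * f k (y k)))"
    by (rule summable_comparison_test'[OF summable_mult2[OF N1.summable_a, of 1]])
      (use N1.norm_trace_term_le[of "\<lambda>x. x" 1] in auto)
  moreover have t2: "summable (\<lambda>k. norm (- (of_real (b k) * g k (z k))))"
    by (rule summable_comparison_test'[OF summable_mult2[OF N2.summable_a, of 1]])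
      (use N2.norm_trace_term_le[of "\<lambda>x. x" 1] in auto)
  moreover have "(\<Sum>k. of_real (c k) * h k (w k)) = (\<Sum>k. of_real (a k) * f k (y k)) + (\<Sum>k. - (of_real (b k) * g k (z k)))"
  proof -
    have "(if even k then of_real (a (k div 2)) * f (k div 2) (y (k div 2)) else - (of_real (b (k div 2)) * g (k div 2) (z (k div 2))))
      = of_real (c k) * h k (w k)" for k
      by (simp add: c_def h_def w_def bounded_clinear_minus[OF N2.bcf])
    then show ?thesis using interleaved_sums[OF t1 t2] by (simp add: sums_iff)
  qed
  moreover have "(\<Sum>k. - (of_real (b k) * g k (z k))) = - N2.tr (\<lambda>x. x)"
    unfolding N2.tr_def by (rule suminf_minus[OF N2.summable_trace[OF bounded_clinear_ident]])
  ultimately show ?thesis by (simp add: N1.tr_def)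
qed

section \<open>Products of nuclear operators\<close>

text \<open>Among the unit vectors orthogonal to \<open>Y\<close> the supremum of \<open>|M x|\<close> need not be attained, but half
  of it is exceeded. The zero vector is admitted for the case that \<open>M\<close> vanishes on the complement.\<close>

definition near_maximizer :: "(ell2 \<Rightarrow> ell2) \<Rightarrow> ell2 set \<Rightarrow> ell2 \<Rightarrow> bool"
  where "near_maximizer M Y x \<longleftrightarrow> (norm x = 1 \<or> x = 0) \<and> (\<forall>y\<in>Y. cinner x y = 0) \<and>
    (\<forall>z. (\<forall>y\<in>Y. cinner z y = 0) \<longrightarrow> norm (M z) \<le> 2 * norm (M x) * norm z)"

lemma near_maximizer_exists:
  assumes M: "bounded_clinear M"
  shows "\<exists>x. near_maximizer M Y x"
proof (cases "\<exists>z. (\<forall>y\<in>Y. cinner z y = 0) \<and> M z \<noteq> 0")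
  case False
  then show ?thesis
    by (intro exI[of _ 0]) (auto simp: near_maximizer_def bounded_clinear_zero[OF M])
next
  case True
  then obtain z0 where z0: "\<forall>y\<in>Y. cinner z0 y = 0" "M z0 \<noteq> 0" by blast
  obtain K where K: "K > 0" "\<And>x. norm (M x) \<le> K * norm x" using bounded_clinear_bound[OF M] by blast
  define Z where "Z = {z. norm z = 1 \<and> (\<forall>y\<in>Y. cinner z y = 0)}"
  define s where "s = Sup ((\<lambda>z. norm (M z)) ` Z)"
  have bdd: "bdd_above ((\<lambda>z. norm (M z)) ` Z)"
  proof (rule bdd_aboveI2)
    show "norm (M z) \<le> K" if "z \<in> Z" for z using K(2)[of z] that by (simp add: Z_def)
  qed
  have unit: "inverse (complex_of_real (norm z)) *\<^sub>C z \<in> Z" if "\<forall>y\<in>Y. cinner z y = 0" "z \<noteq> 0" for z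
    using that by (simp add: Z_def norm_scaleC norm_inverse norm_divide cinner_scale_left)
  have le: "norm (M z) \<le> s * norm z" if "\<forall>y\<in>Y. cinner z y = 0" for z
  proof (cases "z = 0")
    case False
    have "norm (M (inverse (complex_of_real (norm z)) *\<^sub>C z)) \<le> s"
      unfolding s_def using unit[OF that False] bdd by (intro cSup_upper) auto
    then have "norm (M z) / norm z \<le> s"
      by (simp add: bounded_clinear_scaleC[OF M] norm_scaleC norm_inverse norm_divide divide_inverse mult.commute)
    then show ?thesis using False by (simp add: pos_divide_le_eq)
  qed (simp add: bounded_clinear_zero[OF M])
  have z00: "z0 \<noteq> 0" using z0(2) bounded_clinear_zero[OF M] by auto
  have "0 < norm (M z0)" using z0(2) by simp
  also have "\<dots> \<le> s * norm z0" by (rule le[OF z0(1)])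
  finally have s: "s > 0" by (simp add: zero_less_mult_iff)
  have "\<exists>v\<in>(\<lambda>z. norm (M z)) ` Z. s / 2 < v"
    unfolding s_def by (rule less_cSupD) (use unit[OF z0(1) z00] s in \<open>auto simp: s_def\<close>)
  then obtain x where x: "x \<in> Z" "s / 2 < norm (M x)" by blast
  have "norm (M z) \<le> 2 * norm (M x) * norm z" if "\<forall>y\<in>Y. cinner z y = 0" for z
  proof -
    have "norm (M z) \<le> s * norm z" by (rule le[OF that])
    also have "\<dots> \<le> (2 * norm (M x)) * norm z" using x(2) by (intro mult_right_mono) auto
    finally show ?thesis .
  qed
  then show ?thesis using x(1) by (intro exI[of _ x]) (auto simp: near_maximizer_def Z_def)
qed

primrec greedy_list :: "(ell2 \<Rightarrow> ell2) \<Rightarrow> nat \<Rightarrow> ell2 list" where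
  "greedy_list M 0 = []"
| "greedy_list M (Suc n) = greedy_list M n @ [SOME x. near_maximizer M (set (greedy_list M n)) x]"

text \<open>A Hilbert--Schmidt operator is of order \<open>1 / \<surd>j\<close> on the complement of \<open>j\<close> suitable vectors:
  choose them one after another so that they almost maximize \<open>|M x|\<close>.\<close>

lemma greedy_orthosystem:
  fixes M :: "ell2 \<Rightarrow> ell2"
  assumes M: "bounded_clinear M"
    and H: "\<And>x n. orthosystem x \<Longrightarrow> (\<Sum>j<n. (norm (M (x j)))\<^sup>2) \<le> H"
  obtains x where "orthosystem x"
    "\<And>j z. (\<And>i. i < j \<Longrightarrow> cinner z (x i) = 0) \<Longrightarrow> norm (M z) \<le> sqrt (4 * H / real (Suc j)) * norm z"
proof -
  define x where "x n = last (greedy_list M (Suc n))" for n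
  have set_list: "set (greedy_list M n) = x ` {..<n}" for n
    by (induction n) (auto simp: x_def lessThan_Suc)
  have nm: "near_maximizer M (x ` {..<n}) (x n)" for n
    using someI_ex[OF near_maximizer_exists[OF M, of "set (greedy_list M n)"]]
    by (simp add: x_def[of n] set_list)
  have lt: "cinner (x i) (x j) = 0" if "j < i" for i j
    using nm[of i] that by (auto simp: near_maximizer_def)
  have os: "orthosystem x"
    unfolding orthosystem_def
  proof (intro conjI allI impI)
    show "norm (x i) = 1 \<or> x i = 0" for i using nm[of i] by (simp add: near_maximizer_def)
    show "cinner (x i) (x j) = 0" if "i \<noteq> j" for i j
    proof (cases "j < i")
      case False
      then have "cinner (x j) (x i) = 0" using that lt[of i j] by simp
      then show ?thesis by (subst cinner_commute) simp
    qed (rule lt)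
  qed
  show ?thesis
  proof (rule that[OF os])
    fix j z assume z: "\<And>i. i < j \<Longrightarrow> cinner z (x i) = 0"
    have "(norm (M z))\<^sup>2 \<le> 4 * (norm z)\<^sup>2 * (norm (M (x i)))\<^sup>2" if "i \<le> j" for i
    proof -
      have "norm (M z) \<le> 2 * norm (M (x i)) * norm z"
        using nm[of i] z that by (auto simp: near_maximizer_def)
      then have "(norm (M z))\<^sup>2 \<le> (2 * norm (M (x i)) * norm z)\<^sup>2" by (intro power_mono) auto
      then show ?thesis by (simp add: power_mult_distrib mult_ac)
    qed
    then have "(\<Sum>i<Suc j. (norm (M z))\<^sup>2) \<le> (\<Sum>i<Suc j. 4 * (norm z)\<^sup>2 * (norm (M (x i)))\<^sup>2)"
      by (intro sum_mono) auto
    then have "real (Suc j) * (norm (M z))\<^sup>2 \<le> 4 * (norm z)\<^sup>2 * (\<Sum>i<Suc j. (norm (M (x i)))\<^sup>2)"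
      by (simp only: sum_constant card_lessThan sum_distrib_left)
    also have "\<dots> \<le> 4 * (norm z)\<^sup>2 * H" by (intro mult_left_mono H[OF os]) auto
    finally have "(norm (M z))\<^sup>2 \<le> 4 * H / real (Suc j) * (norm z)\<^sup>2" by (simp add: field_simps)
    then have "norm (M z) \<le> sqrt (4 * H / real (Suc j) * (norm z)\<^sup>2)" by (rule real_le_rsqrt)
    then show "norm (M z) \<le> sqrt (4 * H / real (Suc j)) * norm z"
      by (simp only: real_sqrt_mult real_sqrt_abs abs_norm_cancel)
  qed
qed

lemma quarter_le: "real (Suc k) / 4 \<le> real (k div 4 + 1)"
proof -
  have "Suc k \<le> 4 * (k div 4 + 1)" by presburger
  then have "real (Suc k) \<le> real (4 * (k div 4 + 1))" by (simp only: of_nat_le_iff)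
  then show ?thesis by simp
qed

lemma divide_quarter_square: "c / (real (Suc k) / 4)\<^sup>2 = (16 * c) * real (Suc k) powr (-2)"
proof -
  have "x powr (-2) = 1 / x\<^sup>2" if "x > 0" for x :: real
    using that by (simp add: powr_minus_divide)
  from this[of "real (Suc k)"] show ?thesis by (simp add: power_divide del: of_nat_Suc)
qed

lemma summable_quarter_powr:
  assumes "c > 0"
  shows "summable (\<lambda>k. (c / (real (k div 4 + 1))\<^sup>2) powr (2/3))"
proof (rule summable_comparison_test')
  have "summable (\<lambda>k. real (Suc k) powr (-4/3))"
    by (subst summable_Suc_iff) (simp add: summable_real_powr_iff)
  then show "summable (\<lambda>k. (16 * c) powr (2/3) * real (Suc k) powr (-4/3))" by (rule summable_mult)
  fix k
  have "(real (Suc k) / 4)\<^sup>2 \<le> (real (k div 4 + 1))\<^sup>2"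
    by (intro power_mono quarter_le) auto
  then have "c / (real (k div 4 + 1))\<^sup>2 \<le> c / (real (Suc k) / 4)\<^sup>2"
    using assms by (intro divide_left_mono) auto
  also have "\<dots> = (16 * c) * real (Suc k) powr (-2)"
    by (rule divide_quarter_square)
  finally have "(c / (real (k div 4 + 1))\<^sup>2) powr (2/3) \<le> ((16 * c) * real (Suc k) powr (-2)) powr (2/3)"
    using assms by (intro powr_mono2) auto
  also have "\<dots> = (16 * c) powr (2/3) * real (Suc k) powr (-4/3)"
    using assms by (simp add: powr_mult powr_powr)
  finally show "norm ((c / (real (k div 4 + 1))\<^sup>2) powr (2/3)) \<le> (16 * c) powr (2/3) * real (Suc k) powr (-4/3)" by simp
qed

lemma summable_quarter:
  "summable (\<lambda>k. c / (real (k div 4 + 1))\<^sup>2)"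
proof (rule summable_comparison_test')
  have "summable (\<lambda>k. real (Suc k) powr (-2))"
    by (subst summable_Suc_iff) (simp add: summable_real_powr_iff)
  then show "summable (\<lambda>k. (16 * \<bar>c\<bar>) * real (Suc k) powr (-2))" by (rule summable_mult)
  fix k
  have "(real (Suc k) / 4)\<^sup>2 \<le> (real (k div 4 + 1))\<^sup>2"
    by (intro power_mono quarter_le) auto
  then have "\<bar>c\<bar> / (real (k div 4 + 1))\<^sup>2 \<le> \<bar>c\<bar> / (real (Suc k) / 4)\<^sup>2"
    by (intro divide_left_mono) auto
  also have "\<dots> = (16 * \<bar>c\<bar>) * real (Suc k) powr (-2)"
    by (rule divide_quarter_square)
  finally show "norm (c / (real (k div 4 + 1))\<^sup>2) \<le> (16 * \<bar>c\<bar>) * real (Suc k) powr (-2)" by simp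
qed

context nuclear_series
begin

definition syn :: "ell2 \<Rightarrow> 'a" where "syn = synthesis (\<lambda>k. sqrt (a k)) y"
definition ana :: "'a \<Rightarrow> ell2" where "ana = analysis (\<lambda>k. sqrt (a k)) f"

text \<open>The factorization \<open>A = syn \<circ> ana\<close> through the sequence space, with the factors interchanged.\<close>

definition gram :: "ell2 \<Rightarrow> ell2" where "gram c = ana (syn c)"

lemma sb: "summable (\<lambda>k. (sqrt (a k))\<^sup>2)" using summable_a by (simp add: a_nonneg)

lemma bc_syn: "bounded_clinear syn" unfolding syn_def by (rule bounded_clinear_synthesis[OF sb y_le])
lemma bc_ana: "bounded_clinear ana" unfolding ana_def by (rule bounded_clinear_analysis[OF sb bcf f_le])
lemma bc_gram: "bounded_clinear gram" unfolding gram_def[abs_def] by (rule bounded_clinear_compose[OF bc_ana bc_syn])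

lemma coord_ana: "coord (ana x) k = of_real (sqrt (a k)) * f k x"
  unfolding ana_def by (rule coord_analysis[OF sb bcf f_le])

lemma syn_ana: "syn (ana x) = A x"
proof -
  have "syn (ana x) = (\<Sum>k. (of_real (a k) * f k x) *\<^sub>C y k)"
    unfolding syn_def synthesis_def coord_ana by (rule suminf_cong) (simp only: mult.assoc[symmetric] sqrt_a)
  then show ?thesis using sums_unique[OF A_sums[of x]] by simp
qed

lemma syn_gram_power: "syn ((gram ^^ k) c) = (A ^^ k) (syn c)"
  by (induction k) (simp_all add: gram_def syn_ana)

text \<open>Row \<open>k\<close> of \<open>gram\<close> is \<open>\<surd>(a k)\<close> times a bounded functional, so Bessel's inequality can be applied to
  each row and summed.\<close>

lemma gram_hilbert_schmidt:
  obtains H where "\<And>x n. orthosystem x \<Longrightarrow> (\<Sum>j<n. (norm (gram (x j)))\<^sup>2) \<le> H"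
proof -
  obtain C where C: "C > 0" "\<And>c. norm (syn c) \<le> C * norm c" using bounded_clinear_bound[OF bc_syn] by blast
  have "\<exists>r. (\<forall>x. f k (syn x) = cinner x r) \<and> norm r \<le> C" for k
  proof (rule ell2_riesz_representation[OF bounded_clinear_compose[OF bcf bc_syn], of k C])
    show "cmod (f k (syn x)) \<le> C * norm x" for x using f_le[of k "syn x"] C(2)[of x] by linarith
  qed (use C in auto)
  then obtain r where r: "\<And>k x. f k (syn x) = cinner x (r k)" "\<And>k. norm (r k) \<le> C" by metis
  have "(\<Sum>j<n. (norm (gram (x j)))\<^sup>2) \<le> (\<Sum>k. a k * C\<^sup>2)" if x: "orthosystem x" for x n
  proof -
    have sq: "(cmod (coord (gram z) k))\<^sup>2 = a k * (cmod (cinner z (r k)))\<^sup>2" for z k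
      using a_nonneg[of k] by (simp add: gram_def coord_ana r(1) norm_mult power_mult_distrib)
    have sm: "summable (\<lambda>k. a k * (cmod (cinner z (r k)))\<^sup>2)" for z
      using summable_coord[of "gram z"] by (simp only: sq)
    have "(\<Sum>j<n. (norm (gram (x j)))\<^sup>2) = (\<Sum>j<n. \<Sum>k. a k * (cmod (cinner (x j) (r k)))\<^sup>2)"
      unfolding norm_ell2_sq sq ..
    also have "\<dots> = (\<Sum>k. \<Sum>j<n. a k * (cmod (cinner (x j) (r k)))\<^sup>2)"
      by (rule suminf_sum[symmetric]) (rule sm)
    also have "\<dots> \<le> (\<Sum>k. a k * C\<^sup>2)"
    proof (rule suminf_le)
      show "summable (\<lambda>k. \<Sum>j<n. a k * (cmod (cinner (x j) (r k)))\<^sup>2)" by (rule summable_sum) (rule sm)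
      show "summable (\<lambda>k. a k * C\<^sup>2)" by (rule summable_mult2[OF summable_a])
      fix k
      have "(\<Sum>j<n. (cmod (cinner (x j) (r k)))\<^sup>2) = (\<Sum>j<n. (cmod (cinner (r k) (x j)))\<^sup>2)"
        by (rule sum.cong[OF refl], subst cinner_commute) simp
      also have "\<dots> \<le> (norm (r k))\<^sup>2" by (rule bessel[OF x])
      also have "\<dots> \<le> C\<^sup>2" using r(2) by (intro power_mono) auto
      finally show "(\<Sum>j<n. a k * (cmod (cinner (x j) (r k)))\<^sup>2) \<le> a k * C\<^sup>2"
        unfolding sum_distrib_left[symmetric] using a_nonneg by (intro mult_left_mono) auto
    qed
    finally show ?thesis .
  qed
  then show ?thesis using that by blast
qed

text \<open>Let \<open>gram\<close> be of order \<open>1 / \<surd>j\<close> on the complement of \<open>x\<^sub>0, \<dots>, x\<^bsub>j-1\<^esub>\<close>. If \<open>z\<close> is orthogonal to the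
  \<open>4 j\<close> vectors \<open>(gram\<^sup>*)\<^sup>t x\<^sub>i\<close> with \<open>i < j\<close> and \<open>t < 4\<close>, this gain is available at each of the four
  applications of \<open>gram\<close> to \<open>z\<close>.\<close>

lemma gram_power_decay:
  obtains e c where "orthosystem e" "c > 0"
    "\<And>k z. (\<And>i. i < k \<Longrightarrow> cinner z (e i) = 0) \<Longrightarrow> norm ((gram ^^ 4) z) \<le> c / (real (k div 4 + 1))\<^sup>2 * norm z"
proof -
  obtain H where H: "\<And>x n. orthosystem x \<Longrightarrow> (\<Sum>j<n. (norm (gram (x j)))\<^sup>2) \<le> H"
    using gram_hilbert_schmidt by blast
  have "H \<ge> (\<Sum>j<(1::nat). (norm (gram ((\<lambda>_. 0) j)))\<^sup>2)"
    by (rule H) (simp add: orthosystem_def)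
  then have H0: "H \<ge> 0" by (simp add: bounded_clinear_zero[OF bc_gram])
  obtain x where x: "orthosystem x"
    "\<And>j z. (\<And>i. i < j \<Longrightarrow> cinner z (x i) = 0) \<Longrightarrow> norm (gram z) \<le> sqrt (4 * H / real (Suc j)) * norm z"
    using greedy_orthosystem[OF bc_gram H] by blast
  have "\<exists>v. \<forall>z. cinner ((gram ^^ (k mod 4)) z) (x (k div 4)) = cinner z v" for k
  proof -
    have bc: "bounded_clinear (\<lambda>z. cinner ((gram ^^ (k mod 4)) z) (x (k div 4)))"
      by (rule bounded_clinear_compose[OF bounded_clinear_cinner bounded_clinear_funpow[OF bc_gram]])
    obtain K where K: "K > 0" "\<And>z. norm (cinner ((gram ^^ (k mod 4)) z) (x (k div 4))) \<le> K * norm z"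
      using bounded_clinear_bound[OF bc] by blast
    show ?thesis
      by (rule ell2_riesz_representation[OF bc K(2)]) (use K(1) in auto)
  qed
  then obtain v where v: "\<And>k z. cinner ((gram ^^ (k mod 4)) z) (x (k div 4)) = cinner z (v k)" by metis
  define e where "e = orthonormalize v"
  define c where "c = 16 * H\<^sup>2 + 1"
  show ?thesis
  proof (rule that[of e c])
    show "orthosystem e" unfolding e_def by (rule orthosystem_orthonormalize)
    show "c > 0" using zero_le_power2[of H] by (simp add: c_def add_nonneg_pos)
    fix k z assume z: "\<And>i. i < k \<Longrightarrow> cinner z (e i) = 0"
    let ?j = "k div 4"
    let ?d = "sqrt (4 * H / real (Suc ?j))"
    have zv: "cinner z (v i) = 0" if "i < k" for i
      by (rule orthogonal_orthonormalize[of k]) (use z that in \<open>auto simp: e_def\<close>)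
    have orth: "cinner ((gram ^^ t) z) (x i) = 0" if "i < ?j" "t < 4" for i t
    proof -
      have "4 * i + t < k" using that by linarith
      moreover have "(4 * i + t) mod 4 = t" "(4 * i + t) div 4 = i" using that by auto
      ultimately show ?thesis using v[of "4 * i + t" z] zv by simp
    qed
    have "norm ((gram ^^ t) z) \<le> ?d ^ t * norm z" if "t \<le> 4" for t
      using that
    proof (induction t)
      case (Suc t)
      have "norm (gram ((gram ^^ t) z)) \<le> ?d * norm ((gram ^^ t) z)"
        by (rule x(2)) (use orth Suc.prems in auto)
      also have "\<dots> \<le> ?d * (?d ^ t * norm z)"
        using Suc H0 by (intro mult_left_mono) auto
      finally show ?case by (simp add: mult.assoc)
    qed simp
    from this[of 4] have "norm ((gram ^^ 4) z) \<le> ?d ^ 4 * norm z" by simp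
    also have "?d ^ 4 = 16 * H\<^sup>2 / (real (?j + 1))\<^sup>2"
    proof -
      have "?d ^ 4 = (?d\<^sup>2)\<^sup>2" by simp
      also have "?d\<^sup>2 = 4 * H / real (Suc ?j)" using H0 by simp
      finally show ?thesis by (simp add: power_divide power_mult_distrib)
    qed
    also have "16 * H\<^sup>2 / (real (?j + 1))\<^sup>2 * norm z \<le> c / (real (?j + 1))\<^sup>2 * norm z"
      by (intro mult_right_mono divide_right_mono) (auto simp: c_def)
    finally show "norm ((gram ^^ 4) z) \<le> c / (real (?j + 1))\<^sup>2 * norm z" .
  qed
qed

text \<open>Write \<open>T\<^sup>n\<close> as \<open>syn \<circ> gram\<^sup>4 \<circ> ana \<circ> T\<^sup>l\<close> with \<open>l = n - 5 q\<close>, and expand along the orthonormal system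
  for which \<open>gram\<^sup>4\<close> decays like \<open>1 / k\<^sup>2\<close>. In the resulting series for \<open>T\<^sup>n\<close> the coefficients
  to the power \<open>2/3\<close> are of order \<open>k powr (- 4/3)\<close>, hence summable. Its trace is computed in another basis of the sequence space than \<open>tr\<close>, with the same result.\<close>

theorem rapidly_converging_series:
  assumes T: "bounded_clinear T" and A: "A = T ^^ q" and n: "n \<ge> 5 * q"
  obtains a' f' y' where "nuclear_series (T ^^ n) a' f' y'" "\<And>k. a' k > 0"
    "summable (\<lambda>k. a' k powr (2/3))" "nuclear_series.tr a' f' y' (\<lambda>x. x) = tr (T ^^ (n - q))"
proof -
  define l where "l = n - 5 * q"
  obtain e c where e: "orthosystem e" and c: "c > 0"
    and decay: "\<And>k z. (\<And>i. i < k \<Longrightarrow> cinner z (e i) = 0) \<Longrightarrow> norm ((gram ^^ 4) z) \<le> c / (real (k div 4 + 1))\<^sup>2 * norm z"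
    by (rule gram_power_decay) blast
  define \<gamma> where "\<gamma> k = c / (real (k div 4 + 1))\<^sup>2" for k
  have \<gamma>0: "\<gamma> k > 0" for k using c by (simp add: \<gamma>_def)
  have s\<gamma>: "summable \<gamma>" unfolding \<gamma>_def by (rule summable_quarter)
  define S where "S z = syn ((gram ^^ 4) z)" for z
  define W where "W x = ana ((T ^^ l) x)" for x
  have bcG: "bounded_clinear (gram ^^ 4)" by (rule bounded_clinear_funpow[OF bc_gram])
  have bcS: "bounded_clinear S" unfolding S_def[abs_def] by (rule bounded_clinear_compose[OF bc_syn bcG])
  have bcW: "bounded_clinear W" unfolding W_def[abs_def]
    by (rule bounded_clinear_compose[OF bc_ana bounded_clinear_funpow[OF T]])
  obtain CV where CV: "CV > 0" "\<And>z. norm (syn z) \<le> CV * norm z" using bounded_clinear_bound[OF bc_syn] by blast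
  obtain CW where CW: "CW > 0" "\<And>x. norm (W x) \<le> CW * norm x" using bounded_clinear_bound[OF bcW] by blast
  have Sdecay: "norm (S z) \<le> CV * \<gamma> k * norm z" if "\<And>i. i < k \<Longrightarrow> cinner z (e i) = 0" for z k
  proof -
    have "norm (S z) \<le> CV * norm ((gram ^^ 4) z)" unfolding S_def by (rule CV(2))
    also have "\<dots> \<le> CV * (\<gamma> k * norm z)" using decay[OF that] CV(1) by (intro mult_left_mono) (auto simp: \<gamma>_def)
    finally show ?thesis by (simp add: mult.assoc)
  qed
  have eS: "norm (S (e k)) \<le> CV * \<gamma> k" for k
  proof -
    have "norm (S (e k)) \<le> CV * \<gamma> k * norm (e k)" by (rule Sdecay) (use e in \<open>auto simp: orthosystem_def\<close>)
    also have "\<dots> \<le> CV * \<gamma> k * 1" using orthosystem_norm_le[OF e] CV(1) \<gamma>0 by (intro mult_left_mono) (auto simp: less_imp_le)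
    finally show ?thesis by simp
  qed
  have S_sums: "(\<lambda>k. cinner z (e k) *\<^sub>C S (e k)) sums S z" for z
  proof -
    have "norm ((\<Sum>k<N. cinner z (e k) *\<^sub>C S (e k)) - S z) \<le> CV * \<gamma> N * norm z" for N
    proof -
      have "(\<Sum>k<N. cinner z (e k) *\<^sub>C S (e k)) - S z = - S (z - projection e N z)"
        by (simp add: bounded_clinear_diff[OF bcS] projection_def bounded_clinear_sum[OF bcS] bounded_clinear_scaleC[OF bcS])
      also have "norm \<dots> \<le> CV * \<gamma> N * norm (z - projection e N z)"
        unfolding norm_minus_cancel by (rule Sdecay) (rule cinner_diff_projection[OF e])
      also have "\<dots> \<le> CV * \<gamma> N * norm z"
        using CV(1) \<gamma>0 by (intro mult_left_mono norm_diff_projection_le[OF e]) (auto simp: less_imp_le)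
      finally show ?thesis .
    qed
    then have ev: "\<forall>\<^sub>F N in sequentially. norm ((\<Sum>k<N. cinner z (e k) *\<^sub>C S (e k)) - S z) \<le> CV * \<gamma> N * norm z"
      by (rule always_eventually[OF allI])
    have "(\<lambda>N. CV * \<gamma> N * norm z) \<longlonglongrightarrow> CV * 0 * norm z"
      by (intro tendsto_mult tendsto_const summable_LIMSEQ_zero[OF s\<gamma>])
    then have "(\<lambda>N. CV * \<gamma> N * norm z) \<longlonglongrightarrow> 0" by simp
    from Lim_null_comparison[OF ev this]
    have "(\<lambda>N. (\<Sum>k<N. cinner z (e k) *\<^sub>C S (e k)) - S z) \<longlonglongrightarrow> 0" .
    then show ?thesis unfolding sums_def by (rule LIM_zero_cancel)
  qed
  have Tn: "S (W x) = (T ^^ n) x" for x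
  proof -
    have "S (W x) = (A ^^ 4) (A ((T ^^ l) x))" by (simp add: S_def W_def syn_gram_power syn_ana)
    also have "\<dots> = (T ^^ (q * 4 + (q + l))) x"
      by (simp only: A funpow_mult funpow_add comp_apply)
    also have "q * 4 + (q + l) = n" using n by (simp add: l_def)
    finally show ?thesis .
  qed
  define a' where "a' k = CW * CV * \<gamma> k" for k
  define f' where "f' k x = cinner (W x) (e k) / of_real CW" for k x
  define y' where "y' k = (1 / of_real (CV * \<gamma> k)) *\<^sub>C S (e k)" for k
  have term_eq: "(of_real (a' k) * f' k x) *\<^sub>C y' k = cinner (W x) (e k) *\<^sub>C S (e k)" for k x
    using CV(1) CW(1) \<gamma>0[of k] by (simp add: a'_def f'_def y'_def scaleC_scaleC)
  have ns: "nuclear_series (T ^^ n) a' f' y'"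
  proof
    show "0 \<le> a' k" for k using CV(1) CW(1) \<gamma>0[of k] by (simp add: a'_def)
    show "summable a'" unfolding a'_def by (rule summable_mult[OF s\<gamma>])
    show f'le: "cmod (f' k x) \<le> norm x" for k x
    proof -
      have "cmod (cinner (W x) (e k)) \<le> norm (W x) * norm (e k)" by (rule cmod_cinner_le)
      also have "\<dots> \<le> (CW * norm x) * 1"
        using CW orthosystem_norm_le[OF e] by (intro mult_mono) auto
      finally show ?thesis using CW(1) by (simp add: f'_def norm_divide pos_divide_le_eq mult.commute)
    qed
    show "bounded_clinear (f' k)" for k
    proof (rule bounded_clinearI)
      show "norm (f' k x) \<le> 1 * norm x" for x using f'le by simp
    qed (simp_all add: f'_def bounded_clinear_add[OF bcW] bounded_clinear_scaleC[OF bcW] cinner_add_left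
        cinner_scale_left add_divide_distrib scaleC_complex_def)
    show "norm (y' k) \<le> 1" for k
      using eS[of k] CV(1) \<gamma>0[of k] by (simp add: y'_def norm_scaleC norm_divide norm_mult divide_le_eq)
    show "(\<lambda>k. (of_real (a' k) * f' k x) *\<^sub>C y' k) sums (T ^^ n) x" for x
      unfolding term_eq Tn[symmetric] by (rule S_sums)
  qed
  show ?thesis
  proof (rule that[OF ns])
    show "a' k > 0" for k using CV(1) CW(1) \<gamma>0[of k] by (simp add: a'_def)
    have "summable (\<lambda>k. ((CW * CV * c) / (real (k div 4 + 1))\<^sup>2) powr (2/3))"
      by (rule summable_quarter_powr) (use CV(1) CW(1) c in auto)
    then show "summable (\<lambda>k. a' k powr (2/3))" by (simp add: a'_def \<gamma>_def)
    define N where "N z = W (S z)" for z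
    have bcN: "bounded_clinear N" unfolding N_def[abs_def] by (rule bounded_clinear_compose[OF bcW bcS])
    have Ne: "norm (N (e i)) \<le> CW * CV * \<gamma> i" for i
    proof -
      have "norm (N (e i)) \<le> CW * norm (S (e i))" unfolding N_def by (rule CW(2))
      also have "\<dots> \<le> CW * (CV * \<gamma> i)" using eS CW(1) by (intro mult_left_mono) auto
      finally show ?thesis by simp
    qed
    have diag: "coord (N (ell2_unit k)) k = of_real (a k) * f k ((T ^^ (n - q)) (y k))" for k
    proof -
      have "N (ell2_unit k) = ana ((T ^^ l) ((A ^^ 4) (of_real (sqrt (a k)) *\<^sub>C y k)))"
        by (simp add: N_def W_def S_def syn_gram_power) (simp add: syn_def synthesis_unit)
      also have "\<dots> = ana ((T ^^ (l + q * 4)) (of_real (sqrt (a k)) *\<^sub>C y k))"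
        by (simp only: A funpow_mult funpow_add comp_apply)
      also have "l + q * 4 = n - q" using n by (simp add: l_def)
      finally have "coord (N (ell2_unit k)) k = of_real (sqrt (a k)) * (of_real (sqrt (a k)) * f k ((T ^^ (n - q)) (y k)))"
        by (simp add: coord_ana bounded_clinear_scaleC[OF bounded_clinear_funpow[OF T]] bounded_clinear_scaleC[OF bcf] scaleC_complex_def)
      then show ?thesis by (simp only: mult.assoc[symmetric] sqrt_a)
    qed
    have N_sums: "(\<lambda>i. cinner z (e i) *\<^sub>C N (e i)) sums N z" for z
      using bounded_linear.sums[OF bounded_clinear_imp_bounded_linear[OF bcW] S_sums[of z]]
      by (simp add: N_def bounded_clinear_scaleC[OF bcW])
    have diag_sums: "(\<lambda>i. coord (N (e i)) k * cnj (coord (e i) k)) sums coord (N (ell2_unit k)) k" for k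
      using bounded_linear.sums[OF bounded_clinear_imp_bounded_linear[OF bounded_clinear_coord] N_sums[of "ell2_unit k"], of k]
      by (simp add: mult.commute)
    have sN: "summable (\<lambda>i. CW * CV * \<gamma> i)" by (rule summable_mult[OF s\<gamma>])
    have "(\<lambda>K. \<Sum>i. \<Sum>k<K. coord (N (e i)) k * cnj (coord (e i) k)) \<longlonglongrightarrow> (\<Sum>i. cinner (N (e i)) (e i))"
    proof -
      have lim: "(\<lambda>K. \<Sum>k<K. coord (N (e i)) k * cnj (coord (e i) k)) \<longlonglongrightarrow> cinner (N (e i)) (e i)" for i
        unfolding cinner_def by (rule summable_LIMSEQ[OF summable_cinner])
      have "norm (\<Sum>k<K. coord (N (e i)) k * cnj (coord (e i) k)) \<le> CW * CV * \<gamma> i" for i K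
      proof -
        have "(\<Sum>k<K. coord (N (e i)) k * cnj (coord (e i) k)) = cinner (\<Sum>k<K. coord (N (e i)) k *\<^sub>C ell2_unit k) (e i)"
          by (simp add: cinner_sum_left cinner_scale_left)
        also have "cmod \<dots> \<le> norm (\<Sum>k<K. coord (N (e i)) k *\<^sub>C ell2_unit k) * norm (e i)" by (rule cmod_cinner_le)
        also have "\<dots> \<le> norm (N (e i)) * 1"
        proof (rule mult_mono)
          show "norm (\<Sum>k<K. coord (N (e i)) k *\<^sub>C ell2_unit k) \<le> norm (N (e i))"
          proof (rule norm_ell2_leI)
            fix m
            have "(\<Sum>j<m. (cmod (coord (\<Sum>k<K. coord (N (e i)) k *\<^sub>C ell2_unit k) j))\<^sup>2) \<le> (\<Sum>j<m. (cmod (coord (N (e i)) j))\<^sup>2)"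
              by (rule sum_mono) (simp add: coord_sum if_distrib[of "\<lambda>u. _ * u"] cong: if_cong)
            also have "\<dots> \<le> (norm (N (e i)))\<^sup>2" by (rule sum_coord_le_norm)
            finally show "(\<Sum>j<m. (cmod (coord (\<Sum>k<K. coord (N (e i)) k *\<^sub>C ell2_unit k) j))\<^sup>2) \<le> (norm (N (e i)))\<^sup>2" .
          qed simp
        qed (auto simp: orthosystem_norm_le[OF e])
        finally show ?thesis using Ne[of i] by simp
      qed
      then have "\<forall>\<^sub>F (i, K) in sequentially \<times>\<^sub>F sequentially. norm (\<Sum>k<K. coord (N (e i)) k * cnj (coord (e i) k)) \<le> CW * CV * \<gamma> i"
        by (intro always_eventually) auto
      from tannerys_theorem[OF lim this sN] show ?thesis by simp
    qed
    moreover have "(\<Sum>i. \<Sum>k<K. coord (N (e i)) k * cnj (coord (e i) k)) = (\<Sum>k<K. of_real (a k) * f k ((T ^^ (n - q)) (y k)))" for K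
      using sums_sum[of "{..<K}" "\<lambda>k i. coord (N (e i)) k * cnj (coord (e i) k)", OF diag_sums]
      by (simp add: sums_iff diag)
    ultimately have lim1: "(\<lambda>K. \<Sum>k<K. of_real (a k) * f k ((T ^^ (n - q)) (y k))) \<longlonglongrightarrow> (\<Sum>i. cinner (N (e i)) (e i))" by simp
    have "(\<lambda>K. \<Sum>k<K. of_real (a k) * f k ((T ^^ (n - q)) (y k))) \<longlonglongrightarrow> tr (T ^^ (n - q))"
      unfolding tr_def by (rule summable_LIMSEQ[OF summable_trace[OF bounded_clinear_funpow[OF T]]])
    with lim1 have "(\<Sum>i. cinner (N (e i)) (e i)) = tr (T ^^ (n - q))" by (rule LIMSEQ_unique)
    moreover have "of_real (a' i) * f' i (y' i) = cinner (N (e i)) (e i)" for i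
      using CV(1) CW(1) \<gamma>0[of i]
      by (simp add: a'_def f'_def y'_def N_def bounded_clinear_scaleC[OF bcW] cinner_scale_left)
    ultimately show "nuclear_series.tr a' f' y' (\<lambda>x. x) = tr (T ^^ (n - q))"
      by (simp add: nuclear_series.tr_def[OF ns])
  qed
qed

end

lemma sums_extended_by_zero:
  fixes g g' :: "nat \<Rightarrow> 'b::{comm_monoid_add, topological_space}"
  assumes "(g has_sum t) I" "\<And>k. k \<in> I \<Longrightarrow> g' k = g k" "\<And>k. k \<notin> I \<Longrightarrow> g' k = 0"
  shows "g' sums t"
proof -
  have "(g' has_sum t) UNIV \<longleftrightarrow> (g has_sum t) I"
    by (rule has_sum_cong_neutral) (use assms in auto)
  then show ?thesis using assms(1) has_sum_imp_sums by blast
qed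

text \<open>Terms outside the index set are replaced by zero.\<close>

lemma nuclear_representation_series:
  fixes A :: "'a::complex_banach \<Rightarrow> 'a"
  assumes "nuclear_representation A q a f y"
  obtains a' f' y' where "nuclear_series A a' f' y'"
    "(\<lambda>k. a k powr (2/3)) summable_on index_set q \<Longrightarrow> summable (\<lambda>k. a' k powr (2/3))"
    "\<And>t. ((\<lambda>k. of_real (a k) * f k (y k)) has_sum t) (index_set q) \<Longrightarrow> nuclear_series.tr a' f' y' (\<lambda>x. x) = t"
proof -
  let ?I = "index_set q"
  note rep = assms[unfolded nuclear_representation_def]
  define a' where "a' k = (if k \<in> ?I then a k else 0)" for k
  define f' where "f' k x = (if k \<in> ?I then f k x else 0)" for k x
  define y' where "y' k = (if k \<in> ?I then y k else 0)" for k
  have ns: "nuclear_series A a' f' y'"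
  proof
    show "0 \<le> a' k" for k using rep by (auto simp: a'_def less_imp_le)
    have "a summable_on ?I" using rep by blast
    then obtain t where "(a has_sum t) ?I" by (auto simp: summable_on_def)
    from sums_extended_by_zero[OF this, of a'] show "summable a'" by (auto simp: a'_def sums_iff)
    show f'le: "cmod (f' k x) \<le> norm x" for k x
    proof (cases "k \<in> ?I")
      case True
      then have "bounded_linear (f k)" "onorm (f k) \<le> 1" using rep by auto
      from onorm[OF this(1), of x] mult_right_mono[OF this(2), of "norm x"]
      have "norm (f k x) \<le> norm x" by simp
      then show ?thesis using True by (simp add: f'_def)
    qed (simp add: f'_def)
    show "bounded_clinear (f' k)" for k
    proof (cases "k \<in> ?I")
      case True
      then have "bounded_clinear (f k)" using rep by (auto simp: bounded_clinear_def)
      moreover have "f' k = f k" using True by (auto simp: f'_def)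
      ultimately show ?thesis by simp
    next
      case False
      then have "f' k = (\<lambda>x. 0)" by (auto simp: f'_def)
      then show ?thesis by (auto intro!: bounded_clinearI[where K = 0] simp: scaleC_complex_def)
    qed
    show "norm (y' k) \<le> 1" for k using rep by (auto simp: y'_def)
    show "(\<lambda>k. (of_real (a' k) * f' k x) *\<^sub>C y' k) sums A x" for x
      by (rule sums_extended_by_zero[where g = "\<lambda>k. (of_real (a k) * f k x) *\<^sub>C y k"]) (use rep in \<open>auto simp: a'_def f'_def y'_def\<close>)
  qed
  show ?thesis
  proof (rule that[OF ns])
    assume "(\<lambda>k. a k powr (2/3)) summable_on ?I"
    then obtain t where "((\<lambda>k. a k powr (2/3)) has_sum t) ?I" by (auto simp: summable_on_def)
    from sums_extended_by_zero[OF this, of "\<lambda>k. a' k powr (2/3)"] show "summable (\<lambda>k. a' k powr (2/3))"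
      by (auto simp: a'_def sums_iff)
  next
    fix t assume "((\<lambda>k. of_real (a k) * f k (y k)) has_sum t) ?I"
    from sums_extended_by_zero[OF this, of "\<lambda>k. of_real (a' k) * f' k (y' k)"]
    show "nuclear_series.tr a' f' y' (\<lambda>x. x) = t"
      unfolding nuclear_series.tr_def[OF ns] by (auto simp: a'_def f'_def y'_def sums_iff)
  qed
qed

text \<open>The indices of a nuclear representation start from 1.\<close>

lemma series_nuclear_representation:
  assumes "nuclear_series A a f y" "\<And>k. a k > 0" "summable (\<lambda>k. a k powr (2/3))"
  shows "\<exists>q a' f' y'. nuclear_representation A q a' f' y' \<and> (\<lambda>k. a' k powr (2/3)) summable_on index_set q \<and>
    ((\<lambda>k. of_real (a' k) * f' k (y' k)) has_sum nuclear_series.tr a f y (\<lambda>x. x)) (index_set q)"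
proof -
  interpret nuclear_series A a f y by fact
  have I: "index_set \<infinity> = range Suc"
    by (auto simp: index_set_def image_iff intro: gr0_implies_Suc[unfolded One_nat_def Suc_le_eq])
      (metis Suc_pred Suc_le_eq)
  have hs: "(g has_sum t) (index_set \<infinity>)" if "summable (\<lambda>k. norm (g (Suc k)))" "(\<lambda>k. g (Suc k)) sums t"
    for g :: "nat \<Rightarrow> 'b::banach" and t
    unfolding I by (subst has_sum_reindex) (use norm_summable_imp_has_sum[OF that] in \<open>auto simp: comp_def\<close>)
  let ?a = "\<lambda>k. a (k - 1)" and ?f = "\<lambda>k. f (k - 1)" and ?y = "\<lambda>k. y (k - 1)"
  have rep: "nuclear_representation A \<infinity> ?a ?f ?y"
    unfolding nuclear_representation_def
  proof (intro conjI ballI allI)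
    fix k
    show "?a k > 0" by (rule assms)
    show "clinear (?f k)" "bounded_linear (?f k)" using bcf by (auto simp: bounded_clinear_def)
    show "onorm (?f k) \<le> 1" by (rule onorm_bound) (use f_le in auto)
    show "norm (?y k) \<le> 1" by (rule y_le)
  next
    show "?a summable_on index_set \<infinity>"
      unfolding summable_on_def
      by (rule exI, rule hs[of ?a]) (use summable_a a_nonneg in \<open>auto intro: summable_sums\<close>)
    show "((\<lambda>k. (of_real (?a k) * ?f k x) *\<^sub>C ?y k) has_sum A x) (index_set \<infinity>)" for x
    proof (rule hs)
      show "summable (\<lambda>k. norm ((of_real (a (Suc k - 1)) * f (Suc k - 1) x) *\<^sub>C y (Suc k - 1)))"
        by (rule summable_comparison_test'[OF summable_mult2[OF summable_a, of "norm x"]]) (simp add: norm_term_le)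
      show "(\<lambda>k. (of_real (a (Suc k - 1)) * f (Suc k - 1) x) *\<^sub>C y (Suc k - 1)) sums A x" using A_sums by simp
    qed
  qed
  have s23: "(\<lambda>k. ?a k powr (2/3)) summable_on index_set \<infinity>"
    unfolding summable_on_def
    by (rule exI, rule hs[of "\<lambda>k. ?a k powr (2/3)"]) (use assms(3) in \<open>auto intro: summable_sums\<close>)
  have "((\<lambda>k. of_real (?a k) * ?f k (?y k)) has_sum tr (\<lambda>x. x)) (index_set \<infinity>)"
  proof (rule hs)
    show "summable (\<lambda>k. norm (of_real (a (Suc k - 1)) * f (Suc k - 1) (y (Suc k - 1))))"
      by (rule summable_comparison_test'[OF summable_mult2[OF summable_a, of 1]])
        (use norm_trace_term_le[of "\<lambda>x. x" 1] in auto)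
    show "(\<lambda>k. of_real (a (Suc k - 1)) * f (Suc k - 1) (y (Suc k - 1))) sums tr (\<lambda>x. x)"
      unfolding tr_def using summable_sums[OF summable_trace[OF bounded_clinear_ident]] by simp
  qed
  then show ?thesis using rep s23 by blast
qed

text \<open>By the rapidly converging series, \<open>tr (T\<^bsup>n - q\<^esup>)\<close> is a value of the kind that \<open>Trace\<close> describes; by
  Grothendieck's theorem it is the only one.\<close>

theorem (in nuclear_series) Trace_power:
  assumes T: "bounded_clinear T" and A: "A = T ^^ q" and n: "n \<ge> 5 * q"
  shows "Trace (T ^^ n) = tr (T ^^ (n - q))"
proof -
  obtain a1 f1 y1 where s1: "nuclear_series (T ^^ n) a1 f1 y1" "\<And>k. a1 k > 0"
    "summable (\<lambda>k. a1 k powr (2/3))" "nuclear_series.tr a1 f1 y1 (\<lambda>x. x) = tr (T ^^ (n - q))"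
    by (rule rapidly_converging_series[OF assms]) blast
  show ?thesis
    unfolding Trace_def
  proof (rule the_equality)
    show "\<exists>s a f y. nuclear_representation (T ^^ n) s a f y \<and> (\<lambda>k. a k powr (2/3)) summable_on index_set s \<and>
      ((\<lambda>k. of_real (a k) * f k (y k)) has_sum tr (T ^^ (n - q))) (index_set s)"
      using series_nuclear_representation[OF s1(1-3)] unfolding s1(4) .
  next
    fix t assume "\<exists>s a f y. nuclear_representation (T ^^ n) s a f y \<and> (\<lambda>k. a k powr (2/3)) summable_on index_set s \<and>
      ((\<lambda>k. of_real (a k) * f k (y k)) has_sum t) (index_set s)"
    then obtain q2 a2 f2 y2 where r: "nuclear_representation (T ^^ n) q2 a2 f2 y2"
      "(\<lambda>k. a2 k powr (2/3)) summable_on index_set q2"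
      "((\<lambda>k. of_real (a2 k) * f2 k (y2 k)) has_sum t) (index_set q2)" by blast
    obtain a3 f3 y3 where s3: "nuclear_series (T ^^ n) a3 f3 y3" "summable (\<lambda>k. a3 k powr (2/3))"
      "nuclear_series.tr a3 f3 y3 (\<lambda>x. x) = t"
      by (rule nuclear_representation_series[OF r(1)]) (use r in blast)
    show "t = tr (T ^^ (n - q))"
      using trace_independent_of_series[OF s1(1,3) s3(1,2)] s1(4) s3(3) by simp
  qed
qed

section \<open>Traces and eigenvalues\<close>

text \<open>The independence of exponentials for a family in which bases may be repeated.\<close>

lemma exponential_family_coefficients_zero:
  fixes w b :: "'i \<Rightarrow> complex"
  assumes I: "finite I" "\<And>i. i \<in> I \<Longrightarrow> cmod (b i) > r" and r: "r > 0"
    and bound: "\<And>k. k \<ge> k0 \<Longrightarrow> cmod (\<Sum>i\<in>I. w i * b i ^ k) \<le> K * r ^ k"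
  shows "(\<Sum>i\<in>{i \<in> I. b i = \<gamma>}. w i) = 0" "(\<Sum>i\<in>I. w i * b i ^ k) = 0"
proof -
  define c where "c \<beta> = (\<Sum>i\<in>{i \<in> I. b i = \<beta>}. w i)" for \<beta>
  have eq: "(\<Sum>i\<in>I. w i * b i ^ k) = (\<Sum>\<beta>\<in>b ` I. c \<beta> * \<beta> ^ k)" for k
  proof -
    have "(\<Sum>\<beta>\<in>b ` I. c \<beta> * \<beta> ^ k) = (\<Sum>\<beta>\<in>b ` I. \<Sum>i\<in>{i \<in> I. b i = \<beta>}. w i * b i ^ k)"
      unfolding c_def sum_distrib_right by (intro sum.cong refl) auto
    also have "\<dots> = (\<Sum>i\<in>I. w i * b i ^ k)" by (rule sum.group) (use I(1) in auto)
    finally show ?thesis ..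
  qed
  have c0: "c \<beta> = 0" if "\<beta> \<in> b ` I" for \<beta>
    by (rule exponential_sum_coefficients_zero[OF _ _ r _ that, where c = c and K = K])
      (use I bound in \<open>auto simp: eq[symmetric]\<close>)
  show "(\<Sum>i\<in>I. w i * b i ^ k) = 0" unfolding eq using c0 by simp
  show "(\<Sum>i\<in>{i \<in> I. b i = \<gamma>}. w i) = 0"
  proof (cases "\<gamma> \<in> b ` I")
    case True
    then show ?thesis using c0 by (simp add: c_def)
  next
    case False
    then have e: "{i \<in> I. b i = \<gamma>} = {}" by auto
    show ?thesis unfolding e by simp
  qed
qed

text \<open>Coordinates with respect to a basis of a finite-dimensional subspace are bounded, because the
  span of the other basis vectors is closed.\<close>

lemma bounded_coordinates:
  fixes E :: "'a::complex_banach \<Rightarrow> 'a"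
  assumes E: "bounded_clinear E" and range: "range E = cvs.span (e ` {..<m})"
    and ind: "cvs.independent (e ` {..<m})" "card (e ` {..<m}) = m" and id: "\<And>x. E (E x) = E x"
  obtains \<phi> where "\<And>i. i < m \<Longrightarrow> bounded_clinear (\<phi> i :: 'a \<Rightarrow> complex)"
    "\<And>x. E x = (\<Sum>i<m. \<phi> i x *\<^sub>C e i)" "\<And>i j. i < m \<Longrightarrow> j < m \<Longrightarrow> \<phi> i (e j) = (if i = j then 1 else 0)"
proof -
  let ?b = "e ` {..<m}"
  define \<phi> where "\<phi> i x = cvs.representation ?b (E x) (e i)" for i x
  have span: "E x \<in> cvs.span ?b" for x using range by auto
  have inj: "inj_on e {..<m}" using ind(2) by (intro eq_card_imp_inj_on) auto
  have expand: "E x = (\<Sum>i<m. \<phi> i x *\<^sub>C e i)" for x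
  proof -
    have "(\<Sum>b\<in>?b. cvs.representation ?b (E x) b *\<^sub>C b) = E x"
      by (rule cvs.sum_representation_eq[OF ind(1) span]) auto
    then show ?thesis unfolding sum.reindex[OF inj] by (simp add: \<phi>_def)
  qed
  show ?thesis
  proof (rule that[of \<phi>, OF _ expand])
    fix i assume i: "i < m"
    define F where "F = cvs.span (?b - {e i})"
    have F: "cvs.subspace F" "closed F" by (simp_all add: F_def closed_span_finite)
    have "e i \<notin> F" using ind(1) i unfolding F_def cvs.dependent_def by blast
    then have d: "infdist (e i) F > 0"
      using F cvs.subspace_0 by (metis infdist_pos_not_in_closed empty_iff)
    have bound: "cmod (\<phi> i x) * infdist (e i) F \<le> norm (E x)" for x
    proof -
      have "(\<Sum>j\<in>{..<m} - {i}. \<phi> j x *\<^sub>C e j) \<in> F"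
        unfolding F_def
      proof (rule cvs.span_sum)
        fix j assume j: "j \<in> {..<m} - {i}"
        then have "e j \<noteq> e i" using inj i by (auto dest: inj_onD)
        then have "e j \<in> ?b - {e i}" using j by auto
        then show "\<phi> j x *\<^sub>C e j \<in> cvs.span (?b - {e i})" by (intro cvs.span_scale) (rule cvs.span_base)
      qed
      from infdist_scale_bound[OF F(1) this, of "\<phi> i x" "e i"]
      show ?thesis unfolding expand[of x] using i by (subst sum.remove[of _ i]) auto
    qed
    obtain K where K: "K > 0" "\<And>x. norm (E x) \<le> K * norm x" using bounded_clinear_bound[OF E] by blast
    show "bounded_clinear (\<phi> i)"
    proof (rule bounded_clinearI)
      show "\<phi> i (x + y) = \<phi> i x + \<phi> i y" for x y
        unfolding \<phi>_def bounded_clinear_add[OF E] by (simp add: cvs.representation_add[OF ind(1) span span])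
      show "\<phi> i (c *\<^sub>C x) = c *\<^sub>C \<phi> i x" for c x
        unfolding \<phi>_def bounded_clinear_scaleC[OF E] by (simp add: cvs.representation_scale[OF ind(1) span] scaleC_complex_def)
      show "norm (\<phi> i x) \<le> (K / infdist (e i) F) * norm x" for x
        using order_trans[OF bound[of x] K(2)[of x]] d by (simp add: pos_le_divide_eq)
    qed
  next
    fix i j assume ij: "i < m" "j < m"
    have "e j \<in> range E" unfolding range using ij by (intro cvs.span_base) auto
    then have "E (e j) = e j" using id by auto
    then have "\<phi> i (e j) = cvs.representation ?b (e j) (e i)" by (simp add: \<phi>_def)
    also have "\<dots> = (if e i = e j then 1 else 0)"
      using cvs.representation_basis[OF ind(1), of "e j"] ij by auto
    finally show "\<phi> i (e j) = (if i = j then 1 else 0)" using inj ij by (auto dest: inj_onD)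
  qed
qed

lemma (in nuclear_series) tr_sum:
  assumes "finite I" "\<And>i. i \<in> I \<Longrightarrow> bounded_clinear (B i)"
  shows "tr (\<lambda>x. \<Sum>i\<in>I. B i x) = (\<Sum>i\<in>I. tr (B i))"
  using assms
proof (induction I)
  case empty
  show ?case by (simp add: tr_def bounded_clinear_zero[OF bcf])
next
  case (insert i I)
  have "tr (\<lambda>x. B i x + (\<Sum>i\<in>I. B i x)) = tr (B i) + tr (\<lambda>x. \<Sum>i\<in>I. B i x)"
    using insert by (intro tr_add bounded_clinear_sum_fun) auto
  then show ?case using insert by simp
qed

locale compact_with_nuclear_power = nuclear_series +
  fixes T :: "'a \<Rightarrow> 'a" and q :: nat
  assumes T: "compact_operator T" and A_eq: "A = T ^^ q"
begin

lemma bounded_clinear_T: "bounded_clinear T" by (rule compact_operator_bounded_clinear[OF T])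

abbreviation m :: "complex \<Rightarrow> nat" where "m \<equiv> alg_multiplicity T"

text \<open>On a generalized eigenspace \<open>T\<close> is triangular with constant diagonal \<open>\<alpha>\<close>.\<close>

lemma trace_on_generalized_eigenspace:
  assumes \<alpha>: "\<alpha> \<noteq> 0"
  shows "tr (\<lambda>x. (T ^^ n) (riesz_projection T \<alpha> x)) = of_nat (m \<alpha>) * \<alpha> ^ (n + q)"
proof -
  obtain B e where sp: "spectral_splitting T \<alpha> (riesz_projection T \<alpha>) B (m \<alpha>) e"
    using riesz_splitting[OF T \<alpha>] .
  let ?E = "blinfun_apply (riesz_projection T \<alpha>)"
  note s = splittingD[OF sp]
  note bTn = bounded_clinear_funpow[OF bounded_clinear_T]
  have bE: "bounded_clinear ?E" by (rule s(1))
  have ind: "cvs.independent (e ` {..<m \<alpha>})" "card (e ` {..<m \<alpha>}) = m \<alpha>"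
    using flag_independent[of "m \<alpha>" e, OF s(11)] by simp_all
  obtain \<phi> where \<phi>: "\<And>i. i < m \<alpha> \<Longrightarrow> bounded_clinear (\<phi> i :: 'a \<Rightarrow> complex)"
    "\<And>x. ?E x = (\<Sum>i<m \<alpha>. \<phi> i x *\<^sub>C e i)"
    "\<And>i j. i < m \<alpha> \<Longrightarrow> j < m \<alpha> \<Longrightarrow> \<phi> i (e j) = (if i = j then 1 else 0)"
    by (rule bounded_coordinates[OF bE s(10) ind s(3)]) blast
  have T_span: "T v \<in> cvs.span (e ` {..<i})" if "i \<le> m \<alpha>" "v \<in> cvs.span (e ` {..<i})" for v i
    using that(2)
  proof (induction rule: cvs.span_induct_alt)
    case base
    then show ?case by (simp add: bounded_clinear_zero[OF bounded_clinear_T] cvs.span_zero)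
  next
    case (step c x z)
    then obtain j where j: "x = e j" "j < i" by auto
    have "\<alpha> *\<^sub>C e j - T (e j) \<in> cvs.span (e ` {..<j})" using s(12)[of j] j that(1) by simp
    then have 1: "\<alpha> *\<^sub>C e j - T (e j) \<in> cvs.span (e ` {..<i})"
      using cvs.span_mono[of "e ` {..<j}" "e ` {..<i}"] j by force
    have "e j \<in> e ` {..<i}" using j by auto
    then have 2: "\<alpha> *\<^sub>C e j \<in> cvs.span (e ` {..<i})" by (intro cvs.span_scale) (rule cvs.span_base)
    have "T x \<in> cvs.span (e ` {..<i})" using cvs.span_diff[OF 2 1] by (simp add: j)
    then show ?case
      using step.IH unfolding bounded_clinear_add[OF bounded_clinear_T] bounded_clinear_scaleC[OF bounded_clinear_T]
      by (intro cvs.span_add cvs.span_scale)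
  qed
  have diag: "\<phi> i ((T ^^ k) (e i)) = \<alpha> ^ k" if i: "i < m \<alpha>" for i k
  proof -
    have "(T ^^ k) (e i) - \<alpha> ^ k *\<^sub>C e i \<in> cvs.span (e ` {..<i})"
    proof (induction k)
      case (Suc k)
      let ?d = "(T ^^ k) (e i) - \<alpha> ^ k *\<^sub>C e i"
      have "(T ^^ Suc k) (e i) - \<alpha> ^ Suc k *\<^sub>C e i = T ?d - \<alpha> ^ k *\<^sub>C (\<alpha> *\<^sub>C e i - T (e i))"
        by (simp add: bounded_clinear_diff[OF bounded_clinear_T] bounded_clinear_scaleC[OF bounded_clinear_T]
          cvs.scale_right_diff_distrib scaleC_scaleC mult.commute)
      also have "\<dots> \<in> cvs.span (e ` {..<i})"
        by (intro cvs.span_diff cvs.span_scale T_span s(12) Suc) (use i in auto)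
      finally show ?case .
    qed (simp add: scaleC_one cvs.span_zero)
    moreover have "\<phi> i v = 0" if "v \<in> cvs.span (e ` {..<i})" for v
      using that
    proof (induction rule: cvs.span_induct_alt)
      case (step c x z)
      then obtain j where j: "x = e j" "j < i" by auto
      then show ?case using step i \<phi>(3)[of i j]
        by (simp add: bounded_clinear_add[OF \<phi>(1)[OF i]] bounded_clinear_scaleC[OF \<phi>(1)[OF i]] scaleC_complex_def)
    qed (simp add: bounded_clinear_zero[OF \<phi>(1)[OF i]])
    ultimately have "\<phi> i ((T ^^ k) (e i) - \<alpha> ^ k *\<^sub>C e i) = 0" by blast
    then show ?thesis
      using \<phi>(3)[OF i i] by (simp add: bounded_clinear_diff[OF \<phi>(1)[OF i]] bounded_clinear_scaleC[OF \<phi>(1)[OF i]] scaleC_complex_def)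
  qed
  have "tr (\<lambda>x. (T ^^ n) (?E x)) = tr (\<lambda>x. \<Sum>i<m \<alpha>. \<phi> i x *\<^sub>C (T ^^ n) (e i))"
    by (simp add: \<phi>(2) bounded_clinear_sum[OF bTn] bounded_clinear_scaleC[OF bTn])
  also have "\<dots> = (\<Sum>i<m \<alpha>. tr (\<lambda>x. \<phi> i x *\<^sub>C (T ^^ n) (e i)))"
  proof (rule tr_sum)
    fix i assume "i \<in> {..<m \<alpha>}"
    then have b: "bounded_clinear (\<phi> i)" using \<phi>(1) by simp
    obtain K where K: "K > 0" "\<And>x. norm (\<phi> i x) \<le> K * norm x" using bounded_clinear_bound[OF b] by blast
    show "bounded_clinear (\<lambda>x. \<phi> i x *\<^sub>C (T ^^ n) (e i))"
    proof (rule bounded_clinearI)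
      show "norm (\<phi> i x *\<^sub>C (T ^^ n) (e i)) \<le> (K * norm ((T ^^ n) (e i))) * norm x" for x
        using mult_right_mono[OF K(2)[of x], of "norm ((T ^^ n) (e i))"] by (simp add: norm_scaleC mult_ac)
    qed (simp_all add: bounded_clinear_add[OF b] bounded_clinear_scaleC[OF b] scaleC_add_left scaleC_complex_def scaleC_scaleC)
  qed simp
  also have "\<dots> = (\<Sum>i<m \<alpha>. \<phi> i ((T ^^ (n + q)) (e i)))"
    by (rule sum.cong) (simp_all add: tr_rank_one[OF \<phi>(1)] A_eq funpow_add[of q n, unfolded add.commute[of q]])
  also have "\<dots> = of_nat (m \<alpha>) * \<alpha> ^ (n + q)" by (simp add: diag)
  finally show ?thesis .
qed

text \<open>Split \<open>T\<^bsup>n - q\<^esup>\<close> along the generalized eigenspaces for the eigenvalues of modulus at least \<open>\<rho>\<close>. Each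
  of these contributes \<open>m(\<alpha>) \<alpha>\<^sup>n\<close>, which is \<open>O(\<rho>\<^sup>n)\<close> on the circle \<open>|\<alpha>| = \<rho>\<close>. The rest of \<open>T\<^bsup>n - q\<^esup>\<close> is
  \<open>O(\<rho>\<^sup>n)\<close> in norm, hence so is its trace against \<open>A\<close>.\<close>

theorem trace_asymptotics:
  assumes \<rho>: "\<rho> > 0"
  defines "G \<equiv> {\<alpha> \<in> spectrum T. \<rho> < cmod \<alpha>}"
  obtains K where "finite G" "\<And>n. n \<ge> q \<Longrightarrow> cmod (tr (T ^^ (n - q)) - (\<Sum>\<alpha>\<in>G. of_nat (m \<alpha>) * \<alpha> ^ n)) \<le> K * \<rho> ^ n"
proof -
  define F where "F = {\<alpha> \<in> spectrum T. \<rho> \<le> cmod \<alpha>}"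
  have fin: "finite F" unfolding F_def by (rule finite_spectrum_outside_disc[OF T \<rho>])
  have GF: "G \<subseteq> F" by (auto simp: G_def F_def)
  have F0: "\<alpha> \<noteq> 0" if "\<alpha> \<in> F" for \<alpha> using that \<rho> by (auto simp: F_def)
  let ?E = "\<lambda>\<alpha>. blinfun_apply (riesz_projection T \<alpha>)"
  note bTn = bounded_clinear_funpow[OF bounded_clinear_T]
  have bE: "bounded_clinear (?E \<alpha>)" if \<alpha>: "\<alpha> \<in> F" for \<alpha>
  proof -
    obtain B e where "spectral_splitting T \<alpha> (?E \<alpha>) B (m \<alpha>) e" using riesz_splitting[OF T F0[OF \<alpha>]] .
    then show ?thesis by (rule splittingD(1))
  qed
  obtain K where K: "\<And>n x. norm ((T ^^ n) (x - (\<Sum>\<alpha>\<in>F. ?E \<alpha> x))) \<le> K * \<rho> ^ n * norm x"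
    using growth_off_large_eigenvalues[OF T \<rho>] unfolding F_def by blast
  define D where "D = (\<Sum>k. a k) * \<bar>K\<bar> / \<rho> ^ q + (\<Sum>\<alpha>\<in>F. real (m \<alpha>))"
  have main: "cmod (tr (T ^^ (n - q)) - (\<Sum>\<alpha>\<in>G. of_nat (m \<alpha>) * \<alpha> ^ n)) \<le> D * \<rho> ^ n" if n: "n \<ge> q" for n
  proof -
    let ?k = "n - q"
    let ?Q = "\<lambda>x. (T ^^ ?k) (x - (\<Sum>\<alpha>\<in>F. ?E \<alpha> x))"
    have bQ: "bounded_clinear ?Q"
      by (intro bounded_clinear_compose[OF bTn] bounded_clinear_minus_fun bounded_clinear_ident bounded_clinear_sum_fun bE)
    have bTE: "bounded_clinear (\<lambda>x. (T ^^ ?k) (?E \<alpha> x))" if "\<alpha> \<in> F" for \<alpha>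
      by (rule bounded_clinear_compose[OF bTn bE[OF that]])
    have "(T ^^ ?k) = (\<lambda>x. (\<Sum>\<alpha>\<in>F. (T ^^ ?k) (?E \<alpha> x)) + ?Q x)"
      by (simp add: bounded_clinear_diff[OF bTn] bounded_clinear_sum[OF bTn])
    then have "tr (T ^^ ?k) = tr (\<lambda>x. (\<Sum>\<alpha>\<in>F. (T ^^ ?k) (?E \<alpha> x)) + ?Q x)" by simp
    also have "\<dots> = tr (\<lambda>x. \<Sum>\<alpha>\<in>F. (T ^^ ?k) (?E \<alpha> x)) + tr ?Q"
      by (intro tr_add bounded_clinear_sum_fun bTE bQ)
    also have "tr (\<lambda>x. \<Sum>\<alpha>\<in>F. (T ^^ ?k) (?E \<alpha> x)) = (\<Sum>\<alpha>\<in>F. of_nat (m \<alpha>) * \<alpha> ^ n)"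
      using n by (simp add: tr_sum[OF fin bTE] trace_on_generalized_eigenspace[OF F0])
    also have "(\<Sum>\<alpha>\<in>F. of_nat (m \<alpha>) * \<alpha> ^ n) = (\<Sum>\<alpha>\<in>F - G. of_nat (m \<alpha>) * \<alpha> ^ n) + (\<Sum>\<alpha>\<in>G. of_nat (m \<alpha>) * \<alpha> ^ n)"
      by (rule sum.subset_diff[OF GF fin])
    finally have "tr (T ^^ ?k) - (\<Sum>\<alpha>\<in>G. of_nat (m \<alpha>) * \<alpha> ^ n) = (\<Sum>\<alpha>\<in>F - G. of_nat (m \<alpha>) * \<alpha> ^ n) + tr ?Q" by simp
    also have "cmod \<dots> \<le> (\<Sum>\<alpha>\<in>F. real (m \<alpha>)) * \<rho> ^ n + ((\<Sum>k. a k) * \<bar>K\<bar> / \<rho> ^ q) * \<rho> ^ n"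
    proof (rule order_trans[OF norm_triangle_ineq], rule add_mono)
      have "cmod (\<Sum>\<alpha>\<in>F - G. of_nat (m \<alpha>) * \<alpha> ^ n) \<le> (\<Sum>\<alpha>\<in>F - G. real (m \<alpha>) * \<rho> ^ n)"
      proof (rule order_trans[OF norm_sum], rule sum_mono)
        fix \<alpha> assume "\<alpha> \<in> F - G"
        then have "cmod \<alpha> = \<rho>" by (auto simp: F_def G_def)
        then show "norm (of_nat (m \<alpha>) * \<alpha> ^ n) \<le> real (m \<alpha>) * \<rho> ^ n" by (simp add: norm_mult norm_power)
      qed
      also have "\<dots> \<le> (\<Sum>\<alpha>\<in>F. real (m \<alpha>) * \<rho> ^ n)" using fin \<rho> by (intro sum_mono2) auto
      finally show "cmod (\<Sum>\<alpha>\<in>F - G. of_nat (m \<alpha>) * \<alpha> ^ n) \<le> (\<Sum>\<alpha>\<in>F. real (m \<alpha>)) * \<rho> ^ n"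
        by (simp add: sum_distrib_right)
      have "cmod (tr ?Q) \<le> (\<Sum>k. a k) * (\<bar>K\<bar> * \<rho> ^ ?k)"
      proof (rule norm_tr_le)
        show "norm (?Q x) \<le> \<bar>K\<bar> * \<rho> ^ ?k * norm x" for x
          using K[of ?k x] \<rho> by (rule_tac order_trans) (auto intro!: mult_right_mono)
      qed (use \<rho> in simp)
      also have "\<rho> ^ ?k = \<rho> ^ n / \<rho> ^ q" using n \<rho> by (simp add: power_diff)
      finally show "cmod (tr ?Q) \<le> ((\<Sum>k. a k) * \<bar>K\<bar> / \<rho> ^ q) * \<rho> ^ n" by simp
    qed
    finally show ?thesis by (simp add: D_def algebra_simps)
  qed
  show ?thesis by (rule that[OF finite_subset[OF GF fin] main])
qed

text \<open>A substitute for Lidskii's theorem. As a function of \<open>k\<close>, three times the trace of \<open>T\<^bsup>n k\<^esup>\<close> is the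
  sum of the \<open>\<nu>\<^sub>j\<^bsup>3 k\<^esup>\<close>; on the other hand it is the sum of the \<open>3 m(\<alpha>) \<alpha>\<^bsup>n k\<^esup>\<close> with \<open>|\<alpha>| > \<rho>\<close> up to
  \<open>O(\<rho>\<^bsup>n k\<^esup>)\<close>. So the terms with bases of modulus larger than \<open>\<rho>\<^sup>n\<close> agree. For \<open>k = 1\<close> they add up to
  zero by assumption, and \<open>\<rho> \<rightarrow> 0\<close> exhausts all \<open>\<nu>\<^sub>j\<close>.\<close>

lemma trace_zero_if_eigenvalue_sums_zero:
  assumes n: "n \<ge> 3 * q" "n > 0"
    and zero: "\<And>\<rho>. \<rho> > 0 \<Longrightarrow> (\<Sum>\<alpha>\<in>{\<alpha> \<in> spectrum T. \<rho> < cmod \<alpha>}. of_nat (m \<alpha>) * \<alpha> ^ n) = 0"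
  shows "tr (T ^^ (n - q)) = 0"
proof -
  obtain \<nu> C where \<nu>: "\<And>j. cmod (\<nu> j) \<le> sqrt (C / real (Suc j))" and C: "C \<ge> 0"
    and pow: "\<And>k. k > 0 \<Longrightarrow> (\<Sum>j. \<nu> j ^ (3 * k)) = 3 * tr (T ^^ (n * k - q))"
    by (rule traces_are_power_sums[OF bounded_clinear_T A_eq n(1)]) blast
  have s3: "summable (\<lambda>j. cmod (\<nu> j) ^ 3)"
    by (rule summable_comparison_test'[OF summable_sqrt_power[OF C order_refl]]) (use \<nu> in \<open>auto intro!: power_mono\<close>)
  have summable_pow: "summable (\<lambda>j. cmod (\<nu> j ^ (3 * k)))" if "k > 0" for k
    by (rule summable_comparison_test'[OF summable_sqrt_power[OF C, of "3 * k"]])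
      (use that \<nu> in \<open>auto simp: norm_power intro!: power_mono\<close>)
  have large_terms: "(\<Sum>j\<in>{j. \<rho> ^ n < cmod (\<nu> j) ^ 3}. \<nu> j ^ 3) = 0" "finite {j. \<rho> ^ n < cmod (\<nu> j) ^ 3}" if \<rho>: "\<rho> > 0" for \<rho>
  proof -
    define J where "J = {j. \<rho> ^ n < cmod (\<nu> j) ^ 3}"
    define G where "G = {\<alpha> \<in> spectrum T. \<rho> < cmod \<alpha>}"
    obtain K where K: "finite G"
      "\<And>k. k \<ge> q \<Longrightarrow> cmod (tr (T ^^ (k - q)) - (\<Sum>\<alpha>\<in>G. of_nat (m \<alpha>) * \<alpha> ^ k)) \<le> K * \<rho> ^ k"
      using trace_asymptotics[OF \<rho>] unfolding G_def by blast
    have "eventually (\<lambda>j. cmod (\<nu> j) ^ 3 < \<rho> ^ n) sequentially"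
      using \<rho> by (intro order_tendstoD(2)[OF summable_LIMSEQ_zero[OF s3]]) auto
    then obtain N where N: "\<And>j. j \<ge> N \<Longrightarrow> cmod (\<nu> j) ^ 3 < \<rho> ^ n" unfolding eventually_sequentially by blast
    have "J \<subseteq> {..<N}"
    proof
      fix j assume "j \<in> J"
      then show "j \<in> {..<N}" using N[of j] by (cases "j < N") (auto simp: J_def)
    qed
    then have finJ: "finite J" using finite_subset by blast
    let ?I = "G <+> J"
    \<comment> \<open>The eigenvalues enter with positive and the \<open>\<nu> j\<close> with negative weights, so that the sum is small.\<close>
    define w where "w = case_sum (\<lambda>\<alpha>. 3 * of_nat (m \<alpha>)) (\<lambda>j::nat. - 1 :: complex)"
    define b where "b = case_sum (\<lambda>\<alpha>. \<alpha> ^ n) (\<lambda>j. \<nu> j ^ 3)"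
    have sums: "(\<Sum>i\<in>?I. w i * b i ^ k) = 3 * (\<Sum>\<alpha>\<in>G. of_nat (m \<alpha>) * \<alpha> ^ (n * k)) - (\<Sum>j\<in>J. \<nu> j ^ (3 * k))" for k
      using K(1) finJ by (simp add: sum.Plus w_def b_def power_mult sum_negf sum_distrib_left mult.assoc)
    have bound: "cmod (\<Sum>i\<in>?I. w i * b i ^ k) \<le> (3 * \<bar>K\<bar> + (\<Sum>j. cmod (\<nu> j) ^ 3) / \<rho> ^ n) * (\<rho> ^ n) ^ k" if k: "k \<ge> 1" for k
    proof -
      have kq: "n * k \<ge> q" using n(1) mult_le_mono2[OF k, of n] by linarith
      let ?s = "\<lambda>j. if j \<in> J then 0 else \<nu> j ^ (3 * k)"
      have le: "norm (?s j) \<le> cmod (\<nu> j) ^ 3 * ((\<rho> ^ n) ^ (k - 1))" for j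
      proof (cases "j \<in> J")
        case False
        then have "cmod (\<nu> j) ^ 3 \<le> \<rho> ^ n" by (simp add: J_def)
        then have "(cmod (\<nu> j) ^ 3) ^ (k - 1) \<le> (\<rho> ^ n) ^ (k - 1)" by (intro power_mono) auto
        then have "cmod (\<nu> j) ^ 3 * (cmod (\<nu> j) ^ 3) ^ (k - 1) \<le> cmod (\<nu> j) ^ 3 * (\<rho> ^ n) ^ (k - 1)"
          by (intro mult_left_mono) auto
        moreover have "norm (\<nu> j ^ (3 * k)) = cmod (\<nu> j) ^ 3 * (cmod (\<nu> j) ^ 3) ^ (k - 1)"
          using k by (simp only: norm_power power_mult power_Suc[symmetric]) simp
        ultimately show ?thesis using False by simp
      qed (use \<rho> in simp)
      have sm: "summable (\<lambda>j. cmod (\<nu> j) ^ 3 * ((\<rho> ^ n) ^ (k - 1)))" by (rule summable_mult2[OF s3])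
      have sumall: "(\<lambda>j. \<nu> j ^ (3 * k)) sums (3 * tr (T ^^ (n * k - q)))"
        using pow[of k] k summable_norm_cancel[OF summable_pow[of k]] by (simp add: sums_iff)
      have "(\<lambda>j. if j \<in> J then \<nu> j ^ (3 * k) else 0) sums (\<Sum>j\<in>J. \<nu> j ^ (3 * k))"
        by (rule sums_If_finite_set[OF finJ])
      from sums_diff[OF sumall this]
      have "(\<lambda>j. \<nu> j ^ (3 * k) - (if j \<in> J then \<nu> j ^ (3 * k) else 0)) sums (3 * tr (T ^^ (n * k - q)) - (\<Sum>j\<in>J. \<nu> j ^ (3 * k)))" .
      also have "(\<lambda>j. \<nu> j ^ (3 * k) - (if j \<in> J then \<nu> j ^ (3 * k) else 0)) = ?s" by auto
      finally have tail: "3 * tr (T ^^ (n * k - q)) - (\<Sum>j\<in>J. \<nu> j ^ (3 * k)) = suminf ?s" by (simp add: sums_iff)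
      have "(\<Sum>i\<in>?I. w i * b i ^ k) = suminf ?s - 3 * (tr (T ^^ (n * k - q)) - (\<Sum>\<alpha>\<in>G. of_nat (m \<alpha>) * \<alpha> ^ (n * k)))"
        unfolding sums tail[symmetric] by (simp add: algebra_simps)
      also have "cmod \<dots> \<le> (\<Sum>j. cmod (\<nu> j) ^ 3) * (\<rho> ^ n) ^ (k - 1) + 3 * (\<bar>K\<bar> * \<rho> ^ (n * k))"
      proof (rule order_trans[OF norm_triangle_ineq4], rule add_mono)
        show "cmod (suminf ?s) \<le> (\<Sum>j. cmod (\<nu> j) ^ 3) * (\<rho> ^ n) ^ (k - 1)"
          unfolding suminf_mult2[OF s3] by (rule norm_suminf_le[OF le sm])
        have "cmod (tr (T ^^ (n * k - q)) - (\<Sum>\<alpha>\<in>G. of_nat (m \<alpha>) * \<alpha> ^ (n * k))) \<le> \<bar>K\<bar> * \<rho> ^ (n * k)"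
          using K(2)[OF kq] \<rho> by (rule_tac order_trans) (auto intro!: mult_right_mono)
        then show "cmod (3 * (tr (T ^^ (n * k - q)) - (\<Sum>\<alpha>\<in>G. of_nat (m \<alpha>) * \<alpha> ^ (n * k)))) \<le> 3 * (\<bar>K\<bar> * \<rho> ^ (n * k))"
          unfolding norm_mult by simp
      qed
      also have "(\<rho> ^ n) ^ (k - 1) = (\<rho> ^ n) ^ k / \<rho> ^ n" using k \<rho> by (simp add: power_diff)
      finally show ?thesis by (simp only: power_mult) (simp add: algebra_simps)
    qed
    have big: "cmod (b i) > \<rho> ^ n" if "i \<in> ?I" for i
      using that \<rho> n(2) by (auto simp: b_def G_def J_def norm_power intro!: power_strict_mono)
    have "(\<Sum>i\<in>?I. w i * b i ^ 1) = 0"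
      by (rule exponential_family_coefficients_zero(2)[OF _ big _ bound]) (use K(1) finJ \<rho> in auto)
    then show "(\<Sum>j\<in>{j. \<rho> ^ n < cmod (\<nu> j) ^ 3}. \<nu> j ^ 3) = 0"
      unfolding sums using zero[OF \<rho>] by (simp add: G_def J_def)
    show "finite {j. \<rho> ^ n < cmod (\<nu> j) ^ 3}" using finJ by (simp add: J_def)
  qed
  \<comment> \<open>For \<open>\<rho> N\<close> in place of \<open>\<rho>\<close> the large terms drop out; the remaining ones tend to zero one by one.\<close>
  define \<rho> where "\<rho> N = 1 / real (Suc N)" for N
  define s where "s j N = (if \<rho> N ^ n < cmod (\<nu> j) ^ 3 then 0 else \<nu> j ^ 3)" for j N
  have s_sum: "(\<Sum>j. s j N) = (\<Sum>j. \<nu> j ^ 3)" for N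
  proof -
    let ?J = "{j. \<rho> N ^ n < cmod (\<nu> j) ^ 3}"
    have pos: "\<rho> N > 0" by (simp add: \<rho>_def)
    have 1: "(\<lambda>j. \<nu> j ^ 3) sums (\<Sum>j. \<nu> j ^ 3)"
      using summable_norm_cancel[OF summable_pow[of 1]] by (simp add: summable_sums)
    have 2: "(\<lambda>j. if j \<in> ?J then \<nu> j ^ 3 else 0) sums (\<Sum>j\<in>?J. \<nu> j ^ 3)"
      by (rule sums_If_finite_set[OF large_terms(2)[OF pos]])
    have "(\<lambda>j. \<nu> j ^ 3 - (if j \<in> ?J then \<nu> j ^ 3 else 0)) = (\<lambda>j. s j N)" by (auto simp: s_def)
    then show ?thesis using sums_diff[OF 1 2] large_terms(1)[OF pos] by (simp add: sums_iff)
  qed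
  have lim: "(\<lambda>N. s j N) \<longlonglongrightarrow> 0" for j
  proof (cases "\<nu> j = 0")
    case True
    then have "s j N = 0" for N by (auto simp: s_def)
    then show ?thesis by simp
  next
    case False
    have lim0: "(\<lambda>N. \<rho> N ^ n) \<longlonglongrightarrow> 0 ^ n"
      unfolding \<rho>_def using LIMSEQ_inverse_real_of_nat by (intro tendsto_power) (simp add: inverse_eq_divide)
    have "eventually (\<lambda>N. \<rho> N ^ n < cmod (\<nu> j) ^ 3) sequentially"
      by (rule order_tendstoD(2)[OF lim0]) (use n(2) False in \<open>auto simp: zero_power\<close>)
    then have "eventually (\<lambda>N. s j N = 0) sequentially" by eventually_elim (simp add: s_def)
    then show ?thesis by (rule tendsto_eventually)
  qed
  have "\<forall>\<^sub>F (j, N) in sequentially \<times>\<^sub>F sequentially. norm (s j N) \<le> cmod (\<nu> j) ^ 3"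
    by (intro always_eventually) (auto simp: s_def norm_power)
  from tannerys_theorem[OF lim this s3]
  have "(\<lambda>N. \<Sum>j. s j N) \<longlonglongrightarrow> 0" by simp
  then have "(\<Sum>j. \<nu> j ^ 3) = 0" by (simp add: s_sum LIMSEQ_const_iff)
  then show ?thesis using pow[of 1] by simp
qed

end

section \<open>Rotation of the spectrum by a root of unity\<close>

lemma root_of_unity_power:
  fixes d n :: nat
  assumes d: "d \<ge> 2" and \<omega>: "\<omega> = exp (2 * of_real pi * \<i> / of_nat d)"
  shows "\<omega> ^ n = 1 \<longleftrightarrow> d dvd n" "cmod \<omega> = 1"
proof -
  have "\<omega> ^ n = exp (of_nat n * (2 * of_real pi * \<i> / of_nat d))" unfolding \<omega> by (simp only: exp_of_nat_mult)
  also have "\<dots> = 1 \<longleftrightarrow> (\<exists>k::int. real n * (2 * pi) / real d = real_of_int (2 * k) * pi)"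
    unfolding exp_eq_1 by simp
  also have "\<dots> \<longleftrightarrow> (\<exists>k::int. int n = int d * k)"
  proof (intro ex_cong1)
    fix k :: int
    have "real n * (2 * pi) / real d = real_of_int (2 * k) * pi \<longleftrightarrow> real n = real d * real_of_int k"
      using d pi_gt_zero by (auto simp: field_simps)
    also have "\<dots> \<longleftrightarrow> real_of_int (int n) = real_of_int (int d * k)" by simp
    also have "\<dots> \<longleftrightarrow> int n = int d * k" by (rule of_int_eq_iff)
    finally show "real n * (2 * pi) / real d = real_of_int (2 * k) * pi \<longleftrightarrow> int n = int d * k" .
  qed
  also have "\<dots> \<longleftrightarrow> int d dvd int n" by (simp add: dvd_def)
  finally show "\<omega> ^ n = 1 \<longleftrightarrow> d dvd n" by simp
  have "2 * of_real pi * \<i> / of_nat d = \<i> * of_real (2 * pi / real d)" by simp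
  then show "cmod \<omega> = 1" unfolding \<omega> by (simp only: norm_exp_i_times)
qed

context compact_with_nuclear_power
begin

text \<open>Multiplication by \<open>\<omega>\<close> permutes the eigenvalues of modulus larger than \<open>\<rho>\<close> and preserves their
  multiplicities, so that the sum of the \<open>m(\<alpha>) \<alpha>\<^sup>n\<close> is equal to its product with \<open>\<omega>\<^sup>n \<noteq> 1\<close>.\<close>

lemma symmetric_spectrum_imp_traces_zero:
  assumes \<omega>: "cmod \<omega> = 1" "\<omega> ^ n \<noteq> 1" and n: "n \<ge> 3 * q" "n > 0"
    and sym: "\<And>\<beta>. \<beta> \<noteq> 0 \<Longrightarrow> m (\<beta> * \<omega>) = m \<beta>"
  shows "tr (T ^^ (n - q)) = 0"
proof (rule trace_zero_if_eigenvalue_sums_zero[OF n])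
  fix \<rho> :: real assume \<rho>: "\<rho> > 0"
  let ?G = "{\<alpha> \<in> spectrum T. \<rho> < cmod \<alpha>}"
  define H where "H = {\<alpha>. \<rho> < cmod \<alpha> \<and> m \<alpha> \<noteq> 0}"
  have fin: "finite ?G" using trace_asymptotics[OF \<rho>] by blast
  have HG: "H \<subseteq> ?G"
  proof
    fix \<alpha> assume \<alpha>: "\<alpha> \<in> H"
    then have "\<alpha> \<noteq> 0" using \<rho> by (auto simp: H_def)
    then show "\<alpha> \<in> ?G" using alg_multiplicity_outside_spectrum[OF T, of \<alpha>] \<alpha> by (auto simp: H_def)
  qed
  have \<omega>0: "\<omega> \<noteq> 0" using \<omega>(1) by auto
  have rot: "\<alpha> * \<omega> \<in> H" if "\<alpha> \<in> H" for \<alpha>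
    using that sym[of \<alpha>] \<rho> by (cases "\<alpha> = 0") (auto simp: H_def norm_mult \<omega>(1))
  have inj: "inj_on (\<lambda>\<alpha>. \<alpha> * \<omega>) H" using \<omega>0 by (intro inj_onI) simp
  have onto: "(\<lambda>\<alpha>. \<alpha> * \<omega>) ` H = H"
    by (rule endo_inj_surj[OF finite_subset[OF HG fin] _ inj]) (use rot in auto)
  define s where "s = (\<Sum>\<alpha>\<in>H. of_nat (m \<alpha>) * \<alpha> ^ n)"
  have "s = (\<Sum>\<alpha>\<in>(\<lambda>\<alpha>. \<alpha> * \<omega>) ` H. of_nat (m \<alpha>) * \<alpha> ^ n)" unfolding onto by (simp add: s_def)
  also have "\<dots> = (\<Sum>\<alpha>\<in>H. of_nat (m (\<alpha> * \<omega>)) * (\<alpha> * \<omega>) ^ n)" by (simp add: sum.reindex[OF inj])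
  also have "\<dots> = (\<Sum>\<alpha>\<in>H. \<omega> ^ n * (of_nat (m \<alpha>) * \<alpha> ^ n))"
  proof (rule sum.cong[OF refl])
    fix \<alpha> assume "\<alpha> \<in> H"
    then have "\<alpha> \<noteq> 0" using \<rho> by (auto simp: H_def)
    then show "of_nat (m (\<alpha> * \<omega>)) * (\<alpha> * \<omega>) ^ n = \<omega> ^ n * (of_nat (m \<alpha>) * \<alpha> ^ n)"
      by (simp add: sym power_mult_distrib)
  qed
  also have "\<dots> = \<omega> ^ n * s" by (simp add: s_def sum_distrib_left)
  finally have "s = 0" using \<omega>(2) by simp
  moreover have "(\<Sum>\<alpha>\<in>?G. of_nat (m \<alpha>) * \<alpha> ^ n) = s"
    unfolding s_def by (rule sum.mono_neutral_right[OF fin HG]) (auto simp: H_def)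
  ultimately show "(\<Sum>\<alpha>\<in>?G. of_nat (m \<alpha>) * \<alpha> ^ n) = 0" by simp
qed

text \<open>Let \<open>s n\<close> be the sum of the \<open>m(\<alpha>) \<alpha>\<^sup>n\<close> with \<open>|\<alpha>| > \<rho>\<close>. Then \<open>(\<omega>\<^bsup>k n\<^esup> - 1) s n\<close> is \<open>O(\<rho>\<^sup>n)\<close>: either the
  first factor vanishes or the trace of \<open>T\<^sup>n\<close> does. As an exponential sum this expression has the
  coefficient \<open>m(\<beta>) - m(\<beta> \<omega>\<^sup>k)\<close> at the base \<open>\<beta> \<omega>\<^sup>k\<close>, which is therefore zero.\<close>

lemma traces_zero_imp_symmetric_spectrum:
  assumes \<omega>: "cmod \<omega> = 1"
    and zero: "\<And>n. n \<ge> N \<Longrightarrow> \<omega> ^ n \<noteq> 1 \<Longrightarrow> tr (T ^^ (n - q)) = 0"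
    and \<beta>: "\<beta> \<noteq> 0"
  shows "m (\<beta> * \<omega> ^ k) = m \<beta>"
proof -
  define \<rho> where "\<rho> = cmod \<beta> / 2"
  have \<rho>: "\<rho> > 0" and \<beta>_large: "\<rho> < cmod \<beta>" using \<beta> by (simp_all add: \<rho>_def)
  define G where "G = {\<alpha> \<in> spectrum T. \<rho> < cmod \<alpha>}"
  obtain K where fin: "finite G"
    and K: "\<And>n. n \<ge> q \<Longrightarrow> cmod (tr (T ^^ (n - q)) - (\<Sum>\<alpha>\<in>G. of_nat (m \<alpha>) * \<alpha> ^ n)) \<le> K * \<rho> ^ n"
    using trace_asymptotics[OF \<rho>] unfolding G_def by blast
  define s where "s n = (\<Sum>\<alpha>\<in>G. of_nat (m \<alpha>) * \<alpha> ^ n)" for n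
  let ?I = "G <+> G"
  define w :: "complex + complex \<Rightarrow> complex" where "w = case_sum (\<lambda>\<alpha>. of_nat (m \<alpha>)) (\<lambda>\<alpha>. - of_nat (m \<alpha>))"
  define b where "b = case_sum (\<lambda>\<alpha>. \<alpha> * \<omega> ^ k) (\<lambda>\<alpha>::complex. \<alpha>)"
  have sums: "(\<Sum>i\<in>?I. w i * b i ^ n) = ((\<omega> ^ k) ^ n - 1) * s n" for n
  proof -
    have "(\<Sum>i\<in>?I. w i * b i ^ n) = (\<Sum>\<alpha>\<in>G. of_nat (m \<alpha>) * (\<alpha> * \<omega> ^ k) ^ n) - s n"
      using fin by (simp add: sum.Plus w_def b_def s_def sum_negf)
    also have "(\<Sum>\<alpha>\<in>G. of_nat (m \<alpha>) * (\<alpha> * \<omega> ^ k) ^ n) = (\<omega> ^ k) ^ n * s n"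
      unfolding s_def sum_distrib_left by (rule sum.cong) (simp_all add: power_mult_distrib)
    finally show ?thesis by (simp add: left_diff_distrib)
  qed
  have bound: "cmod (\<Sum>i\<in>?I. w i * b i ^ n) \<le> (2 * \<bar>K\<bar>) * \<rho> ^ n" if n: "n \<ge> max N q" for n
  proof (cases "\<omega> ^ n = 1")
    case True
    have "(\<omega> ^ k) ^ n = (\<omega> ^ n) ^ k" by (simp add: power_mult[symmetric] mult.commute)
    then show ?thesis unfolding sums using True \<rho> by simp
  next
    case False
    then have "tr (T ^^ (n - q)) = 0" using zero n by simp
    then have "cmod (s n) \<le> K * \<rho> ^ n" using K[of n] n by (simp add: s_def)
    also have "\<dots> \<le> \<bar>K\<bar> * \<rho> ^ n" using \<rho> by (intro mult_right_mono) auto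
    finally have s: "cmod (s n) \<le> \<bar>K\<bar> * \<rho> ^ n" .
    have "cmod ((\<omega> ^ k) ^ n - 1) \<le> 2"
      using norm_triangle_ineq4[of "(\<omega> ^ k) ^ n" 1] by (simp add: norm_power \<omega>)
    from mult_mono[OF this s] show ?thesis unfolding sums by (simp add: norm_mult)
  qed
  have big: "\<rho> < cmod (b i)" if "i \<in> ?I" for i
    using that by (auto simp: b_def G_def norm_mult norm_power \<omega>)
  let ?\<gamma> = "\<beta> * \<omega> ^ k"
  have \<omega>0: "\<omega> ^ k \<noteq> 0" using \<omega> by auto
  have mG: "m \<alpha> = 0" if "\<rho> < cmod \<alpha>" "\<alpha> \<notin> G" for \<alpha>
    using alg_multiplicity_outside_spectrum[OF T, of \<alpha>] that \<rho> by (cases "\<alpha> = 0") (auto simp: G_def)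
  have large: "\<rho> < cmod ?\<gamma>" using \<beta>_large by (simp add: norm_mult norm_power \<omega>)
  have "{i \<in> ?I. b i = ?\<gamma>} = ({\<beta>} \<inter> G) <+> ({?\<gamma>} \<inter> G)"
    using \<omega>0 by (auto simp: b_def)
  then have "(\<Sum>i\<in>({\<beta>} \<inter> G) <+> ({?\<gamma>} \<inter> G). w i) = 0"
    using exponential_family_coefficients_zero(1)[OF _ big \<rho> bound, where \<gamma> = ?\<gamma> and ?k0.0 = "max N q"] fin by simp
  then have "(\<Sum>\<alpha>\<in>{\<beta>} \<inter> G. of_nat (m \<alpha>)) - (\<Sum>\<alpha>\<in>{?\<gamma>} \<inter> G. of_nat (m \<alpha>)) = (0::complex)"
    using fin by (simp add: sum.Plus w_def sum_negf)
  moreover have "(\<Sum>\<alpha>\<in>{\<beta>} \<inter> G. of_nat (m \<alpha>)) = (of_nat (m \<beta>) :: complex)"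
    using mG[OF \<beta>_large] by (cases "\<beta> \<in> G") auto
  moreover have "(\<Sum>\<alpha>\<in>{?\<gamma>} \<inter> G. of_nat (m \<alpha>)) = (of_nat (m ?\<gamma>) :: complex)"
    using mG[OF large] by (cases "?\<gamma> \<in> G") auto
  ultimately show ?thesis by simp
qed

end

theorem theorem1:
  fixes T :: "'a::complex_banach \<Rightarrow> 'a"
    and d q\<^sub>s :: nat
    and \<omega> :: complex
  assumes "d \<ge> 2"
    and "\<omega> = exp (2 * of_real pi * \<i> / of_nat d)"
    and "compact_operator T"
    and "q\<^sub>s > 0"
    and "nuclear (T ^^ q\<^sub>s)"
  shows "(\<forall>\<beta>. \<beta> \<noteq> 0 \<longrightarrow>
            (\<forall>k\<in>{0..d - 1}. alg_multiplicity T (\<beta> * \<omega> ^ k) = alg_multiplicity T \<beta>))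
     \<longleftrightarrow>
         (\<exists>p\<^sub>s\<ge>4 * q\<^sub>s. \<forall>p\<ge>p\<^sub>s. \<forall>r\<in>{1..d - 1}. Trace (T ^^ (d * p + r)) = 0)"
proof -
  obtain q a f y where "nuclear_representation (T ^^ q\<^sub>s) q a f y"
    using assms(5) unfolding nuclear_def by blast
  then obtain a' f' y' where "nuclear_series (T ^^ q\<^sub>s) a' f' y'"
    by (rule nuclear_representation_series) blast
  then interpret compact_with_nuclear_power "T ^^ q\<^sub>s" a' f' y' T q\<^sub>s
    unfolding compact_with_nuclear_power_def compact_with_nuclear_power_axioms_def
    using assms(3) by simp
  note root = root_of_unity_power[OF assms(1,2)]
  have Trace: "Trace (T ^^ n) = tr (T ^^ (n - q\<^sub>s))" if "n \<ge> 5 * q\<^sub>s" for n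
    by (rule Trace_power[OF bounded_clinear_T refl that])
  have indivisible: "\<not> d dvd d * p + r" if "r \<in> {1..d - 1}" for p r
    using that assms(1) by (auto simp: dvd_add_right_iff dest: dvd_imp_le)
  show ?thesis
  proof
    assume sym: "\<forall>\<beta>. \<beta> \<noteq> 0 \<longrightarrow> (\<forall>k\<in>{0..d - 1}. m (\<beta> * \<omega> ^ k) = m \<beta>)"
    have sym1: "m (\<beta> * \<omega>) = m \<beta>" if "\<beta> \<noteq> 0" for \<beta>
      using sym[rule_format, OF that, of 1] assms(1) by simp
    have "Trace (T ^^ (d * p + r)) = 0" if p: "p \<ge> 5 * q\<^sub>s" and r: "r \<in> {1..d - 1}" for p r
    proof -
      have "1 * p \<le> d * p" by (rule mult_le_mono1) (use assms(1) in simp)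
      then have n: "d * p + r \<ge> 5 * q\<^sub>s" using p by linarith
      then show ?thesis
        unfolding Trace[OF n]
        by (intro symmetric_spectrum_imp_traces_zero[OF root(2) _ _ _ sym1])
          (use r root(1) indivisible[OF r] in auto)
    qed
    \<comment> \<open>With \<open>5 q\<^sub>s\<close> instead of \<open>4 q\<^sub>s\<close> the traces are given by the series for \<open>T ^^ q\<^sub>s\<close>.\<close>
    then show "\<exists>p\<^sub>s\<ge>4 * q\<^sub>s. \<forall>p\<ge>p\<^sub>s. \<forall>r\<in>{1..d - 1}. Trace (T ^^ (d * p + r)) = 0"
      by (intro exI[of _ "5 * q\<^sub>s"]) simp
  next
    assume "\<exists>p\<^sub>s\<ge>4 * q\<^sub>s. \<forall>p\<ge>p\<^sub>s. \<forall>r\<in>{1..d - 1}. Trace (T ^^ (d * p + r)) = 0"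
    then obtain p\<^sub>s where p\<^sub>s: "\<And>p r. p \<ge> p\<^sub>s \<Longrightarrow> r \<in> {1..d - 1} \<Longrightarrow> Trace (T ^^ (d * p + r)) = 0"
      by blast
    have zero: "tr (T ^^ (n - q\<^sub>s)) = 0" if n: "n \<ge> max (d * p\<^sub>s) (5 * q\<^sub>s)" and \<omega>n: "\<omega> ^ n \<noteq> 1" for n
    proof -
      have "n div d \<ge> p\<^sub>s" using n assms(1) by (simp add: less_eq_div_iff_mult_less_eq mult.commute)
      moreover have "n mod d \<in> {1..d - 1}"
      proof -
        have "n mod d < d" using assms(1) by simp
        moreover have "n mod d \<noteq> 0" using \<omega>n unfolding root(1) dvd_eq_mod_eq_0 .
        ultimately show ?thesis unfolding atLeastAtMost_iff by linarith
      qed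
      ultimately have "Trace (T ^^ (d * (n div d) + n mod d)) = 0" by (rule p\<^sub>s)
      then show ?thesis using Trace[of n] n by simp
    qed
    show "\<forall>\<beta>. \<beta> \<noteq> 0 \<longrightarrow> (\<forall>k\<in>{0..d - 1}. m (\<beta> * \<omega> ^ k) = m \<beta>)"
      using traces_zero_imp_symmetric_spectrum[OF root(2) zero] by blast
  qed
qed

end
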